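(* Let $n\ge 0$ and $l\ge 1$ be integers, and let $I$ be a finite set of indices such that $I=\bigcup_{\mathbf{s}\in I}\operatorname{Sub}(\mathbf{s})$. Then $$\begin{aligned} &\operatorname{tr.deg}_{k}\,k\left(\partial_t^{(n')}\Omega|_{t=\theta},\ \partial_t^{(n')}\Omega_l^{(-l')}|_{t=\theta},\ \partial_t^{(n')}\zeta_A^{\mathrm{AT}}(\mathbf{s})|_{t=\theta}\ \middle|\ 0\le n'\le n,\ 0\le l'\le l-1,\ \mathbf{s}\in I\right)\\ =\;&\operatorname{tr.deg}_{k}\,k\left(\partial_t^{(n')}\Omega|_{t=\theta},\ \partial_t^{(n')}\Omega_l^{(-l')}|_{t=\theta}\ \middle|\ 0\le n'\le n,\ 0\le l'\le l-1\right)\\ &+\operatorname{tr.deg}_{k}\,k\left(\partial_t^{(n')}\Omega|_{t=\theta},\ \partial_t^{(n')}\zeta_A^{\mathrm{AT}}(\mathbf{s})|_{t=\theta}\ \middle|\ 0\le n'\le n,\ \mathbf{s}\in I\right)\\ &-\operatorname{tr.deg}_{k}\,k\left(\partial_t^{(n')}\Omega|_{t=\theta}\ \middle|\ 0\le n'\le n\right). \end{aligned}$$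
   Context: Let $q$ be a power of a prime $p$, $A=\mathbb{F}_q[\theta]$, $k=\mathbb{F}_q(\theta)$, $k_\infty=\mathbb{F}_q((1/\theta))$ its completion at the infinite place, and $\mathbb{C}_\infty$ the completion of an algebraic closure of $k_\infty$, with absolute value $|\cdot|_\infty$ normalized by $|\theta|_\infty=q$. Let $\overline{k}$ be the algebraic closure of $k$ in $\mathbb{C}_\infty$. Let $t$ be a variable independent of $\theta$. For $m\in\mathbb{Z}$, the $m$-fold Frobenius twist of $f=\sum_i a_it^i\in\mathbb{C}_\infty((t))$ is $f^{(m)}:=\sum_i a_i^{q^m}t^i$. For $m\ge 0$, the $m$-th hyperderivative is the $\mathbb{C}_\infty$-linear operator $\partial_t^{(m)}\left(\sum_i a_it^i\right)=\sum_i\binom{i}{m}a_it^{i-m}$ on $\mathbb{C}_\infty((t))$ (binomial coefficients reduced to $\mathbb{F}_p$). All series below and their hyperderivatives converge at $t=\theta$. For $l\ge 1$, fix a $(q^l-1)$-th root of $-\theta$ and put $$\Omega_l:=(-\theta)^{\frac{-q^l}{q^l-1}}\prod_{i=1}^\infty\left(1-\frac{t}{\theta^{q^{il}}}\right),\qquad \Omega:=\Omega_1,$$ and $\Omega_l^{(-l')}$ denotes the $(-l')$-fold Frobenius twist of $\Omega_l$. An index is a tuple $\mathbf{s}=(s_1,\dots,s_d)$ of positive integers with $d\ge 1$; $\operatorname{Sub}(\mathbf{s}):=\{(s_i,s_{i+1},\dots,s_j)\mid 1\le i\le j\le d\}$. Anderson–Thakur polynomials $H_m\in A[t]$ ($m\ge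 0$): put $D_0(t)=1$, $D_i(t)=\prod_{j=0}^{i-1}(t^{q^i}-t^{q^j})$, $G_0=1$, $G_i=\prod_{j=1}^i(t^{q^i}-\theta^{q^j})$, and for $m=\sum_i m_iq^i$ with $0\le m_i\le q-1$ put $\gamma_m(t)=\prod_i D_i(t)^{m_i}$. Then $H_m$ is defined by $\left(1-\sum_{i\ge 0}\frac{G_i}{D_i(t)}x^{q^i}\right)^{-1}=\sum_{m\ge 0}\frac{H_m}{\gamma_m(t)}x^m$. Put $\mathbb{L}_0=1$ and $\mathbb{L}_i=(t-\theta)^{(1)}\cdots(t-\theta)^{(i)}=(t-\theta^q)\cdots(t-\theta^{q^i})$ for $i\ge1$. The Anderson–Thakur series of an index $\mathbf{s}=(s_1,\dots,s_d)$ is $$\zeta_A^{\mathrm{AT}}(\mathbf{s}):=\sum_{i_1>\cdots>i_d\ge 0}\frac{H_{s_1-1}^{(i_1)}\cdots H_{s_d-1}^{(i_d)}}{\mathbb{L}_{i_1}^{s_1}\cdots\mathbb{L}_{i_d}^{s_d}}.$$ *)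

theory Defs
  imports
    "HOL-Analysis.Analysis"
    "HOL-Computational_Algebra.Computational_Algebra"
    "HOL-Library.Poly_Mapping"
begin

section \<open>Subfields and transcendence degree\<close>

definition is_subfield :: "'a::field set \<Rightarrow> bool" where
  "is_subfield F \<longleftrightarrow> 0 \<in> F \<and> 1 \<in> F \<and>
     (\<forall>x\<in>F. \<forall>y\<in>F. x + y \<in> F \<and> x * y \<in> F) \<and> (\<forall>x\<in>F. - x \<in> F \<and> inverse x \<in> F)"

definition adjoin :: "'a::field set \<Rightarrow> 'a set \<Rightarrow> 'a set" where
  "adjoin K S = is_subfield hull (K \<union> S)"

definition algebraic_over :: "'a::field set \<Rightarrow> 'a \<Rightarrow> bool" where
  "algebraic_over K x \<longleftrightarrow> (\<exists>f::'a poly. f \<noteq> 0 \<and> set (coeffs f) \<subseteq> K \<and> poly f x = 0)"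

text \<open>A multivariate polynomial is a finitely supported map from monomials to coefficients, a
  monomial being a finitely supported map from variables to exponents. The elements of
  the field serve as the names of the variables, and \<open>mpoly_value\<close> substitutes every element for
  the variable it names.\<close>

definition mpoly_value :: "(('a \<Rightarrow>\<^sub>0 nat) \<Rightarrow>\<^sub>0 'a::field) \<Rightarrow> 'a" where
  "mpoly_value P =
     (\<Sum>m \<in> Poly_Mapping.keys P. Poly_Mapping.lookup P m *
        (\<Prod>x \<in> Poly_Mapping.keys m. x ^ Poly_Mapping.lookup m x))"

definition alg_independent :: "'a::field set \<Rightarrow> 'a set \<Rightarrow> bool" where
  "alg_independent K B \<longleftrightarrow>
     (\<forall>P. (\<forall>m \<in> Poly_Mapping.keys P. Poly_Mapping.lookup P m \<in> K \<and> Poly_Mapping.keys m \<subseteq> B) \<and>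
          mpoly_value P = 0 \<longrightarrow> P = 0)"

definition transcendence_basis :: "'a::field set \<Rightarrow> 'a set \<Rightarrow> 'a set \<Rightarrow> bool" where
  "transcendence_basis K L B \<longleftrightarrow>
     B \<subseteq> L \<and> alg_independent K B \<and> (\<forall>x\<in>L. algebraic_over (adjoin K B) x)"

text \<open>All transcendence bases of \<open>L\<close> over \<open>K\<close> are equipotent. Extensions of infinite transcendence
  degree get the junk value 0; the definition is meant for finitely generated extensions.\<close>

definition trdeg :: "'a::field set \<Rightarrow> 'a set \<Rightarrow> nat" where
  "trdeg K L = card (SOME B. transcendence_basis K L B)"


section \<open>The field \<open>\<complex>\<^sub>\<infinity>\<close>\<close>

locale nonarch_abs_value =
  fixes v :: "'c::field \<Rightarrow> real"
  assumes nonneg: "v x \<ge> 0"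
    and eq_0_iff: "v x = 0 \<longleftrightarrow> x = 0"
    and mult: "v (x * y) = v x * v y"
    and ultrametric: "v (x + y) \<le> max (v x) (v y)"
begin

lemma v_uminus: "v (- x) = v x"
proof -
  have "v (- 1) * v (- 1) = 1"
    using mult[of "- 1" "- 1"] mult[of 1 1] eq_0_iff[of 1] by auto
  hence "v (- 1) = 1"
    using nonneg[of "- 1"] by (metis abs_of_nonneg power2_eq_square power2_eq_1_iff abs_1 abs_minus_cancel)
  thus ?thesis
    using mult[of "- 1" x] by simp
qed

sublocale Metric_space UNIV "\<lambda>x y. v (x - y)"
proof
  fix x y z :: 'c
  show "v (x - y) = v (y - x)"
    using v_uminus[of "x - y"] by simp
  show "v (x - z) \<le> v (x - y) + v (y - z)"
    using ultrametric[of "x - y" "y - z"] nonneg[of "x - y"] nonneg[of "y - z"] by simp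
qed (simp_all add: nonneg eq_0_iff)

end

text \<open>The finite field \<open>\<F>\<^sub>q\<close> inside an algebraically closed field of characteristic \<open>p\<close> is the
  set of solutions of \<open>x ^ q = x\<close>; \<open>rat_field\<close> is \<open>k = \<F>\<^sub>q(\<theta>)\<close>.\<close>

definition rat_field :: "nat \<Rightarrow> 'c::field \<Rightarrow> 'c set" where
  "rat_field q \<theta> = adjoin {x. x ^ q = x} {\<theta>}"

text \<open>The completion of an algebraic closure of \<open>k\<^sub>\<infinity>\<close>, characterized up to isometric isomorphism.
  A nonarchimedean absolute value restricted to \<open>k\<close> is trivial on \<open>\<F>\<^sub>q\<close>, so \<open>v \<theta> = q\<close> forces it to
  be the normalized one at the infinite place. As the whole field is complete, \<open>k\<^sub>\<infinity>\<close> is the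
  topological closure of \<open>k\<close>; and \<open>kinf_bar\<close>, the elements algebraic over \<open>k\<^sub>\<infinity>\<close>, is required to
  be algebraically closed and dense.\<close>

locale C_infinity = nonarch_abs_value v for v :: "'c::field \<Rightarrow> real" +
  fixes q :: nat and \<theta> :: 'c
  assumes prime_char: "prime CHAR('c)"
    and q_power: "\<exists>e>0. q = CHAR('c) ^ e"
    and v_theta: "v \<theta> = real q"
    and complete: "mcomplete"
  fixes kinf kinf_bar :: "'c set"
  defines "kinf \<equiv> mtopology closure_of rat_field q \<theta>"
    and "kinf_bar \<equiv> {x. algebraic_over kinf x}"
  assumes alg_closed:
      "\<And>f::'c poly. set (coeffs f) \<subseteq> kinf_bar \<Longrightarrow> degree f > 0 \<Longrightarrow> \<exists>x\<in>kinf_bar. poly f x = 0"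
    and dense: "mtopology closure_of kinf_bar = UNIV"


section \<open>Limits, Frobenius twists, hyperderivatives\<close>

definition vlim :: "('c::field \<Rightarrow> real) \<Rightarrow> 'b filter \<Rightarrow> ('b \<Rightarrow> 'c) \<Rightarrow> 'c" where
  "vlim v F f = (THE L. limitin (Metric_space.mtopology UNIV (\<lambda>x y. v (x - y))) f L F)"

text \<open>All Laurent series in \<open>t\<close> considered here are power series. Their infinite products and sums
  converge with respect to the absolute value \<open>v\<close> of the coefficients, not \<open>t\<close>-adically; hence
  limits are taken coefficientwise in \<open>v\<close>.\<close>

definition fps_vlim :: "('c::field \<Rightarrow> real) \<Rightarrow> 'b filter \<Rightarrow> ('b \<Rightarrow> 'c fps) \<Rightarrow> 'c fps" where
  "fps_vlim v F f = Abs_fps (\<lambda>n. vlim v F (\<lambda>x. fps_nth (f x) n))"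

definition fps_value :: "('c::field \<Rightarrow> real) \<Rightarrow> 'c fps \<Rightarrow> 'c \<Rightarrow> 'c" where
  "fps_value v f x = vlim v sequentially (\<lambda>N. \<Sum>n<N. fps_nth f n * x ^ n)"

text \<open>\<open>x\<close> to the power \<open>q ^ m\<close> for an integer \<open>m\<close>; for negative \<open>m\<close> this is the unique root, which
  exists because the field is algebraically closed of characteristic \<open>p\<close>.\<close>

definition frobenius :: "nat \<Rightarrow> int \<Rightarrow> 'c::field \<Rightarrow> 'c" where
  "frobenius q m x = (if m \<ge> 0 then x ^ (q ^ nat m) else (THE y. y ^ (q ^ nat (- m)) = x))"

definition twist :: "nat \<Rightarrow> int \<Rightarrow> 'c::field fps \<Rightarrow> 'c fps" where
  "twist q m f = Abs_fps (\<lambda>i. frobenius q m (fps_nth f i))"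

definition hyperderiv :: "nat \<Rightarrow> 'c::field fps \<Rightarrow> 'c fps" where
  "hyperderiv m f = Abs_fps (\<lambda>i. of_nat ((i + m) choose m) * fps_nth f (i + m))"


section \<open>The series \<open>\<Omega>\<^sub>l\<close>\<close>

text \<open>The argument \<open>\<rho>\<close> is the chosen \<open>(q ^ l - 1)\<close>-th root of \<open>- \<theta>\<close>.\<close>

definition Omega :: "('c::field \<Rightarrow> real) \<Rightarrow> nat \<Rightarrow> 'c \<Rightarrow> nat \<Rightarrow> 'c \<Rightarrow> 'c fps" where
  "Omega v q \<theta> l \<rho> =
     fps_const (inverse (\<rho> ^ (q ^ l))) *
     fps_vlim v sequentially
       (\<lambda>N. \<Prod>i=1..N. 1 - fps_const (inverse (\<theta> ^ (q ^ (i * l)))) * fps_X)"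


section \<open>Anderson--Thakur polynomials and series\<close>

definition AT_D :: "nat \<Rightarrow> nat \<Rightarrow> 'c::field poly" where
  "AT_D q i = (\<Prod>j<i. monom 1 (q ^ i) - monom 1 (q ^ j))"

definition AT_G :: "nat \<Rightarrow> 'c::field \<Rightarrow> nat \<Rightarrow> 'c poly" where
  "AT_G q \<theta> i = (\<Prod>j=1..i. monom 1 (q ^ i) - [:\<theta> ^ (q ^ j):])"

text \<open>The \<open>i\<close>-th base \<open>q\<close> digit of \<open>m\<close> is \<open>m div q ^ i mod q\<close>, and it is 0 for \<open>i > m\<close>.\<close>

definition AT_gamma :: "nat \<Rightarrow> nat \<Rightarrow> 'c::field poly" where
  "AT_gamma q m = (\<Prod>i\<le>m. AT_D q i ^ (m div q ^ i mod q))"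

text \<open>The series \<open>\<Sum>\<^sub>i (G\<^sub>i / D\<^sub>i) x ^ (q ^ i)\<close> in \<open>x\<close> over the field of rational functions in \<open>t\<close>.\<close>

definition AT_gen :: "nat \<Rightarrow> 'c::field \<Rightarrow> 'c poly fract fps" where
  "AT_gen q \<theta> = Abs_fps (\<lambda>j. \<Sum>i | q ^ i = j. Fraction_Field.Fract (AT_G q \<theta> i) (AT_D q i))"

definition AT_H :: "nat \<Rightarrow> 'c::field \<Rightarrow> nat \<Rightarrow> 'c poly" where
  "AT_H q \<theta> m =
     (THE h. fps_nth (inverse (1 - AT_gen q \<theta>)) m = Fraction_Field.Fract h (AT_gamma q m))"

definition AT_L :: "nat \<Rightarrow> 'c::field \<Rightarrow> nat \<Rightarrow> 'c poly" where
  "AT_L q \<theta> i = (\<Prod>j=1..i. [:- (\<theta> ^ (q ^ j)), 1:])"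

definition is_index :: "nat list \<Rightarrow> bool" where
  "is_index s \<longleftrightarrow> s \<noteq> [] \<and> (\<forall>a \<in> set s. a > 0)"

definition Sub :: "nat list \<Rightarrow> nat list set" where
  "Sub s = {map ((!) s) [i..<Suc j] | i j. i \<le> j \<and> j < length s}"

definition AT_zeta_term :: "nat \<Rightarrow> 'c::field \<Rightarrow> nat list \<Rightarrow> nat list \<Rightarrow> 'c fps" where
  "AT_zeta_term q \<theta> s is' =
     (\<Prod>j<length s. twist q (int (is' ! j)) (fps_of_poly (AT_H q \<theta> (s ! j - 1))) /
        fps_of_poly (AT_L q \<theta> (is' ! j)) ^ (s ! j))"

definition AT_zeta :: "('c::field \<Rightarrow> real) \<Rightarrow> nat \<Rightarrow> 'c \<Rightarrow> nat list \<Rightarrow> 'c fps" where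
  "AT_zeta v q \<theta> s =
     fps_vlim v (finite_subsets_at_top {is'. length is' = length s \<and> sorted_wrt (>) is'})
       (\<lambda>F. \<Sum>is' \<in> F. AT_zeta_term q \<theta> s is')"

end

theory Submission
  imports Defs
begin

text \<open>Fix the inverse Frobenius twist \<open>\<sigma>\<close> and put \<open>\<tau> = \<sigma>\<^sup>l\<close>. With \<open>\<theta>\<^sub>i = \<theta>\<^bsup>1/q^i\<^esup>\<close> the product
  expansions give \<open>\<tau> \<Omega> = (\<Prod>i<l. t - \<theta>\<^sub>i) \<Omega>\<close> and \<open>\<tau> u\<^sub>i = (t - \<theta>\<^sub>i) u\<^sub>i\<close> for the twists
  \<open>u\<^sub>i = \<Omega>\<^sub>l\<^sup>(\<^sup>-\<^sup>i\<^sup>)\<close>, \<open>i < l\<close>, and the functions \<open>Z\<^sub>s = \<Omega>\<^bsup>wt(s)\<^esup> \<zeta>(s)\<close> satisfy \<open>\<tau> Z\<^sub>s = Z\<^sub>s + \<Omega> e\<close>, where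
  \<open>e\<close> is a polynomial in \<open>\<Omega>\<close> and the \<open>Z\<close> of shorter indices. The claim says that over the field
  generated by the hyperderivatives of \<open>\<Omega>\<close> the two other groups of values contribute to the
  transcendence degree independently of each other. One inequality is the submodularity of the
  rank of algebraic dependence. The other one is proved for functions and then transferred to
  their values at \<open>\<theta>\<close>.

  Transfer. Values never have a larger rank than functions, because an algebraic relation between
  functions, divided by the largest possible power of \<open>t - \<theta>\<close>, can be evaluated at \<open>\<theta>\<close>
  (\<open>rk_values_le_functions\<close>). For the solutions of a linear difference system the ranks agree: this
  is a linear independence criterion in the style of Anderson, Brownawell and Papanikolas, proved
  by an auxiliary function with zeros at the points \<open>\<theta>\<^sub>N\<close> (\<open>value_rank_criterion\<close>) and applied to
  all monomials of bounded degree (\<open>rk_functions_le_values\<close>). The hyperderivatives of \<open>\<Omega>\<close>, of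
  the \<open>u\<^sub>i\<close> and of the series \<open>\<zeta>(s)\<close> form such systems.

  Functions. The field of the hyperderivatives of \<open>u\<^sub>i\<close> up to order \<open>n\<close> is generated by \<open>u\<^sub>i\<close> and the
  quotients \<open>w\<^sub>i\<^sub>j = \<partial>\<^sup>(\<^sup>j\<^sup>) u\<^sub>i / u\<^sub>i\<close>. These are adjoined one after the other, and each of them is
  algebraic over the previous ones together with the hyperderivatives of \<open>\<Omega>\<close> as soon as it is so
  in the presence of the \<open>Z\<^sub>s\<close> and their hyperderivatives.
  For \<open>w\<^sub>i\<^sub>j\<close> the reason is a grading. It satisfies \<open>\<tau> w = w + \<beta>\<close> with \<open>\<beta>\<close> of weight 0, whereas
  the inhomogeneous terms of the equations of the \<open>Z\<^sub>s\<close> are divisible by \<open>\<Omega>\<close>, which is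
  transcendental of weight 1; a relation can be replaced by its part of weight 0
  (\<open>weight_zero_algebraic\<close>).
  For \<open>i < l - 1\<close> the function \<open>u\<^sub>i\<close> is transcendental over everything before it, since the
  multipliers of semi-invariants in a tower of solutions of first order equations are
  multiplicatively generated by the multipliers of the steps and by those of rational functions,
  up to roots (\<open>exponents_in_list\<close>, \<open>rational_exponents_trivial\<close>), and no nontrivial power of \<open>t - \<theta>\<^sub>i\<close> occurs
  among them. Finally \<open>u\<^bsub>l-1\<^esub>\<close> is determined by \<open>\<Omega>\<close> and the other \<open>u\<^sub>i\<close>, because
  \<open>\<Omega> / \<Prod>i<l. u\<^sub>i\<close> is invariant under \<open>\<tau>\<close> and therefore rational (\<open>constants_rational\<close>).\<close>

section \<open>Subrings, subfields and linear spans\<close>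

definition is_subring :: "'a::comm_ring_1 set => bool" where "is_subring R \<longleftrightarrow> 0\<in>R \<and> 1\<in>R \<and>
   (\<forall>x\<in>R. \<forall>y\<in>R. x + y\<in>R \<and> x * y\<in>R) \<and> (\<forall>x\<in>R. - x\<in>R)"

lemma subringI: assumes "0\<in>R" "1\<in>R" "\<And>x y. x\<in>R ==> y\<in>R ==> x + y\<in>R"
  "\<And>x y. x\<in>R ==> y\<in>R ==> x * y\<in>R" "\<And>x. x\<in>R ==> - x\<in>R" shows "is_subring R"
 using assms unfolding is_subring_def by blast

lemma subring_0: "is_subring R ==> 0\<in>R" and subring_1: "is_subring R ==> 1\<in>R"
 and subring_add: "is_subring R ==> x\<in>R ==> y\<in>R ==> x + y\<in>R"
 and subring_mult: "is_subring R ==> x\<in>R ==> y\<in>R ==> x * y\<in>R" and subring_uminus: "is_subring R ==> x\<in>R ==> - x\<in>R"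
 unfolding is_subring_def by blast+

lemma subring_diff: "is_subring R ==> x\<in>R ==> y\<in>R ==> x - y\<in>R"
 using subring_add[of R x "- y"] subring_uminus[of R y] by simp

lemma subring_power: "is_subring R ==> x\<in>R ==> x^n\<in>R" by (induction n) (auto intro: subring_1 subring_mult)

lemma subring_sum: "is_subring R ==> (\<And>i. i\<in>A ==> f i\<in>R) ==> sum f A\<in>R"
 by (induction A rule: infinite_finite_induct) (auto intro: subring_0 subring_add)

lemma subring_prod: "is_subring R ==> (\<And>i. i\<in>A ==> f i\<in>R) ==> prod f A\<in>R"
 by (induction A rule: infinite_finite_induct) (auto intro: subring_1 subring_mult)

lemma subring_of_nat: "is_subring R ==> of_nat n\<in>R" by (induction n) (auto intro: subring_0 subring_1 subring_add)

lemma subfield_subring: "is_subfield F ==> is_subring F" unfolding is_subfield_def is_subring_def by blast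

lemma subfield_inverse: "is_subfield F ==> x\<in>F ==> inverse x\<in>F" unfolding is_subfield_def by blast

lemma subfield_divide: "is_subfield F ==> x\<in>F ==> y\<in>F ==> x/y\<in>F" unfolding divide_inverse
 by (auto intro: subring_mult[OF subfield_subring] subfield_inverse)

lemma subfieldI: assumes "is_subring R" "\<And>x. x\<in>R ==> inverse x\<in>R" shows "is_subfield R"
 using assms unfolding is_subring_def is_subfield_def by blast

definition rgen :: "'a::comm_ring_1 set => 'a set => 'a set" where "rgen R S = is_subring hull (R\<union>S)"

lemma rgen_subring: "is_subring (rgen R S)" unfolding rgen_def by (rule hull_in) (auto simp: is_subring_def)

lemma rgen_base: "R\<subseteq>rgen R S" and rgen_gens: "S\<subseteq>rgen R S"
 unfolding rgen_def using hull_subset[of "R\<union>S" is_subring] by auto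

lemma rgen_minimal: "R\<subseteq>T ==> S\<subseteq>T ==> is_subring T ==> rgen R S\<subseteq>T" unfolding rgen_def by (rule hull_minimal) auto

lemma rgen_mono: "R\<subseteq>R' ==> S\<subseteq>S' ==> rgen R S\<subseteq>rgen R' S'" unfolding rgen_def by (rule hull_mono) auto

lemma adjoin_subfield: "is_subfield (adjoin K S)" unfolding adjoin_def by (rule hull_in) (auto simp: is_subfield_def)

lemma adjoin_base: "K\<subseteq>adjoin K S" and adjoin_gens: "S\<subseteq>adjoin K S"
 unfolding adjoin_def using hull_subset[of "K\<union>S" is_subfield] by auto

lemma adjoin_minimal: "K\<subseteq>F ==> S\<subseteq>F ==> is_subfield F ==> adjoin K S\<subseteq>F" unfolding adjoin_def by (rule hull_minimal) auto

lemma adjoin_mono: "K\<subseteq>K' ==> S\<subseteq>S' ==> adjoin K S\<subseteq>adjoin K' S'" unfolding adjoin_def by (rule hull_mono) auto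

lemma adjoin_Un: "adjoin (adjoin K S) T = adjoin K (S\<union>T)" unfolding adjoin_def by (metis hull_Un_left sup_assoc)

lemma adjoin_same: "is_subfield K ==> S\<subseteq>K ==> adjoin K S = K" unfolding adjoin_def by (simp add: hull_same Un_absorb2)

definition fracs :: "'a::field set => 'a set" where "fracs R = {a/b | a b. a\<in>R \<and> b\<in>R}"

lemma fracs_subfield: assumes R: "is_subring R" shows "is_subfield (fracs R)"
proof (rule subfieldI[OF subringI])
 have *: "a/b\<in>fracs R" if "a\<in>R" "b\<in>R" for a b using that unfolding fracs_def by blast
 show "0\<in>fracs R" "1\<in>fracs R" using *[of 0 1] *[of 1 1] subring_0[OF R] subring_1[OF R] by auto
 fix x y assume "x\<in>fracs R" "y\<in>fracs R"
 then obtain a b c d where x: "x = a/b" "a\<in>R" "b\<in>R" and y: "y = c/d" "c\<in>R" "d\<in>R"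
  unfolding fracs_def by blast
 show "x * y\<in>fracs R" using *[of "a * c" "b * d"] x y by (simp add: subring_mult[OF R])
 show "x + y\<in>fracs R"
 proof (cases "b = 0 \<or> d = 0")
  case True thus ?thesis using x y * by auto
 next case False hence "x + y = (a * d + c * b)/(b * d)" using x y by (simp add: field_simps)
  thus ?thesis using *[of "a * d + c * b" "b * d"] x y by (simp add: subring_mult[OF R] subring_add[OF R])
 qed
next fix x assume "x\<in>fracs R"
 then obtain a b where x: "x = a/b" "a\<in>R" "b\<in>R" unfolding fracs_def by blast
 have "- x = (- a)/b" "inverse x = b/a" using x by simp_all
 thus "- x\<in>fracs R" "inverse x\<in>fracs R" using x subring_uminus[OF R, of a] unfolding fracs_def by blast+
qed

lemma fracs_base: "is_subring R ==> R\<subseteq>fracs R" unfolding fracs_def using subring_1[of R] by force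

lemma adjoin_eq_fracs: "adjoin K S = fracs (rgen K S)"
proof
 show "adjoin K S\<subseteq>fracs (rgen K S)" using fracs_base[OF rgen_subring, of K S] rgen_base[of K S] rgen_gens[of S K]
  by (intro adjoin_minimal fracs_subfield rgen_subring) auto
 have "rgen K S\<subseteq>adjoin K S" by (intro rgen_minimal adjoin_base adjoin_gens subfield_subring adjoin_subfield)
 thus "fracs (rgen K S)\<subseteq>adjoin K S" unfolding fracs_def using subfield_divide[OF adjoin_subfield[of K S]] by blast
qed

lemma common_denominator: assumes R: "is_subring R" and "finite A" "A\<subseteq>fracs R" shows "\<exists>d\<in>R. d~=0 \<and> (\<forall>a\<in>A. d * a\<in>R)"
 using assms(2,3)
proof (induction A)
 case empty show ?case using subring_1[OF R] by (intro bexI[of _ 1]) auto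
next case (insert x A)
 then obtain d where d: "d\<in>R" "d~=0" "\<forall>a\<in>A. d * a\<in>R" by auto
 from insert obtain a b where x: "x = a/b" "a\<in>R" "b\<in>R" unfolding fracs_def by auto
 show ?case
 proof (cases "b = 0")
  case True thus ?thesis using d x subring_0[OF R] by (intro bexI[of _ d]) auto
 next case False
  have "b * d * y\<in>R" if "y\<in>insert x A" for y
  proof (cases "y = x")
   case True hence "b * d * y = d * a" using x False by simp thus ?thesis using d x subring_mult[OF R, of d a] by metis
  next case False thus ?thesis using that d x subring_mult[OF R, of b "d * y"] by (simp add: mult.assoc)
  qed
  thus ?thesis using d x False subring_mult[OF R] by (intro bexI[of _ "b * d"]) auto
 qed
qed

inductive_set lspan :: "'a::comm_ring_1 set => 'a set => 'a set" for R S where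
 zero: "0\<in>lspan R S"
| step: "r\<in>R ==> s\<in>S ==> y\<in>lspan R S ==> r * s + y\<in>lspan R S"

lemma lspan_add: "x\<in>lspan R S ==> y\<in>lspan R S ==> x + y\<in>lspan R S"
 by (induction x rule: lspan.induct) (simp_all add: add.assoc lspan.step)

lemma lspan_scale: assumes "is_subring R" "r\<in>R" "x\<in>lspan R S" shows "r * x\<in>lspan R S" using assms(3)
proof induction
 case zero thus ?case by (simp add: lspan.zero)
next case (step a s y) hence "(r * a) * s + r * y\<in>lspan R S"
  using subring_mult[OF assms(1,2)] by (intro lspan.step) auto
 thus ?case by (simp add: algebra_simps)
qed

lemma lspan_mult_gen: "r\<in>R ==> s\<in>S ==> r * s\<in>lspan R S" using lspan.step[OF _ _ lspan.zero, of r R s S] by simp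

lemma lspan_gen: "is_subring R ==> s\<in>S ==> s\<in>lspan R S" using lspan_mult_gen[OF subring_1, of R s S] by simp

lemma lspan_uminus: "is_subring R ==> x\<in>lspan R S ==> - x\<in>lspan R S"
 using lspan_scale[of R "- 1" x S] subring_uminus[of R 1] subring_1[of R] by simp

lemma lspan_sum: "(\<And>i. i\<in>A ==> f i\<in>lspan R S) ==> sum f A\<in>lspan R S"
 by (induction A rule: infinite_finite_induct) (auto intro: lspan.zero lspan_add)

lemma lspan_mono: "R\<subseteq>R' ==> S\<subseteq>S' ==> lspan R S\<subseteq>lspan R' S'"
proof
 fix x assume "R\<subseteq>R'" "S\<subseteq>S'" "x\<in>lspan R S"
 from this(3,1,2) show "x\<in>lspan R' S'" by induction (auto intro: lspan.intros)
qed

lemma lspan_mult_image: assumes "\<And>s. s\<in>S ==> a * s\<in>lspan R T" "is_subring R" "x\<in>lspan R S" shows "a * x\<in>lspan R T"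
 using assms(3)
proof induction
 case (step r s y) hence "r*(a * s) + a * y\<in>lspan R T" using assms lspan_scale lspan_add by blast
 thus ?case by (simp add: algebra_simps)
qed (simp add: lspan.zero)

lemma lspan_mult: assumes R: "is_subring R" and "x\<in>lspan R S" "y\<in>lspan R T"
 shows "x * y\<in>lspan R {s * t | s t. s\<in>S \<and> t\<in>T}" using assms(2)
proof induction
 case (step r s x)
 have "s * y\<in>lspan R {s * t | s t. s\<in>S \<and> t\<in>T}"
  by (rule lspan_mult_image[OF _ R assms(3)], rule lspan_gen[OF R]) (use step(2) in blast)
 hence "r*(s * y) + x * y\<in>lspan R {s * t | s t. s\<in>S \<and> t\<in>T}"
  by (rule lspan_add[OF lspan_scale[OF R step(1)] step(4)])
 thus ?case by (simp add: distrib_right mult.assoc)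
qed (simp add: lspan.zero)

lemma lspan_finite: assumes R: "is_subring R" and "finite S" "x\<in>lspan R S"
 shows "\<exists>c. (\<forall>s\<in>S. c s\<in>R) \<and> x = (\<Sum>s\<in>S. c s * s)" using assms(3)
proof induction
 case zero show ?case using subring_0[OF R] by (intro exI[of _ "\<lambda>_. 0"]) auto
next case (step r s y)
 then obtain c where c: "\<forall>s\<in>S. c s\<in>R" "y = (\<Sum>s\<in>S. c s * s)" by auto
 have "(\<Sum>u\<in>S. (c u + (if u = s then r else 0)) * u) = y + (\<Sum>u\<in>S. if u = s then r * u else 0)"
  unfolding c(2) by (subst sum.distrib[symmetric]) (auto intro!: sum.cong simp: algebra_simps)
 also have "... = r * s + y" using step assms(2) by (simp add: sum.delta')
 finally show ?case using step c R
  by (intro exI[of _ "\<lambda>u. c u + (if u = s then r else 0)"]) (auto intro: subring_add subring_0)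
qed

text \<open>Gaussian elimination: a homogeneous linear system with more unknowns than equations has a
  nontrivial solution over the subfield that contains its coefficients.\<close>

lemma homogeneous_system: assumes K: "is_subfield K" and "finite J" "finite I" "card J < card I"
  and "\<And>i j. i\<in>I ==> j\<in>J ==> c i j\<in>K" shows "\<exists>x. (\<forall>i\<in>I. x i\<in>K) \<and> (\<exists>i\<in>I. x i~=0) \<and> (\<forall>j\<in>J. (\<Sum>i\<in>I. x i * c i j) = 0)"
 using assms(2-5)
proof (induction J arbitrary: I c)
 case empty thus ?case using subring_1[OF subfield_subring[OF K]]
  by (intro exI[of _ "\<lambda>_. 1"]) (auto simp: card_gt_0_iff)
next case (insert k J)
 note R = subfield_subring[OF K]
 show ?case
 proof (cases "\<forall>i\<in>I. c i k = 0")
  case True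
  have "card J < card I" using insert by simp
  from insert.IH[OF insert.prems(1) this] insert.prems(3) obtain x where
   "\<forall>i\<in>I. x i\<in>K" "\<exists>i\<in>I. x i~=0" "\<forall>j\<in>J. (\<Sum>i\<in>I. x i * c i j) = 0" by blast
  thus ?thesis using True by (intro exI[of _ x]) auto
 next case False
  then obtain m where m: "m\<in>I" "c m k~=0" by auto
  define c' where "c' i j = c i j - c i k/c m k * c m j" for i j
  have 1: "finite (I - {m})" "card J < card (I - {m})" using insert m by auto
  have 2: "c' i j\<in>K" if "i\<in>I - {m}" "j\<in>J" for i j unfolding c'_def using that insert.prems(3) m
   by (intro subring_diff[OF R] subring_mult[OF R] subfield_divide[OF K]) auto
  obtain x where x: "\<forall>i\<in>I - {m}. x i\<in>K" "\<exists>i\<in>I - {m}. x i~=0" "\<forall>j\<in>J. (\<Sum>i\<in>I - {m}. x i * c' i j) = 0"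
   using insert.IH[OF 1, of c'] 2 by blast
  define z where "z = - (\<Sum>i\<in>I - {m}. x i*(c i k/c m k))"
  define y where "y = x(m := z)"
  have sm: "(\<Sum>i\<in>I. y i * c i j) = z * c m j + (\<Sum>i\<in>I - {m}. x i * c i j)" for j
   unfolding y_def using m insert.prems(1) by (subst sum.remove[of _ m]) (auto intro!: sum.cong)
  have z: "z\<in>K" unfolding z_def using x(1) insert.prems(3) m
   by (intro subring_uminus[OF R] subring_sum[OF R] subring_mult[OF R] subfield_divide[OF K]) auto
  have "(\<Sum>i\<in>I. y i * c i j) = 0" if "j\<in>insert k J" for j
  proof (cases "j = k")
   case True
   have "z * c m k = - (\<Sum>i\<in>I - {m}. x i * c i k)" unfolding z_def using m by (simp add: sum_distrib_right)
   thus ?thesis using True sm by simp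
  next case False hence "(\<Sum>i\<in>I - {m}. x i * c' i j) = 0" using that x by auto
   hence "(\<Sum>i\<in>I - {m}. x i * c i j) = (\<Sum>i\<in>I - {m}. x i*(c i k/c m k)) * c m j"
    unfolding c'_def by (simp add: right_diff_distrib sum_subtractf sum_distrib_right mult.assoc)
   thus ?thesis unfolding sm z_def by simp
  qed
  moreover have "\<forall>i\<in>I. y i\<in>K" using x(1) z by (auto simp: y_def)
  moreover have "\<exists>i\<in>I. y i~=0" using x(2) by (auto simp: y_def)
  ultimately show ?thesis by blast
 qed
qed

lemma lspan_dependent: assumes K: "is_subfield K" and "finite W" "finite I" "card W < card I"
  and "\<And>i. i\<in>I ==> f i\<in>lspan K W" shows "\<exists>x. (\<forall>i\<in>I. x i\<in>K) \<and> (\<exists>i\<in>I. x i~=0) \<and> (\<Sum>i\<in>I. x i * f i) = 0"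
proof -
 have "\<forall>i\<in>I. \<exists>c. (\<forall>s\<in>W. c s\<in>K) \<and> f i = (\<Sum>s\<in>W. c s * s)"
  using lspan_finite[OF subfield_subring[OF K] assms(2)] assms(5) by blast
 then obtain c where c: "\<And>i s. i\<in>I ==> s\<in>W ==> c i s\<in>K" "\<And>i. i\<in>I ==> f i = (\<Sum>s\<in>W. c i s * s)" by metis
 obtain x where x: "\<forall>i\<in>I. x i\<in>K" "\<exists>i\<in>I. x i~=0" "\<forall>j\<in>W. (\<Sum>i\<in>I. x i * c i j) = 0"
  using homogeneous_system[OF assms(1-4), of c] c(1) by blast
 have "(\<Sum>i\<in>I. x i * f i) = (\<Sum>i\<in>I. \<Sum>s\<in>W. x i * c i s * s)"
  using c(2) by (auto intro!: sum.cong simp: sum_distrib_left mult.assoc)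
 also have "... = (\<Sum>s\<in>W. (\<Sum>i\<in>I. x i * c i s) * s)" by (subst sum.swap) (simp add: sum_distrib_right)
 also have "... = 0" using x(3) by simp
 finally show ?thesis using x by blast
qed

section \<open>Polynomials over a subring\<close>

definition pol :: "'a::comm_ring_1 set => 'a poly set" where "pol R = {p. \<forall>i. coeff p i\<in>R}"

lemma polD: "p\<in>pol R ==> coeff p i\<in>R" by (simp add: pol_def)

lemma polI: "(\<And>i. coeff p i\<in>R) ==> p\<in>pol R" by (simp add: pol_def)

lemma pol_subring: assumes R: "is_subring R" shows "is_subring (pol R)" by (rule subringI)
  (auto simp: pol_def coeff_mult coeff_1 intro!: subring_sum[OF R] subring_mult[OF R]
   subring_add[OF R] subring_uminus[OF R] subring_0[OF R] subring_1[OF R])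

lemma pol_smult: "is_subring R ==> c\<in>R ==> p\<in>pol R ==> smult c p\<in>pol R" by (auto simp: pol_def intro: subring_mult)

lemma pol_pCons: "c\<in>R ==> p\<in>pol R ==> pCons c p\<in>pol R" by (auto simp: pol_def coeff_pCons split: nat.split)

lemma pol_0: "is_subring R ==> 0\<in>pol R" and pol_1: "is_subring R ==> 1\<in>pol R"
 using subring_0[OF pol_subring] subring_1[OF pol_subring] by blast+

lemma pol_const: "is_subring R ==> c\<in>R ==> [:c:]\<in>pol R" by (intro pol_pCons pol_0)

lemma pol_monom: "is_subring R ==> c\<in>R ==> monom c n\<in>pol R" by (auto simp: pol_def intro: subring_0)

lemma pol_mono: "R\<subseteq>S ==> pol R\<subseteq>pol S" by (auto simp: pol_def)

lemma pol_eval: "is_subring R ==> p\<in>pol R ==> x\<in>R ==> poly p x\<in>R"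
 unfolding poly_altdef by (auto simp: pol_def intro!: subring_sum subring_mult subring_power)

lemma pol_pcompose: assumes R: "is_subring R" and "p\<in>pol R" "r\<in>pol R" shows "pcompose p r\<in>pol R"
proof -
 have "\<forall>i. coeff p i\<in>R ==> pcompose p r\<in>pol R"
 proof (induction p)
  case (pCons a p)
  have "a\<in>R" "\<forall>i. coeff p i\<in>R" using pCons.prems coeff_pCons_0[of a p] coeff_pCons_Suc[of a p] by metis+
  with pCons assms(3) show ?case by (auto simp: pcompose_pCons intro!: subring_add[OF pol_subring[OF R]]
    subring_mult[OF pol_subring[OF R]] pol_const[OF R])
 qed (simp add: pol_0[OF R])
 thus ?thesis using assms(2) by (simp add: pol_def)
qed

lemma coeffs_subset_iff_pol: assumes "0\<in>R" shows "set (coeffs p)\<subseteq>R \<longleftrightarrow> p\<in>pol R"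
proof -
 have "p\<in>pol R \<longleftrightarrow> range (coeff p)\<subseteq>R" by (auto simp: pol_def)
 thus ?thesis using assms by (simp add: range_coeff)
qed

lemma algebraic_iff_pol: assumes "is_subfield K" shows "algebraic_over K x \<longleftrightarrow> (\<exists>f\<in>pol K. f~=0 \<and> poly f x = 0)"
 unfolding algebraic_over_def using coeffs_subset_iff_pol[OF subring_0[OF subfield_subring[OF assms]]] by blast

lemma rgen_singleton: assumes R: "is_subring R" shows "rgen R {x} = {poly p x | p. p\<in>pol R}"
proof
 have "is_subring {poly p x | p. p\<in>pol R}"
 proof (rule subringI)
  show "0\<in>{poly p x |p. p\<in>pol R}" using pol_0[OF R] by (auto intro!: exI[of _ 0])
  show "1\<in>{poly p x |p. p\<in>pol R}" using pol_1[OF R] by (auto intro!: exI[of _ 1])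
  fix a b assume "a\<in>{poly p x |p. p\<in>pol R}" "b\<in>{poly p x |p. p\<in>pol R}"
  then obtain p q where pq: "a = poly p x" "b = poly q x" "p\<in>pol R" "q\<in>pol R" by auto
  show "a + b\<in>{poly p x |p. p\<in>pol R}"
   using pq subring_add[OF pol_subring[OF R], of p q] by (auto intro!: exI[of _ "p + q"])
  show "a * b\<in>{poly p x |p. p\<in>pol R}"
   using pq subring_mult[OF pol_subring[OF R], of p q] by (auto intro!: exI[of _ "p * q"])
 next fix a assume "a\<in>{poly p x |p. p\<in>pol R}"
  then obtain p where "a = poly p x" "p\<in>pol R" by auto
  thus "- a\<in>{poly p x |p. p\<in>pol R}"
   using subring_uminus[OF pol_subring[OF R], of p] by (auto intro!: exI[of _ "- p"])
 qed
 moreover have "r\<in>{poly p x | p. p\<in>pol R}" if "r\<in>R" for r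
  using pol_const[OF R that] by (auto intro!: exI[of _ "[:r:]"])
 moreover have "x\<in>{poly p x | p. p\<in>pol R}" using pol_pCons[OF subring_0[OF R] pol_1[OF R]]
  by (auto intro!: exI[of _ "[:0, 1:]"] simp: one_pCons)
 ultimately show "rgen R {x}\<subseteq>{poly p x | p. p\<in>pol R}" by (intro rgen_minimal) auto
 show "{poly p x | p. p\<in>pol R}\<subseteq>rgen R {x}"
  using pol_eval[OF rgen_subring] pol_mono[OF rgen_base] rgen_gens[of "{x}" R] by blast
qed

lemma adjoin_singleton: assumes K: "is_subfield K" and "y\<in>adjoin K {x}"
 obtains p q where "p\<in>pol K" "q\<in>pol K" "poly q x~=0" "y = poly p x/poly q x"
proof -
 obtain p q where pq: "p\<in>pol K" "q\<in>pol K" "y = poly p x/poly q x"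
  using assms(2) unfolding adjoin_eq_fracs fracs_def rgen_singleton[OF subfield_subring[OF K]] by auto
 show ?thesis
 proof (cases "poly q x = 0")
  case True thus ?thesis using that[of 0 1] pq pol_0 pol_1 subfield_subring[OF K] by auto
 next case False thus ?thesis using that pq by blast
 qed
qed

section \<open>Algebraic elements\<close>

text \<open>A finite-dimensional space that contains 1 and is stable under multiplication by the elements
  of \<open>A\<close> forces them, and everything they generate, to be algebraic. This turns the
  closure properties of algebraic elements into the construction of spanning sets.\<close>

definition fin_stable :: "'a::field set => 'a set => bool" where
 "fin_stable K A \<longleftrightarrow> (\<exists>W. finite W \<and> 1\<in>W \<and> (\<forall>a\<in>A. \<forall>w\<in>W. a * w\<in>lspan K W))"

lemma fin_stable_algebraic: assumes K: "is_subfield K" and "fin_stable K {x}" shows "algebraic_over K x"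
proof -
 note R = subfield_subring[OF K]
 obtain W where W: "finite W" "1\<in>W" "\<forall>w\<in>W. x * w\<in>lspan K W" using assms(2) unfolding fin_stable_def by auto
 have pw: "x^i\<in>lspan K W" for i
 proof (induction i)
  case 0 thus ?case using lspan_gen[OF R W(2)] by simp
 next case (Suc i)
  have "x * x^i\<in>lspan K W" by (rule lspan_mult_image[OF _ R Suc]) (use W(3) in blast)
  thus ?case by simp
 qed
 obtain y where y: "\<forall>i\<in>{..card W}. y i\<in>K" "\<exists>i\<in>{..card W}. y i~=0" "(\<Sum>i\<in>{..card W}. y i * x^i) = 0"
  using lspan_dependent[OF K W(1), of "{..card W}" "\<lambda>i. x^i"] pw by auto
 define f where "f = (\<Sum>i\<le>card W. monom (y i) i)"
 have c: "coeff f i = (if i\<le>card W then y i else 0)" for i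
  unfolding f_def coeff_sum coeff_monom by (auto simp: sum.delta')
 have "f\<in>pol K" using y(1) subring_0[OF R] by (auto simp: pol_def c)
 moreover have "f~=0" using y(2) c by (metis atMost_iff coeff_0)
 moreover have "poly f x = 0" unfolding f_def using y(3) by (simp add: poly_sum poly_monom)
 ultimately show ?thesis unfolding algebraic_iff_pol[OF K] by blast
qed

lemma fin_stable_empty: "is_subring K ==> fin_stable K {}" unfolding fin_stable_def by (auto intro!: exI[of _ "{1}"])

lemma fin_stable_insert: assumes R: "is_subring K" and "fin_stable K A"
  and rel: "x^d = (\<Sum>i<d. c i * x^i)" and c: "\<And>i. i < d ==> c i\<in>K\<union>A" shows "fin_stable K (insert x A)"
proof -
 obtain W where W: "finite W" "1\<in>W" "\<forall>a\<in>A. \<forall>w\<in>W. a * w\<in>lspan K W" using assms(2) unfolding fin_stable_def by auto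
 have d: "d > 0" using rel by (cases d) auto
 define W' where "W' = (\<lambda>(i, w). x^i * w)`({..<d}\<times>W)"
 have mem: "x^i * w\<in>lspan K W'" if "i < d" "w\<in>lspan K W" for i w
  by (rule lspan_mult_image[OF _ R that(2)], rule lspan_gen[OF R]) (use that(1) in \<open>auto simp: W'_def\<close>)
 have cw: "c i * w\<in>lspan K W" if "i < d" "w\<in>W" for i w
  using c[OF that(1)] W(3) that(2) lspan_mult_gen[of "c i" K w W] by blast
 show ?thesis unfolding fin_stable_def
 proof (intro exI conjI ballI)
  show "finite W'" using W by (simp add: W'_def)
  show "1\<in>W'" unfolding W'_def using d W(2) by (auto intro!: image_eqI[of _ _ "(0, 1)"])
  fix a w' assume a: "a\<in>insert x A" and "w'\<in>W'"
  then obtain i w where iw: "i < d" "w\<in>W" "w' = x^i * w" by (auto simp: W'_def)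
  show "a * w'\<in>lspan K W'"
  proof (cases "a\<in>A")
   case True
   have "x^i*(a * w)\<in>lspan K W'" using mem iw(1,2) W(3) True by blast
   thus ?thesis using iw by (simp add: ac_simps)
  next case False hence a: "a * w' = x^Suc i * w" using a iw by simp show ?thesis
   proof (cases "Suc i < d")
    case True thus ?thesis unfolding a using mem lspan_gen[OF R iw(2)] by blast
   next case False hence "Suc i = d" using iw by simp hence "a * w' = (\<Sum>i<d. x^i*(c i * w))"
     unfolding a by (simp only: rel sum_distrib_right) (simp add: ac_simps)
    thus ?thesis using mem cw[OF _ iw(2)] by (auto intro: lspan_sum)
   qed
  qed
 qed
qed

lemma fin_stable_mono: "fin_stable K A ==> B\<subseteq>A ==> fin_stable K B" unfolding fin_stable_def by blast

lemma fin_stable_add: "is_subring K ==> fin_stable K {x, y} ==> fin_stable K {x + y}"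
 unfolding fin_stable_def by (auto simp: distrib_right intro!: lspan_add)

lemma fin_stable_mult: assumes "is_subring K" "fin_stable K {x, y}" shows "fin_stable K {x * y}"
proof -
 obtain W where W: "finite W" "1\<in>W" "\<forall>a\<in>{x,y}. \<forall>w\<in>W. a * w\<in>lspan K W"
  using assms(2) unfolding fin_stable_def by auto
 have "x*(y * w)\<in>lspan K W" if "w\<in>W" for w
  using W that by (intro lspan_mult_image[OF _ assms(1), of W x W "y * w"]) auto
 thus ?thesis using W unfolding fin_stable_def by (auto simp: mult.assoc)
qed

lemma algebraic_monic: assumes K: "is_subfield K" and "f\<in>pol K" "f~=0" "poly f x = 0"
 shows "x^degree f = (\<Sum>i<degree f. (- coeff f i/lead_coeff f) * x^i)"
proof -
 have "(\<Sum>i\<le>degree f. coeff f i * x^i) = 0" using assms(4) by (simp add: poly_altdef)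
 hence "(\<Sum>i<degree f. coeff f i * x^i) + lead_coeff f * x^degree f = 0" by (simp flip: lessThan_Suc_atMost)
 hence "x^degree f = - (\<Sum>i<degree f. coeff f i * x^i)/lead_coeff f"
  using assms(3) by (simp add: field_simps add_eq_0_iff)
 thus ?thesis by (simp add: sum_divide_distrib sum_negf)
qed

lemma fin_stable_insert_algebraic: assumes K: "is_subfield K" and "fin_stable K A" "algebraic_over K x"
 shows "fin_stable K (insert x A)"
proof -
 obtain f where f: "f\<in>pol K" "f~=0" "poly f x = 0" using assms(3) unfolding algebraic_iff_pol[OF K] by auto
 have "- coeff f i/lead_coeff f\<in>K" for i
  using f(1) subfield_divide[OF K] subring_uminus[OF subfield_subring[OF K]] by (simp add: pol_def)
 thus ?thesis using fin_stable_insert[OF subfield_subring[OF K] assms(2) algebraic_monic[OF K f]] by blast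
qed

lemma fin_stable_finite: assumes K: "is_subfield K" and "finite A" "\<And>x. x\<in>A ==> algebraic_over K x"
 shows "fin_stable K A" using assms(2,3)
 by (induction A) (auto intro: fin_stable_empty subfield_subring[OF K] fin_stable_insert_algebraic[OF K])

lemma algebraic_base: assumes "is_subfield K" "x\<in>K" shows "algebraic_over K x"
proof -
 note R = subfield_subring[OF assms(1)]
 have "[:- x, 1:]\<in>pol K" by (intro pol_pCons pol_0[OF R] subring_1[OF R] subring_uminus[OF R] assms(2))
 thus ?thesis unfolding algebraic_iff_pol[OF assms(1)] by (intro bexI[of _ "[:- x, 1:]"]) auto
qed

lemma algebraics_subfield: assumes K: "is_subfield K" shows "is_subfield {x. algebraic_over K x}"
proof (rule subfieldI[OF subringI]; unfold mem_Collect_eq)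
 note R = subfield_subring[OF K]
 show "algebraic_over K 0" "algebraic_over K 1" using algebraic_base[OF K] subring_0[OF R] subring_1[OF R] by auto
 fix x y assume "algebraic_over K x" "algebraic_over K y"
 hence st: "fin_stable K {x, y}" by (intro fin_stable_finite[OF K]) auto
 show "algebraic_over K (x + y)" "algebraic_over K (x * y)"
  using fin_stable_algebraic[OF K] fin_stable_add[OF R st] fin_stable_mult[OF R st] by auto
next note R = subfield_subring[OF K]
 fix x assume x: "algebraic_over K x"
 have "fin_stable K {x, - 1}" using x algebraic_base[OF K subring_uminus[OF R subring_1[OF R]]]
  by (intro fin_stable_finite[OF K]) auto
 thus "algebraic_over K (- x)" using fin_stable_algebraic[OF K] fin_stable_mult[OF R, of x "- 1"] by simp
 show "algebraic_over K (inverse x)"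
 proof (cases "x = 0")
  case True thus ?thesis using x by simp
 next case False
  obtain f where f: "f\<in>pol K" "f~=0" "poly f x = 0" using x unfolding algebraic_iff_pol[OF K] by auto
  have "reflect_poly f\<in>pol K" using f(1) subring_0[OF R] by (auto simp: pol_def coeff_reflect_poly)
  moreover have "poly (reflect_poly f) (inverse x) = 0" using False f(3) by (simp add: poly_reflect_poly_nz)
  ultimately show ?thesis unfolding algebraic_iff_pol[OF K] using f(2) by (intro bexI[of _ "reflect_poly f"]) auto
 qed
qed

lemma algebraic_trans: assumes K: "is_subfield K" and "algebraic_over {y. algebraic_over K y} x"
 shows "algebraic_over K x"
proof -
 define L where "L = {y. algebraic_over K y}"
 have L: "is_subfield L" unfolding L_def by (rule algebraics_subfield[OF K])
 obtain f where f: "f\<in>pol L" "f~=0" "poly f x = 0"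
  using assms(2) unfolding L_def[symmetric] algebraic_iff_pol[OF L] by auto
 define c where "c i = - coeff f i/lead_coeff f" for i
 have c: "c i\<in>L" for i using f(1) subfield_divide[OF L] subring_uminus[OF subfield_subring[OF L]]
  by (simp add: pol_def c_def)
 have "fin_stable K (c`{..<degree f})" using c by (intro fin_stable_finite[OF K]) (auto simp: L_def)
 hence "fin_stable K (insert x (c`{..<degree f}))" using algebraic_monic[OF L f] unfolding c_def[symmetric]
  by (intro fin_stable_insert[OF subfield_subring[OF K]]) auto
 thus ?thesis using fin_stable_algebraic[OF K] fin_stable_mono by blast
qed

definition acl :: "'a::field set => 'a set => 'a set" where "acl K S = {x. algebraic_over (adjoin K S) x}"

lemma acl_subfield: "is_subfield (acl K S)" unfolding acl_def by (rule algebraics_subfield[OF adjoin_subfield])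

lemma adjoin_acl: "adjoin K S\<subseteq>acl K S" unfolding acl_def using algebraic_base[OF adjoin_subfield] by blast

lemma acl_gens: "S\<subseteq>acl K S" and acl_base: "K\<subseteq>acl K S"
 using adjoin_acl[of K S] adjoin_gens[of S K] adjoin_base[of K S] by auto

lemma algebraic_mono: assumes "K\<subseteq>L" "algebraic_over K x" shows "algebraic_over L x"
 using assms unfolding algebraic_over_def by blast

lemma acl_closed: assumes "T\<subseteq>acl K S" shows "acl K T\<subseteq>acl K S"
proof
 fix x assume "x\<in>acl K T"
 moreover have "adjoin K T\<subseteq>acl K S" by (intro adjoin_minimal acl_base assms acl_subfield)
 ultimately have "algebraic_over (acl K S) x" using algebraic_mono[of "adjoin K T" "acl K S" x] by (simp add: acl_def)
 thus "x\<in>acl K S" using algebraic_trans[OF adjoin_subfield[of K S], of x] by (simp add: acl_def)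
qed

lemma acl_mono: "S\<subseteq>T ==> acl K S\<subseteq>acl K T" using acl_closed[of S K T] acl_gens[of T K] by auto

lemma acl_genI: "x\<in>S ==> x\<in>acl K S" using acl_gens[of S K] by auto

lemma acl_monoD: "x\<in>acl K S ==> S\<subseteq>T ==> x\<in>acl K T" using acl_mono[of S T K] by auto

lemma acl_eqI: "S\<subseteq>acl K T ==> T\<subseteq>acl K S ==> acl K S = acl K T" using acl_closed[of S K T] acl_closed[of T K S] by auto

lemma acl_base_change: assumes "K\<subseteq>F" "F\<subseteq>acl K {}" shows "acl F S = acl K S"
proof
 have "adjoin K S\<subseteq>adjoin F S" by (rule adjoin_mono[OF assms(1)]) simp
 thus "acl K S\<subseteq>acl F S" unfolding acl_def using algebraic_mono by auto
 have "adjoin F S\<subseteq>acl K S"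
  using assms(2) acl_mono[of "{}" S K] acl_gens[of S K] by (intro adjoin_minimal acl_subfield) auto
 hence "x\<in>acl K S" if "x\<in>acl F S" for x
  using that algebraic_trans[OF adjoin_subfield[of K S], of x] algebraic_mono[of "adjoin F S" _ x]
  unfolding acl_def by simp
 thus "acl F S\<subseteq>acl K S" by auto
qed

lemma poly_eq_sum:
 fixes p :: "'a::comm_ring_1 poly"
 assumes "degree p\<le>N" shows "poly p x = (\<Sum>j\<le>N. coeff p j * x^j)" unfolding poly_altdef using assms
 by (intro sum.mono_neutral_left) (auto simp: coeff_eq_0)

text \<open>An algebraic relation for \<open>y\<close> over \<open>M(x)\<close> becomes, after clearing denominators, a polynomial
  relation between \<open>x\<close> and \<open>y\<close> over \<open>M\<close>, and then it may be read as a relation for \<open>x\<close>.\<close>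

lemma acl_exchange: assumes "y\<in>acl K (insert x S)" "y\<notin>acl K S" shows "x\<in>acl K (insert y S)"
proof -
 define M where "M = adjoin K S"
 have M: "is_subfield M" unfolding M_def by (rule adjoin_subfield)
 note R = subfield_subring[OF M]
 have "algebraic_over (adjoin M {x}) y" using assms(1) unfolding acl_def M_def adjoin_Un by (simp add: Un_commute)
 then obtain f where f: "f\<in>pol (adjoin M {x})" "f~=0" "poly f y = 0"
  unfolding algebraic_iff_pol[OF adjoin_subfield] by auto
 have "coeff f`{..degree f}\<subseteq>fracs (rgen M {x})" using f(1) unfolding adjoin_eq_fracs pol_def by auto
 from common_denominator[OF rgen_subring _ this] obtain d where
  d: "d\<in>rgen M {x}" "d~=0" "\<forall>i\<le>degree f. d * coeff f i\<in>rgen M {x}" by auto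
 from d(3) have "\<forall>i. \<exists>p. i\<le>degree f --> p\<in>pol M \<and> d * coeff f i = poly p x" unfolding rgen_singleton[OF R] by blast
 then obtain P where P: "\<And>i. i\<le>degree f ==> P i\<in>pol M" "\<And>i. i\<le>degree f ==> d * coeff f i = poly (P i) x" by metis
 obtain N where N: "\<And>i. i\<le>degree f ==> degree (P i)\<le>N"
  using finite_nat_set_iff_bounded_le[of "(\<lambda>i. degree (P i))`{..degree f}"] by auto
 define Q where "Q j = (\<Sum>i\<le>degree f. monom (coeff (P i) j) i)" for j
 have cQ: "coeff (Q j) i = (if i\<le>degree f then coeff (P i) j else 0)" for i j
  unfolding Q_def coeff_sum coeff_monom by (auto simp: sum.delta')
 have Q: "Q j\<in>pol M" for j using P(1) subring_0[OF R] by (auto simp: pol_def cQ)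
 define h where "h = (\<Sum>j\<le>N. monom (poly (Q j) y) j)"
 have ch: "coeff h j = (if j\<le>N then poly (Q j) y else 0)" for j
  unfolding h_def coeff_sum coeff_monom by (auto simp: sum.delta')
 have "poly (Q j) y\<in>adjoin M {y}" for j using Q[of j] adjoin_gens[of "{y}" M] adjoin_base[of M "{y}"] pol_mono
  by (intro pol_eval subfield_subring adjoin_subfield) auto
 hence hp: "h\<in>pol (adjoin M {y})"
  using subring_0[OF subfield_subring[OF adjoin_subfield[of M "{y}"]]] by (auto simp: pol_def ch)
 have "poly h x = (\<Sum>j\<le>N. \<Sum>i\<le>degree f. coeff (P i) j * y^i * x^j)"
  unfolding h_def Q_def by (simp add: poly_sum poly_monom sum_distrib_right)
 also have "... = (\<Sum>i\<le>degree f. (\<Sum>j\<le>N. coeff (P i) j * x^j) * y^i)"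
  by (subst sum.swap) (simp add: sum_distrib_left sum_distrib_right ac_simps)
 also have "... = (\<Sum>i\<le>degree f. d * coeff f i * y^i)"
 proof (rule sum.cong)
  fix i assume i: "i\<in>{..degree f}"
  have "poly (P i) x = (\<Sum>j\<le>N. coeff (P i) j * x^j)" using N i by (intro poly_eq_sum) auto
  thus "(\<Sum>j\<le>N. coeff (P i) j * x^j) * y^i = d * coeff f i * y^i" using P(2) i by simp
 qed simp
 also have "... = d * poly f y" by (simp add: poly_altdef sum_distrib_left mult.assoc)
 finally have h0: "poly h x = 0" using f(3) by simp
 have "poly (P (degree f)) x~=0" using P(2)[of "degree f"] d f(2) by auto
 then obtain j where j: "coeff (P (degree f)) j~=0" by (metis poly_0 poly_eqI coeff_0)
 have jN: "j\<le>N" using j N[of "degree f"] le_degree by fastforce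
 have "Q j~=0" using j cQ[of j "degree f"] by auto
 hence "poly (Q j) y~=0" using assms(2) Q[of j] unfolding acl_def M_def[symmetric] algebraic_iff_pol[OF M] by auto
 hence "h~=0" using ch[of j] jN by auto
 hence "algebraic_over (adjoin M {y}) x" unfolding algebraic_iff_pol[OF adjoin_subfield] using hp h0 by auto
 thus ?thesis unfolding acl_def M_def adjoin_Un by (simp add: Un_commute)
qed

section \<open>Independence and rank\<close>

definition indep :: "'a::field set => 'a set => bool" where "indep K B \<longleftrightarrow> (\<forall>x\<in>B. x\<notin>acl K (B - {x}))"

lemma indep_mono: "indep K B ==> A\<subseteq>B ==> indep K A" unfolding indep_def by (meson Diff_mono acl_monoD order_refl subsetD)

lemma indep_insert: assumes "indep K A" "y\<notin>acl K A" shows "indep K (insert y A)" unfolding indep_def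
proof
 have yA: "y\<notin>A" using assms(2) acl_genI by metis
 fix z assume z: "z\<in>insert y A"
 show "z\<notin>acl K (insert y A - {z})"
 proof (cases "z = y")
  case True thus ?thesis using assms(2) yA by simp
 next case False hence eq: "insert y A - {z} = insert y (A - {z})" "insert z (A - {z}) = A" using z by auto show ?thesis
  proof
   assume "z\<in>acl K (insert y A - {z})"
   hence "y\<in>acl K (insert z (A - {z}))"
    using acl_exchange[of z K y "A - {z}"] assms(1) z False unfolding eq indep_def by auto
   thus False using assms(2) eq by simp
  qed
 qed
qed

text \<open>The exchange argument: elements of \<open>I\<close> are replaced by elements of \<open>J\<close>, one at a time.\<close>

lemma indep_card_le_aux: assumes "finite J" "finite I" "indep K I" "I\<subseteq>acl K J" shows "card I\<le>card J"
 using assms(2-4)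
proof (induction "card (I - J)" arbitrary: I rule: less_induct)
 case less show ?case
 proof (cases "I\<subseteq>J")
  case True thus ?thesis using card_mono assms(1) by blast
 next case False
  then obtain x where x: "x\<in>I" "x\<notin>J" by auto
  have "\<not> J\<subseteq>acl K (I - {x})"
  proof
   assume "J\<subseteq>acl K (I - {x})"
   hence "x\<in>acl K (I - {x})" using acl_closed[of J K "I - {x}"] x less.prems(3) by auto
   thus False using less.prems(2) x by (auto simp: indep_def)
  qed
  then obtain y where y: "y\<in>J" "y\<notin>acl K (I - {x})" by auto
  hence yI: "y\<notin>I - {x}" using acl_genI by metis
  define I' where "I' = insert y (I - {x})"
  have "I' - J \<subset> I - J" using x y by (auto simp: I'_def)
  hence "card (I' - J) < card (I - J)" using less.prems by (intro psubset_card_mono) auto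
  moreover have "indep K I'" unfolding I'_def using less.prems y by (intro indep_insert) (auto intro: indep_mono)
  moreover have "I'\<subseteq>acl K J" using less.prems y acl_gens[of J K] by (auto simp: I'_def)
  ultimately have "card I'\<le>card J" using less.hyps less.prems by (simp add: I'_def)
  moreover have "card I' = card I" using yI x less.prems using card_Suc_Diff1[of I x] by (simp add: I'_def)
  ultimately show ?thesis by simp
 qed
qed

lemma indep_card_le: assumes "finite J" "indep K I" "I\<subseteq>acl K J" shows "finite I \<and> card I\<le>card J"
proof (cases "finite I")
 case True thus ?thesis using indep_card_le_aux assms by blast
next case False
 then obtain I' where "I'\<subseteq>I" "finite I'" "card I' = Suc (card J)" using infinite_arbitrarily_large by blast
 hence "card I'\<le>card J" using indep_card_le_aux[OF assms(1), of I'] assms indep_mono by blast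
 thus ?thesis using \<open>card I' = _\<close> by simp
qed

lemma exists_basis: assumes "finite S" shows "\<exists>B\<subseteq>S. indep K B \<and> S\<subseteq>acl K B" using assms
proof (induction S)
 case empty show ?case by (auto simp: indep_def)
next case (insert x S)
 then obtain B where B: "B\<subseteq>S" "indep K B" "S\<subseteq>acl K B" by auto
 show ?case
 proof (cases "x\<in>acl K B")
  case True thus ?thesis using B by blast
 next case False hence "indep K (insert x B)" "insert x S\<subseteq>acl K (insert x B)"
   using B indep_insert[of K B x] False acl_mono[of B "insert x B" K] acl_gens[of "insert x B" K] by auto
  thus ?thesis using B by (intro exI[of _ "insert x B"]) auto
 qed
qed

definition rk :: "'a::field set => 'a set => nat" where "rk K S = card (SOME B. indep K B \<and> B\<subseteq>acl K S \<and> S\<subseteq>acl K B)"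

lemma rk_eqI: assumes "finite S" "indep K B" "B\<subseteq>acl K S" "S\<subseteq>acl K B" shows "rk K S = card B"
proof -
 have fin: "finite B" if "indep K B" "B\<subseteq>acl K S" for B using indep_card_le[OF assms(1) that] by blast
 define C where "C = (SOME B. indep K B \<and> B\<subseteq>acl K S \<and> S\<subseteq>acl K B)"
 have C: "indep K C" "C\<subseteq>acl K S" "S\<subseteq>acl K C"
  unfolding C_def using someI[of "\<lambda>B. indep K B \<and> B\<subseteq>acl K S \<and> S\<subseteq>acl K B" B] assms by auto
 have "card C\<le>card B" using indep_card_le[OF fin[OF assms(2,3)] C(1)] C(2) acl_closed[OF assms(4)] by auto
 moreover have "card B\<le>card C" using indep_card_le[OF fin[OF C(1,2)] assms(2)] assms(3) acl_closed[OF C(3)] by auto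
 ultimately show ?thesis unfolding rk_def C_def by simp
qed

lemma rk_basis: assumes "finite S"
 obtains B where "B\<subseteq>S" "indep K B" "S\<subseteq>acl K B" "rk K S = card B"
proof -
 obtain B where B: "B\<subseteq>S" "indep K B" "S\<subseteq>acl K B" using exists_basis[OF assms] by blast
 hence "B\<subseteq>acl K S" using acl_gens[of S K] by auto
 thus thesis using that[OF B] rk_eqI[OF assms B(2) _ B(3)] by simp
qed

lemma rk_insert: assumes "finite S" shows "rk K (insert x S) = (if x\<in>acl K S then rk K S else Suc (rk K S))"
proof -
 obtain B where B: "B\<subseteq>S" "indep K B" "S\<subseteq>acl K B" "rk K S = card B" using rk_basis[OF assms] by blast
 have eq: "acl K B = acl K S" using B acl_gens[of S K] by (intro acl_eqI) auto
 show ?thesis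
 proof (cases "x\<in>acl K S")
  case True
  have "rk K (insert x S) = card B" using B eq True assms acl_gens[of "insert x S" K] by (intro rk_eqI) auto
  thus ?thesis using True B by simp
 next case False hence "x\<notin>acl K B" "x\<notin>B" using eq acl_gens[of B K] by auto
  moreover have "insert x B\<subseteq>acl K (insert x S)" using B acl_gens[of "insert x S" K] by auto
  moreover have "insert x S\<subseteq>acl K (insert x B)"
   using B acl_mono[of B "insert x B" K] acl_gens[of "insert x B" K] by auto
  ultimately have "rk K (insert x S) = card (insert x B)" using B assms indep_insert[of K B x] by (intro rk_eqI) auto
  thus ?thesis using False B \<open>x \<notin> B\<close> finite_subset[OF B(1) assms] by simp
 qed
qed

lemma rk_cong: assumes "finite S" "finite T" "S\<subseteq>acl K T" "T\<subseteq>acl K S" shows "rk K S = rk K T"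
proof -
 obtain B where B: "B\<subseteq>S" "indep K B" "S\<subseteq>acl K B" "rk K S = card B" using rk_basis[OF assms(1)] by blast
 have "rk K T = card B" using B assms acl_closed[OF B(3)] by (intro rk_eqI[OF assms(2)]) auto
 thus ?thesis using B by simp
qed

lemma rk_base_change: assumes "K\<subseteq>F" "F\<subseteq>acl K {}" shows "rk F S = rk K S"
 unfolding rk_def indep_def acl_base_change[OF assms] by simp

text \<open>Adjoining \<open>y\<close> raises the rank over a larger set only if it does so over a smaller one.\<close>

lemma rk_submodular: assumes "finite A" "finite X" "finite Y"
 shows "rk K (A\<union>X\<union>Y) + rk K A\<le>rk K (A\<union>X) + rk K (A\<union>Y)" using assms(3)
proof (induction Y)
 case (insert y Y)
 have "y\<in>acl K (A\<union>Y) ==> y\<in>acl K (A\<union>X\<union>Y)" using acl_mono[of "A\<union>Y" "A\<union>X\<union>Y" K] by blast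
 moreover have "A\<union>X\<union>insert y Y = insert y (A\<union>X\<union>Y)" "A\<union>insert y Y = insert y (A\<union>Y)" by auto
 ultimately show ?case using insert assms by (simp add: rk_insert)
qed simp

text \<open>If no element of the list becomes newly dependent when \<open>D\<close> is adjoined, then the list
  contributes the same rank over \<open>A\<close> and over \<open>A \<union> D\<close>.\<close>

lemma rk_modular_list: assumes "finite A" "finite D" and "\<And>i. i < length xs ==> xs ! i\<in>acl K (A\<union>D\<union>set (take i xs)) ==>
      xs ! i\<in>acl K (A\<union>set (take i xs))" shows "rk K (A\<union>D\<union>set xs) + rk K A = rk K (A\<union>D) + rk K (A\<union>set xs)"
 using assms(3)
proof (induction xs rule: rev_induct)
 case (snoc x xs)
 have "rk K (A\<union>D\<union>set xs) + rk K A = rk K (A\<union>D) + rk K (A\<union>set xs)"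
 proof (rule snoc.IH)
  fix i assume "i < length xs" "xs ! i\<in>acl K (A\<union>D\<union>set (take i xs))"
  thus "xs ! i\<in>acl K (A\<union>set (take i xs))" using snoc.prems[of i] by (simp add: nth_append)
 qed
 moreover have "x\<in>acl K (A\<union>D\<union>set xs) ==> x\<in>acl K (A\<union>set xs)" using snoc.prems[of "length xs"] by simp
 moreover have "x\<in>acl K (A\<union>set xs) ==> x\<in>acl K (A\<union>D\<union>set xs)"
  using acl_mono[of "A\<union>set xs" "A\<union>D\<union>set xs" K] by blast
 moreover have "A\<union>D\<union>set (xs @ [x]) = insert x (A\<union>D\<union>set xs)" "A\<union>set (xs @ [x]) = insert x (A\<union>set xs)" by auto
 ultimately show ?case using assms by (simp add: rk_insert)
qed simp

section \<open>Monomials\<close>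

fun prods :: "'a::comm_monoid_mult set => nat => 'a set" where "prods X 0 = {1}"
| "prods X (Suc d) = prods X d\<union>{x * m | x m. x\<in>X \<and> m\<in>prods X d}"

lemma prods_mono: "d\<le>d' ==> prods X d\<subseteq>prods X d'" using lift_Suc_mono_le[of "prods X" d d'] by auto

lemma one_in_prods: "1\<in>prods X d" by (induction d) auto

lemma prods_mult: "x\<in>prods X a ==> y\<in>prods X b ==> x * y\<in>prods X (a + b)"
proof (induction a arbitrary: x)
 case 0 thus ?case by simp
next case (Suc a)
 then consider "x\<in>prods X a" | z m where "x = z * m" "z\<in>X" "m\<in>prods X a" by auto
 thus ?case
 proof cases
  case 1 thus ?thesis using Suc by auto
 next case 2 hence "m * y\<in>prods X (a + b)" using Suc by blast thus ?thesis using 2 by (auto simp: mult.assoc)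
 qed
qed

lemma prods_insert: assumes "m\<in>prods (insert y X) d" shows "\<exists>a b u. a + b\<le>d \<and> u\<in>prods X a \<and> m = u * y^b"
 using assms
proof (induction d arbitrary: m)
 case 0 thus ?case by (auto intro!: exI[of _ 0])
next case (Suc d) show ?case
 proof (cases "m\<in>prods (insert y X) d")
  case True
  then obtain a b u where "a + b\<le>d" "u\<in>prods X a" "m = u * y^b" using Suc.IH by blast
  hence "a + b\<le>Suc d \<and> u\<in>prods X a \<and> m = u * y^b" by simp
  thus ?thesis by blast
 next case False
  then obtain z w where zw: "m = z * w" "z\<in>insert y X" "w\<in>prods (insert y X) d" using Suc.prems by auto
  then obtain a b u where ab: "a + b\<le>d" "u\<in>prods X a" "w = u * y^b" using Suc.IH by blast
  show ?thesis
  proof (cases "z = y")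
   case True hence "a + Suc b\<le>Suc d \<and> u\<in>prods X a \<and> m = u * y^Suc b" using ab zw by (simp add: ac_simps)
   thus ?thesis by blast
  next case False hence "Suc a + b\<le>Suc d \<and> z * u\<in>prods X (Suc a) \<and> m = (z * u) * y^b"
    using ab zw False by (auto simp: mult.assoc)
   thus ?thesis by blast
  qed
 qed
qed

lemma lspan_prods_mult: assumes R: "is_subring K" and "x\<in>lspan K (prods X a)" "y\<in>lspan K (prods X b)"
 shows "x * y\<in>lspan K (prods X (a + b))"
proof -
 have "{s * t |s t. s\<in>prods X a \<and> t\<in>prods X b}\<subseteq>prods X (a + b)" using prods_mult by blast
 thus ?thesis using lspan_mult[OF assms] lspan_mono[OF order_refl] by blast
qed

lemma lspan_prods_mono: "a\<le>b ==> x\<in>lspan K (prods X a) ==> x\<in>lspan K (prods X b)"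
 using lspan_mono[OF order_refl prods_mono, of a b K X] by auto

lemma rgen_prods: assumes R: "is_subring K" and "x\<in>rgen K X" shows "\<exists>d. x\<in>lspan K (prods X d)"
proof -
 have "is_subring {x. \<exists>d. x\<in>lspan K (prods X d)}" (is "is_subring ?U")
 proof (rule subringI)
  show "0\<in>?U" by (auto intro: lspan.zero)
  show "1\<in>?U" using lspan_gen[OF R one_in_prods] by auto
  fix a b assume "a\<in>?U" "b\<in>?U"
  then obtain d e where de: "a\<in>lspan K (prods X d)" "b\<in>lspan K (prods X e)" by auto
  hence "a\<in>lspan K (prods X (d + e))" "b\<in>lspan K (prods X (d + e))"
   using lspan_prods_mono[OF le_add1 de(1)] lspan_prods_mono[OF le_add2 de(2)] by auto
  thus "a + b\<in>?U" using lspan_add by blast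
  show "a * b\<in>?U" using lspan_prods_mult[OF R de] by blast
 qed (use lspan_uminus[OF R] in blast)
 moreover have "K\<subseteq>?U"
 proof
  fix k assume "k\<in>K"
  hence "k*1\<in>lspan K (prods X 0)" by (intro lspan_mult_gen) auto
  thus "k\<in>?U" by (metis (mono_tags) mem_Collect_eq mult.right_neutral)
 qed
 moreover have "X\<subseteq>?U"
 proof
  fix k assume "k\<in>X"
  hence "k\<in>prods X 1" by auto
  thus "k\<in>?U" using lspan_gen[OF R] by blast
 qed
 ultimately show ?thesis using rgen_minimal[of K ?U X] assms(2) by auto
qed


definition expo :: "'x set => ('x => nat) set" where "expo X = {e. \<forall>x. x\<notin>X --> e x = 0}"

definition mon :: "('x => 'a::comm_monoid_mult) => 'x set => ('x => nat) => 'a" where "mon f X e = (\<Prod>x\<in>X. f x^e x)"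

text \<open>Algebraic independence of a family \<open>f\<close> indexed by \<open>X\<close>. The index set keeps the names of the
  variables apart from their values.\<close>

definition free_monomials :: "'a::field set => ('x => 'a) => 'x set => bool" where
 "free_monomials K f X \<longleftrightarrow> (\<forall>\<Lambda> c. finite \<Lambda> \<and> \<Lambda>\<subseteq>expo X \<and> (\<forall>e\<in>\<Lambda>. c e\<in>K) \<and>
   (\<Sum>e\<in>\<Lambda>. c e * mon f X e) = 0 --> (\<forall>e\<in>\<Lambda>. c e = 0))"

lemma free_monomialsD: "free_monomials K f X ==> finite \<Lambda> ==> \<Lambda>\<subseteq>expo X ==> (\<And>e. e\<in>\<Lambda> ==> c e\<in>K) ==>
  (\<Sum>e\<in>\<Lambda>. c e * mon f X e) = 0 ==> e\<in>\<Lambda> ==> c e = 0" unfolding free_monomials_def by (metis (no_types, lifting))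

lemma mon_insert: "finite X ==> x\<notin>X ==> mon f (insert x X) e = f x^e x * mon f X e" by (simp add: mon_def)

lemma mon_in_prods: assumes "finite X" "f`X\<subseteq>Y" "\<And>x. e x\<le>m" shows "mon f X e\<in>prods Y (card X * m)"
 using assms(1,2)
proof (induction X)
 case (insert x X)
 have "y^k\<in>prods Y k" if "y\<in>Y" for y k by (induction k) (use that in auto)
 hence "f x^e x\<in>prods Y m" using insert.prems assms(3)[of x] prods_mono[of "e x" m Y] by blast
 hence "f x^e x * mon f X e\<in>prods Y (m + card X * m)" using insert by (intro prods_mult) auto
 thus ?case using insert.hyps by (simp add: mon_insert)
qed (simp add: mon_def)

lemma bounded_exponents: assumes "finite X"
 obtains \<Lambda> where "finite \<Lambda>" "\<Lambda>\<subseteq>expo X" "card \<Lambda> = (m + 1)^card X" "\<And>e x. e\<in>\<Lambda> ==> e x\<le>m"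
proof -
 define h where "h e x = (if x\<in>X then e x else (0::nat))" for e :: "'a => nat" and x
 have "inj_on h (X \<rightarrow>\<^sub>E {..m})"
 proof (rule inj_onI)
  fix f g assume fg: "f\<in>X \<rightarrow>\<^sub>E {..m}" "g\<in>X \<rightarrow>\<^sub>E {..m}" "h f = h g"
  show "f = g" using fun_cong[OF fg(3)] by (intro PiE_ext[OF fg(1,2)]) (metis h_def)
 qed
 hence "card (h`(X \<rightarrow>\<^sub>E {..m})) = (m + 1)^card X" by (simp add: card_image card_PiE assms)
 moreover have "finite (h`(X \<rightarrow>\<^sub>E {..m}))" using assms by (intro finite_imageI finite_PiE) auto
 ultimately show thesis by (intro that[of "h`(X \<rightarrow>\<^sub>E {..m})"]) (auto simp: h_def expo_def PiE_def Pi_def)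
qed

lemma free_monomials_insert:
 assumes K: "is_subfield K" and X: "finite X" "x\<notin>X" and free: "free_monomials K f X" and x: "f x\<notin>acl K (f`X)"
 shows "free_monomials K f (insert x X)" unfolding free_monomials_def
proof (intro allI impI ballI, elim conjE)
 note R = subfield_subring[OF K]
 fix \<Lambda> c e assume L: "finite \<Lambda>" "\<Lambda>\<subseteq>expo (insert x X)" "\<forall>e\<in>\<Lambda>. c e\<in>K"
  and z: "(\<Sum>e\<in>\<Lambda>. c e * mon f (insert x X) e) = 0" and e: "e\<in>\<Lambda>"
 define P where "P = (\<Sum>e\<in>\<Lambda>. monom (c e * mon f X e) (e x))"
 have B: "mon f X e\<in>adjoin K (f`X)" for e unfolding mon_def using adjoin_gens[of "f`X" K]
  by (intro subring_prod subring_power subfield_subring adjoin_subfield) auto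
 have "P\<in>pol (adjoin K (f`X))" unfolding P_def using L(3) adjoin_base[of K "f`X"] B
  by (intro subring_sum pol_subring pol_monom subring_mult subfield_subring adjoin_subfield) auto
 moreover have "poly P (f x) = 0" using z X by (simp add: P_def poly_sum poly_monom mon_insert ac_simps)
 ultimately have "P = 0" using x unfolding acl_def algebraic_iff_pol[OF adjoin_subfield] by blast
 moreover have "coeff P (e x) = (\<Sum>e'\<in>{e'\<in>\<Lambda>. e' x = e x}. c e' * mon f X e')"
  unfolding P_def by (simp add: coeff_sum sum.inter_filter L(1))
 ultimately have 0: "(\<Sum>e'\<in>{e'\<in>\<Lambda>. e' x = e x}. c e' * mon f X e') = 0" by simp
 define r where "r = (\<lambda>e'. e'(x := 0::nat))"
 have inj: "inj_on r {e'\<in>\<Lambda>. e' x = e x}" by (auto intro!: inj_onI simp: r_def fun_eq_iff) (metis)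
 have mr: "mon f X (r e') = mon f X e'" for e' unfolding mon_def using X(2) by (intro prod.cong) (auto simp: r_def)
 define c' where "c' = (\<lambda>e'. c (e'(x := e x)))"
 have c': "c' (r e') = c e'" if "e' x = e x" for e' using that by (auto simp: c'_def r_def intro!: arg_cong[of _ _ c])
 have "c' (r e) = 0"
 proof (rule free_monomialsD[OF free, of "r`{e'\<in>\<Lambda>. e' x = e x}"])
  show "r`{e'\<in>\<Lambda>. e' x = e x}\<subseteq>expo X" using L(2) by (auto simp: r_def expo_def)
  show "(\<Sum>e\<in>r`{e'\<in>\<Lambda>. e' x = e x}. c' e * mon f X e) = 0" unfolding sum.reindex[OF inj] o_def mr using 0 c' by simp
 qed (use L e c' in auto)
 thus "c e = 0" using c' by simp
qed

lemma indep_free_monomials: assumes K: "is_subfield K" and "finite X" "inj_on f X" "indep K (f`X)"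
 shows "free_monomials K f X" using assms(2-)
proof (induction X)
 case empty
 have "expo {} = {\<lambda>_ :: 'b. 0 :: nat}" by (auto simp: expo_def)
 thus ?case by (auto simp: free_monomials_def mon_def subset_singleton_iff)
next case (insert x X)
 have "f x\<notin>f`X" using insert by auto
 hence "f x\<notin>acl K (f`X)" using insert.prems(2) by (simp add: indep_def)
 moreover have "indep K (f`X)" by (rule indep_mono[OF insert.prems(2)]) auto
 ultimately show ?case using insert free_monomials_insert[OF K] by simp
qed


section \<open>Growth of the spaces of monomials\<close>

definition growth_le :: "'a::field set => 'a set => nat => bool" where
 "growth_le K X r \<longleftrightarrow> (\<exists>C. \<forall>d. \<exists>J. finite J \<and> card J\<le>C*(d + 1)^r \<and> prods X d\<subseteq>lspan K J)"

lemma growth_le_insert_Suc: assumes R: "is_subring K" and g: "growth_le K X r" shows "growth_le K (insert y X) (Suc r)"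
proof -
 obtain C where C: "\<And>d. \<exists>J. finite J \<and> card J\<le>C*(d + 1)^r \<and> prods X d\<subseteq>lspan K J"
  using g unfolding growth_le_def by blast
 have "\<exists>J. finite J \<and> card J\<le>C*(d + 1)^Suc r \<and> prods (insert y X) d\<subseteq>lspan K J" for d
 proof -
  obtain J where J: "finite J" "card J\<le>C*(d + 1)^r" "prods X d\<subseteq>lspan K J" using C by blast
  define J' where "J' = (\<lambda>(w, k). w * y^k)`(J\<times>{..d})"
  have "card J'\<le>card (J\<times>{..d})" unfolding J'_def using J by (intro card_image_le) auto
  also have "...\<le>C*(d + 1)^r*(d + 1)" using J unfolding card_cartesian_product by (intro mult_mono) auto
  finally have "card J'\<le>C*(d + 1)^Suc r" by (simp add: ac_simps)
  moreover have "prods (insert y X) d\<subseteq>lspan K J'"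
  proof
   fix m assume "m\<in>prods (insert y X) d"
   then obtain a b u where m: "a + b\<le>d" "u\<in>prods X a" "m = u * y^b" using prods_insert by blast
   have uJ: "u\<in>lspan K J" using m J(3) prods_mono[of a d X] by auto
   have "y^b * u\<in>lspan K J'" by (rule lspan_mult_image[OF lspan_gen[OF R] R uJ])
     (use m(1) in \<open>auto simp: J'_def intro!: image_eqI[of _ _ "(_, b)"]\<close>)
   thus "m\<in>lspan K J'" by (simp add: m(3) mult.commute)
  qed
  ultimately show ?thesis using J(1) by (intro exI[of _ J']) (simp add: J'_def)
 qed
 thus ?thesis unfolding growth_le_def by blast
qed

text \<open>An algebraic element \<open>y\<close> satisfies \<open>c * y ^ n = \<dots>\<close> with \<open>c\<close> and the lower coefficients in
  \<open>K[X]\<close>; multiplication by \<open>c ^ d\<close>, which is injective, reduces all powers of \<open>y\<close> to exponents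
  below \<open>n\<close> at the price of a bounded factor in the degree.\<close>

lemma growth_le_insert: assumes K: "is_subfield K" and g: "growth_le K X r" and "y\<in>acl K X"
 shows "growth_le K (insert y X) r"
proof -
 note R = subfield_subring[OF K]
 obtain f where f: "f\<in>pol (adjoin K X)" "f~=0" "poly f y = 0"
  using assms(3) unfolding acl_def algebraic_iff_pol[OF adjoin_subfield] by auto
 define n where "n = degree f"
 have "coeff f`{..n}\<subseteq>fracs (rgen K X)" using f(1) unfolding adjoin_eq_fracs pol_def by auto
 from common_denominator[OF rgen_subring _ this] obtain d0 where
  d0: "d0~=0" "\<forall>i\<le>n. d0 * coeff f i\<in>rgen K X" by auto
 define a where "a i = d0 * coeff f i" for i
 have "\<forall>i\<in>{..n}. \<exists>e. a i\<in>lspan K (prods X e)" using d0 rgen_prods[OF R] by (auto simp: a_def)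
 then obtain e where e: "\<And>i. i\<le>n ==> a i\<in>lspan K (prods X (e i))" by (metis atMost_iff)
 obtain D where D: "\<And>i. i\<le>n ==> e i\<le>D" using finite_nat_set_iff_bounded_le[of "e`{..n}"] by auto
 have aD: "a i\<in>lspan K (prods X D)" if "i\<le>n" for i using lspan_prods_mono[OF D e] that by blast
 define c where "c = a n"
 have c: "c~=0" using d0 f(2) by (simp add: c_def a_def n_def)
 have rel: "c * y^n = (\<Sum>i<n. (- a i) * y^i)"
 proof -
  have "(\<Sum>i\<le>n. a i * y^i) = d0 * poly f y" by (simp add: a_def poly_altdef n_def sum_distrib_left mult.assoc)
  hence "(\<Sum>i<n. a i * y^i) + c * y^n = 0" using f(3) by (simp add: c_def flip: lessThan_Suc_atMost)
  thus ?thesis by (simp add: sum_negf add_eq_0_iff2)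
 qed
 have n: "n > 0" using rel c by (cases n) simp_all
 define Y where "Y k = {m * y^i | m i. m\<in>prods X k \<and> i < n}" for k
 have Y1: "u * y^j\<in>lspan K (Y k)" if "j < n" "u\<in>lspan K (prods X k)" for u j k
 proof -
  have "y^j * u\<in>lspan K (Y k)"
   by (rule lspan_mult_image[OF lspan_gen[OF R] R that(2)]) (use that(1) in \<open>auto simp: Y_def mult.commute\<close>)
  thus ?thesis by (simp add: mult.commute)
 qed
 have Yscale: "u * z\<in>lspan K (Y (k + k'))" if "u\<in>lspan K (prods X k)" "z\<in>lspan K (Y k')" for u z k k'
 proof -
  have "{s * t | s t. s\<in>prods X k \<and> t\<in>Y k'}\<subseteq>Y (k + k')"
   unfolding Y_def using prods_mult[of _ X k _ k'] by (fastforce simp: mult.assoc[symmetric])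
  thus ?thesis using lspan_mult[OF R that] lspan_mono[OF order_refl] by blast
 qed
 have pw: "c^k * y^k\<in>lspan K (Y (D * k))" for k
 proof (induction k)
  case 0
  have "1 * y^0\<in>lspan K (Y 0)" using n lspan_gen[OF R one_in_prods, of X 0] by (intro Y1)
  thus ?case by simp
 next case (Suc k)
  have cy: "c * y^Suc i\<in>lspan K (Y D)" if "i < n" for i
  proof (cases "Suc i = n")
   case True show ?thesis unfolding True rel by (intro lspan_sum Y1 lspan_uminus[OF R] aD) auto
  next case False thus ?thesis using that aD[of n] by (intro Y1) (auto simp: c_def)
  qed
  have "(c * y)*(c^k * y^k)\<in>lspan K (Y (D * k + D))"
  proof (rule lspan_mult_image[OF _ R Suc])
   fix s assume "s\<in>Y (D * k)"
   then obtain m i where s: "m\<in>prods X (D * k)" "i < n" "s = m * y^i" by (auto simp: Y_def)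
   have "m*(c * y^Suc i)\<in>lspan K (Y (D * k + D))" by (rule Yscale[OF lspan_gen[OF R s(1)] cy[OF s(2)]])
   thus "c * y * s\<in>lspan K (Y (D * k + D))" by (simp add: s(3) ac_simps)
  qed
  thus ?case by (simp add: ac_simps)
 qed
 have cD: "c^j\<in>lspan K (prods X (D * j))" for j
 proof (induction j)
  case (Suc j) thus ?case using lspan_prods_mult[OF R aD[of n] Suc] by (simp add: c_def)
 qed (use lspan_gen[OF R one_in_prods, of X 0] in simp)
 obtain C where C: "\<And>d. \<exists>J. finite J \<and> card J\<le>C*(d + 1)^r \<and> prods X d\<subseteq>lspan K J"
  using g unfolding growth_le_def by blast
 show ?thesis unfolding growth_le_def
 proof (rule exI[of _ "C*(D + 1)^r * n"], rule allI)
  fix d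
  obtain J where J: "finite J" "card J\<le>C*((D + 1) * d + 1)^r" "prods X ((D + 1) * d)\<subseteq>lspan K J" using C by blast
  define J' where "J' = (\<lambda>(w, i). w * y^i/c^d)`(J\<times>{..<n})"
  have "card J'\<le>card (J\<times>{..<n})" unfolding J'_def using J by (intro card_image_le) auto
  also have "...\<le>C*((D + 1) * d + 1)^r * n" using J by (simp add: card_cartesian_product)
  also have "...\<le>C*((D + 1)*(d + 1))^r * n" by (intro mult_mono power_mono) auto
  also have "... = (C*(D + 1)^r * n)*(d + 1)^r" by (simp only: power_mult_distrib ac_simps)
  finally have card: "card J'\<le>(C*(D + 1)^r * n)*(d + 1)^r" .
  have Y_span: "inverse (c^d) * z\<in>lspan K J'" if "z\<in>lspan K (Y ((D + 1) * d))" for z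
  proof (rule lspan_mult_image[OF _ R that])
   fix s assume "s\<in>Y ((D + 1) * d)"
   then obtain m i where s: "m\<in>lspan K J" "i < n" "s = m * y^i" using J(3) by (auto simp: Y_def)
   have "y^i/c^d * m\<in>lspan K J'" by (rule lspan_mult_image[OF lspan_gen[OF R] R s(1)])
     (use s(2) in \<open>auto simp: J'_def intro!: image_eqI[of _ _ "(_, i)"]\<close>)
   thus "inverse (c^d) * s\<in>lspan K J'" by (simp add: s(3) divide_inverse ac_simps)
  qed
  have "prods (insert y X) d\<subseteq>lspan K J'"
  proof
   fix m assume "m\<in>prods (insert y X) d"
   then obtain i k u where ik: "i + k\<le>d" "u\<in>prods X i" "m = u * y^k" using prods_insert by blast
   have "u * c^(d - k)\<in>lspan K (prods X (i + D*(d - k)))"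
    by (rule lspan_prods_mult[OF R lspan_gen[OF R ik(2)] cD])
   from Yscale[OF this pw[of k]]
   have "(u * c^(d - k))*(c^k * y^k)\<in>lspan K (Y (i + D*(d - k) + D * k))" .
   moreover have "(u * c^(d - k))*(c^k * y^k) = c^d * m"
    using ik power_add[of c "d - k" k] by (simp add: ac_simps)
   moreover have "D*(d - k) + D * k = D * d" using ik(1) by (simp flip: distrib_left)
   hence "i + D*(d - k) + D * k\<le>(D + 1) * d" using ik(1) by simp
   hence "Y (i + D*(d - k) + D * k)\<subseteq>Y ((D + 1) * d)" unfolding Y_def using prods_mono by blast
   ultimately have "c^d * m\<in>lspan K (Y ((D + 1) * d))" using lspan_mono[OF order_refl] by (metis subsetD)
   from Y_span[OF this] show "m\<in>lspan K J'" using c by (simp flip: mult.assoc)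
  qed
  thus "\<exists>J. finite J \<and> card J\<le>(C*(D + 1)^r * n)*(d + 1)^r \<and> prods (insert y X) d\<subseteq>lspan K J"
   using card J(1) by (intro exI[of _ J']) (auto simp: J'_def)
 qed
qed

lemma growth_le_rk: assumes K: "is_subfield K" and "finite X" shows "growth_le K X (rk K X)"
proof -
 note R = subfield_subring[OF K]
 obtain B where B: "B\<subseteq>X" "indep K B" "X\<subseteq>acl K B" "rk K X = card B" using rk_basis[OF assms(2)] by blast
 have base: "growth_le K B (card B)" if "finite B" for B using that
 proof (induction B)
  case empty
  have "prods {} d = {1 :: 'a}" for d by (induction d) auto
  thus ?case unfolding growth_le_def using lspan_gen[OF R, of 1 "{1}"] by (intro exI[of _ 1] allI exI[of _ "{1}"]) simp
 qed (simp add: growth_le_insert_Suc[OF R])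
 have "growth_le K (A\<union>B) (card B)" if "finite A" "A\<subseteq>X" for A using that
 proof (induction A)
  case empty thus ?case using base finite_subset[OF B(1) assms(2)] by simp
 next case (insert y A) thus ?case
   using growth_le_insert[OF K, of "A\<union>B" "card B" y] B(3) acl_monoD[of y K B "A\<union>B"] by auto
 qed
 from this[of X] show ?thesis using assms B by (simp add: Un_absorb2)
qed

lemma polynomial_growth: assumes main: "\<And>m. (m + 1)^r\<le>C*(r * m + 1)^s" shows "r\<le>(s :: nat)"
proof (rule ccontr)
 assume "\<not> r\<le>s"
 define m where "m = C*(r + 1)^s"
 have "(m + 1)^(s + 1)\<le>(m + 1)^r" using \<open>\<not> r \<le> s\<close> by (intro power_increasing) auto
 also have "...\<le>C*(r * m + 1)^s" by (rule main)
 also have "...\<le>C*((r + 1)*(m + 1))^s" by (intro mult_left_mono power_mono) auto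
 also have "... = m*(m + 1)^s" unfolding m_def by (simp only: power_mult_distrib mult.assoc)
 finally show False by simp
qed

text \<open>Comparison of the number \<open>(m + 1) ^ card X\<close> of monomials with the growth of the space that contains them.\<close>

lemma free_monomials_card_le_rk: assumes K: "is_subfield K" and X: "finite X" and free: "free_monomials K f X"
 shows "card X\<le>rk K (f`X)"
proof -
 obtain C where C: "\<And>d. \<exists>J. finite J \<and> card J\<le>C*(d + 1)^rk K (f`X) \<and> prods (f`X) d\<subseteq>lspan K J"
  using growth_le_rk[OF K, of "f`X"] X unfolding growth_le_def by blast
 have "(m + 1)^card X\<le>C*(card X * m + 1)^rk K (f`X)" for m
 proof -
  obtain J where J: "finite J" "card J\<le>C*(card X * m + 1)^rk K (f`X)" "prods (f`X) (card X * m)\<subseteq>lspan K J"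
   using C by blast
  obtain \<Lambda> where L: "finite \<Lambda>" "\<Lambda>\<subseteq>expo X" "card \<Lambda> = (m + 1)^card X" "\<And>e x. e\<in>\<Lambda> ==> e x\<le>m"
   by (rule bounded_exponents[OF X]) blast
  have "card \<Lambda>\<le>card J"
  proof (rule ccontr)
   assume "\<not> card \<Lambda>\<le>card J"
   moreover have "mon f X e\<in>lspan K J" if "e\<in>\<Lambda>" for e
    using mon_in_prods[OF X order_refl, of e m f] L(4)[OF that] J(3) by blast
   ultimately obtain c where "\<forall>e\<in>\<Lambda>. c e\<in>K" "\<exists>e\<in>\<Lambda>. c e~=0" "(\<Sum>e\<in>\<Lambda>. c e * mon f X e) = 0"
    using lspan_dependent[OF K J(1) L(1), of "mon f X"] by auto
   thus False using free L(1,2) unfolding free_monomials_def by blast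
  qed
  thus ?thesis using J(2) L(3) by simp
 qed
 thus ?thesis by (rule polynomial_growth)
qed

section \<open>Transcendence degree as a rank\<close>

lemma rk_mono: assumes "finite S" "finite T" "T\<subseteq>acl K S" shows "rk K T\<le>rk K S"
proof -
 obtain A where A: "A\<subseteq>S" "indep K A" "S\<subseteq>acl K A" "rk K S = card A" using rk_basis[OF assms(1)] .
 obtain B where B: "B\<subseteq>T" "indep K B" "T\<subseteq>acl K B" "rk K T = card B" using rk_basis[OF assms(2)] .
 have "acl K S\<subseteq>acl K A" by (rule acl_closed[OF A(3)])
 hence "B\<subseteq>acl K A" using B(1) assms(3) by blast
 thus ?thesis using indep_card_le[OF finite_subset[OF A(1) assms(1)] B(2)] A(4) B(4) by simp
qed

lemma lookup_Abs_expo: assumes "finite B" "e\<in>expo B" shows "Poly_Mapping.lookup (Abs_poly_mapping e) = e"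
proof (rule lookup_Abs_poly_mapping)
 have "{x. e x~=0}\<subseteq>B" using assms(2) by (auto simp: expo_def)
 thus "finite {x. e x~=0}" using assms(1) finite_subset by blast
qed

lemma prod_keys_eq_mon: assumes "finite B" "Poly_Mapping.keys m\<subseteq>B"
 shows "(\<Prod>x\<in>Poly_Mapping.keys m. x^Poly_Mapping.lookup m x) = mon (\<lambda>x. x) B (Poly_Mapping.lookup m)"
 unfolding mon_def using assms by (intro prod.mono_neutral_left) (auto simp: in_keys_iff)

lemma alg_independent_free_monomials: assumes K: "0\<in>K" and "alg_independent K B" "finite B"
 shows "free_monomials K (\<lambda>x. x) B" unfolding free_monomials_def
proof (intro allI impI ballI, elim conjE)
 fix \<Lambda> c e
 assume L: "finite \<Lambda>" "\<Lambda>\<subseteq>expo B" and "\<forall>e\<in>\<Lambda>. c e\<in>K" and zero: "(\<Sum>e\<in>\<Lambda>. c e * mon (\<lambda>x. x) B e) = 0" and e: "e\<in>\<Lambda>"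
 hence c: "\<And>e. e\<in>\<Lambda> ==> c e\<in>K" by blast
 define M where "M = Abs_poly_mapping`\<Lambda>"
 have lM: "Poly_Mapping.lookup (Abs_poly_mapping e) = e" if "e\<in>\<Lambda>" for e
  using lookup_Abs_expo[OF assms(3)] L(2) that by blast
 have inj: "inj_on Abs_poly_mapping \<Lambda>" by (rule inj_onI) (metis lM)
 define g where "g = (\<lambda>m. if m\<in>M then c (Poly_Mapping.lookup m) else 0)"
 have fing: "finite {m. g m~=0}" by (rule finite_subset[of _ M]) (auto simp: g_def M_def L)
 define P where "P = Abs_poly_mapping g"
 have lP: "Poly_Mapping.lookup P = g" unfolding P_def by (rule lookup_Abs_poly_mapping[OF fing])
 have kP: "Poly_Mapping.keys P\<subseteq>M" by (auto simp: in_keys_iff lP g_def split: if_splits)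
 have km: "Poly_Mapping.keys m\<subseteq>B" if "m\<in>M" for m
 proof -
  obtain e where "e\<in>\<Lambda>" "m = Abs_poly_mapping e" using \<open>m \<in> M\<close> by (auto simp: M_def)
  hence "Poly_Mapping.lookup m = e" "e\<in>expo B" using lM L(2) by auto
  thus ?thesis by (auto simp: in_keys_iff expo_def)
 qed
 have "mpoly_value P = (\<Sum>m\<in>M. g m*(\<Prod>x\<in>Poly_Mapping.keys m. x^Poly_Mapping.lookup m x))"
  unfolding mpoly_value_def lP using kP L(1) by (intro sum.mono_neutral_left) (auto simp: M_def in_keys_iff lP)
 also have "... = (\<Sum>m\<in>M. g m * mon (\<lambda>x. x) B (Poly_Mapping.lookup m))"
  using km prod_keys_eq_mon[OF assms(3)] by (intro sum.cong) auto
 also have "... = (\<Sum>e\<in>\<Lambda>. c e * mon (\<lambda>x. x) B e)" unfolding M_def sum.reindex[OF inj] using lM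
  by (intro sum.cong) (auto simp: g_def M_def)
 finally have "mpoly_value P = 0" using zero by simp
 moreover have "Poly_Mapping.lookup P m\<in>K \<and> Poly_Mapping.keys m\<subseteq>B" if "m\<in>Poly_Mapping.keys P" for m
  using that kP km c lM by (auto simp: lP g_def M_def K)
 ultimately have "P = 0" using assms(2) unfolding alg_independent_def by blast
 hence "g (Abs_poly_mapping e) = 0" using lP by (metis lookup_zero)
 thus "c e = 0" using e lM by (simp add: g_def M_def)
qed

lemma free_monomials_alg_independent: assumes "finite B" "free_monomials K (\<lambda>x. x) B" shows "alg_independent K B"
 unfolding alg_independent_def
proof (intro allI impI, elim conjE)
 fix P :: "('a \<Rightarrow>\<^sub>0 nat) \<Rightarrow>\<^sub>0 'a"
 assume P: "\<forall>m\<in>Poly_Mapping.keys P. Poly_Mapping.lookup P m\<in>K \<and> Poly_Mapping.keys m\<subseteq>B" and z: "mpoly_value P = 0"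
 define \<Lambda> where "\<Lambda> = Poly_Mapping.lookup`Poly_Mapping.keys P"
 define c where "c = (\<lambda>e. Poly_Mapping.lookup P (Abs_poly_mapping e))"
 have inj: "inj_on Poly_Mapping.lookup (Poly_Mapping.keys P)" by (rule inj_onI) (simp add: lookup_inject)
 have c: "c (Poly_Mapping.lookup m) = Poly_Mapping.lookup P m" for m by (simp add: c_def)
 have L: "\<Lambda>\<subseteq>expo B"
 proof
  fix e assume "e\<in>\<Lambda>"
  then obtain m where m: "m\<in>Poly_Mapping.keys P" "e = Poly_Mapping.lookup m" unfolding \<Lambda>_def by blast
  hence "Poly_Mapping.keys m\<subseteq>B" using P by blast
  hence "Poly_Mapping.lookup m x = 0" if "x\<notin>B" for x using that not_in_keys_iff_lookup_eq_zero by (metis subsetD)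
  thus "e\<in>expo B" by (simp add: m(2) expo_def)
 qed
 have "(\<Sum>e\<in>\<Lambda>. c e * mon (\<lambda>x. x) B e) = mpoly_value P" unfolding \<Lambda>_def sum.reindex[OF inj] mpoly_value_def o_def c
 proof (rule sum.cong)
  fix m assume "m\<in>Poly_Mapping.keys P"
  hence "Poly_Mapping.keys m\<subseteq>B" using P by blast
  thus "Poly_Mapping.lookup P m * mon (\<lambda>x. x) B (Poly_Mapping.lookup m) =
    Poly_Mapping.lookup P m*(\<Prod>x\<in>Poly_Mapping.keys m. x^Poly_Mapping.lookup m x)"
   by (simp only: prod_keys_eq_mon[OF assms(1)])
 qed simp
 hence z': "(\<Sum>e\<in>\<Lambda>. c e * mon (\<lambda>x. x) B e) = 0" using z by simp
 have cK: "c e\<in>K" if "e\<in>\<Lambda>" for e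
 proof -
  obtain m where m: "m\<in>Poly_Mapping.keys P" "e = Poly_Mapping.lookup m" using \<open>e \<in> \<Lambda>\<close> unfolding \<Lambda>_def by blast
  thus ?thesis using P c by simp
 qed
 have "Poly_Mapping.lookup P m = 0" for m
 proof (cases "m\<in>Poly_Mapping.keys P")
  case True hence "Poly_Mapping.lookup m\<in>\<Lambda>" by (simp add: \<Lambda>_def)
  hence "c (Poly_Mapping.lookup m) = 0" using free_monomialsD[OF assms(2) _ L cK z'] by (simp add: \<Lambda>_def)
  thus ?thesis by (simp only: c)
 qed (simp add: in_keys_iff)
 thus "P = 0" by (simp add: poly_mapping_eqI)
qed


lemma alg_independent_mono: "alg_independent K B ==> A\<subseteq>B ==> alg_independent K A" unfolding alg_independent_def by blast

text \<open>Transcendence bases are defined by polynomial relations, whereas the rank is defined by the closure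
  operator \<open>acl\<close>. An infinite transcendence basis of a finitely generated field is excluded by the growth
  of spaces of monomials, so the cardinality of the chosen basis is meaningful.\<close>

lemma trdeg_eq_rk: assumes K: "is_subfield K" and "finite S" shows "trdeg K (adjoin K S) = rk K S"
proof -
 define L where "L = adjoin K S"
 have tb: "transcendence_basis K L B \<longleftrightarrow> B\<subseteq>L \<and> alg_independent K B \<and> L\<subseteq>acl K B" for B
  unfolding transcendence_basis_def acl_def by auto
 obtain B where B: "B\<subseteq>S" "indep K B" "S\<subseteq>acl K B" using exists_basis[OF assms(2)] by blast
 have finB: "finite B" by (rule finite_subset[OF B(1) assms(2)])
 hence "alg_independent K B"
  using indep_free_monomials[OF K finB, of "\<lambda>x. x"] B(2) by (intro free_monomials_alg_independent) auto
 moreover have "L\<subseteq>acl K B" unfolding L_def by (intro adjoin_minimal acl_base B(3) acl_subfield)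
 moreover have "B\<subseteq>L" using B(1) adjoin_gens[of S K] by (auto simp: L_def)
 ultimately have ex: "transcendence_basis K L B" unfolding tb by blast
 define C where "C = (SOME B. transcendence_basis K L B)"
 have "transcendence_basis K L C" unfolding C_def by (rule someI[of _ B]) (rule ex)
 hence C: "C\<subseteq>L" "alg_independent K C" "L\<subseteq>acl K C" unfolding tb by auto
 have CS: "C\<subseteq>acl K S" and SC: "S\<subseteq>acl K C" using C(1,3) adjoin_acl[of K S] adjoin_gens[of S K] by (auto simp: L_def)
 have le: "card A\<le>rk K S" if "finite A" "A\<subseteq>C" for A
 proof -
  have "free_monomials K (\<lambda>x. x) A"
   by (intro alg_independent_free_monomials subring_0 subfield_subring K alg_independent_mono[OF C(2)] that)
  from free_monomials_card_le_rk[OF K that(1) this] have "card A\<le>rk K A" by simp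
  also have "...\<le>rk K S" using that CS by (intro rk_mono assms(2)) auto
  finally show ?thesis .
 qed
 have finC: "finite C"
 proof (rule ccontr)
  assume "infinite C"
  then obtain A where "finite A" "card A = Suc (rk K S)" "A\<subseteq>C" using infinite_arbitrarily_large by metis
  thus False using le[of A] by simp
 qed
 obtain A where A: "A\<subseteq>C" "indep K A" "C\<subseteq>acl K A" "rk K C = card A" using rk_basis[OF finC] .
 have "rk K S\<le>rk K C" by (rule rk_mono[OF finC assms(2) SC])
 also have "...\<le>card C" using A card_mono[OF finC A(1)] by simp
 finally show ?thesis using le[OF finC order_refl] unfolding trdeg_def C_def L_def by simp
qed

section \<open>Convergence in a nonarchimedean field\<close>

context nonarch_abs_value
begin

lemma v_0 [simp]: "v 0 = 0" using eq_0_iff by blast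

lemma v_1 [simp]: "v 1 = 1" using mult[of 1 1] eq_0_iff[of 1] by auto

lemma v_diff: "v (x - y)\<le>max (v x) (v y)" using ultrametric[of x "- y"] v_uminus[of y] by simp

lemma v_diff_commute: "v (x - y) = v (y - x)" using v_uminus[of "x - y"] by simp

lemma v_power: "v (x^n) = v x^n" by (induction n) (simp_all add: mult)

lemma v_inverse: "v (inverse x) = inverse (v x)"
proof (cases "x = 0")
 case False hence "v x * v (inverse x) = 1" using mult[of x "inverse x"] by simp
 thus ?thesis by (simp add: inverse_unique)
qed simp

lemma v_divide: "v (x/y) = v x/v y" by (simp add: divide_inverse mult v_inverse)

lemma v_sum: "0\<le>C ==> (\<And>i. i\<in>A ==> v (f i)\<le>C) ==> v (sum f A)\<le>C"
proof (induction A rule: infinite_finite_induct)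
 case (insert x F) hence "max (v (f x)) (v (sum f F))\<le>C" by simp
 hence "v (f x + sum f F)\<le>C" using ultrametric[of "f x" "sum f F"] by (rule order.trans[rotated])
 thus ?case using insert by simp
qed simp_all

lemma v_of_nat: "v (of_nat n)\<le>1"
proof (induction n)
 case (Suc n) thus ?case using ultrametric[of 1 "of_nat n"] by simp
qed simp

lemma v_add_eq: assumes "v x < v y" shows "v (x + y) = v y"
proof (rule antisym)
 show "v (x + y)\<le>v y" using ultrametric[of x y] assms by simp
 show "v y\<le>v (x + y)" using v_diff[of "x + y" x] assms by simp
qed

definition vconv :: "'b filter => ('b => 'c) => 'c => bool" where "vconv F f L \<longleftrightarrow> (\<forall>e>0. \<forall>\<^sub>F x in F. v (f x - L) < e)"

lemma vconvD: "vconv F f L ==> e > 0 ==> \<forall>\<^sub>F x in F. v (f x - L) < e" unfolding vconv_def by blast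

lemma limitin_vconv: "limitin mtopology f L F \<longleftrightarrow> vconv F f L" unfolding limitin_metric vconv_def by simp

lemma vconv_unique: assumes "vconv F f L" "vconv F f M" "F~=bot" shows "L = M"
proof (rule ccontr)
 assume "L~=M"
 hence e: "v (L - M) > 0" using eq_0_iff[of "L - M"] nonneg[of "L - M"] by (simp add: order_less_le)
 have "\<forall>\<^sub>F x in F. v (f x - L) < v (L - M) \<and> v (f x - M) < v (L - M)"
  using vconvD[OF assms(1) e] vconvD[OF assms(2) e] by eventually_elim simp
 then obtain x where "v (f x - L) < v (L - M)" "v (f x - M) < v (L - M)" using assms(3) eventually_happens by blast
 thus False using v_diff[of "f x - M" "f x - L"] by simp
qed

lemma vlim_eq: "vconv F f L ==> F~=bot ==> vlim v F f = L" unfolding vlim_def limitin_vconv using vconv_unique by blast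

lemma vconv_const: "vconv F (\<lambda>_. c) c" unfolding vconv_def by simp

lemma vconv_add: assumes "vconv F f L" "vconv F g M" shows "vconv F (\<lambda>x. f x + g x) (L + M)" unfolding vconv_def
proof (intro allI impI)
 fix e :: real assume "e > 0"
 hence "\<forall>\<^sub>F x in F. v (f x - L) < e" "\<forall>\<^sub>F x in F. v (g x - M) < e" using assms vconvD by blast+
 thus "\<forall>\<^sub>F x in F. v (f x + g x - (L + M)) < e"
 proof eventually_elim
  case (elim x)
  have "f x + g x - (L + M) = (f x - L) + (g x - M)" by simp
  thus ?case using ultrametric[of "f x - L" "g x - M"] elim by (simp only:)
 qed
qed

lemma vconv_mult_left: assumes "vconv F f L" shows "vconv F (\<lambda>x. c * f x) (c * L)"
proof (cases "c = 0")
 case True thus ?thesis by (simp add: vconv_const)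
next case False hence c: "v c > 0" using eq_0_iff nonneg by (metis less_eq_real_def) show ?thesis unfolding vconv_def
 proof (intro allI impI)
  fix e :: real assume "e > 0"
  hence "\<forall>\<^sub>F x in F. v (f x - L) < e/v c" using c vconvD[OF assms, of "e/v c"] by simp
  thus "\<forall>\<^sub>F x in F. v (c * f x - c * L) < e"
  proof eventually_elim
   case (elim x) hence "v c * v (f x - L) < e" using c by (simp add: field_simps)
   thus ?case by (simp only: right_diff_distrib[symmetric] mult)
  qed
 qed
qed

lemma vconv_uminus: "vconv F f L ==> vconv F (\<lambda>x. - f x) (- L)" using vconv_mult_left[of F f L "- 1"] by simp

lemma vconv_diff: "vconv F f L ==> vconv F g M ==> vconv F (\<lambda>x. f x - g x) (L - M)"
 using vconv_add[of F f L "\<lambda>x. - g x" "- M"] vconv_uminus[of F g M] by simp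

lemma vconv_sum: "(\<And>i. i\<in>A ==> vconv F (f i) (L i)) ==> vconv F (\<lambda>x. \<Sum>i\<in>A. f i x) (\<Sum>i\<in>A. L i)"
 by (induction A rule: infinite_finite_induct) (auto intro: vconv_const vconv_add)

lemma vconv_bound: assumes "vconv F f L" "F~=bot" "\<forall>\<^sub>F x in F. v (f x)\<le>C" shows "v L\<le>C"
proof (rule ccontr)
 assume "\<not> v L\<le>C"
 hence "v L > C" by simp
 have L: "v L > 0"
 proof -
  obtain x where "v (f x)\<le>C" using assms(2,3) eventually_happens by blast
  thus ?thesis using \<open>v L > C\<close> nonneg[of "f x"] by linarith
 qed
 from vconvD[OF assms(1) L] assms(3) have "\<forall>\<^sub>F x in F. v (f x - L) < v L \<and> v (f x)\<le>C" by eventually_elim simp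
 then obtain x where "v (f x - L) < v L" "v (f x)\<le>C" using assms(2) eventually_happens by blast
 thus False using v_add_eq[of "f x - L" L] \<open>v L > C\<close> by simp
qed

lemma vconv_null: assumes "\<And>x. v (f x)\<le>b x" "(b \<longlongrightarrow> 0) F" shows "vconv F f 0" unfolding vconv_def
proof (intro allI impI)
 fix e :: real assume "e > 0"
 hence "\<forall>\<^sub>F x in F. b x < e" using assms(2) order_tendstoD(2) by blast
 thus "\<forall>\<^sub>F x in F. v (f x - 0) < e" by eventually_elim (use assms(1) in \<open>auto intro: le_less_trans\<close>)
qed

lemma vconv_Suc: "vconv sequentially f L ==> vconv sequentially (\<lambda>n. f (Suc n)) L"
 unfolding vconv_def by (auto simp: eventually_sequentially_Suc[where P = "\<lambda>n. v (f n - L) < _"])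

text \<open>In a nonarchimedean metric a sequence is Cauchy as soon as consecutive differences tend to 0.\<close>

lemma v_consecutive: assumes "\<And>n. n\<ge>N ==> v (s (Suc n) - s n) < e" "e > 0" "m\<ge>N" shows "v (s m - s N) < e"
 using assms(3)
proof (induction m rule: dec_induct)
 case base thus ?case using assms(2) by simp
next case (step m) thus ?case using ultrametric[of "s (Suc m) - s m" "s m - s N"] assms(1)[of m] by simp
qed

lemma complete_consecutive: assumes "mcomplete" "\<And>e. e > 0 ==> \<exists>N. \<forall>n\<ge>N. v (s (Suc n) - s n) < e"
 shows "\<exists>L. vconv sequentially s L"
proof -
 have "MCauchy s" unfolding MCauchy_def
 proof (intro conjI allI impI)
  fix e :: real assume e: "e > 0"
  then obtain N where N: "\<forall>n\<ge>N. v (s (Suc n) - s n) < e" using assms(2) by blast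
  hence 1: "v (s m - s N) < e" if "m\<ge>N" for m using v_consecutive[of N s e] e that by blast
  have "v (s n - s m) < e" if "n\<ge>N" "m\<ge>N" for n m
   using 1[OF that(1)] 1[OF that(2)] v_diff[of "s n - s N" "s m - s N"] by simp
  thus "\<exists>N. \<forall>n n'. N\<le>n --> N\<le>n' --> v (s n - s n') < e" by blast
 qed simp
 thus ?thesis using assms(1) unfolding mcomplete_def limitin_vconv by blast
qed

section \<open>Power series bounded on a disc\<close>

definition nb :: "real => real => 'c fps => bool" where "nb R C f \<longleftrightarrow> (\<forall>n. v (fps_nth f n) * R^n\<le>C)"

definition bdd :: "real => 'c fps => bool" where "bdd R f \<longleftrightarrow> (\<exists>C. nb R C f)"

lemma nbD: "nb R C f ==> v (fps_nth f n) * R^n\<le>C" by (simp add: nb_def)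

lemma nb_nonneg: "nb R C f ==> 0\<le>C" using nbD[of R C f 0] nonneg[of "fps_nth f 0"] by simp

lemma nb_mono: "nb R C f ==> C\<le>D ==> nb R D f" unfolding nb_def by (meson order.trans)

lemma nb_0: "0\<le>C ==> nb R C 0" by (simp add: nb_def)

lemma nb_add: assumes "nb R C f" "nb R C g" "R\<ge>0" shows "nb R C (f + g)" unfolding nb_def
proof
 fix n
 have "v (fps_nth (f + g) n) * R^n\<le>max (v (fps_nth f n)) (v (fps_nth g n)) * R^n"
  using assms(3) ultrametric by (intro mult_right_mono) auto
 also have "...\<le>C" using assms(1,2) by (simp add: nb_def max_def)
 finally show "v (fps_nth (f + g) n) * R^n\<le>C" .
qed

lemma nb_uminus: "nb R C f ==> nb R C (- f)" by (simp add: nb_def v_uminus)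

lemma nb_const: "nb R (v c) (fps_const c)" by (auto simp: nb_def nonneg)

lemma nb_mult: assumes "nb R C f" "nb R D g" "R\<ge>0" shows "nb R (C * D) (f * g)" unfolding nb_def
proof
 fix n
 have CD: "0\<le>C" "0\<le>D" using assms nb_nonneg by auto
 show "v (fps_nth (f * g) n) * R^n\<le>C * D"
 proof (cases "R = 0 \<and> n > 0")
  case True thus ?thesis using CD by (simp add: power_0_left)
 next case False hence Rn: "R^n > 0" using assms(3) by (cases "n = 0") auto
  have "v (fps_nth (f * g) n)\<le>C * D/R^n" unfolding fps_mult_nth
  proof (rule v_sum)
   fix i assume i: "i\<in>{0..n}"
   have "(v (fps_nth f i) * R^i)*(v (fps_nth g (n - i)) * R^(n - i))\<le>C * D"
    using assms CD by (intro mult_mono) (auto simp: nbD nonneg)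
   moreover have "R^n = R^i * R^(n - i)" using i by (simp flip: power_add)
   ultimately show "v (fps_nth f i * fps_nth g (n - i))\<le>C * D/R^n" using Rn by (simp add: mult field_simps)
  qed (use CD Rn in simp)
  thus ?thesis using Rn by (simp add: field_simps)
 qed
qed

lemma bddI: "nb R C f ==> bdd R f" by (auto simp: bdd_def)

lemma bdd_add: "R\<ge>0 ==> bdd R f ==> bdd R g ==> bdd R (f + g)"
 unfolding bdd_def by (meson max.cobounded1 max.cobounded2 nb_add nb_mono)

lemma bdd_mult: "R\<ge>0 ==> bdd R f ==> bdd R g ==> bdd R (f * g)" unfolding bdd_def using nb_mult by blast

lemma bdd_uminus: "bdd R f ==> bdd R (- f)" unfolding bdd_def using nb_uminus by blast

lemma bdd_const: "bdd R (fps_const c)" using nb_const bddI by blast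

lemma bdd_X: "bdd R fps_X" by (rule bddI[of _ "max 0 R"]) (auto simp: nb_def fps_X_def)

lemma bdd_subring: "R\<ge>0 ==> is_subring {f. bdd R f}" using bdd_const[of R 0] bdd_const[of R 1]
 by (intro subringI) (auto intro: bdd_add bdd_mult bdd_uminus)

lemma bdd_sum: "R\<ge>0 ==> (\<And>i. i\<in>A ==> bdd R (f i)) ==> bdd R (sum f A)" using subring_sum[OF bdd_subring, of R A f] by simp

lemma bdd_prod: "R\<ge>0 ==> (\<And>i. i\<in>A ==> bdd R (f i)) ==> bdd R (prod f A)"
 using subring_prod[OF bdd_subring, of R A f] by simp

lemma bdd_power: "R\<ge>0 ==> bdd R f ==> bdd R (f^n)" using subring_power[OF bdd_subring, of R f n] by simp

lemma bdd_poly: "R\<ge>0 ==> bdd R (fps_of_poly p)"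
proof (induction p)
 case (pCons a p) thus ?case by (simp add: fps_of_poly_pCons bdd_add bdd_const bdd_mult bdd_X)
qed (use bdd_const[of R 0] in simp)

text \<open>The value \<open>c\<close> of a bounded series \<open>f\<close> at \<open>x\<close> is characterized by the divisibility of
  \<open>f - c\<close> by \<open>t - x\<close> among bounded series; this makes evaluation a ring homomorphism without any
  manipulation of Cauchy products. The quotient even satisfies a better bound, as the Schwarz
  lemma requires.\<close>

lemma value_divide: assumes "nb R C f" "0 < v x" "v x < R" "mcomplete"
 shows "\<exists>c g. nb R (C/R) g \<and> f = fps_const c + (fps_X - fps_const x) * g"
proof -
 have R: "R > 0" using assms by linarith
 have x0: "x~=0" using assms by auto
 have C: "0\<le>C" using nb_nonneg assms(1) .
 define S where "S N = (\<Sum>n<N. fps_nth f n * x^n)" for N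
 define \<rho> where "\<rho> = v x/R"
 have rho: "0 < \<rho>" "\<rho> < 1" using assms R by (auto simp: \<rho>_def)
 have tm: "v (fps_nth f n * x^n)\<le>C*\<rho>^n" for n
 proof -
  have "v (fps_nth f n * x^n) = (v (fps_nth f n) * R^n)*\<rho>^n"
   using R by (simp add: mult v_power \<rho>_def power_divide)
  also have "...\<le>C*\<rho>^n" using nbD[OF assms(1)] rho by (intro mult_right_mono) auto
  finally show ?thesis .
 qed
 have lim: "(\<lambda>n. C*\<rho>^n) \<longlonglongrightarrow> 0" using rho LIMSEQ_power_zero[of \<rho>] tendsto_mult_right_zero by auto
 have "\<exists>N. \<forall>n\<ge>N. v (S (Suc n) - S n) < e" if e: "e > 0" for e
 proof -
  obtain N where "\<forall>n\<ge>N. C*\<rho>^n < e" using order_tendstoD(2)[OF lim e] by (auto simp: eventually_sequentially)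
  thus ?thesis using tm by (auto simp: S_def intro!: exI[of _ N] intro: le_less_trans)
 qed
 then obtain c where c: "vconv sequentially S c" using complete_consecutive[OF assms(4), of S] by blast
 have tail: "v (S N - c)\<le>C*\<rho>^N" for N
 proof -
  have "vconv sequentially (\<lambda>m. S N - S m) (S N - c)" by (intro vconv_diff vconv_const c)
  moreover have "v (S N - S m)\<le>C*\<rho>^N" if "m\<ge>N" for m
  proof -
   have "S m - S N = (\<Sum>n\<in>{N..<m}. fps_nth f n * x^n)" using sum_diff_nat_ivl[of 0 N m "\<lambda>n. fps_nth f n * x^n"] that
    by (simp add: S_def atLeast0LessThan)
   also have "v ...\<le>C*\<rho>^N"
   proof (rule v_sum)
    fix n assume "n\<in>{N..<m}"
    hence "C*\<rho>^n\<le>C*\<rho>^N" using C rho by (intro mult_left_mono power_decreasing) auto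
    thus "v (fps_nth f n * x^n)\<le>C*\<rho>^N" using tm[of n] by linarith
   qed (use C rho in simp)
   finally show ?thesis by (simp add: v_diff_commute)
  qed
  ultimately show ?thesis by (intro vconv_bound[of sequentially]) (auto simp: eventually_sequentially)
 qed
 define g where "g = Abs_fps (\<lambda>n. (c - S (Suc n))/x^Suc n)"
 have "f = fps_const c + (fps_X - fps_const x) * g"
 proof (rule fps_ext)
  fix n
  show "fps_nth f n = fps_nth (fps_const c + (fps_X - fps_const x) * g) n"
  proof (cases n)
   case 0 thus ?thesis using x0 by (simp add: left_diff_distrib g_def S_def)
  next case (Suc m)
   have "A/X - x*((A - a * X)/(x * X)) = a" if "X~=0" for A X a :: 'c using that x0 by (simp add: field_simps)
   from this[of "x^n" "c - S n" "fps_nth f n"]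
   have "(c - S n)/x^n - x*((c - S (Suc n))/x^Suc n) = fps_nth f n"
    using x0 by (simp add: S_def algebra_simps)
   thus ?thesis using Suc by (simp add: left_diff_distrib g_def)
  qed
 qed
 moreover have "nb R (C/R) g" unfolding nb_def
 proof
  fix n
  have "v (fps_nth g n) = v (S (Suc n) - c)/v x^Suc n" by (simp add: g_def v_divide v_power mult v_diff_commute)
  also have "...\<le>C*\<rho>^Suc n/v x^Suc n" using tail[of "Suc n"] assms by (intro divide_right_mono) auto
  also have "... = C/R^Suc n" using assms by (simp add: \<rho>_def power_divide)
  finally show "v (fps_nth g n) * R^n\<le>C/R" using R by (simp add: field_simps)
 qed
 ultimately show ?thesis by blast
qed

lemma fps_value_eq: assumes "bdd R g" "0 < v x" "v x < R" "f = fps_const c + (fps_X - fps_const x) * g"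
 shows "fps_value v f x = c"
proof -
 have R: "R > 0" using assms by linarith
 obtain C where C: "nb R C g" using assms by (auto simp: bdd_def)
 have part: "(\<Sum>n<Suc N. fps_nth f n * x^n) = c - fps_nth g N * x^Suc N" for N
 proof (induction N)
  case 0 thus ?case by (simp add: assms(4) left_diff_distrib)
 next case (Suc N) thus ?case by (simp add: assms(4) left_diff_distrib algebra_simps)
 qed
 have "vconv sequentially (\<lambda>N. fps_nth g N * x^Suc N) 0"
 proof (rule vconv_null)
  fix N
  have "v (fps_nth g N * x^Suc N) = (v (fps_nth g N) * R^N)*((v x/R)^N * v x)"
   using R by (simp add: mult v_power power_divide)
  also have "...\<le>C*((v x/R)^N * v x)" using nbD[OF C] assms R by (intro mult_right_mono) auto
  finally show "v (fps_nth g N * x^Suc N)\<le>C*((v x/R)^N * v x)" .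
  have "(\<lambda>N. C*((v x/R)^N * v x)) \<longlonglongrightarrow> C*(0 * v x)" using assms R by (intro tendsto_intros LIMSEQ_power_zero) auto
  thus "(\<lambda>N. C*((v x/R)^N * v x)) \<longlonglongrightarrow> 0" by simp
 qed
 hence "vconv sequentially (\<lambda>N. \<Sum>n<Suc N. fps_nth f n * x^n) (c - 0)" unfolding part by (intro vconv_diff vconv_const)
 hence "vconv sequentially (\<lambda>N. \<Sum>n<N. fps_nth f n * x^n) c" unfolding vconv_def
  by (subst (asm) eventually_sequentially_Suc[where P = "\<lambda>N. v ((\<Sum>n<N. fps_nth f n * x^n) - _) < _"]) simp
 thus ?thesis unfolding fps_value_def by (rule vlim_eq) simp
qed

end

locale complete_nonarch = nonarch_abs_value v for v :: "'c::field => real" +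
 assumes complete: mcomplete
begin

lemma value_divide': assumes "nb R C f" "0 < v x" "v x < R"
 obtains g where "nb R (C/R) g" "f = fps_const (fps_value v f x) + (fps_X - fps_const x) * g"
proof -
 obtain c g where g: "nb R (C/R) g" "f = fps_const c + (fps_X - fps_const x) * g"
  using value_divide[OF assms complete] by blast
 have "fps_value v f x = c" using fps_value_eq[OF bddI[OF g(1)] assms(2,3) g(2)] .
 thus thesis using that[of g] g by simp
qed

lemma value_ex: assumes "bdd R f" "0 < v x" "v x < R"
 obtains g where "bdd R g" "f = fps_const (fps_value v f x) + (fps_X - fps_const x) * g"
proof -
 obtain C where "nb R C f" using assms(1) by (auto simp: bdd_def)
 thus thesis using value_divide'[OF _ assms(2,3)] that bddI by metis
qed

lemma value_add: assumes "bdd R f" "bdd R g" "0 < v x" "v x < R"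
 shows "fps_value v (f + g) x = fps_value v f x + fps_value v g x"
proof -
 obtain a where a: "bdd R a" "f = fps_const (fps_value v f x) + (fps_X - fps_const x) * a"
  using value_ex[OF assms(1,3,4)] by blast
 obtain b where b: "bdd R b" "g = fps_const (fps_value v g x) + (fps_X - fps_const x) * b"
  using value_ex[OF assms(2,3,4)] by blast
 have "f + g = fps_const (fps_value v f x + fps_value v g x) + (fps_X - fps_const x)*(a + b)"
  by (subst a(2), subst b(2)) (simp add: algebra_simps flip: fps_const_add)
 moreover have "bdd R (a + b)" using assms by (intro bdd_add a(1) b(1)) auto
 ultimately show ?thesis using fps_value_eq[OF _ assms(3,4)] by blast
qed

lemma value_mult: assumes "bdd R f" "bdd R g" "0 < v x" "v x < R"
 shows "fps_value v (f * g) x = fps_value v f x * fps_value v g x"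
proof -
 obtain a where a: "bdd R a" "f = fps_const (fps_value v f x) + (fps_X - fps_const x) * a"
  using value_ex[OF assms(1,3,4)] by blast
 obtain b where b: "bdd R b" "g = fps_const (fps_value v g x) + (fps_X - fps_const x) * b"
  using value_ex[OF assms(2,3,4)] by blast
 define c where "c = fps_value v f x"
 have "f * g = fps_const c*(fps_const (fps_value v g x) + (fps_X - fps_const x) * b)
   + (fps_X - fps_const x) * a * g" unfolding b(2)[symmetric] by (subst a(2)) (simp add: algebra_simps c_def)
 also have "... = fps_const (c * fps_value v g x)
   + (fps_X - fps_const x)*(fps_const c * b + a * g)" by (simp add: algebra_simps flip: fps_const_mult)
 finally have eq: "f * g = fps_const (c * fps_value v g x)
   + (fps_X - fps_const x)*(fps_const c * b + a * g)" .
 have "bdd R (fps_const c * b + a * g)" using assms by (intro bdd_add bdd_mult bdd_const a(1) b(1)) auto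
 from fps_value_eq[OF this assms(3,4) eq] show ?thesis by (simp only: c_def)
qed

lemma value_const: "0 < v x ==> fps_value v (fps_const c) x = c"
 using fps_value_eq[of "v x + 1" 0 x "fps_const c" c] bdd_const[of _ 0] by simp

lemma value_X: "0 < v x ==> fps_value v fps_X x = x"
 using fps_value_eq[of "v x + 1" 1 x fps_X x] bdd_const[of _ 1] by simp

lemma value_sum: assumes "\<And>i. i\<in>A ==> bdd R (f i)" "0 < v x" "v x < R"
 shows "fps_value v (\<Sum>i\<in>A. f i) x = (\<Sum>i\<in>A. fps_value v (f i) x)" using assms(1)
proof (induction A rule: infinite_finite_induct)
 case (insert a A) thus ?case using value_add[of R "f a" "sum f A"] bdd_sum[of R A f] assms(2,3) by simp
qed (use value_const[OF assms(2), of 0] in simp_all)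

lemma value_prod: assumes "\<And>i. i\<in>A ==> bdd R (f i)" "0 < v x" "v x < R"
 shows "fps_value v (\<Prod>i\<in>A. f i) x = (\<Prod>i\<in>A. fps_value v (f i) x)" using assms(1)
proof (induction A rule: infinite_finite_induct)
 case (insert a A) thus ?case using value_mult[of R "f a" "prod f A"] bdd_prod[of R A f] assms(2,3) by simp
qed (use value_const[OF assms(2), of 1] in simp_all)

lemma value_poly: assumes "0 < v x" shows "fps_value v (fps_of_poly p) x = poly p x"
proof (induction p)
 case 0 thus ?case using value_const[OF assms, of 0] by simp
next case (pCons a p)
 have "fps_value v (fps_const a + fps_of_poly p * fps_X) x = a + poly p x * x"
  using value_add[of "v x + 1" "fps_const a" "fps_of_poly p * fps_X" x]
   value_mult[of "v x + 1" "fps_of_poly p" fps_X x] assms pCons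
  by (simp add: bdd_const bdd_mult bdd_poly bdd_X value_const value_X)
 thus ?case by (simp add: fps_of_poly_pCons mult.commute)
qed

text \<open>Schwarz lemma: dividing \<open>f\<close> by \<open>t - z\<close> for a zero \<open>z\<close> improves the bound by the factor \<open>1 / R\<close> and divides
  the constant coefficient by \<open>- z\<close>.\<close>

lemma schwarz_zeros: assumes "nb R C f" "finite Z" "\<And>z. z\<in>Z ==> 0 < v z \<and> v z < R \<and> fps_value v f z = 0"
 shows "v (fps_nth f 0)\<le>C*(\<Prod>z\<in>Z. v z/R)" using assms(2,1,3)
proof (induction Z arbitrary: f C)
 case empty thus ?case using nbD[of R C f 0] by simp
next case (insert z Z)
 have z: "0 < v z" "v z < R" "fps_value v f z = 0" using insert by auto
 obtain g where g: "nb R (C/R) g" "f = fps_const (fps_value v f z) + (fps_X - fps_const z) * g"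
  using value_divide'[OF insert.prems(1) z(1,2)] by blast
 have f: "f = (fps_X - fps_const z) * g" using g(2) unfolding z(3) by simp
 have "fps_value v g y = 0" if "y\<in>Z" for y
 proof -
  have y: "0 < v y" "v y < R" "fps_value v f y = 0" "y~=z" using insert that by auto
  have "bdd R (fps_X - fps_const z)" using bdd_add[OF _ bdd_X bdd_const[of R "- z"]] y by (simp flip: fps_const_neg)
  hence "0 = fps_value v (fps_X - fps_const z) y * fps_value v g y"
   using value_mult[OF _ bddI[OF g(1)] y(1,2)] y(3) f by simp
  moreover have "fps_value v (fps_X + fps_const (- z)) y = y + - z"
   using value_add[OF bdd_X bdd_const y(1,2)] y(1) by (simp add: value_X value_const)
  moreover have "fps_X + fps_const (- z) = fps_X - fps_const z" by (simp flip: fps_const_neg)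
  ultimately show ?thesis using y(4) by simp
 qed
 hence "v (fps_nth g 0)\<le>C/R*(\<Prod>z\<in>Z. v z/R)" using insert.IH[OF g(1)] insert.prems by simp
 hence "v z * v (fps_nth g 0)\<le>v z*(C/R*(\<Prod>z\<in>Z. v z/R))" using z by (intro mult_left_mono) auto
 moreover have "v (fps_nth f 0) = v z * v (fps_nth g 0)" by (subst f) (simp add: left_diff_distrib mult v_uminus)
 moreover have "v z*(C/R*(\<Prod>z\<in>Z. v z/R)) = C*(\<Prod>z\<in>insert z Z. v z/R)" using insert.hyps by simp
 ultimately show ?case by simp
qed

end

section \<open>Frobenius roots\<close>

sublocale C_infinity \<subseteq> complete_nonarch v by unfold_locales (rule complete)

lemma map_poly_pol: assumes "\<And>x. x\<in>R ==> f x\<in>S" "f 0 = 0" "p\<in>pol R" shows "map_poly f p\<in>pol S"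
 using assms by (auto simp: pol_def coeff_map_poly)

context C_infinity
begin

lemma q_ge2: "q\<ge>2"
proof -
 obtain e where e: "e > 0" "q = CHAR('c)^e" using q_power by blast
 have "CHAR('c)\<ge>2" using prime_char prime_ge_2_nat by blast
 moreover from this have "CHAR('c)^1\<le>CHAR('c)^e" using e by (intro power_increasing) auto
 ultimately show ?thesis using e by simp
qed

lemma frob_add: "(x + y :: 'c)^q = x^q + y^q" using freshmans_dream'[OF prime_char] q_power by blast

lemma frob_pow_add: "(x + y :: 'c)^(q^n) = x^(q^n) + y^(q^n)"
proof -
 obtain e where "q = CHAR('c)^e" using q_power by blast
 hence "q^n = CHAR('c)^(e * n)" by (simp add: power_mult)
 thus ?thesis using freshmans_dream'[OF prime_char] by blast
qed

lemma frob_pow_uminus: "(- x :: 'c)^(q^n) = - (x^(q^n))"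
 using frob_pow_add[of x "- x" n] q_ge2 by (simp add: power_0_left eq_neg_iff_add_eq_0 add.commute)

lemma frob_pow_diff: "(x - y :: 'c)^(q^n) = x^(q^n) - y^(q^n)"
 using frob_pow_add[of x "- y" n] frob_pow_uminus by simp

lemma frob_uminus: "(- x :: 'c)^q = - (x^q)" using frob_pow_uminus[of x 1] by simp

lemma frob_inj: "(x :: 'c)^q = y^q ==> x = y" using frob_pow_diff[of x y 1] by simp

lemma rat_field_subfield: "is_subfield (rat_field q \<theta>)" unfolding rat_field_def by (rule adjoin_subfield)

lemma rat_field_kinf_bar: "rat_field q \<theta>\<subseteq>kinf_bar"
proof
 fix x assume x: "x\<in>rat_field q \<theta>"
 have sub: "rat_field q \<theta>\<subseteq>kinf" unfolding kinf_def by (rule closure_of_subset) simp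
 have "algebraic_over (rat_field q \<theta>) x" by (rule algebraic_base[OF rat_field_subfield x])
 thus "x\<in>kinf_bar" unfolding kinf_bar_def using algebraic_mono[OF sub] by blast
qed

lemma root_exists: "\<exists>y :: 'c. y^q = x"
proof -
 note k = subfield_subring[OF rat_field_subfield]
 have bar: "\<exists>y. y^q = x" if x: "x\<in>kinf_bar" for x
 proof -
  define f where "f = [:x:] + monom (- 1) q"
  have c: "coeff f i = (if i = 0 then x else if i = q then - 1 else 0)" for i
   using q_ge2 by (auto simp: f_def coeff_pCons split: nat.split)
  have "set (coeffs f)\<subseteq>insert 0 (range (coeff f))" using range_coeff[of f] by blast
  also have "...\<subseteq>kinf_bar" using x rat_field_kinf_bar subring_0[OF k] subring_uminus[OF k subring_1[OF k]]
   by (auto simp: c)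
  finally have "set (coeffs f)\<subseteq>kinf_bar" .
  moreover have "degree f > 0" using c[of q] q_ge2 le_degree[of f q] by (auto split: if_splits)
  ultimately obtain y where "poly f y = 0" using alg_closed by blast
  hence "y^q = x" by (simp add: f_def poly_monom)
  thus ?thesis by blast
 qed
 have "\<exists>y\<in>kinf_bar. v (x - y) < inverse (Suc n)" for n
 proof -
  have "x\<in>mtopology closure_of kinf_bar" using dense by simp
  thus ?thesis unfolding metric_closure_of mball_def by (auto dest!: spec[of _ "inverse (real (Suc n))"])
 qed
 then obtain y where y: "\<And>n. y n\<in>kinf_bar" "\<And>n. v (x - y n) < inverse (Suc n)" by metis
 from bar[OF y(1)] obtain z where z: "\<And>n. z n^q = y n" by metis
 have dz: "v (a - b)^q = v (a^q - b^q)" for a b using frob_pow_diff[of a b 1] by (simp flip: v_power)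
 have lim: "(\<lambda>n. inverse (real (Suc n))) \<longlonglongrightarrow> 0" by (rule LIMSEQ_inverse_real_of_nat)
 have "\<exists>N. \<forall>n\<ge>N. v (z (Suc n) - z n) < e" if e: "e > 0" for e
 proof -
  have "e^q > 0" using e by simp
  then obtain N where N: "\<And>n. n\<ge>N ==> inverse (real (Suc n)) < e^q"
   using order_tendstoD(2)[OF lim] by (auto simp: eventually_sequentially)
  have "v (z (Suc n) - z n) < e" if "n\<ge>N" for n
  proof -
   have "v (z (Suc n) - z n)^q = v ((x - y n) - (x - y (Suc n)))" by (simp add: dz z)
   also have "...\<le>max (v (x - y n)) (v (x - y (Suc n)))" by (rule v_diff)
   also have "... < e^q" using y(2)[of n] y(2)[of "Suc n"] N[of n] N[of "Suc n"] that by simp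
   finally show ?thesis using e by (auto intro: power_less_imp_less_base)
  qed
  thus ?thesis by blast
 qed
 then obtain L where L: "vconv sequentially z L" using complete_consecutive[OF complete] by blast
 have "vconv sequentially y (L^q)" unfolding vconv_def
 proof (intro allI impI)
  fix e :: real assume e: "e > 0"
  have "root q e > 0" using e q_ge2 by simp
  from vconvD[OF L this] show "\<forall>\<^sub>F n in sequentially. v (y n - L^q) < e"
  proof eventually_elim
   case (elim n)
   have "v (y n - L^q) = v (z n - L)^q" by (simp add: dz z)
   also have "... < root q e^q" using elim q_ge2 nonneg by (intro power_strict_mono) auto
   finally show ?case using e q_ge2 by (simp add: real_root_pow_pos2)
  qed
 qed
 moreover have "vconv sequentially (\<lambda>n. y n - x) 0"
 proof (rule vconv_null[OF _ lim])
  show "v (y n - x)\<le>inverse (real (Suc n))" for n using y(2)[of n] v_diff_commute[of x "y n"] by simp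
 qed
 hence "vconv sequentially (\<lambda>n. (y n - x) + x) (0 + x)" by (intro vconv_add vconv_const)
 ultimately have "L^q = x" using vconv_unique[of sequentially y "L^q" x] by simp
 thus ?thesis by blast
qed

definition rt :: "'c => 'c" where "rt x = (THE y. y^q = x)"

lemma rt_pow [simp]: "rt x^q = x"
proof -
 obtain y where y: "y^q = x" using root_exists by blast
 have "(THE y. y^q = x) = y"
 proof (rule the_equality)
  fix z assume "z^q = x"
  thus "z = y" by (intro frob_inj[of z y]) (simp add: y)
 qed (rule y)
 thus ?thesis using y by (simp add: rt_def)
qed

lemma rt_eqI: "y^q = x ==> rt x = y" using rt_pow[of x] frob_inj[of "rt x" y] by simp

lemma rt_of_pow [simp]: "rt (x^q) = x" by (rule rt_eqI) simp

lemma rt_0 [simp]: "rt 0 = 0" and rt_1 [simp]: "rt 1 = 1" using q_ge2 by (auto intro: rt_eqI)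

lemma rt_add: "rt (x + y) = rt x + rt y" by (rule rt_eqI) (simp add: frob_add)
lemma rt_mult: "rt (x * y) = rt x * rt y" by (rule rt_eqI) (simp add: power_mult_distrib)
lemma rt_uminus: "rt (- x) = - rt x" by (rule rt_eqI) (simp add: frob_uminus)
lemma rt_diff: "rt (x - y) = rt x - rt y" using rt_add[of x "- y"] rt_uminus by simp
lemma rt_inverse: "rt (inverse x) = inverse (rt x)" by (rule rt_eqI) (simp add: power_inverse)
lemma rt_power: "rt (x^n) = rt x^n" by (rule rt_eqI) (metis rt_pow power_mult mult.commute)
lemma rt_sum: "rt (sum f A) = (\<Sum>i\<in>A. rt (f i))" by (induction A rule: infinite_finite_induct) (simp_all add: rt_add)
lemma rt_eq_0 [simp]: "rt x = 0 \<longleftrightarrow> x = 0" by (metis rt_pow rt_0 rt_of_pow)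
lemma rt_of_nat [simp]: "rt (of_nat n) = of_nat n" by (induction n) (simp_all add: rt_add)

lemma v_rt: "v (rt x)^q = v x" by (simp flip: v_power)

lemma rtn_pow: "((rt ^^ m) x)^(q^m) = x"
proof (induction m arbitrary: x)
 case (Suc m)
 have "((rt ^^ Suc m) x)^(q^Suc m) = (((rt ^^ m) (rt x))^(q^m))^q"
  by (simp add: funpow_swap1 mult.commute flip: power_mult)
 thus ?case using Suc by simp
qed simp

lemma frobenius_neg: "frobenius q (- int m) x = (rt ^^ m) x"
proof (cases "m = 0")
 case False
 have "(THE y. y^(q^m) = x) = (rt ^^ m) x"
 proof (rule the_equality)
  show "((rt ^^ m) x)^(q^m) = x" by (rule rtn_pow)
  fix y assume "y^(q^m) = x"
  hence "(y - (rt ^^ m) x)^(q^m) = 0" by (simp add: frob_pow_diff rtn_pow)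
  thus "y = (rt ^^ m) x" by simp
 qed
 thus ?thesis using False by (simp add: frobenius_def)
qed (simp add: frobenius_def)

text \<open>The twist \<open>f\<^sup>(\<^sup>-\<^sup>1\<^sup>)\<close> as an endomorphism of the ring of power series.\<close>

definition sg :: "'c fps => 'c fps" where "sg f = Abs_fps (\<lambda>n. rt (fps_nth f n))"

lemma sg_nth [simp]: "fps_nth (sg f) n = rt (fps_nth f n)" by (simp add: sg_def)

lemma sgn_nth: "fps_nth ((sg ^^ m) f) n = (rt ^^ m) (fps_nth f n)" by (induction m) simp_all

lemma twist_neg: "twist q (- int m) f = (sg ^^ m) f" by (rule fps_ext) (simp add: twist_def frobenius_neg sgn_nth)

lemma sg_add: "sg (f + g) = sg f + sg g" by (rule fps_ext) (simp add: rt_add)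
lemma sg_mult: "sg (f * g) = sg f * sg g" by (rule fps_ext) (simp add: fps_mult_nth rt_sum rt_mult)
lemma sg_uminus: "sg (- f) = - sg f" by (rule fps_ext) (simp add: rt_uminus)
lemma sg_diff: "sg (f - g) = sg f - sg g" by (rule fps_ext) (simp add: rt_diff)
lemma sg_const [simp]: "sg (fps_const c) = fps_const (rt c)" by (rule fps_ext) simp
lemma sg_0 [simp]: "sg 0 = 0" and sg_1 [simp]: "sg 1 = 1" and sg_X [simp]: "sg fps_X = fps_X"
 by (rule fps_ext, simp add: fps_X_def)+
lemma sg_power: "sg (f^n) = sg f^n" by (induction n) (simp_all add: sg_mult)
lemma sg_sum: "sg (sum f A) = (\<Sum>i\<in>A. sg (f i))" by (induction A rule: infinite_finite_induct) (simp_all add: sg_add)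
lemma sg_prod: "sg (prod f A) = (\<Prod>i\<in>A. sg (f i))" by (induction A rule: infinite_finite_induct) (simp_all add: sg_mult)
lemma sg_inj: "sg f = sg g \<longleftrightarrow> f = g" by (metis fps_ext sg_nth rt_pow)
lemma sg_poly: "sg (fps_of_poly p) = fps_of_poly (map_poly rt p)" by (rule fps_ext) (simp add: coeff_map_poly)

lemma sgn_mult: "(sg ^^ m) (f * g) = (sg ^^ m) f*(sg ^^ m) g" by (induction m) (simp_all add: sg_mult)
lemma sgn_sum: "(sg ^^ m) (sum f A) = (\<Sum>i\<in>A. (sg ^^ m) (f i))" by (induction m) (simp_all add: sg_sum)
lemma sgn_poly: "(sg ^^ m) (fps_of_poly p) = fps_of_poly ((map_poly rt ^^ m) p)"
 by (induction m) (simp_all add: sg_poly)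

text \<open>A twist shrinks the disc of convergence to a root of its radius.\<close>

lemma bdd_sg: assumes "bdd R f" "R > 0" shows "bdd (root q R) (sg f)"
proof -
 obtain C where C: "nb R C f" using assms by (auto simp: bdd_def)
 have "nb (root q R) (max 1 C) (sg f)" unfolding nb_def
 proof
  fix n
  define y where "y = v (rt (fps_nth f n)) * root q R^n"
  have "y^q = v (fps_nth f n)*(root q R^q)^n"
   by (simp add: y_def power_mult_distrib v_rt) (metis mult.commute power_mult)
  also have "root q R^q = R" using assms q_ge2 by (simp add: real_root_pow_pos2)
  finally have yq: "y^q\<le>C" using nbD[OF C] by simp
  have "y\<le>max 1 C"
  proof (cases "y\<le>1")
   case False hence "y^1\<le>y^q" using q_ge2 by (intro power_increasing) auto thus ?thesis using yq by simp
  qed simp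
  thus "v (fps_nth (sg f) n) * root q R^n\<le>max 1 C" by (simp add: y_def)
 qed
 thus ?thesis by (rule bddI)
qed

lemma value_sg: assumes "bdd R f" "0 < v x" "v x < R" shows "fps_value v (sg f) (rt x) = rt (fps_value v f x)"
proof -
 have R: "R > 0" using assms by linarith
 obtain g where g: "bdd R g" "f = fps_const (fps_value v f x) + (fps_X - fps_const x) * g"
  using value_ex[OF assms] by blast
 define c where "c = fps_value v f x"
 have f: "f = fps_const c + (fps_X - fps_const x) * g" using g(2) by (simp only: c_def)
 have "sg f = fps_const (rt c) + (fps_X - fps_const (rt x)) * sg g" by (subst f) (simp add: sg_add sg_mult sg_diff)
 moreover have "0 < v (rt x)" "v (rt x) < root q R"
 proof -
  show "0 < v (rt x)" using assms(2) eq_0_iff nonneg rt_eq_0 by (metis less_eq_real_def v_0)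
  have "v (rt x)^q < root q R^q" using assms R q_ge2 by (simp add: v_rt real_root_pow_pos2)
  thus "v (rt x) < root q R" by (rule power_less_imp_less_base) (use R q_ge2 in simp)
 qed
 ultimately have "fps_value v (sg f) (rt x) = rt c" using fps_value_eq[OF bdd_sg[OF g(1) R]] by blast
 thus ?thesis by (simp add: c_def)
qed

lemma bdd_antimono: assumes "bdd R f" "0\<le>R'" "R'\<le>R" shows "bdd R' f"
proof -
 obtain C where C: "nb R C f" using assms by (auto simp: bdd_def)
 have "v (fps_nth f n) * R'^n\<le>C" for n
  using nbD[OF C, of n] mult_left_mono[OF power_mono[OF assms(3,2), of n] nonneg[of "fps_nth f n"]] by linarith
 thus ?thesis by (intro bddI[of _ C]) (simp add: nb_def)
qed

section \<open>The points \<open>\<theta>\<close> to the power \<open>1 / q ^ N\<close>\<close>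

definition th :: "nat => 'c" where "th N = (rt ^^ N) \<theta>"

lemma th_0: "th 0 = \<theta>" and th_Suc: "th (Suc N) = rt (th N)" and th_Suc_pow: "th (Suc N)^q = th N"
 by (simp_all add: th_def)

lemma th_add_pow: "th (M + N)^(q^N) = th M" by (induction N) (simp_all add: th_0 power_mult th_Suc_pow)

lemma v_th_gt1: "v (th N) > 1"
proof (induction N)
 case 0 show ?case using v_theta q_ge2 by (simp add: th_0)
next case (Suc N) show ?case
 proof (rule ccontr)
  assume "\<not> 1 < v (th (Suc N))"
  hence "v (th (Suc N))^q\<le>1" using nonneg by (intro power_le_one) auto
  thus False using Suc by (simp add: th_Suc_pow flip: v_power)
 qed
qed

lemma v_th_Suc: "v (th (Suc N))^q = v (th N)" by (simp add: th_Suc_pow flip: v_power)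

lemma v_th_strict: "v (th (Suc N)) < v (th N)"
 using power_strict_increasing[of 1 q "v (th (Suc N))"] v_th_gt1[of "Suc N"] q_ge2 v_th_Suc[of N] by simp

lemma v_th_antimono: "strict_antimono_on UNIV (\<lambda>N. v (th N))"
proof -
 have "v (th (N + Suc k)) < v (th N)" for N k by (induction k) (use v_th_strict in \<open>auto intro: order.strict_trans\<close>)
 thus ?thesis unfolding monotone_on_def by (metis less_imp_Suc_add add_Suc_right)
qed

lemma v_th_less: "M < N ==> v (th N) < v (th M)" using v_th_antimono unfolding monotone_on_def by blast

lemma v_th_le: "v (th N)\<le>v \<theta>" using v_th_less[of 0 N] by (cases "N = 0") (auto simp: th_0)

lemma th_inj: "inj th" by (rule injI) (metis v_th_less linorder_neqE_nat less_irrefl)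

lemma prod_v_th: "(\<Prod>N<T. v (th N))\<le>v \<theta>^2"
proof -
 have *: "(\<Prod>N<Suc T. v (th N)) * v (th T)\<le>v \<theta>^2" for T
 proof (induction T)
  case 0 thus ?case by (simp add: th_0 power2_eq_square)
 next case (Suc T)
  have "v (th (Suc T)) * v (th (Suc T))\<le>v (th (Suc T))^q"
   using power_increasing[of 2 q "v (th (Suc T))"] q_ge2 v_th_gt1[of "Suc T"] by (simp add: power2_eq_square)
  hence "v (th (Suc T)) * v (th (Suc T))\<le>v (th T)" by (simp add: v_th_Suc)
  hence "(\<Prod>N<Suc T. v (th N))*(v (th (Suc T)) * v (th (Suc T)))\<le>(\<Prod>N<Suc T. v (th N)) * v (th T)"
   using nonneg by (intro mult_left_mono prod_nonneg) auto
  thus ?case using Suc by (simp add: mult.assoc)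
 qed
 show ?thesis
 proof (cases T)
  case 0 thus ?thesis using v_th_gt1[of 0] by (simp add: th_0)
 next case (Suc S)
  have "1*(\<Prod>N<Suc S. v (th N))\<le>v (th S)*(\<Prod>N<Suc S. v (th N))"
   using v_th_gt1[of S] nonneg by (intro mult_right_mono prod_nonneg) auto
  thus ?thesis using *[of S] Suc by (simp add: mult.commute)
 qed
qed

end

section \<open>The discrete ring of constants\<close>

text \<open>The coefficient field is enlarged from \<open>\<F>\<^sub>q(\<theta>)\<close> to the perfect closure of
  \<open>\<F>\<^sub>Q(\<theta>)\<close>, \<open>Q = q ^ l\<close>; this is an algebraic extension. Its ring of integers is the
  union of the rings \<open>\<F>\<^sub>Q[\<theta>\<^bsup>1/q^M\<^esup>]\<close>, in which nonzero elements have absolute value at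
  least 1: the Liouville inequality holds for trivial reasons.\<close>

locale C_inf_l = C_infinity v q \<theta> for v :: "'c::field => real" and q \<theta> +
 fixes l :: nat
 assumes l_pos: "l\<ge>1"
begin

definition Fc :: "'c set" where "Fc = {x. x^(q^l) = x}"

lemma ql_ge2: "q^l\<ge>2" using power_increasing[of 1 l q] l_pos q_ge2 by simp

lemma Fc_subfield: "is_subfield Fc" using ql_ge2 q_ge2 unfolding Fc_def by (intro subfieldI subringI)
  (auto simp: frob_pow_add power_mult_distrib frob_pow_uminus power_inverse)

lemmas Fc_subring = subfield_subring[OF Fc_subfield]

lemma Fc_rt: "x\<in>Fc ==> rt x\<in>Fc" unfolding Fc_def by (simp flip: rt_power)

lemma Fc_finite: "finite Fc"
proof -
 define f where "f = monom (1::'c) (q^l) - monom 1 1"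
 have "coeff f (q^l) = 1" using ql_ge2 by (simp add: f_def)
 hence "f~=0" by auto
 hence "finite {x. poly f x = 0}" by (rule poly_roots_finite)
 moreover have "Fc = {x. poly f x = 0}" by (auto simp: Fc_def f_def poly_monom)
 ultimately show ?thesis by simp
qed

lemma Fc_card: "card Fc\<ge>2"
proof -
 have "card {0, 1 :: 'c}\<le>card Fc"
  using subring_0[OF Fc_subring] subring_1[OF Fc_subring] by (intro card_mono Fc_finite) auto
 thus ?thesis by simp
qed

lemma v_Fc: "x\<in>Fc ==> x~=0 ==> v x = 1"
proof -
 assume x: "x\<in>Fc" "x~=0"
 have "x^(q^l - 1) * x = x" using x(1) ql_ge2 power_minus_mult[of "q^l" x] q_ge2 by (simp add: Fc_def)
 hence "v x^(q^l - 1) = 1" using x(2) by (simp flip: v_power)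
 thus "v x = 1" using ql_ge2 nonneg power_eq_imp_eq_base[of "v x" "q^l - 1" 1] by simp
qed

lemma v_poly_th: assumes "p\<in>pol Fc" "p~=0" shows "v (poly p (th M)) = v (th M)^degree p"
proof (cases "degree p = 0")
 case True
 then obtain a where "p = [:a:]" by (rule degree_eq_zeroE)
 thus ?thesis using assms v_Fc[of a] polD[OF assms(1), of 0] by simp
next case False
 define d where "d = degree p"
 have l1: "v (lead_coeff p) = 1" using assms by (intro v_Fc polD) auto
 have "v (\<Sum>i<d. coeff p i * th M^i)\<le>v (th M)^(d - 1)"
 proof (rule v_sum)
  fix i assume i: "i\<in>{..<d}"
  have "v (coeff p i)\<le>1" using v_Fc polD[OF assms(1)] by (cases "coeff p i = 0") auto
  hence "v (coeff p i) * v (th M)^i\<le>1 * v (th M)^(d - 1)"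
   using i v_th_gt1[of M] by (intro mult_mono power_increasing) auto
  thus "v (coeff p i * th M^i)\<le>v (th M)^(d - 1)" by (simp add: mult v_power)
 qed (simp add: nonneg)
 also have "... < v (th M)^d" using False v_th_gt1[of M] by (intro power_strict_increasing) (auto simp: d_def)
 also have "... = v (coeff p d * th M^d)" using l1 by (simp add: mult v_power d_def)
 finally have "v ((\<Sum>i<d. coeff p i * th M^i) + coeff p d * th M^d) = v (coeff p d * th M^d)" by (rule v_add_eq)
 thus ?thesis using l1 by (simp add: poly_altdef d_def mult v_power flip: lessThan_Suc_atMost)
qed

definition Bd :: "nat => nat => 'c set" where "Bd M n = {poly p (th M) | p. p\<in>pol Fc \<and> degree p\<le>n}"

lemma BdI: "p\<in>pol Fc ==> degree p\<le>n ==> poly p (th M)\<in>Bd M n" unfolding Bd_def by blast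

lemma Bd_liouville: "x\<in>Bd M n ==> x~=0 ==> v x\<ge>1"
proof -
 assume x: "x\<in>Bd M n" "x~=0"
 then obtain p where p: "p\<in>pol Fc" "x = poly p (th M)" by (auto simp: Bd_def)
 hence p0: "p~=0" using x by auto
 show "v x\<ge>1" using p(2) v_poly_th[OF p(1) p0, of M] v_th_gt1[of M] by (simp add: one_le_power)
qed

lemma Bd_upper: "x\<in>Bd M n ==> v x\<le>v (th M)^n"
proof -
 assume "x\<in>Bd M n"
 then obtain p where p: "p\<in>pol Fc" "degree p\<le>n" "x = poly p (th M)" by (auto simp: Bd_def)
 show ?thesis
 proof (cases "p = 0")
  case True thus ?thesis using p v_th_gt1[of M] by simp
 next case False thus ?thesis using p v_poly_th[OF p(1), of M] v_th_gt1[of M] by (simp add: power_increasing)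
 qed
qed

lemma Bd_mono: "n\<le>n' ==> Bd M n\<subseteq>Bd M n'" unfolding Bd_def by auto

lemma Bd_Fc: "a\<in>Fc ==> a\<in>Bd M n" using BdI[of "[:a:]" n M] pol_const[OF Fc_subring] by simp

lemma Bd_0: "0\<in>Bd M n" and Bd_1: "1\<in>Bd M n" using Bd_Fc subring_0[OF Fc_subring] subring_1[OF Fc_subring] by auto

lemma Bd_add: assumes "x\<in>Bd M n" "y\<in>Bd M n" shows "x + y\<in>Bd M n"
proof -
 obtain p r where "p\<in>pol Fc" "degree p\<le>n" "x = poly p (th M)"
  "r\<in>pol Fc" "degree r\<le>n" "y = poly r (th M)" using assms by (auto simp: Bd_def)
 thus ?thesis using BdI[of "p + r" n M] subring_add[OF pol_subring[OF Fc_subring], of p r] by (simp add: degree_add_le)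
qed

lemma Bd_uminus: assumes "x\<in>Bd M n" shows "- x\<in>Bd M n"
proof -
 obtain p where "p\<in>pol Fc" "degree p\<le>n" "x = poly p (th M)" using assms by (auto simp: Bd_def)
 thus ?thesis using BdI[of "- p" n M] subring_uminus[OF pol_subring[OF Fc_subring], of p] by simp
qed

lemma Bd_diff: "x\<in>Bd M n ==> y\<in>Bd M n ==> x - y\<in>Bd M n" using Bd_add[of x M n "- y"] Bd_uminus by simp

lemma Bd_sum: "(\<And>i. i\<in>A ==> f i\<in>Bd M n) ==> sum f A\<in>Bd M n"
 by (induction A rule: infinite_finite_induct) (auto intro: Bd_0 Bd_add)

lemma Bd_mult: assumes "x\<in>Bd M n" "y\<in>Bd M m" shows "x * y\<in>Bd M (n + m)"
proof -
 obtain p r where "p\<in>pol Fc" "degree p\<le>n" "x = poly p (th M)"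
  "r\<in>pol Fc" "degree r\<le>m" "y = poly r (th M)" using assms by (auto simp: Bd_def)
 thus ?thesis using BdI[of "p * r" "n + m" M] subring_mult[OF pol_subring[OF Fc_subring], of p r]
  using degree_mult_le[of p r] by simp
qed

lemma Bd_th: "th M^i\<in>Bd M i" using BdI[of "monom 1 i" i M] pol_monom[OF Fc_subring subring_1[OF Fc_subring]]
 by (simp add: poly_monom degree_monom_eq)

lemma Bd_level: assumes "x\<in>Bd M n" shows "x\<in>Bd (M + k) (n * q^k)"
proof -
 obtain p where p: "p\<in>pol Fc" "degree p\<le>n" "x = poly p (th M)" using assms by (auto simp: Bd_def)
 have "x = (\<Sum>i\<le>degree p. coeff p i * th (M + k)^(q^k * i))"
  unfolding p(3) poly_altdef by (simp add: th_add_pow power_mult)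
 also have "...\<in>Bd (M + k) (n * q^k)"
 proof (rule Bd_sum)
  fix i assume "i\<in>{..degree p}"
  hence "0 + q^k * i\<le>n * q^k" using p(2) by (simp add: mult.commute)
  from subsetD[OF Bd_mono[OF this] Bd_mult[OF Bd_Fc[OF polD[OF p(1)]] Bd_th]]
  show "coeff p i * th (M + k)^(q^k * i)\<in>Bd (M + k) (n * q^k)" .
 qed
 finally show ?thesis .
qed

lemma Bd_rt: assumes "x\<in>Bd M n" shows "rt x\<in>Bd (Suc M) n"
proof -
 obtain p where p: "p\<in>pol Fc" "degree p\<le>n" "x = poly p (th M)" using assms by (auto simp: Bd_def)
 have "rt x = poly (map_poly rt p) (th (Suc M))"
  unfolding p(3) by (simp add: poly_altdef rt_sum rt_mult rt_power th_Suc coeff_map_poly degree_map_poly)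
 moreover have "map_poly rt p\<in>pol Fc" using map_poly_pol[of Fc rt Fc p] Fc_rt p(1) by auto
 ultimately show ?thesis using BdI[of "map_poly rt p" n "Suc M"] p(2) by (metis degree_map_poly rt_eq_0)
qed

lemma Bd_card: "finite (Bd M n) \<and> card (Bd M n) = card Fc^(n + 1)"
proof -
 define U where "U = {..n} \<rightarrow>\<^sub>E Fc"
 define P where "P a = (\<Sum>i\<le>n. monom (a i) i)" for a :: "nat => 'c"
 have cP: "coeff (P a) i = (if i\<le>n then a i else 0)" for a i
  unfolding P_def coeff_sum coeff_monom by (auto simp: sum.delta')
 have PF: "P a\<in>pol Fc" "degree (P a)\<le>n" if "a\<in>U" for a
  using that subring_0[OF Fc_subring] by (auto simp: pol_def cP U_def intro!: degree_le)
 have img: "Bd M n = (\<lambda>a. poly (P a) (th M))`U"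
 proof
  show "Bd M n\<subseteq>(\<lambda>a. poly (P a) (th M))`U"
  proof
   fix x assume "x\<in>Bd M n"
   then obtain p where p: "p\<in>pol Fc" "degree p\<le>n" "x = poly p (th M)" by (auto simp: Bd_def)
   have "P (restrict (coeff p) {..n}) = p" by (rule poly_eqI) (use p(2) in \<open>auto simp: cP coeff_eq_0\<close>)
   moreover have "restrict (coeff p) {..n}\<in>U" using p(1) by (auto simp: U_def pol_def)
   ultimately show "x\<in>(\<lambda>a. poly (P a) (th M))`U" using p(3) by (intro image_eqI) auto
  qed
 qed (use PF BdI in auto)
 have inj: "inj_on (\<lambda>a. poly (P a) (th M)) U"
 proof (rule inj_onI)
  fix a b assume ab: "a\<in>U" "b\<in>U" "poly (P a) (th M) = poly (P b) (th M)"
  have "P a - P b\<in>pol Fc" using PF ab by (intro subring_diff[OF pol_subring[OF Fc_subring]])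
  hence "P a - P b = 0" using v_poly_th[of "P a - P b" M] ab(3) v_th_gt1[of M] by fastforce
  hence "coeff (P a) i = coeff (P b) i" for i by simp
  thus "a = b" using ab by (intro ext) (auto simp: cP U_def PiE_def extensional_def; metis)
 qed
 have "finite U" unfolding U_def using Fc_finite by (intro finite_PiE) auto
 moreover have "card U = card Fc^(n + 1)" unfolding U_def by (simp add: card_PiE)
 ultimately show ?thesis unfolding img by (simp add: card_image[OF inj])
qed

text \<open>Siegel's lemma by the pigeonhole principle.\<close>

lemma siegel: assumes fin: "finite I" "finite E" and A: "\<And>k i. k\<in>E ==> i\<in>I ==> A k i\<in>Bd M (d k)"
  and less: "(\<Sum>k\<in>E. n + d k + 1) < card I*(n + 1)"
 shows "\<exists>x. (\<forall>i\<in>I. x i\<in>Bd M n) \<and> (\<exists>i\<in>I. x i~=0) \<and> (\<forall>k\<in>E. (\<Sum>i\<in>I. x i * A k i) = 0)"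
proof -
 define U where "U = I \<rightarrow>\<^sub>E Bd M n"
 define V where "V = PiE E (\<lambda>k. Bd M (n + d k))"
 define f where "f x = restrict (\<lambda>k. \<Sum>i\<in>I. x i * A k i) E" for x
 have "finite V" unfolding V_def using fin Bd_card by (intro finite_PiE) auto
 moreover have fV: "f`U\<subseteq>V" using A by (auto simp: U_def V_def f_def intro!: Bd_sum Bd_mult)
 ultimately have "card (f`U)\<le>card V" by (rule card_mono)
 also have "card V = (\<Prod>k\<in>E. card Fc^(n + d k + 1))" unfolding V_def using fin Bd_card by (simp add: card_PiE)
 also have "... = card Fc^(\<Sum>k\<in>E. n + d k + 1)" by (simp add: power_sum)
 also have "... < card Fc^(card I*(n + 1))" using less Fc_card by (intro power_strict_increasing) auto
 also have "... = (card Fc^(n + 1))^card I" by (simp only: power_mult[symmetric] mult.commute)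
 also have "... = card U" unfolding U_def using fin Bd_card by (simp add: card_PiE)
 finally have "\<not> inj_on f U" by (rule pigeonhole)
 then obtain x y where xy: "x\<in>U" "y\<in>U" "x~=y" "f x = f y" by (auto simp: inj_on_def)
 obtain i where i: "i\<in>I" "x i~=y i" using xy unfolding U_def by (metis PiE_ext)
 have "(\<Sum>i\<in>I. (x i - y i) * A k i) = 0" if "k\<in>E" for k
  using fun_cong[OF xy(4), of k] that by (simp add: f_def left_diff_distrib sum_subtractf)
 thus ?thesis using xy(1,2) i by (intro exI[of _ "\<lambda>i. x i - y i"]) (auto simp: U_def intro!: Bd_diff)
qed

text \<open>Normalized degrees: the elements of degree at most \<open>X\<close> in \<open>\<theta>\<close>, at level \<open>M\<close>.\<close>

definition Bn :: "nat => nat => 'c set" where "Bn M X = Bd M (X * q^M)"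

lemma Bn_mono: "X\<le>Y ==> x\<in>Bn M X ==> x\<in>Bn M Y" unfolding Bn_def using Bd_mono[of "X * q^M" "Y * q^M" M] by auto

lemma Bn_level: assumes "M\<le>M'" "x\<in>Bn M X" shows "x\<in>Bn M' X" using Bd_level[of x M "X * q^M" "M' - M"] assms
 by (simp add: Bn_def mult.assoc flip: power_add)

lemma Bn_rt: "x\<in>Bn M (2 * X) ==> rt x\<in>Bn (Suc M) X"
 using Bd_rt[of x M "2 * X * q^M"] Bd_mono[of "2 * X * q^M" "X * q^Suc M" "Suc M"] q_ge2
 unfolding Bn_def by (auto simp: mult_ac)

lemma Bn_rt': "x\<in>Bn M X ==> rt x\<in>Bn (Suc M) X" using Bn_rt Bn_mono[of X "2 * X"] by simp

lemma Bn_mult: "x\<in>Bn M X ==> y\<in>Bn M Y ==> x * y\<in>Bn M (X + Y)" unfolding Bn_def by (simp add: Bd_mult distrib_right)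

lemma Bn_sum: "(\<And>i. i\<in>A ==> f i\<in>Bn M X) ==> sum f A\<in>Bn M X" unfolding Bn_def by (rule Bd_sum)

lemma Bn_0: "0\<in>Bn M X" and Bn_1: "1\<in>Bn M X" unfolding Bn_def by (rule Bd_0, rule Bd_1)

lemma Bn_th: "th N^i\<in>Bn N i" unfolding Bn_def using Bd_th[of N i] Bd_mono[of i "i * q^N" N] q_ge2 by auto

lemma Bn_upper: assumes "x\<in>Bn M X" shows "v x\<le>v \<theta>^X"
proof -
 have "v (th M)^q^M = v \<theta>" using th_add_pow[of 0 M] by (simp add: th_0 flip: v_power)
 thus ?thesis using Bd_upper assms unfolding Bn_def by (metis mult.commute power_mult)
qed

definition BB :: "'c set" where "BB = (\<Union>M X. Bn M X)"

lemma BB_uniform: assumes "finite A" "A\<subseteq>BB" shows "\<exists>M X. A\<subseteq>Bn M X" using assms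
proof (induction A)
 case (insert x A)
 then obtain M X M' X' where a: "A\<subseteq>Bn M X" "x\<in>Bn M' X'" by (auto simp: BB_def)
 have "insert x A\<subseteq>Bn (max M M') (max X X')" using a Bn_level[OF max.cobounded1 Bn_mono[OF max.cobounded1]]
   Bn_level[OF max.cobounded2 Bn_mono[OF max.cobounded2]] by blast
 thus ?case by blast
qed simp

lemma BB_uniform2: assumes "x\<in>BB" "y\<in>BB" obtains M X where "x\<in>Bn M X" "y\<in>Bn M X"
 using BB_uniform[of "{x, y}"] assms by auto

lemma BnBB: "x\<in>Bn M X ==> x\<in>BB" by (auto simp: BB_def)

lemma BB_subring: "is_subring BB"
proof (rule subringI)
 show "0\<in>BB" "1\<in>BB" using BnBB Bn_0 Bn_1 by blast+
 fix x y assume "x\<in>BB" "y\<in>BB"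
 then obtain M X where "x\<in>Bn M X" "y\<in>Bn M X" using BB_uniform2 by blast
 thus "x + y\<in>BB" "x * y\<in>BB"
  using BnBB[of "x + y" M X] BnBB[of "x * y" M "X + X"] Bn_mult by (auto simp: Bn_def Bd_add)
next fix x assume "x\<in>BB"
 then obtain M X where "x\<in>Bn M X" by (auto simp: BB_def)
 thus "- x\<in>BB" using BnBB[of "- x" M X] by (simp add: Bn_def Bd_uminus)
qed

lemma BB_rt: "x\<in>BB ==> rt x\<in>BB"
proof -
 assume "x\<in>BB"
 then obtain M X where "x\<in>Bn M X" by (auto simp: BB_def)
 thus "rt x\<in>BB" using BnBB[OF Bn_rt'] by blast
qed

lemma BB_liouville: "x\<in>BB ==> x~=0 ==> v x\<ge>1" using Bd_liouville by (auto simp: BB_def Bn_def)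

lemma BB_Fc: "Fc\<subseteq>BB" using Bd_Fc[of _ 0 0] BnBB[of _ 0 0] by (auto simp: Bn_def)

lemma BB_th: "th N\<in>BB" using Bn_th[of N 1] BnBB by simp

lemma BB_theta: "\<theta>\<in>BB" using BB_th[of 0] by (simp add: th_0)

definition FF :: "'c set" where "FF = fracs BB"

lemma FF_subfield: "is_subfield FF" unfolding FF_def by (rule fracs_subfield[OF BB_subring])

lemma BB_FF: "BB\<subseteq>FF" unfolding FF_def by (rule fracs_base[OF BB_subring])

text \<open>Passing from \<open>k\<close> to \<open>FF\<close> does not change algebraic closures.\<close>

lemma rat_field_FF: "rat_field q \<theta>\<subseteq>FF"
proof -
 have "x^(q^n) = x" if "x^q = x" for x :: 'c and n using that by (induction n) (simp_all add: power_mult)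
 hence "{x. x^q = x}\<subseteq>FF" using BB_Fc BB_FF by (auto simp: Fc_def)
 thus ?thesis unfolding rat_field_def using BB_theta BB_FF by (intro adjoin_minimal FF_subfield) auto
qed

lemma FF_algebraic: "FF\<subseteq>acl (rat_field q \<theta>) {}"
proof -
 let ?K = "rat_field q \<theta>"
 have alg: "x\<in>acl ?K {}" if "x^n\<in>?K" "n > 0" for x n
 proof -
  note R = subfield_subring[OF rat_field_subfield]
  define f where "f = monom 1 n - [:x^n:]"
  have "f\<in>pol ?K" unfolding f_def by (intro subring_diff[OF pol_subring[OF R]] pol_monom pol_const R subring_1 that)
  moreover have "coeff f n = 1" using that by (simp add: f_def coeff_pCons split: nat.split)
  moreover have "poly f x = 0" by (simp add: f_def poly_monom)
  ultimately have "algebraic_over ?K x" unfolding algebraic_iff_pol[OF rat_field_subfield] by (intro bexI[of _ f]) auto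
  thus ?thesis by (simp add: acl_def adjoin_same[OF rat_field_subfield])
 qed
 have F: "Fc\<subseteq>acl ?K {}"
 proof
  fix x assume x: "x\<in>Fc"
  show "x\<in>acl ?K {}"
  proof (cases "x = 0")
   case False
   have "x^(q^l - 1) * x = x" using x ql_ge2 power_minus_mult[of "q^l" x] q_ge2 by (simp add: Fc_def)
   hence "x^(q^l - 1) = 1" using False by simp
   thus ?thesis using alg[of x "q^l - 1"] ql_ge2 subring_1[OF subfield_subring[OF rat_field_subfield]] by simp
  qed (use acl_base subring_0[OF subfield_subring[OF acl_subfield]] in blast)
 qed
 have T: "th M\<in>acl ?K {}" for M using alg[of "th M" "q^M"] th_add_pow[of 0 M] q_ge2 adjoin_gens[of "{\<theta>}"]
  by (simp add: th_0 rat_field_def)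
 have "BB\<subseteq>acl ?K {}" unfolding BB_def Bn_def Bd_def
  using pol_eval[OF subfield_subring[OF acl_subfield] _ T] pol_mono[OF F] by blast
 thus ?thesis unfolding FF_def fracs_def using subfield_divide[OF acl_subfield] by blast
qed

lemma rk_FF: "rk FF S = rk (rat_field q \<theta>) S" by (rule rk_base_change[OF rat_field_FF FF_algebraic])

end

section \<open>The linear independence criterion\<close>

context C_inf_l
begin

definition PB :: "'c fps set" where "PB = fps_of_poly`pol BB"

lemma PB_I: "p\<in>pol BB ==> fps_of_poly p\<in>PB" by (simp add: PB_def)

lemma PB_subring: "is_subring PB"
proof (rule subringI)
 note R = pol_subring[OF BB_subring]
 show "0\<in>PB" "1\<in>PB" using PB_I[OF subring_0[OF R]] PB_I[OF subring_1[OF R]] by simp_all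
 fix x y assume "x\<in>PB" "y\<in>PB"
 then obtain p r where "p\<in>pol BB" "r\<in>pol BB" "x = fps_of_poly p" "y = fps_of_poly r" by (auto simp: PB_def)
 thus "x + y\<in>PB" "x * y\<in>PB" using PB_I[OF subring_add[OF R, of p r]] PB_I[OF subring_mult[OF R, of p r]]
  by (simp_all add: fps_of_poly_add fps_of_poly_mult)
next fix x assume "x\<in>PB"
 then obtain p where "p\<in>pol BB" "x = fps_of_poly p" by (auto simp: PB_def)
 thus "- x\<in>PB" using PB_I[OF subring_uminus[OF pol_subring[OF BB_subring], of p]] by (simp add: fps_of_poly_uminus)
qed

lemma pol_BB_rt: "p\<in>pol BB ==> map_poly rt p\<in>pol BB" using map_poly_pol[of BB rt BB p] BB_rt by simp

lemma PB_sg: "x\<in>PB ==> sg x\<in>PB" using pol_BB_rt by (auto simp: PB_def sg_poly)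

lemma lspan_PB_sg: "f\<in>lspan PB G ==> sg f\<in>lspan PB (sg`G)"
 by (induction rule: lspan.induct) (auto simp: sg_add sg_mult intro!: lspan.intros PB_sg)

lemma lspan_PB_finite: assumes "finite G" "f\<in>lspan PB G"
 shows "\<exists>c. (\<forall>g\<in>G. c g\<in>pol BB) \<and> f = (\<Sum>g\<in>G. fps_of_poly (c g) * g)"
proof -
 obtain c where c: "\<forall>g\<in>G. c g\<in>PB" "f = (\<Sum>g\<in>G. c g * g)" using lspan_finite[OF PB_subring assms] by blast
 hence "\<forall>g\<in>G. \<exists>p. p\<in>pol BB \<and> c g = fps_of_poly p" by (auto simp: PB_def)
 then obtain p where "\<forall>g\<in>G. p g\<in>pol BB \<and> c g = fps_of_poly (p g)" by metis
 thus ?thesis using c(2) by (intro exI[of _ p]) auto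
qed

lemma lspan_PB_finite_sg: assumes "finite G" "f\<in>lspan PB (sg`G)"
 shows "\<exists>c. (\<forall>g\<in>G. c g\<in>pol BB) \<and> f = (\<Sum>g\<in>G. fps_of_poly (c g) * sg g)"
proof -
 obtain c where c: "\<forall>g\<in>sg`G. c g\<in>pol BB" "f = (\<Sum>g\<in>sg`G. fps_of_poly (c g) * g)"
  using lspan_PB_finite[OF _ assms(2)] assms(1) by blast
 have "inj_on sg G" by (rule inj_onI) (simp add: sg_inj)
 thus ?thesis using c by (intro exI[of _ "\<lambda>g. c (sg g)"]) (auto simp: sum.reindex)
qed

lemma pol_uniform: assumes "finite P" "P\<subseteq>pol BB" shows "\<exists>M X D. \<forall>p\<in>P. degree p\<le>D \<and> (\<forall>i. coeff p i\<in>Bn M X)"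
proof -
 have "finite (\<Union>p\<in>P. range (coeff p))" using assms(1) by (auto simp: range_coeff)
 moreover have "(\<Union>p\<in>P. range (coeff p))\<subseteq>BB" using assms(2) by (auto simp: pol_def)
 ultimately obtain M X where MX: "(\<Union>p\<in>P. range (coeff p))\<subseteq>Bn M X" using BB_uniform by blast
 have "degree p\<le>(\<Sum>p\<in>P. degree p)" if "p\<in>P" for p using assms(1) that by (intro member_le_sum) auto
 moreover have "coeff p i\<in>Bn M X" if "p\<in>P" for p i using MX that by blast
 ultimately show ?thesis by metis
qed

lemma poly_th_Bn: assumes "degree p\<le>D" "\<And>i. coeff p i\<in>Bn M X" shows "poly p (th N)\<in>Bn (M + N) (X + D)"
 unfolding poly_altdef
proof (rule Bn_sum)
 fix i assume "i\<in>{..degree p}"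
 hence "i\<le>D" using assms(1) by simp
 have "coeff p i * th N^i\<in>Bn (M + N) (X + i)"
  using Bn_level[OF le_add1 assms(2)] Bn_level[OF le_add2 Bn_th] by (rule Bn_mult)
 thus "coeff p i * th N^i\<in>Bn (M + N) (X + D)" by (rule Bn_mono[rotated]) (use \<open>i \<le> D\<close> in simp)
qed

text \<open>The leading coefficient of a solution of a linear difference equation is a root of an
  additive polynomial with coefficients in the discrete ring, so it cannot be too small.\<close>

lemma leading_coeff_bound: assumes E: "E~=0" and a: "\<And>i. i\<le>d ==> a i\<in>pol BB" and i0: "i0\<le>d" "a i0~=0"
  and K: "K\<ge>1" "\<And>i j. i\<le>d ==> v (coeff (a i) j)\<le>K" and rel: "(\<Sum>i\<le>d. fps_of_poly (a i)*(sg ^^ i) E) = 0"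
 shows "(1/K)^(q^d)\<le>v (fps_nth E (subdegree E))"
proof -
 define m where "m = subdegree E"
 define lam where "lam = fps_nth E m"
 have l0: "lam~=0" using E by (simp add: lam_def m_def)
 have "\<exists>j i. i\<le>d \<and> coeff (a i) j~=0" using i0 by (metis leading_coeff_0_iff)
 define e where "e = (LEAST j. \<exists>i\<le>d. coeff (a i) j~=0)"
 have e: "\<exists>i\<le>d. coeff (a i) e~=0" unfolding e_def by (rule LeastI_ex) (use \<open>\<exists>j i. _\<close> in blast)
 have elow: "coeff (a i) j = 0" if "i\<le>d" "j < e" for i j
  using not_less_Least[of j "\<lambda>j. \<exists>i\<le>d. coeff (a i) j~=0"] that by (auto simp: e_def)
 define c where "c i = coeff (a i) e" for i
 have nth: "fps_nth (fps_of_poly (a i)*(sg ^^ i) E) (e + m) = c i*(rt ^^ i) lam" if "i\<le>d" for i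
 proof -
  have "fps_nth (fps_of_poly (a i)*(sg ^^ i) E) (e + m) = (\<Sum>j\<in>{e}. coeff (a i) j*(rt ^^ i) (fps_nth E (e + m - j)))"
   unfolding fps_mult_nth fps_of_poly_nth sgn_nth
  proof (rule sum.mono_neutral_right)
   show "\<forall>j\<in>{0..e + m} - {e}. coeff (a i) j*(rt ^^ i) (fps_nth E (e + m - j)) = 0"
   proof
    fix j assume j: "j\<in>{0..e + m} - {e}"
    show "coeff (a i) j*(rt ^^ i) (fps_nth E (e + m - j)) = 0"
    proof (cases "j < e")
     case False hence "fps_nth E (e + m - j) = 0" using j by (intro nth_less_subdegree_zero) (auto simp: m_def)
     moreover have "(rt ^^ i) 0 = 0" by (induction i) auto
     ultimately show ?thesis by simp
    qed (use elow that in simp)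
   qed
  qed auto
  thus ?thesis by (simp add: c_def lam_def)
 qed
 have rel0: "(\<Sum>i\<le>d. c i*(rt ^^ i) lam) = 0"
 proof -
  have "(\<Sum>i\<le>d. c i*(rt ^^ i) lam) = fps_nth (\<Sum>i\<le>d. fps_of_poly (a i)*(sg ^^ i) E) (e + m)"
   by (simp add: fps_sum_nth nth)
  thus ?thesis using rel by simp
 qed
 define i1 where "i1 = Max {i. i\<le>d \<and> c i~=0}"
 have ne: "{i. i\<le>d \<and> c i~=0}~={}" "finite {i. i\<le>d \<and> c i~=0}" using e by (auto simp: c_def)
 have i1: "i1\<le>d" "c i1~=0" using Max_in[OF ne(2,1)] by (auto simp: i1_def)
 have above: "c i = 0" if "i\<le>d" "i > i1" for i
 proof (rule ccontr)
  assume "c i~=0"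
  hence "i\<le>i1" unfolding i1_def using Max_ge[OF ne(2), of i] that by simp
  thus False using that by simp
 qed
 have "(\<Sum>i\<le>d. c i*(rt ^^ i) lam) = (\<Sum>i\<le>i1. c i*(rt ^^ i) lam)" using i1 above by (intro sum.mono_neutral_right) auto
 hence "(\<Sum>i<i1. c i*(rt ^^ i) lam) + c i1*(rt ^^ i1) lam = 0" using rel0 by (simp flip: lessThan_Suc_atMost)
 hence rel1: "c i1*(rt ^^ i1) lam = - (\<Sum>i<i1. c i*(rt ^^ i) lam)" by (simp add: add_eq_0_iff)
 define \<mu> where "\<mu> = (rt ^^ i1) lam"
 have mu0: "\<mu>~=0" using rtn_pow[of i1 lam] l0 q_ge2 by (auto simp: \<mu>_def power_0_left)
 have lmu: "v lam = v \<mu>^(q^i1)" using rtn_pow[of i1 lam] by (simp add: \<mu>_def flip: v_power)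
 have "1/K\<le>v \<mu>"
 proof (cases "v \<mu>\<ge>1")
  case True
  have "1/K\<le>1" using K(1) by simp
  thus ?thesis using True by linarith
 next case False
  have "v (\<Sum>i<i1. c i*(rt ^^ i) lam)\<le>K * v \<mu>^2"
  proof (rule v_sum)
   fix i assume i: "i\<in>{..<i1}"
   have "\<mu> = (rt ^^ (i1 - i)) ((rt ^^ i) lam)"
    using i by (simp add: \<mu>_def funpow_add[symmetric, THEN fun_cong, unfolded o_def])
   hence "(rt ^^ i) lam = \<mu>^(q^(i1 - i))" using rtn_pow by metis
   hence "v ((rt ^^ i) lam) = v \<mu>^(q^(i1 - i))" by (simp add: v_power)
   also have "...\<le>v \<mu>^2"
   proof (rule power_decreasing)
    have "q^1\<le>q^(i1 - i)" using i q_ge2 by (intro power_increasing) auto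
    thus "2\<le>q^(i1 - i)" using q_ge2 by simp
   qed (use False nonneg in auto)
   finally have "v (c i) * v ((rt ^^ i) lam)\<le>K * v \<mu>^2" using K i i1 nonneg by (intro mult_mono) (auto simp: c_def)
   thus "v (c i*(rt ^^ i) lam)\<le>K * v \<mu>^2" by (simp add: mult)
  qed (use K in simp)
  moreover have "v (c i1*\<mu>)\<ge>1 * v \<mu>"
   unfolding mult using i1 a nonneg by (intro mult_right_mono BB_liouville) (auto simp: c_def pol_def)
  ultimately have "v \<mu>\<le>K * v \<mu> * v \<mu>" using rel1 v_uminus by (simp add: \<mu>_def power2_eq_square mult.assoc)
  moreover have "v \<mu> > 0" using mu0 eq_0_iff nonneg by (metis less_eq_real_def)
  ultimately have "1\<le>K * v \<mu>" by simp
  thus ?thesis using K by (simp add: field_simps)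
 qed
 hence "(1/K)^(q^i1)\<le>v lam" unfolding lmu using K by (intro power_mono) auto
 moreover have "(1/K)^(q^d)\<le>(1/K)^(q^i1)"
  using K i1 q_ge2 by (intro power_decreasing power_increasing) auto
 ultimately show ?thesis by (simp add: lam_def m_def)
qed

text \<open>Evaluation of the difference system at the points \<open>\<theta>\<close> to the power \<open>1 / q ^ N\<close>. All
  denominators are products of values of \<open>h\<close>, and sizes stay bounded because a root
  halves normalized degrees.\<close>

lemma value_recursion: assumes fin: "finite G" "finite J" and R: "R > v \<theta>" and bd: "\<And>g. g\<in>G ==> bdd R g"
  and h: "h\<in>pol BB" "\<And>N. N\<ge>1 ==> poly h (th N)~=0" and sys: "\<And>g. g\<in>G ==> fps_of_poly h * g\<in>lspan PB (sg`G)"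
  and val: "\<And>g. g\<in>G ==> fps_value v g \<theta>\<in>lspan FF J"
 shows "\<exists>M C. \<forall>N. \<exists>\<delta> A. \<delta>~=0 \<and> (\<forall>g\<in>G. \<delta> * fps_value v g (th N) = (\<Sum>m\<in>J. A g m*(rt ^^ N) m)
   \<and> (\<forall>m\<in>J. A g m\<in>Bn (M + N) (2 * C)))"
proof -
 have "\<forall>g\<in>G. \<exists>c. (\<forall>g'\<in>G. c g'\<in>pol BB) \<and> fps_of_poly h * g = (\<Sum>g'\<in>G. fps_of_poly (c g') * sg g')"
  using lspan_PB_finite_sg[OF fin(1)] sys by blast
 then obtain c where c: "\<And>g g'. g\<in>G ==> g'\<in>G ==> c g g'\<in>pol BB"
  "\<And>g. g\<in>G ==> fps_of_poly h * g = (\<Sum>g'\<in>G. fps_of_poly (c g g') * sg g')" by metis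
 have "(\<lambda>(g, g'). c g g')`(G\<times>G)\<subseteq>pol BB" using c(1) by auto
 then obtain M1 X1 D1 where "\<forall>p\<in>(\<lambda>(g, g'). c g g')`(G\<times>G). degree p\<le>D1 \<and> (\<forall>i. coeff p i\<in>Bn M1 X1)"
  using pol_uniform[of "(\<lambda>(g, g'). c g g')`(G\<times>G)"] fin by blast
 hence u: "degree (c g g')\<le>D1 \<and> coeff (c g g') i\<in>Bn M1 X1" if "g\<in>G" "g'\<in>G" for g g' i using that by auto
 have "\<forall>g\<in>G. \<exists>b. (\<forall>m\<in>J. b m\<in>FF) \<and> fps_value v g \<theta> = (\<Sum>m\<in>J. b m * m)"
  using lspan_finite[OF subfield_subring[OF FF_subfield] fin(2)] val by blast
 then obtain b where b: "\<And>g m. g\<in>G ==> m\<in>J ==> b g m\<in>FF" "\<And>g. g\<in>G ==> fps_value v g \<theta> = (\<Sum>m\<in>J. b g m * m)" by metis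
 have "(\<lambda>(g, m). b g m)`(G\<times>J)\<subseteq>fracs BB" using b(1) by (auto simp: FF_def)
 from common_denominator[OF BB_subring _ this] fin obtain \<delta>0 where
  d0: "\<delta>0~=0" "\<And>g m. g\<in>G ==> m\<in>J ==> \<delta>0 * b g m\<in>BB" by auto
 have "(\<lambda>(g, m). \<delta>0 * b g m)`(G\<times>J)\<subseteq>BB" using d0(2) by auto
 from BB_uniform[OF _ this] fin obtain M2 X2 where
  u2: "\<And>g m. g\<in>G ==> m\<in>J ==> \<delta>0 * b g m\<in>Bn M2 X2" by (auto simp: image_subset_iff)
 define M where "M = max M1 M2"
 define C where "C = max X2 (X1 + D1)"
 have cC: "poly (c g g') (th N)\<in>Bn (M + N) C" if "g\<in>G" "g'\<in>G" for g g' N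
 proof -
  have "poly (c g g') (th N)\<in>Bn (M1 + N) (X1 + D1)" using u that by (intro poly_th_Bn) auto
  thus ?thesis using Bn_level[of "M1 + N" "M + N" _ C] Bn_mono[of "X1 + D1" C] by (simp add: M_def C_def)
 qed
 have "\<exists>\<delta> A. \<delta>~=0 \<and> (\<forall>g\<in>G. \<delta> * fps_value v g (th N) = (\<Sum>m\<in>J. A g m*(rt ^^ N) m)
   \<and> (\<forall>m\<in>J. A g m\<in>Bn (M + N) (2 * C)))" for N
 proof (induction N)
  case 0
  have "\<delta>0 * b g m\<in>Bn M (2 * C)" if "g\<in>G" "m\<in>J" for g m
  proof -
   have "X2\<le>C" "M2\<le>M" by (simp_all add: C_def M_def)
   hence "X2\<le>2 * C" "M2\<le>M" by simp_all
   thus ?thesis using u2[OF that] Bn_level Bn_mono by blast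
  qed
  thus ?case using d0(1) b(2) by (intro exI[of _ \<delta>0] exI[of _ "\<lambda>g m. \<delta>0 * b g m"])
    (auto simp: th_0 sum_distrib_left mult.assoc)
 next case (Suc N)
  then obtain \<delta> A where dA: "\<delta>~=0" "\<And>g. g\<in>G ==> \<delta> * fps_value v g (th N) = (\<Sum>m\<in>J. A g m*(rt ^^ N) m)"
   "\<And>g m. g\<in>G ==> m\<in>J ==> A g m\<in>Bn (M + N) (2 * C)" by blast
  define x where "x = th (Suc N)"
  define R2 where "R2 = min R (root q R)"
  have vx: "0 < v x" using v_th_gt1[of "Suc N"] by (simp add: x_def)
  have R0: "R > 1" using R v_th_gt1[of 0] by (simp add: th_0)
  have rtR: "root q R^q = R" using q_ge2 R0 by (simp add: real_root_pow_pos2)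
  have "v x^q < root q R^q" unfolding rtR x_def v_th_Suc using v_th_le[of N] R by simp
  hence "v x < root q R" by (rule power_less_imp_less_base) (use R0 q_ge2 in simp)
  hence vR2: "v x < R2" using v_th_le[of "Suc N"] R by (simp add: R2_def x_def)
  have R20: "0\<le>R2" using vx vR2 by linarith
  have bg: "bdd R2 g" "bdd R2 (sg g)" if "g\<in>G" for g
   using bdd_antimono[OF bd[OF that], of R2] bdd_antimono[OF bdd_sg[OF bd[OF that]], of R2] R20 R0
   by (auto simp: R2_def)
  have vs: "fps_value v (sg g) x = rt (fps_value v g (th N))" if "g\<in>G" for g
   using value_sg[OF bd[OF that], of "th N"] v_th_gt1[of N] v_th_le[of N] R by (simp add: x_def th_Suc)
  have step: "poly h x * fps_value v g x = (\<Sum>g'\<in>G. poly (c g g') x * rt (fps_value v g' (th N)))" if "g\<in>G" for g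
  proof -
   have "poly h x * fps_value v g x = fps_value v (fps_of_poly h * g) x"
    using value_mult[OF bdd_poly[OF R20] bg(1)[OF that] vx vR2] by (simp add: value_poly[OF vx])
   also have "... = (\<Sum>g'\<in>G. fps_value v (fps_of_poly (c g g') * sg g') x)"
    unfolding c(2)[OF that] using bg R20 bdd_mult bdd_poly by (intro value_sum[OF _ vx vR2]) auto
   also have "... = (\<Sum>g'\<in>G. poly (c g g') x * rt (fps_value v g' (th N)))"
    using value_mult[OF bdd_poly[OF R20] bg(2) vx vR2] vs by (intro sum.cong) (auto simp: value_poly[OF vx])
   finally show ?thesis .
  qed
  define \<delta>' where "\<delta>' = poly h x * rt \<delta>"
  define A' where "A' g m = (\<Sum>g'\<in>G. poly (c g g') x * rt (A g' m))" for g m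
  have "\<delta>' * fps_value v g x = (\<Sum>m\<in>J. A' g m*(rt ^^ Suc N) m)" if "g\<in>G" for g
  proof -
   have "\<delta>' * fps_value v g x = rt \<delta>*(poly h x * fps_value v g x)" by (simp add: \<delta>'_def)
   also have "... = (\<Sum>g'\<in>G. poly (c g g') x * rt (\<delta> * fps_value v g' (th N)))"
    unfolding step[OF that] by (simp add: sum_distrib_left rt_mult ac_simps)
   also have "... = (\<Sum>g'\<in>G. \<Sum>m\<in>J. poly (c g g') x * rt (A g' m)*(rt ^^ Suc N) m)"
    by (intro sum.cong) (auto simp: dA(2) rt_sum rt_mult sum_distrib_left mult.assoc)
   also have "... = (\<Sum>m\<in>J. A' g m*(rt ^^ Suc N) m)" by (subst sum.swap) (simp add: A'_def sum_distrib_right)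
   finally show ?thesis .
  qed
  moreover have "A' g m\<in>Bn (M + Suc N) (2 * C)" if "g\<in>G" "m\<in>J" for g m unfolding A'_def
  proof (rule Bn_sum)
   fix g' assume g': "g'\<in>G"
   have "rt (A g' m)\<in>Bn (M + Suc N) C" using Bn_rt[OF dA(3)[OF g' that(2)]] by simp
   thus "poly (c g g') x * rt (A g' m)\<in>Bn (M + Suc N) (2 * C)"
    using Bn_mult[OF cC[OF that(1) g', of "Suc N"]] by (simp add: x_def mult_2)
  qed
  moreover have "\<delta>'~=0" using h(2)[of "Suc N"] dA(1) by (simp add: \<delta>'_def x_def)
  ultimately show ?case unfolding x_def by blast
 qed
 thus ?thesis by blast
qed

text \<open>The span of \<open>G\<close> is stable under all twists up to a common denominator, so the twists of a combination
  of its \<open>d\<close> elements stay in a space of dimension \<open>d\<close> and \<open>d + 1\<close> of them are linearly dependent.\<close>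

lemma twist_iterates: assumes h: "h\<in>pol BB" "h~=0" and sys: "\<And>g. g\<in>G ==> fps_of_poly h * sg g\<in>lspan PB G"
 shows "\<exists>H\<in>pol BB. H~=0 \<and> (\<forall>i\<le>d. \<forall>g\<in>G. fps_of_poly H*(sg ^^ i) g\<in>lspan PB G)"
proof (induction d)
 case 0 show ?case using lspan_gen[OF PB_subring] by (intro bexI[of _ 1] pol_1[OF BB_subring]) auto
next case (Suc d)
 then obtain H where H: "H\<in>pol BB" "H~=0" "\<And>i g. i\<le>d ==> g\<in>G ==> fps_of_poly H*(sg ^^ i) g\<in>lspan PB G" by blast
 note R = pol_subring[OF BB_subring]
 define H' where "H' = H*(map_poly rt H * h)"
 have m0: "map_poly rt H~=0" using H(2) by (simp add: map_poly_eq_0_iff)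
 have H': "H'\<in>pol BB" "H'~=0" unfolding H'_def using H h m0 by (auto intro!: subring_mult[OF R] pol_BB_rt)
 have "fps_of_poly H'*(sg ^^ i) g\<in>lspan PB G" if "i\<le>Suc d" "g\<in>G" for i g
 proof (cases "i\<le>d")
  case True
  have "fps_of_poly (map_poly rt H * h)*(fps_of_poly H*(sg ^^ i) g)\<in>lspan PB G"
   using H h by (intro lspan_scale[OF PB_subring PB_I] H(3)[OF True that(2)] subring_mult[OF R] pol_BB_rt)
  thus ?thesis by (simp add: H'_def fps_of_poly_mult ac_simps)
 next case False hence i: "i = Suc d" using that by simp
  have "sg (fps_of_poly H*(sg ^^ d) g)\<in>lspan PB (sg`G)" by (rule lspan_PB_sg[OF H(3)[OF order_refl that(2)]])
  hence "fps_of_poly h * sg (fps_of_poly H*(sg ^^ d) g)\<in>lspan PB G"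
   by (rule lspan_mult_image[OF _ PB_subring, rotated]) (use sys in auto)
  hence "fps_of_poly H*(fps_of_poly h * sg (fps_of_poly H*(sg ^^ d) g))\<in>lspan PB G"
   by (intro lspan_scale[OF PB_subring PB_I[OF H(1)]])
  thus ?thesis by (simp add: i H'_def fps_of_poly_mult sg_mult sg_poly ac_simps)
 qed
 thus ?case using H' by blast
qed

lemma poly_mult_Bn: assumes "\<And>i. coeff p i\<in>Bn M X" "\<And>i. coeff r i\<in>Bn M Y" shows "coeff (p * r) i\<in>Bn M (X + Y)"
 unfolding coeff_mult by (intro Bn_sum Bn_mult assms)

lemma map_poly_rtn_Bn: assumes "\<And>i. coeff p i\<in>Bn M X" shows "coeff ((map_poly rt ^^ k) p) i\<in>Bn (M + k) X"
 using assms by (induction k arbitrary: i) (auto simp: coeff_map_poly intro: Bn_rt')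

lemma degree_map_poly_rtn: "degree ((map_poly rt ^^ k) p) = degree p" by (induction k) (simp_all add: degree_map_poly)

lemma sum_div2_le: "(\<Sum>N<T. D div 2^N)\<le>2*(D::nat)"
proof -
 have "real (\<Sum>N<T. D div 2^N)\<le>(\<Sum>N<T. real D*(1/2)^N)" unfolding of_nat_sum
 proof (rule sum_mono)
  fix N show "real (D div 2^N)\<le>real D*(1/2)^N"
   using of_nat_div_le_of_nat[of D "2^N", where 'a = real] by (simp add: power_one_over field_simps)
 qed
 also have "... = real D*(\<Sum>N<T. (1/2)^N)" by (simp add: sum_distrib_left)
 also have "(\<Sum>N<T. (1/2 :: real)^N) = 2*(1 - (1/2)^T)" by (subst sum_gp_strict) auto
 also have "real D*(2*(1 - (1/2)^T))\<le>2 * real D" by (simp add: algebra_simps)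
 finally show ?thesis by linarith
qed

end

context C_inf_l
begin

lemma nb_sum: assumes "R\<ge>0" "C\<ge>0" "\<And>i. i\<in>A ==> nb R C (f i)" shows "nb R C (sum f A)" using assms(3)
 by (induction A rule: infinite_finite_induct) (auto intro: nb_0 nb_add assms)

lemma th_power_Bn: assumes "i < D" shows "th N^i\<in>Bn N (D div 2^N + 1)"
proof -
 have "D < (D div 2^N + 1)*2^N" using dividend_less_div_times[of "2^N" D] by (simp add: algebra_simps)
 also have "...\<le>(D div 2^N + 1) * q^N" using q_ge2 by (intro mult_left_mono power_mono) auto
 finally have "i\<le>(D div 2^N + 1) * q^N" using assms by simp
 thus ?thesis unfolding Bn_def using subsetD[OF Bd_mono Bd_th] by blast
qed

text \<open>The count of unknowns and equations for the auxiliary function. The factor \<open>T\<close> belongs to the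
  equations of bounded height, \<open>2 * D\<close> to the heights of the powers of the points, whose sum over all
  points stays bounded because the point with number \<open>N\<close> has degree \<open>1 / q ^ N\<close>.\<close>

lemma siegel_count1:
 fixes r s D T C X y :: nat
 assumes "s < r" "D = 2 * r * y" "T = D + y" "X = r*(4 * r + (2 * C + 2)*(2 * r + 1))"
 shows "s*(T*(X + (2 * C + 2)) + 2 * D)\<le>r * D * X"
proof -
 obtain k where r: "r = Suc k" "s\<le>k" using assms(1) by (cases r) auto
 define a where "a = 2 * C + 2"
 define W where "W = 4 * r + a*(2 * r + 1)"
 have X: "X = r * W" by (simp add: assms(4) W_def a_def)
 have "s*(T*(X + a) + 2 * D) = y*(s*((2 * r + 1) * X + W))" by (simp add: assms(2,3) W_def algebra_simps)
 also have "...\<le>y*(k*((2 * r + 1) * X + W))" using r by (intro mult_left_mono mult_right_mono) auto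
 also have "k*((2 * r + 1) * X + W)\<le>(k*(2 * r + 1) + 1) * X" unfolding X r(1) by (simp add: algebra_simps)
 also have "(k*(2 * r + 1) + 1) * X\<le>(2 * r * r) * X"
  unfolding r(1) by (intro mult_right_mono) (auto simp: algebra_simps)
 finally show ?thesis by (simp add: assms(2) a_def ac_simps)
qed

text \<open>The criterion: linear relations over the constants between the values at \<open>\<theta>\<close> of a
  difference system come from linear relations over \<open>FF(t)\<close> between the functions.

  Suppose that the values span a smaller space than the functions. An auxiliary linear
  combination \<open>E\<close> of the functions, with polynomial coefficients of bounded size and of degree
  below \<open>D\<close>, is made to vanish at the \<open>T = D + y\<close> points \<open>\<theta>\<close> to the power \<open>1 / q ^ N\<close>; each of
  these zeros costs only as many conditions as the dimension of the space of values. As there are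
  \<open>y\<close> more zeros than the degree can account for, the Schwarz lemma makes the leading
  coefficient of \<open>E\<close> smaller than \<open>R ^ (- y)\<close> up to a constant. But \<open>E\<close> satisfies a difference
  equation whose coefficients have a size independent of \<open>y\<close>, and this bounds the leading
  coefficient from below.\<close>

theorem value_rank_criterion:
 fixes G S :: "'c fps set" and J :: "'c set"
 assumes fin: "finite G" "finite J" and R: "R > v \<theta>" and bd: "\<And>g. g\<in>G ==> bdd R g"
  and h1: "h1\<in>pol BB" "h1~=0" "\<And>g. g\<in>G ==> fps_of_poly h1 * sg g\<in>lspan PB G"
  and h2: "h2\<in>pol BB" "\<And>N. N\<ge>1 ==> poly h2 (th N)~=0" "\<And>g. g\<in>G ==> fps_of_poly h2 * g\<in>lspan PB (sg`G)"
  and val: "\<And>g. g\<in>G ==> fps_value v g \<theta>\<in>lspan FF J" and SG: "S\<subseteq>G"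
  and indep: "\<And>c. (\<And>g. g\<in>S ==> c g\<in>pol BB) ==> (\<Sum>g\<in>S. fps_of_poly (c g) * g) = 0 ==> \<forall>g\<in>S. c g = 0"
 shows "card S\<le>card J"
proof (rule ccontr)
 define r where "r = card S"
 define s where "s = card J"
 define d where "d = card G"
 assume "\<not> card S\<le>card J"
 hence sr: "s < r" by (simp add: r_def s_def)
 have finS: "finite S" using SG fin(1) finite_subset by blast
 have R1: "R > 1" using R v_th_gt1[of 0] by (simp add: th_0)
 have d0: "d > 0" using sr card_mono[OF fin(1) SG] by (simp add: d_def r_def)
 have "\<exists>M0 C. \<forall>N. \<exists>\<delta> A. \<delta>~=0 \<and> (\<forall>g\<in>G. \<delta> * fps_value v g (th N) = (\<Sum>m\<in>J. A g m*(rt ^^ N) m)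
   \<and> (\<forall>m\<in>J. A g m\<in>Bn (M0 + N) (2 * C)))" by (rule value_recursion) (fact fin R bd h2 val)+
 then obtain M0 C where dA0: "\<forall>N. \<exists>\<delta> A. \<delta>~=0 \<and> (\<forall>g\<in>G. \<delta> * fps_value v g (th N) = (\<Sum>m\<in>J. A g m*(rt ^^ N) m)
   \<and> (\<forall>m\<in>J. A g m\<in>Bn (M0 + N) (2 * C)))" by blast
 obtain \<delta> where "\<forall>N. \<exists>A. \<delta> N~=0 \<and> (\<forall>g\<in>G. \<delta> N * fps_value v g (th N) = (\<Sum>m\<in>J. A g m*(rt ^^ N) m)
   \<and> (\<forall>m\<in>J. A g m\<in>Bn (M0 + N) (2 * C)))" using choice[OF dA0] by blast
 from choice[OF this] obtain A where dA1: "\<forall>N. \<delta> N~=0 \<and>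
   (\<forall>g\<in>G. \<delta> N * fps_value v g (th N) = (\<Sum>m\<in>J. A N g m*(rt ^^ N) m) \<and> (\<forall>m\<in>J. A N g m\<in>Bn (M0 + N) (2 * C)))" by blast
 have dA: "\<And>N. \<delta> N~=0" "\<And>N g. g\<in>G ==> \<delta> N * fps_value v g (th N) = (\<Sum>m\<in>J. A N g m*(rt ^^ N) m)"
  "\<And>N g m. g\<in>G ==> m\<in>J ==> A N g m\<in>Bn (M0 + N) (2 * C)" using dA1 by simp_all
 have "\<exists>H\<in>pol BB. H~=0 \<and> (\<forall>i\<le>d. \<forall>g\<in>G. fps_of_poly H*(sg ^^ i) g\<in>lspan PB G)" by (rule twist_iterates) (fact h1)+
 then obtain H where H: "H\<in>pol BB" "H~=0" "\<And>i g. i\<le>d ==> g\<in>G ==> fps_of_poly H*(sg ^^ i) g\<in>lspan PB G" by blast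
 have "\<exists>c. i\<le>d --> g\<in>G --> (\<forall>g'\<in>G. c g'\<in>pol BB) \<and>
   fps_of_poly H*(sg ^^ i) g = (\<Sum>g'\<in>G. fps_of_poly (c g') * g')" for i g
  using lspan_PB_finite[OF fin(1), of "fps_of_poly H*(sg ^^ i) g"] H(3)[of i g] by auto
 hence "\<exists>\<Phi>. \<forall>i g. i\<le>d --> g\<in>G --> (\<forall>g'\<in>G. \<Phi> i g g'\<in>pol BB) \<and>
   fps_of_poly H*(sg ^^ i) g = (\<Sum>g'\<in>G. fps_of_poly (\<Phi> i g g') * g')" by (intro choice allI)
 then obtain \<Phi> where Phi0: "\<forall>i g. i\<le>d --> g\<in>G --> (\<forall>g'\<in>G. \<Phi> i g g'\<in>pol BB) \<and>
   fps_of_poly H*(sg ^^ i) g = (\<Sum>g'\<in>G. fps_of_poly (\<Phi> i g g') * g')" by blast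
 have Phi: "\<And>i g g'. i\<le>d ==> g\<in>G ==> g'\<in>G ==> \<Phi> i g g'\<in>pol BB"
  "\<And>i g. i\<le>d ==> g\<in>G ==> fps_of_poly H*(sg ^^ i) g = (\<Sum>g'\<in>G. fps_of_poly (\<Phi> i g g') * g')" using Phi0 by simp_all
 define PS where "PS = (\<lambda>(i, g, g'). \<Phi> i g g')`({..d}\<times>G\<times>G)"
 have PSI: "\<Phi> i g g'\<in>PS" if "i\<le>d" "g\<in>G" "g'\<in>G" for i g g'
  unfolding PS_def using that by (intro image_eqI[of _ _ "(i, g, g')"]) auto
 have PS: "finite PS" "PS\<subseteq>pol BB" using fin Phi(1) by (auto simp: PS_def)
 obtain M1 X1 D1 where u: "\<forall>p\<in>PS. degree p\<le>D1 \<and> (\<forall>i. coeff p i\<in>Bn M1 X1)" using pol_uniform[OF PS] by (elim exE)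
 have "\<forall>g\<in>G. \<exists>C. nb R C g" using bd unfolding bdd_def by blast
 from bchoice[OF this] obtain Cb where Cb: "\<And>g. g\<in>G ==> nb R (Cb g) g" by blast
 define Cg where "Cg = (\<Sum>g\<in>G. Cb g)"
 have Cg: "nb R Cg g" if "g\<in>S" for g
 proof -
  have "g\<in>G" using that SG by blast
  moreover have "Cb g\<le>Cg" unfolding Cg_def by (rule member_le_sum[OF \<open>g \<in> G\<close> _ fin(1)]) (use nb_nonneg[OF Cb] in auto)
  ultimately show ?thesis using nb_mono[OF Cb] by blast
 qed
 have Cg0: "Cg\<ge>0" unfolding Cg_def using Cb nb_nonneg by (intro sum_nonneg) blast
 define X where "X = r*(4 * r + (2 * C + 2)*(2 * r + 1))"
 define Y where "Y = X + X1 + 1"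
 define X2 where "X2 = Y*(2 * d + 1)"
 define K where "K = v \<theta>^X2"
 have th1: "v \<theta> > 1" using v_th_gt1[of 0] by (simp add: th_0)
 have K1: "K\<ge>1" using th1 by (simp add: K_def one_le_power)
 define C' where "C' = v \<theta>^(X + 2) * Cg"
 \<comment> \<open>all constants above are independent of \<open>y\<close>, which is chosen now\<close>
 obtain y where y: "C'/(1/K)^(q^d) < R^y" "y > 0"
 proof -
  obtain y0 where "C'/(1/K)^(q^d) < R^y0" using real_arch_pow[OF R1] by blast
  also have "R^y0\<le>R^Suc y0" using R1 by (intro power_increasing) auto
  finally show ?thesis using that[of "Suc y0"] by blast
 qed
 define D where "D = 2 * r * y"
 define T where "T = D + y"
 define M where "M = M0 + T"
 have qM: "q^M\<ge>1" using q_ge2 by simp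
 \<comment> \<open>construction of the auxiliary function\<close>
 have "\<exists>p. (\<forall>i\<in>S\<times>{..<D}. p i\<in>Bd M (X * q^M)) \<and> (\<exists>i\<in>S\<times>{..<D}. p i~=0) \<and>
  (\<forall>k\<in>{..<T}\<times>J. (\<Sum>i\<in>S\<times>{..<D}. p i*(case (k, i) of ((N, m), (g, j)) => th N^j * A N g m)) = 0)"
 proof (rule siegel[where d = "\<lambda>(N, m). (D div 2^N + 1 + 2 * C) * q^M"])
  show "finite (S\<times>{..<D})" "finite ({..<T}\<times>J)" using finS fin by auto
  show "(case (k, i) of ((N, m), (g, j)) => th N^j * A N g m)
    \<in> Bd M (case k of (N, m) => (D div 2^N + 1 + 2 * C) * q^M)" if "k\<in>{..<T}\<times>J" "i\<in>S\<times>{..<D}" for k i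
  proof -
   obtain N m g j where ki: "k = (N, m)" "i = (g, j)" by (metis surj_pair)
   hence "N < T" "m\<in>J" "g\<in>G" "j < D" using that SG by auto
   hence "th N^j\<in>Bn M (D div 2^N + 1)" "A N g m\<in>Bn M (2 * C)"
    using Bn_level[OF _ th_power_Bn, of N M j D] Bn_level[OF _ dA(3), of N M g m] by (auto simp: M_def)
   from Bn_mult[OF this] show ?thesis by (simp add: ki Bn_def)
  qed
  have "(\<Sum>k\<in>{..<T}\<times>J. X * q^M + (case k of (N, m) => (D div 2^N + 1 + 2 * C) * q^M) + 1)
    = (\<Sum>N<T. \<Sum>m\<in>J. X * q^M + (D div 2^N + 1 + 2 * C) * q^M + 1)"
   by (subst sum.cartesian_product) (auto intro!: sum.cong)
  also have "... = s*(\<Sum>N<T. X * q^M + (D div 2^N + 1 + 2 * C) * q^M + 1)" by (simp add: s_def sum_distrib_left)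
  also have "...\<le>s*(\<Sum>N<T. (X + (2 * C + 2) + D div 2^N) * q^M)"
   using qM by (intro mult_left_mono sum_mono) (auto simp: algebra_simps)
  also have "(\<Sum>N<T. (X + (2 * C + 2) + D div 2^N) * q^M)
    = (T*(X + (2 * C + 2)) + (\<Sum>N<T. D div 2^N)) * q^M"
   unfolding sum_distrib_right[symmetric] sum.distrib by (simp add: algebra_simps)
  also have "s*...\<le>s*((T*(X + (2 * C + 2)) + 2 * D) * q^M)"
   using sum_div2_le[of D T] by (intro mult_left_mono mult_right_mono add_left_mono) auto
  also have "...\<le>r * D * X * q^M" using siegel_count1[OF sr D_def T_def X_def] by (simp add: mult.assoc[symmetric])
  also have "... < r * D * X * q^M + r * D" using sr y by (simp add: D_def)
  also have "... = card (S\<times>{..<D})*(X * q^M + 1)" by (simp add: card_cartesian_product r_def algebra_simps)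
  finally show "(\<Sum>k\<in>{..<T}\<times>J. X * q^M + (case k of (N, m) => (D div 2^N + 1 + 2 * C) * q^M) + 1)
    < card (S\<times>{..<D})*(X * q^M + 1)" .
 qed
 then obtain p where p0: "\<forall>i\<in>S\<times>{..<D}. p i\<in>Bd M (X * q^M)" "\<exists>i\<in>S\<times>{..<D}. p i~=0"
  "\<forall>k\<in>{..<T}\<times>J. (\<Sum>i\<in>S\<times>{..<D}. p i*(case (k, i) of ((N, m), (g, j)) => th N^j * A N g m)) = 0" by blast
 have p: "\<And>g j. g\<in>S ==> j < D ==> p (g, j)\<in>Bn M X" "\<exists>i\<in>S\<times>{..<D}. p i~=0"
  "\<And>N m. N < T ==> m\<in>J ==> (\<Sum>(g, j)\<in>S\<times>{..<D}. p (g, j)*(th N^j * A N g m)) = 0"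
  using p0 by (simp_all add: Bn_def case_prod_unfold)
 define P where "P g = (\<Sum>j<D. monom (p (g, j)) j)" for g
 have cP: "coeff (P g) j = (if j < D then p (g, j) else 0)" for g j
  unfolding P_def coeff_sum coeff_monom by (auto simp: sum.delta')
 have PB: "coeff (P g) j\<in>Bn M X" if "g\<in>S" for g j using p(1)[OF that] Bn_0 by (simp add: cP)
 have Pdeg: "degree (P g)\<le>D" for g by (intro degree_le) (auto simp: cP)
 have Ppol: "P g\<in>pol BB" if "g\<in>S" for g by (intro polI BnBB[OF PB[OF that]])
 define E where "E = (\<Sum>g\<in>S. fps_of_poly (P g) * g)"
 have E0: "E~=0"
 proof
  assume "E = 0"
  hence "\<forall>g\<in>S. P g = 0" unfolding E_def by (intro indep[of P] Ppol)
  hence "p (g, j) = 0" if "g\<in>S" "j < D" for g j using that cP[of g j] by simp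
  thus False using p(2) by auto
 qed
 have vth: "0 < v (th N)" "v (th N) < R" for N using v_th_gt1[of N] v_th_le[of N] R by linarith+
 have bdS: "bdd R g" if "g\<in>S" for g using bd SG that by blast
 have Ezero: "fps_value v E (th N) = 0" if N: "N < T" for N
 proof -
  have "fps_value v E (th N) = (\<Sum>g\<in>S. fps_value v (fps_of_poly (P g) * g) (th N))"
   unfolding E_def using R1 bdS by (intro value_sum[OF _ vth] bdd_mult bdd_poly) auto
  also have "... = (\<Sum>g\<in>S. poly (P g) (th N) * fps_value v g (th N))"
   using value_mult[OF bdd_poly bdS vth] R1 by (intro sum.cong) (auto simp: value_poly[OF vth(1)])
  finally have "\<delta> N * fps_value v E (th N) = (\<Sum>g\<in>S. poly (P g) (th N)*(\<delta> N * fps_value v g (th N)))"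
   by (simp add: sum_distrib_left mult.left_commute)
  also have "... = (\<Sum>g\<in>S. \<Sum>j<D. \<Sum>m\<in>J. p (g, j)*(th N^j * A N g m)*(rt ^^ N) m)"
  proof (rule sum.cong)
   fix g assume "g\<in>S"
   hence "\<delta> N * fps_value v g (th N) = (\<Sum>m\<in>J. A N g m*(rt ^^ N) m)" using dA(2) SG by blast
   thus "poly (P g) (th N)*(\<delta> N * fps_value v g (th N)) = (\<Sum>j<D. \<Sum>m\<in>J. p (g, j)*(th N^j * A N g m)*(rt ^^ N) m)"
    by (simp only:) (simp add: P_def poly_sum poly_monom sum_product mult.assoc)
  qed simp
  also have "... = (\<Sum>(g, j)\<in>S\<times>{..<D}. \<Sum>m\<in>J. p (g, j)*(th N^j * A N g m)*(rt ^^ N) m)"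
   by (rule sum.cartesian_product)
  also have "... = (\<Sum>m\<in>J. (\<Sum>(g, j)\<in>S\<times>{..<D}. p (g, j)*(th N^j * A N g m))*(rt ^^ N) m)"
   unfolding case_prod_unfold by (subst sum.swap) (simp add: sum_distrib_right)
  also have "... = 0" using p(3)[OF N] by simp
  finally show ?thesis using dA(1) by simp
 qed
 \<comment> \<open>upper bound for the leading coefficient\<close>
 define CE where "CE = v \<theta>^X * R^D * Cg"
 have CE0: "CE\<ge>0" using Cg0 R1 th1 by (simp add: CE_def)
 have nbE: "nb R CE E" unfolding E_def
 proof (rule nb_sum)
  fix g assume g: "g\<in>S"
  have "nb R (v \<theta>^X * R^D) (fps_of_poly (P g))" unfolding nb_def
  proof
   fix n
   show "v (fps_nth (fps_of_poly (P g)) n) * R^n\<le>v \<theta>^X * R^D"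
   proof (cases "n\<le>D")
    case True thus ?thesis using Bn_upper[OF PB[OF g]] R1 th1 by (auto intro!: mult_mono power_increasing)
   qed (use R1 th1 in \<open>simp add: cP\<close>)
  qed
  thus "nb R CE (fps_of_poly (P g) * g)" unfolding CE_def using Cg[OF g] R1 by (intro nb_mult) auto
 qed (use R1 CE0 in auto)
 define m where "m = subdegree E"
 define E' where "E' = fps_shift m E"
 have EE': "E = E' * fps_X^m" unfolding E'_def m_def by (rule subdegree_decompose)
 have nbE': "nb R CE E'" unfolding nb_def
 proof
  fix n
  have "v (fps_nth E' n) * R^n\<le>v (fps_nth E (n + m)) * R^(n + m)"
   unfolding E'_def fps_shift_nth using R1 nonneg by (intro mult_left_mono power_increasing) auto
  thus "v (fps_nth E' n) * R^n\<le>CE" using nbD[OF nbE, of "n + m"] by linarith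
 qed
 have E'zero: "fps_value v E' (th N) = 0" if "N < T" for N
 proof -
  have "fps_value v (fps_X^m) (th N) = th N^m"
   using value_poly[OF vth(1)[of N], of "monom 1 m"] by (simp add: fps_of_poly_monom' poly_monom)
  hence "fps_value v E (th N) = fps_value v E' (th N) * th N^m"
   using value_mult[OF bddI[OF nbE'] bdd_power[OF _ bdd_X] vth, of m N] R1 EE' by simp
  thus ?thesis using Ezero[OF that] vth(1)[of N] by auto
 qed
 have injT: "inj_on th {..<T}" using th_inj by (rule inj_on_subset) simp
 have "v (fps_nth E' 0)\<le>CE*(\<Prod>z\<in>th`{..<T}. v z/R)" using vth E'zero by (intro schwarz_zeros[OF nbE']) auto
 also have "(\<Prod>z\<in>th`{..<T}. v z/R) = (\<Prod>N<T. v (th N))/R^T"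
  by (simp add: prod.reindex[OF injT] prod_dividef card_image[OF injT])
 also have "CE*...\<le>CE*(v \<theta>^2/R^T)"
  using CE0 R1 prod_v_th[of T] by (intro mult_left_mono divide_right_mono) auto
 also have "... = C'/R^y" using R1 by (simp add: CE_def C'_def T_def power_add power2_eq_square)
 finally have upper: "v (fps_nth E (subdegree E))\<le>C'/R^y" by (simp add: E'_def m_def)
 \<comment> \<open>a difference equation for \<open>E\<close> with small coefficients\<close>
 define L where "L = M + M1 + d"
 have qL: "q^L\<ge>1" using q_ge2 by simp
 define B where "B i g' = (\<Sum>g\<in>S. (map_poly rt ^^ i) (P g)*\<Phi> i g g')" for i g'
 have BBn: "coeff (B i g') e\<in>Bn L (X + X1)" if "i\<le>d" "g'\<in>G" for i g' e unfolding B_def coeff_sum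
 proof (rule Bn_sum, rule poly_mult_Bn)
  fix g j assume g: "g\<in>S"
  show "coeff ((map_poly rt ^^ i) (P g)) j\<in>Bn L X"
   using Bn_level[OF _ map_poly_rtn_Bn[OF PB[OF g]], of i L] that by (simp add: L_def)
  have "coeff (\<Phi> i g g') j\<in>Bn M1 X1" using u PSI[OF that(1) _ that(2)] g SG by blast
  thus "coeff (\<Phi> i g g') j\<in>Bn L X1" by (rule Bn_level[rotated]) (simp add: L_def)
 qed
 have Bdeg: "degree (B i g')\<le>D + D1" if "i\<le>d" "g'\<in>G" for i g' unfolding B_def
 proof (rule degree_sum_le[OF finS])
  fix g assume g: "g\<in>S"
  have "degree (\<Phi> i g g')\<le>D1" using u PSI[OF that(1) _ that(2)] g SG by blast
  thus "degree ((map_poly rt ^^ i) (P g)*\<Phi> i g g')\<le>D + D1"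
   using degree_mult_le[of "(map_poly rt ^^ i) (P g)" "\<Phi> i g g'"] Pdeg[of g] by (simp add: degree_map_poly_rtn)
 qed
 define W where "W = D + D1 + 1"
 define N2 where "N2 = 2 * d * W"
 have "\<exists>x. (\<forall>i\<in>{..d}\<times>{..<N2}. x i\<in>Bd L (X2 * q^L)) \<and> (\<exists>i\<in>{..d}\<times>{..<N2}. x i~=0) \<and>
  (\<forall>k\<in>G\<times>{..<N2 + W}. (\<Sum>i\<in>{..d}\<times>{..<N2}. x i *
    (case (k, i) of ((g', e), (i, j)) => if j\<le>e then coeff (B i g') (e - j) else 0)) = 0)"
 proof (rule siegel[where d = "\<lambda>_. (X + X1) * q^L"])
  show "finite ({..d}\<times>{..<N2})" "finite (G\<times>{..<N2 + W})" using fin by auto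
  show "(case (k, i) of ((g', e), (i, j)) => if j\<le>e then coeff (B i g') (e - j) else 0)
    \<in> Bd L ((X + X1) * q^L)" if "k\<in>G\<times>{..<N2 + W}" "i\<in>{..d}\<times>{..<N2}" for k i
   using that BBn Bd_0 by (auto simp: Bn_def)
  have "(\<Sum>k\<in>G\<times>{..<N2 + W}. X2 * q^L + (X + X1) * q^L + 1)
    = d*(N2 + W)*(X2 * q^L + (X + X1) * q^L + 1)" by (simp add: card_cartesian_product d_def)
  also have "...\<le>d*(N2 + W)*((X2 + Y) * q^L)" using qL by (intro mult_left_mono) (auto simp: Y_def algebra_simps)
  also have "... = (d + 1) * N2*(X2 * q^L)" by (simp add: X2_def N2_def algebra_simps)
  also have "... < (d + 1) * N2*(X2 * q^L + 1)" using d0 by (simp add: N2_def W_def)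
  finally show "(\<Sum>k\<in>G\<times>{..<N2 + W}. X2 * q^L + (X + X1) * q^L + 1)
    < card ({..d}\<times>{..<N2})*(X2 * q^L + 1)" by (simp add: card_cartesian_product)
 qed
 then obtain x where x0: "\<forall>i\<in>{..d}\<times>{..<N2}. x i\<in>Bd L (X2 * q^L)" "\<exists>i\<in>{..d}\<times>{..<N2}. x i~=0"
  "\<forall>k\<in>G\<times>{..<N2 + W}. (\<Sum>i\<in>{..d}\<times>{..<N2}. x i *
    (case (k, i) of ((g', e), (i, j)) => if j\<le>e then coeff (B i g') (e - j) else 0)) = 0" by blast
 have x: "\<And>i j. i\<le>d ==> j < N2 ==> x (i, j)\<in>Bn L X2" "\<exists>i\<in>{..d}\<times>{..<N2}. x i~=0" "\<And>g' e. g'\<in>G ==> e < N2 + W ==>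
   (\<Sum>(i, j)\<in>{..d}\<times>{..<N2}. x (i, j)*(if j\<le>e then coeff (B i g') (e - j) else 0)) = 0"
  using x0 by (simp_all add: Bn_def case_prod_unfold cong: if_cong)
 define a where "a i = (\<Sum>j<N2. monom (x (i, j)) j)" for i
 have ca: "coeff (a i) j = (if j < N2 then x (i, j) else 0)" for i j
  unfolding a_def coeff_sum coeff_monom by (auto simp: sum.delta')
 have aBn: "coeff (a i) j\<in>Bn L X2" if "i\<le>d" for i j using x(1)[OF that] Bn_0 by (simp add: ca)
 have aB: "(\<Sum>i\<le>d. a i * B i g') = 0" if g': "g'\<in>G" for g'
 proof (rule poly_eqI)
  fix e
  have c1: "coeff (a i * B i g') e = (\<Sum>j<N2. x (i, j)*(if j\<le>e then coeff (B i g') (e - j) else 0))" for i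
  proof -
   have "coeff (a i * B i g') e = (\<Sum>j\<in>{..e}. coeff (a i) j * coeff (B i g') (e - j))" by (rule coeff_mult)
   also have "... = (\<Sum>j\<in>{..e}\<inter>{..<N2}. x (i, j)*(if j\<le>e then coeff (B i g') (e - j) else 0))"
    by (rule sum.mono_neutral_cong_right) (auto simp: ca)
   also have "... = (\<Sum>j<N2. x (i, j)*(if j\<le>e then coeff (B i g') (e - j) else 0))"
    by (rule sum.mono_neutral_left) auto
   finally show ?thesis .
  qed
  have "coeff (\<Sum>i\<le>d. a i * B i g') e =
   (\<Sum>(i, j)\<in>{..d}\<times>{..<N2}. x (i, j)*(if j\<le>e then coeff (B i g') (e - j) else 0))"
   by (simp add: coeff_sum c1 sum.cartesian_product)
  also have "... = 0"
  proof (cases "e < N2 + W")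
   case True thus ?thesis by (rule x(3)[OF g'])
  next case False
   have "coeff (B i g') (e - j) = 0" if "i\<le>d" "j < N2" for i j
    using Bdeg[OF that(1) g'] that False by (intro coeff_eq_0) (auto simp: W_def)
   thus ?thesis by (intro sum.neutral) auto
  qed
  finally show "coeff (\<Sum>i\<le>d. a i * B i g') e = coeff 0 e" by simp
 qed
 have HE: "fps_of_poly H*(sg ^^ i) E = (\<Sum>g'\<in>G. fps_of_poly (B i g') * g')" if "i\<le>d" for i
 proof -
  have "fps_of_poly H*(sg ^^ i) E = (\<Sum>g\<in>S. fps_of_poly ((map_poly rt ^^ i) (P g))*(fps_of_poly H*(sg ^^ i) g))"
   unfolding E_def by (simp add: sgn_sum sgn_mult sgn_poly sum_distrib_left ac_simps)
  also have "... = (\<Sum>g\<in>S. \<Sum>g'\<in>G. fps_of_poly ((map_poly rt ^^ i) (P g)*\<Phi> i g g') * g')"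
  proof (rule sum.cong)
   fix g assume "g\<in>S"
   hence "fps_of_poly H*(sg ^^ i) g = (\<Sum>g'\<in>G. fps_of_poly (\<Phi> i g g') * g')" using Phi(2)[OF that] SG by blast
   thus "fps_of_poly ((map_poly rt ^^ i) (P g))*(fps_of_poly H*(sg ^^ i) g) =
     (\<Sum>g'\<in>G. fps_of_poly ((map_poly rt ^^ i) (P g)*\<Phi> i g g') * g')"
    by (simp add: sum_distrib_left fps_of_poly_mult mult.assoc)
  qed simp
  also have "... = (\<Sum>g'\<in>G. fps_of_poly (B i g') * g')"
   by (subst sum.swap) (simp add: B_def fps_of_poly_sum sum_distrib_right)
  finally show ?thesis .
 qed
 have "fps_of_poly H*(\<Sum>i\<le>d. fps_of_poly (a i)*(sg ^^ i) E)
   = (\<Sum>i\<le>d. fps_of_poly (a i)*(fps_of_poly H*(sg ^^ i) E))" by (simp add: sum_distrib_left mult.left_commute)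
 also have "... = (\<Sum>i\<le>d. \<Sum>g'\<in>G. fps_of_poly (a i * B i g') * g')"
  by (intro sum.cong) (auto simp: HE sum_distrib_left fps_of_poly_mult mult.assoc)
 also have "... = (\<Sum>g'\<in>G. fps_of_poly (\<Sum>i\<le>d. a i * B i g') * g')"
  by (subst sum.swap) (simp add: fps_of_poly_sum sum_distrib_right)
 also have "... = 0" by (simp add: aB)
 finally have rel: "(\<Sum>i\<le>d. fps_of_poly (a i)*(sg ^^ i) E) = 0"
  using H(2) by (simp add: fps_of_poly_eq_iff[of H 0, simplified])
 obtain i0 j0 where i0: "i0\<le>d" "j0 < N2" "x (i0, j0)~=0" using x(2) by auto
 have "(1/K)^(q^d)\<le>v (fps_nth E (subdegree E))"
 proof (rule leading_coeff_bound[OF E0 _ i0(1) _ K1 _ rel])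
  show "a i\<in>pol BB" if "i\<le>d" for i by (intro polI BnBB[OF aBn[OF that]])
  show "a i0~=0" using ca[of i0 j0] i0 by auto
  show "v (coeff (a i) j)\<le>K" if "i\<le>d" for i j unfolding K_def by (rule Bn_upper[OF aBn[OF that]])
 qed
 hence "(1/K)^(q^d)\<le>C'/R^y" using upper by linarith
 moreover have "C'/R^y < (1/K)^(q^d)" using y(1) R1 K1 by (simp add: field_simps)
 ultimately show False by linarith
qed

end

section \<open>Rank of values and rank of functions\<close>

lemma finite_prods: "finite X ==> finite (prods X d)"
proof (induction d)
 case (Suc d)
 have "{x * m |x m. x\<in>X \<and> m\<in>prods X d} = (\<lambda>(x, m). x * m)`(X\<times>prods X d)" by auto
 thus ?case using Suc by simp
qed simp

lemma linear_factor_pol: assumes R: "is_subring R" and "x\<in>R" "[:- x, 1:] * p\<in>pol R" shows "p\<in>pol R"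
proof -
 have c: "coeff p i = coeff ([:- x, 1:] * p) (Suc i) + x * coeff p (Suc i)" for i by (simp add: coeff_pCons)
 have "coeff p i\<in>R" if "degree p < i + n" for i n using that
 proof (induction n arbitrary: i)
  case 0 thus ?case using subring_0[OF R] by (simp add: coeff_eq_0)
 next case (Suc n) hence "coeff p (Suc i)\<in>R" by simp
  thus ?case by (subst c) (intro subring_add[OF R] subring_mult[OF R] polD[OF assms(3)] assms(2))
 qed
 from this[of _ "Suc (degree p)"] show ?thesis by (simp add: pol_def)
qed

lemma linear_factor_power_pol: assumes "is_subring R" "x\<in>R" "[:- x, 1:]^k * p\<in>pol R" shows "p\<in>pol R"
 using assms(3)
proof (induction k)
 case (Suc k)
 thus ?case using linear_factor_pol[OF assms(1,2), of "[:- x, 1:]^k * p"] by (simp only: power_Suc mult.assoc)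
qed simp

lemma fps_to_fls_sum: "fps_to_fls (sum f A) = (\<Sum>i\<in>A. fps_to_fls (f i))"
 by (induction A rule: infinite_finite_induct) simp_all

lemma fps_to_fls_mult: "fps_to_fls (f * g) = fps_to_fls f * fps_to_fls (g :: 'a::comm_ring_1 fps)"
 by (simp add: fls_times_fps_to_fls)

lemma fps_to_fls_prod: "fps_to_fls (prod f A) = (\<Prod>i\<in>A. fps_to_fls (f i :: 'a::comm_ring_1 fps))"
 by (induction A rule: infinite_finite_induct) (simp_all add: fps_to_fls_mult)

lemma fps_to_fls_pow: "fps_to_fls (f^n) = fps_to_fls (f :: 'a::comm_ring_1 fps)^n"
 by (induction n) (simp_all add: fps_to_fls_mult)

lemma fps_to_fls_mon: "fps_to_fls (mon (\<lambda>x. x) X e) = mon fps_to_fls X (e :: 'a::comm_ring_1 fps => nat)"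
 by (simp add: mon_def fps_to_fls_prod fps_to_fls_pow)

lemma inj_fps_to_fls: "inj_on fps_to_fls A" by (rule inj_onI) simp

lemma fps_to_fls_subring: assumes R: "is_subring (R :: 'a::comm_ring_1 fps set)" shows "is_subring (fps_to_fls`R)"
proof (rule subringI)
 show "0\<in>fps_to_fls`R" "1\<in>fps_to_fls`R" using subring_0[OF R] subring_1[OF R] by (force intro: image_eqI)+
 fix x y assume "x\<in>fps_to_fls`R" "y\<in>fps_to_fls`R"
 then obtain a b where "x = fps_to_fls a" "y = fps_to_fls b" "a\<in>R" "b\<in>R" by blast
 thus "x + y\<in>fps_to_fls`R" "x * y\<in>fps_to_fls`R" using subring_add[OF R, of a b] subring_mult[OF R, of a b]
  by (metis fps_to_fls_plus imageI, metis fps_to_fls_mult imageI)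
next fix x assume "x\<in>fps_to_fls`R"
 then obtain a where "x = fps_to_fls a" "a\<in>R" by blast
 thus "- x\<in>fps_to_fls`R" using subring_uminus[OF R, of a] by (metis fps_to_fls_uminus imageI)
qed

context C_inf_l
begin

text \<open>The rational functions \<open>FF(t)\<close> inside the field of formal Laurent series.\<close>

definition KK :: "'c fls set" where "KK = fracs (fps_to_fls`PB)"

lemma KK_subfield: "is_subfield KK" unfolding KK_def by (intro fracs_subfield fps_to_fls_subring PB_subring)

lemma PB_KK: "p\<in>PB ==> fps_to_fls p\<in>KK"
 unfolding KK_def using fracs_base[OF fps_to_fls_subring[OF PB_subring]] by blast

text \<open>A finite set of functions which spans the same space over \<open>FF(t)\<close> as its twist. Denominators of
  the inverse relations must not vanish at the points \<open>th N\<close>, \<open>N \<ge> 1\<close>, where these relations are evaluated.\<close>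

definition system :: "'c fps set => bool" where "system G \<longleftrightarrow>
   (\<exists>h\<in>pol BB. h~=0 \<and> (\<forall>g\<in>G. fps_of_poly h * sg g\<in>lspan PB G)) \<and>
   (\<exists>h\<in>pol BB. (\<forall>N\<ge>1. poly h (th N)~=0) \<and> (\<forall>g\<in>G. fps_of_poly h * g\<in>lspan PB (sg`G)))"

lemma sg_prods: "sg`prods G d = prods (sg`G) d"
proof (induction d)
 case (Suc d)
 have "sg`{x * m |x m. x\<in>G \<and> m\<in>prods G d} = {x * m |x m. x\<in>sg`G \<and> m\<in>sg`prods G d}"
  by (force simp: sg_mult)
 thus ?case using Suc by (simp add: image_Un)
qed simp

lemma lspan_power_prods: assumes h: "h\<in>pol BB" and step: "\<And>g. g\<in>G ==> fps_of_poly h * f g\<in>lspan PB G'"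
  and f: "\<And>x y. f (x * y) = f x * f y" "f 1 = 1" and "x\<in>prods G d"
 shows "fps_of_poly (h^d) * f x\<in>lspan PB (prods G' d)" using assms(5)
proof (induction d arbitrary: x)
 case 0 thus ?case using lspan_gen[OF PB_subring, of 1 "{1}"] by (simp add: f)
next case (Suc d) show ?case
 proof (cases "x\<in>prods G d")
  case True
  have "fps_of_poly h*(fps_of_poly (h^d) * f x)\<in>lspan PB (prods G' d)"
   by (intro lspan_scale[OF PB_subring PB_I[OF h]] Suc.IH True)
  hence "fps_of_poly (h^Suc d) * f x\<in>lspan PB (prods G' d)" by (simp add: fps_of_poly_mult mult.assoc)
  thus ?thesis using lspan_mono[OF order_refl, of "prods G' d" "prods G' (Suc d)" PB] by auto
 next case False
  then obtain g m where gm: "x = g * m" "g\<in>G" "m\<in>prods G d" using Suc.prems by auto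
  have "{s * t |s t. s\<in>G' \<and> t\<in>prods G' d}\<subseteq>prods G' (Suc d)" by auto
  hence "(fps_of_poly h * f g)*(fps_of_poly (h^d) * f m)\<in>lspan PB (prods G' (Suc d))"
   using lspan_mult[OF PB_subring step[OF gm(2)] Suc.IH[OF gm(3)]]
    lspan_mono[OF order_refl, of _ _ PB] by blast
  thus ?thesis by (simp add: gm(1) f fps_of_poly_mult ac_simps)
 qed
qed

lemma system_prods: assumes "system G" shows "system (prods G d)"
proof -
 obtain h1 h2 where h1: "h1\<in>pol BB" "h1~=0" "\<forall>g\<in>G. fps_of_poly h1 * sg g\<in>lspan PB G"
  and h2: "h2\<in>pol BB" "\<forall>N\<ge>1. poly h2 (th N)~=0" "\<forall>g\<in>G. fps_of_poly h2 * g\<in>lspan PB (sg`G)"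
  using assms unfolding system_def by blast
 note R = pol_subring[OF BB_subring]
 have "\<forall>g\<in>prods G d. fps_of_poly (h1^d) * sg g\<in>lspan PB (prods G d)"
  using lspan_power_prods[OF h1(1), of G sg G] h1(3) by (simp add: sg_mult)
 moreover have "\<forall>g\<in>prods G d. fps_of_poly (h2^d) * g\<in>lspan PB (sg`prods G d)"
  using lspan_power_prods[OF h2(1), of G "\<lambda>x. x" "sg`G"] h2(3) by (simp add: sg_prods)
 ultimately show ?thesis unfolding system_def
  using h1 h2 subring_power[OF R] by (intro conjI bexI[of _ "h1^d"] bexI[of _ "h2^d"]) auto
qed

text \<open>For a difference system the transcendence degree of the values is at least that of the
  functions: the criterion compares the dimensions of the spaces of monomials of bounded degree,
  whose growth determines the transcendence degrees.\<close>

theorem rk_functions_le_values: assumes G: "finite G" "system G" and R: "R > v \<theta>" and bd: "\<And>g. g\<in>G ==> bdd R g"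
 shows "rk KK (fps_to_fls`G)\<le>rk FF ((\<lambda>g. fps_value v g \<theta>)`G)"
proof -
 define val where "val g = fps_value v g \<theta>" for g
 have R1: "R > 1" "0 < v \<theta>" using R v_th_gt1[of 0] by (simp_all add: th_0)
 have fG: "finite (fps_to_fls`G)" using G(1) by simp
 obtain B' where B': "B'\<subseteq>fps_to_fls`G" "indep KK B'" "fps_to_fls`G\<subseteq>acl KK B'" "rk KK (fps_to_fls`G) = card B'"
  by (rule rk_basis[OF fG])
 obtain B where B: "B\<subseteq>G" "B' = fps_to_fls`B" using B'(1) by (meson subset_imageE)
 have finB: "finite B" using B G finite_subset by blast
 have cB: "rk KK (fps_to_fls`G) = card B" unfolding B'(4) B(2) by (simp add: card_image[OF inj_fps_to_fls])
 have free: "free_monomials KK fps_to_fls B"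
  by (rule indep_free_monomials[OF KK_subfield finB inj_fps_to_fls]) (use B'(2) B(2) in simp)
 obtain C where C: "\<And>d. \<exists>J. finite J \<and> card J\<le>C*(d + 1)^rk FF (val`G) \<and> prods (val`G) d\<subseteq>lspan FF J"
  using growth_le_rk[OF FF_subfield, of "val`G"] G(1) unfolding growth_le_def by blast
 have "(m + 1)^card B\<le>C*(card B * m + 1)^rk FF (val`G)" for m
 proof -
  define d where "d = card B * m"
  obtain J where J: "finite J" "card J\<le>C*(d + 1)^rk FF (val`G)" "prods (val`G) d\<subseteq>lspan FF J" using C by blast
  have bdp: "bdd R x" if "x\<in>prods G e" for x e
   using that by (induction e arbitrary: x) (use bd R1 bdd_const[of R 1] in \<open>auto intro: bdd_mult\<close>)
  have valp: "val x\<in>prods (val`G) e" if "x\<in>prods G e" for x e using that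
  proof (induction e arbitrary: x)
   case 0 thus ?case using value_const[OF R1(2), of 1] by (simp add: val_def)
  next case (Suc e) show ?case
   proof (cases "x\<in>prods G e")
    case False
    then obtain g m where gm: "x = g * m" "g\<in>G" "m\<in>prods G e" using Suc.prems by auto
    hence "val x = val g * val m" unfolding val_def using value_mult[of R g m \<theta>] bd bdp R R1 by simp
    thus ?thesis using gm Suc.IH by auto
   qed (use Suc.IH in auto)
  qed
  obtain \<Lambda> where L: "finite \<Lambda>" "\<Lambda>\<subseteq>expo B" "card \<Lambda> = (m + 1)^card B" "\<And>e x. e\<in>\<Lambda> ==> e x\<le>m"
   by (rule bounded_exponents[OF finB]) blast
  define Mf where "Mf = mon (\<lambda>x. x) B"
  have z: "c e = 0" if "\<And>e. e\<in>\<Lambda>' ==> c e\<in>KK" "(\<Sum>e\<in>\<Lambda>'. c e * fps_to_fls (Mf e)) = 0" "\<Lambda>'\<subseteq>\<Lambda>" "e\<in>\<Lambda>'" for c e \<Lambda>'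
   by (rule free_monomialsD[OF free finite_subset[OF that(3) L(1)] order_trans[OF that(3) L(2)]])
    (use that in \<open>simp_all add: Mf_def fps_to_fls_mon\<close>)
  have injM: "inj_on Mf \<Lambda>"
  proof (rule inj_onI, rule ccontr)
   fix e e' assume ee: "e\<in>\<Lambda>" "e'\<in>\<Lambda>" "Mf e = Mf e'" "e~=e'"
   have "(if e = e then 1 else - 1 :: 'c fls) = 0" using ee subring_1[OF subfield_subring[OF KK_subfield]]
     subring_uminus[OF subfield_subring[OF KK_subfield] subring_1[OF subfield_subring[OF KK_subfield]]]
    by (intro z[of "{e, e'}" "\<lambda>x. if x = e then 1 else - 1" e]) auto
   thus False by simp
  qed
  define S where "S = Mf`\<Lambda>"
  have "card S\<le>card J"
  proof -
   obtain h1 h2 where h: "h1\<in>pol BB" "h1~=0" "\<And>g. g\<in>prods G d ==> fps_of_poly h1 * sg g\<in>lspan PB (prods G d)"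
    "h2\<in>pol BB" "\<And>N. N\<ge>1 ==> poly h2 (th N)~=0" "\<And>g. g\<in>prods G d ==> fps_of_poly h2 * g\<in>lspan PB (sg`prods G d)"
    using system_prods[OF G(2), of d] unfolding system_def by blast
   have bd': "\<And>g. g\<in>prods G d ==> bdd R g" by (rule bdp)
   have val': "\<And>g. g\<in>prods G d ==> fps_value v g \<theta>\<in>lspan FF J" using valp J(3) by (auto simp: val_def)
   have SG: "S\<subseteq>prods G d" unfolding S_def Mf_def d_def using L(4) B(1) by (intro image_subsetI mon_in_prods finB) auto
   have indp: "\<forall>g\<in>S. c g = 0" if c: "\<And>g. g\<in>S ==> c g\<in>pol BB" "(\<Sum>g\<in>S. fps_of_poly (c g) * g) = 0" for c
   proof
    fix g assume "g\<in>S"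
    then obtain e where e: "e\<in>\<Lambda>" "g = Mf e" by (auto simp: S_def)
    have "(\<Sum>e\<in>\<Lambda>. fps_to_fls (fps_of_poly (c (Mf e))) * fps_to_fls (Mf e)) =
      fps_to_fls (\<Sum>g\<in>S. fps_of_poly (c g) * g)"
     unfolding S_def sum.reindex[OF injM] by (simp add: fps_to_fls_sum fps_to_fls_mult)
    hence "fps_to_fls (fps_of_poly (c (Mf e))) = 0"
     using c e(1) by (intro z[of \<Lambda> "\<lambda>e. fps_to_fls (fps_of_poly (c (Mf e)))" e] PB_KK PB_I) (auto simp: S_def)
    thus "c g = 0" by (simp add: e fps_of_poly_eq_iff[of _ 0, simplified])
   qed
   show ?thesis by (rule value_rank_criterion[where G = "prods G d" and R = R and ?h1.0 = h1 and ?h2.0 = h2])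
     (fact finite_prods[OF G(1)] J(1) R bd' h val' SG indp)+
  qed
  thus ?thesis using J(2) card_image[OF injM] L(3) by (simp add: S_def d_def)
 qed
 from polynomial_growth[OF this] show ?thesis by (simp add: cB val_def)
qed

text \<open>Algebraically independent values come from algebraically independent functions: the coefficients of a
  relation between the functions can be made coprime to \<open>t - \<theta>\<close>, so that not all of them vanish at \<open>\<theta>\<close>.\<close>

theorem rk_values_le_functions: assumes G: "finite G" and R: "R > v \<theta>" and bd: "\<And>g. g\<in>G ==> bdd R g"
 shows "rk FF ((\<lambda>g. fps_value v g \<theta>)`G)\<le>rk KK (fps_to_fls`G)"
proof -
 define val where "val g = fps_value v g \<theta>" for g
 have R1: "R > 1" "0 < v \<theta>" using R v_th_gt1[of 0] by (simp_all add: th_0)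
 have fG: "finite (fps_to_fls`G)" "finite (val`G)" using G by simp_all
 obtain B' where B': "B'\<subseteq>val`G" "indep FF B'" "val`G\<subseteq>acl FF B'" "rk FF (val`G) = card B'"
  using rk_basis[OF fG(2)] by blast
 obtain X where X: "X\<subseteq>G" "inj_on val X" "B' = val`X" using B'(1) by (meson subset_image_inj)
 have finX: "finite X" using X(1) G finite_subset by blast
 have free: "free_monomials FF val X" by (rule indep_free_monomials[OF FF_subfield finX X(2)]) (use B'(2) X(3) in simp)
 have "free_monomials KK fps_to_fls X" unfolding free_monomials_def
 proof (intro allI impI ballI, elim conjE)
  fix \<Lambda> :: "('c fps => nat) set" and c e assume L0: "finite \<Lambda>" "\<Lambda>\<subseteq>expo X" "\<forall>e\<in>\<Lambda>. c e\<in>KK"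
   "(\<Sum>e\<in>\<Lambda>. c e * mon fps_to_fls X e) = 0" "e\<in>\<Lambda>"
  hence L: "finite \<Lambda>" "\<Lambda>\<subseteq>expo X" "\<And>e. e\<in>\<Lambda> ==> c e\<in>KK" "(\<Sum>e\<in>\<Lambda>. c e * mon fps_to_fls X e) = 0" "e\<in>\<Lambda>" by auto
  show "c e = 0"
  proof (rule ccontr)
   assume ce: "c e~=0"
   have "c`\<Lambda>\<subseteq>fracs (fps_to_fls`PB)" using L(3) by (auto simp: KK_def)
   from common_denominator[OF fps_to_fls_subring[OF PB_subring] _ this] L(1)
   have "\<exists>\<delta>. \<delta>~=0 \<and> (\<forall>e\<in>\<Lambda>. \<delta> * c e\<in>fps_to_fls`PB)" by blast
   then obtain \<delta> where \<delta>: "\<delta>~=0" "\<And>e. e\<in>\<Lambda> ==> \<delta> * c e\<in>fps_to_fls`PB" by blast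
   have "\<forall>e\<in>\<Lambda>. \<exists>p. p\<in>pol BB \<and> \<delta> * c e = fps_to_fls (fps_of_poly p)" using \<delta>(2) unfolding PB_def by blast
   from bchoice[OF this] obtain p where p: "\<And>e. e\<in>\<Lambda> ==> p e\<in>pol BB"
    "\<And>e. e\<in>\<Lambda> ==> \<delta> * c e = fps_to_fls (fps_of_poly (p e))" by blast
   have pe: "p e~=0" using p(2)[OF L(5)] ce \<delta>(1) by auto
   define N where "N = {e\<in>\<Lambda>. p e~=0}"
   have N: "finite N" "e\<in>N" using L pe by (auto simp: N_def)
   define k where "k = Min ((\<lambda>e. order \<theta> (p e))`N)"
   have "k\<in>(\<lambda>e. order \<theta> (p e))`N" unfolding k_def using N by (intro Min_in) auto
   then obtain e1 where e1: "e1\<in>N" "k = order \<theta> (p e1)" by blast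
   have "[:- \<theta>, 1:]^k dvd p e" if "e\<in>\<Lambda>" for e
   proof (cases "p e = 0")
    case False hence "k\<le>order \<theta> (p e)" unfolding k_def using that N by (intro Min_le) (auto simp: N_def)
    thus ?thesis using False by (simp add: order_divides)
   qed simp
   hence "\<forall>e\<in>\<Lambda>. \<exists>p'. p e = [:- \<theta>, 1:]^k * p'" unfolding dvd_def by blast
   from bchoice[OF this] obtain p' where p': "\<And>e. e\<in>\<Lambda> ==> p e = [:- \<theta>, 1:]^k * p' e" by blast
   have p'B: "p' e\<in>pol BB" if "e\<in>\<Lambda>" for e
    by (rule linear_factor_power_pol[OF BB_subring BB_theta, of k]) (use p(1)[OF that] p'[OF that] in simp)
   define Mf where "Mf = mon (\<lambda>x. x) X"
   have "fps_to_fls (fps_of_poly ([:- \<theta>, 1:]^k)*(\<Sum>e\<in>\<Lambda>. fps_of_poly (p' e) * Mf e)) =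
     (\<Sum>e\<in>\<Lambda>. fps_to_fls (fps_of_poly (p e)) * mon fps_to_fls X e)" unfolding sum_distrib_left fps_to_fls_sum
    by (intro sum.cong) (auto simp: p' fps_of_poly_mult fps_to_fls_mult Mf_def fps_to_fls_mon mult.assoc)
   also have "... = \<delta>*(\<Sum>e\<in>\<Lambda>. c e * mon fps_to_fls X e)"
    unfolding sum_distrib_left by (intro sum.cong) (auto simp: mult.assoc[symmetric] p(2))
   also have "... = 0" using L(4) by simp
   finally have "fps_of_poly ([:- \<theta>, 1:]^k)*(\<Sum>e\<in>\<Lambda>. fps_of_poly (p' e) * Mf e) = 0" by simp
   moreover have "fps_of_poly ([:- \<theta>, 1:]^k)~=0" using fps_of_poly_eq_iff[of "[:- \<theta>, 1:]^k" 0] by simp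
   ultimately have z: "(\<Sum>e\<in>\<Lambda>. fps_of_poly (p' e) * Mf e) = 0" by simp
   have bX: "bdd R x" if "x\<in>X" for x using bd X(1) that by blast
   have bM: "bdd R (Mf e)" for e unfolding Mf_def mon_def using R1 bX by (intro bdd_prod bdd_power) auto
   have vp: "fps_value v (x^k) \<theta> = val x^k" if "x\<in>X" for x k
   proof (induction k)
    case 0 thus ?case using value_const[OF R1(2), of 1] by simp
   next case (Suc k)
    thus ?case using value_mult[OF bX[OF that] bdd_power[OF _ bX[OF that]] R1(2) R] R1 by (simp add: val_def)
   qed
   have vM: "fps_value v (Mf e) \<theta> = mon val X e" for e
    unfolding Mf_def mon_def using value_prod[of X R "\<lambda>x. x^e x" \<theta>] bX R R1 vp by (simp add: bdd_power)
   have "0 = fps_value v (\<Sum>e\<in>\<Lambda>. fps_of_poly (p' e) * Mf e) \<theta>" using z value_const[OF R1(2), of 0] by simp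
   also have "... = (\<Sum>e\<in>\<Lambda>. fps_value v (fps_of_poly (p' e) * Mf e) \<theta>)"
    using R1 R by (intro value_sum[of _ R] bdd_mult bdd_poly bM) auto
   also have "... = (\<Sum>e\<in>\<Lambda>. poly (p' e) \<theta> * mon val X e)"
    using value_mult[OF bdd_poly bM R1(2) R] R1 by (intro sum.cong) (auto simp: value_poly vM)
   finally have "(\<Sum>e\<in>\<Lambda>. poly (p' e) \<theta> * mon val X e) = 0" by simp
   moreover have "poly (p' e) \<theta>\<in>FF" if "e\<in>\<Lambda>" for e
    using pol_eval[OF BB_subring p'B[OF that] BB_theta] BB_FF by blast
   ultimately have "poly (p' e1) \<theta> = 0"
    using free_monomialsD[OF free L(1,2), of "\<lambda>e. poly (p' e) \<theta>" e1] e1 by (auto simp: N_def)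
   hence "[:- \<theta>, 1:] dvd p' e1" by (simp add: poly_eq_0_iff_dvd)
   hence "[:- \<theta>, 1:]^k * [:- \<theta>, 1:] dvd [:- \<theta>, 1:]^k * p' e1" by (rule mult_dvd_mono[OF dvd_refl])
   moreover have "e1\<in>\<Lambda>" using e1 by (simp add: N_def)
   ultimately have "[:- \<theta>, 1:]^k * [:- \<theta>, 1:] dvd p e1" by (simp only: p')
   hence "[:- \<theta>, 1:]^Suc k dvd p e1" by (simp only: power_Suc2)
   thus False using order_2[of "p e1" \<theta>] e1 by (auto simp: N_def)
  qed
 qed
 from free_monomials_card_le_rk[OF KK_subfield finX this] have "card X\<le>rk KK (fps_to_fls`X)" .
 also have "...\<le>rk KK (fps_to_fls`G)" using finX fG(1) X(1) acl_gens[of "fps_to_fls`G" KK] by (intro rk_mono) auto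
 finally have "card B'\<le>rk KK (fps_to_fls`G)" unfolding X(3) card_image[OF X(2)] .
 thus ?thesis using B'(4) by (simp add: val_def)
qed

end

section \<open>Difference algebra\<close>

text \<open>The elements of \<open>FT\<close> fixed by \<open>\<tau>\<close> lie in \<open>K\<close>; outside \<open>FT\<close> nothing is known about them. In the
  application \<open>FT\<close> consists of quotients of series that converge on a sufficiently large disc.\<close>

locale diff_field =
 fixes \<tau> :: "'a::field => 'a" and K FT :: "'a set"
 assumes t_add: "\<tau> (x + y) = \<tau> x + \<tau> y" and t_mult: "\<tau> (x * y) = \<tau> x*\<tau> y" and t_1: "\<tau> 1 = 1"
  and K: "is_subfield K" and t_K: "x\<in>K ==> \<tau> x\<in>K" and FT: "is_subfield FT" and K_FT: "K\<subseteq>FT"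
  and const: "x\<in>FT ==> \<tau> x = x ==> x\<in>K" and char: "prime CHAR('a)"
begin

lemma t_0: "\<tau> 0 = 0" using t_add[of 0 0] by (metis add.right_neutral add_left_cancel)

lemma t_uminus: "\<tau> (- x) = - \<tau> x" using t_add[of x "- x"] t_0 by (simp add: eq_neg_iff_add_eq_0 add.commute)

lemma t_diff: "\<tau> (x - y) = \<tau> x - \<tau> y" using t_add[of x "- y"] t_uminus by simp

lemma t_inverse: "\<tau> (inverse x) = inverse (\<tau> x)"
proof (cases "x = 0")
 case False hence "\<tau> x*\<tau> (inverse x) = 1" using t_mult[of x "inverse x"] t_1 by simp
 thus ?thesis by (simp add: inverse_unique)
qed (simp add: t_0)

lemma t_divide: "\<tau> (x/y) = \<tau> x/\<tau> y" by (simp add: divide_inverse t_mult t_inverse)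

lemma t_eq_0: "\<tau> x = 0 \<longleftrightarrow> x = 0"
proof
 assume "\<tau> x = 0"
 show "x = 0"
 proof (rule ccontr)
  assume "x~=0"
  hence "\<tau> x*\<tau> (inverse x) = 1" using t_mult[of x "inverse x"] t_1 by simp
  thus False using \<open>\<tau> x = 0\<close> by simp
 qed
qed (simp add: t_0)

lemma t_power: "\<tau> (x^n) = \<tau> x^n" by (induction n) (simp_all add: t_mult t_1)

lemma t_sum: "\<tau> (sum f A) = (\<Sum>i\<in>A. \<tau> (f i))" by (induction A rule: infinite_finite_induct) (simp_all add: t_add t_0)

definition stab :: "'a set => bool" where "stab M \<longleftrightarrow> (\<forall>x\<in>M. \<tau> x\<in>M)"

lemma stabD: "stab M ==> x\<in>M ==> \<tau> x\<in>M" by (simp add: stab_def)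

text \<open>The effect of \<open>\<tau>\<close> on polynomial expressions in an element \<open>y\<close> with \<open>\<tau> y = a * y + b\<close>.\<close>

definition tp :: "'a => 'a => 'a poly => 'a poly" where "tp a b p = pcompose (map_poly \<tau> p) [:b, a:]"

lemma poly_map_t: "\<tau> (poly p x) = poly (map_poly \<tau> p) (\<tau> x)"
 by (induction p) (simp_all add: t_0 t_add t_mult map_poly_pCons)

lemma poly_tp: "\<tau> y = a * y + b ==> poly (tp a b p) y = \<tau> (poly p y)"
 by (simp add: tp_def poly_pcompose poly_map_t algebra_simps)

lemma map_t_pol: "stab M ==> p\<in>pol M ==> map_poly \<tau> p\<in>pol M" by (rule map_poly_pol[of M]) (auto simp: stab_def t_0)

lemma tp_pol: "is_subring M ==> stab M ==> a\<in>M ==> b\<in>M ==> p\<in>pol M ==> tp a b p\<in>pol M"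
 unfolding tp_def by (intro pol_pcompose map_t_pol pol_pCons pol_0)

lemma degree_map_t: "degree (map_poly \<tau> p) = degree p" by (rule degree_map_poly) (simp add: t_eq_0)

lemma lead_map_t: "lead_coeff (map_poly \<tau> p) = \<tau> (lead_coeff p)" by (simp add: degree_map_t coeff_map_poly t_0)

lemma degree_tp: "a~=0 ==> degree (tp a b p) = degree p" by (simp add: tp_def degree_pcompose degree_map_t)

lemma lead_tp: "a~=0 ==> lead_coeff (tp a b p) = \<tau> (lead_coeff p) * a^degree p"
 unfolding tp_def by (subst lead_coeff_comp) (simp_all add: lead_map_t degree_map_t coeff_map_poly t_0)

lemma coeff_tp_top: assumes "degree p\<le>i" shows "coeff (tp 1 b p) i = \<tau> (coeff p i)"
proof (cases "degree p = i")
 case True thus ?thesis using lead_tp[of 1 b p] by (simp add: degree_tp)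
next case False hence "degree p < i" using assms by simp thus ?thesis by (simp add: coeff_eq_0 degree_tp t_0)
qed

lemma map_t_add: "map_poly \<tau> (p + r) = map_poly \<tau> p + map_poly \<tau> r"
 by (rule poly_eqI) (simp add: coeff_map_poly t_0 t_add)

lemma tp_add: "tp a b (p + r) = tp a b p + tp a b r" by (simp add: tp_def map_t_add pcompose_add)

lemma coeff_tp_0: "coeff (tp a b p) 0 = poly (map_poly \<tau> p) b"
 by (metis mult_zero_left add_0_right pcompose_pCons poly_0_coeff_0 poly_pcompose poly_pCons poly_0 tp_def mult.commute)

section \<open>Algebraic and transcendental generators\<close>

lemma transc_zero: "is_subfield M ==> \<not> algebraic_over M y ==> p\<in>pol M ==> poly p y = 0 ==> p = 0"
 by (auto simp: algebraic_iff_pol)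

lemma minimal_poly: assumes M: "is_subfield M" and "algebraic_over M y"
 obtains P where "P\<in>pol M" "lead_coeff P = 1" "poly P y = 0" "degree P > 0"
  "\<And>p. p\<in>pol M ==> degree p < degree P ==> poly p y = 0 ==> p = 0"
proof -
 note R = subfield_subring[OF M]
 define Q where "Q d \<longleftrightarrow> (\<exists>f\<in>pol M. f~=0 \<and> poly f y = 0 \<and> degree f = d)" for d
 have ex: "\<exists>d. Q d" using assms(2) unfolding algebraic_iff_pol[OF M] Q_def by blast
 define d where "d = (LEAST d. Q d)"
 have "Q d" unfolding d_def using LeastI_ex[OF ex] .
 then obtain f where f: "f\<in>pol M" "f~=0" "poly f y = 0" "degree f = d" by (auto simp: Q_def)
 have min: "p = 0" if "p\<in>pol M" "degree p < d" "poly p y = 0" for p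
  using not_less_Least[of "degree p" Q] that unfolding d_def Q_def by blast
 define P where "P = smult (inverse (lead_coeff f)) f"
 have P: "P\<in>pol M" unfolding P_def by (intro pol_smult R subfield_inverse[OF M] f(1) polD[OF f(1)])
 have l: "lead_coeff f~=0" using f(2) by simp
 have dP: "degree P = d" using l f(4) by (simp add: P_def)
 have "degree P > 0"
 proof (rule ccontr)
  assume "\<not> degree P > 0"
  hence "degree f = 0" using dP f(4) by simp
  then obtain a where "f = [:a:]" by (rule degree_eq_zeroE)
  thus False using f by auto
 qed
 moreover have "lead_coeff P = 1" "poly P y = 0" using l f(3) by (simp_all add: P_def)
 ultimately show thesis using P min dP by (intro that[of P]) auto
qed

lemma monic_unique:
 assumes "is_subring M" "P\<in>pol M" "Q\<in>pol M" "lead_coeff P = 1" "lead_coeff Q = 1" "degree P = degree Q"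
  and "poly P y = 0" "poly Q y = 0" "degree P > 0" and "\<And>p. p\<in>pol M ==> degree p < degree P ==> poly p y = 0 ==> p = 0"
 shows "P = Q"
proof -
 have "degree (P - Q) < degree P"
 proof (rule degree_lessI)
  show "P - Q~=0 \<or> degree P > 0" using assms(9) by simp
  show "\<forall>k\<ge>degree P. coeff (P - Q) k = 0"
  proof (intro allI impI)
   fix k assume "degree P\<le>k"
   then consider "k = degree P" | "k > degree P" by linarith
   thus "coeff (P - Q) k = 0" using assms(4-6) by cases (auto simp: coeff_eq_0)
  qed
 qed
 hence "P - Q = 0" using assms by (intro assms(10) subring_diff[OF pol_subring]) auto
 thus ?thesis by simp
qed

lemma monic_division:
 fixes y :: 'a
 assumes S: "is_subring S" and P: "P\<in>pol S" "lead_coeff P = 1" "poly P y = 0" "degree P > 0" and "f\<in>pol S"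
 shows "\<exists>r\<in>pol S. degree r < degree P \<and> poly f y = poly r y" using assms(6)
proof (induction "degree f" arbitrary: f rule: less_induct)
 case less show ?case
 proof (cases "degree f < degree P")
  case True thus ?thesis using less.prems by blast
 next case False
  define Q where "Q = monom (lead_coeff f) (degree f - degree P) * P"
  have Q: "Q\<in>pol S" unfolding Q_def by (intro subring_mult[OF pol_subring[OF S]] pol_monom S polD[OF less.prems] P(1))
  have f0: "f~=0" "degree f > 0" using False P(4) by auto
  have l0: "lead_coeff f~=0" using f0 by simp
  hence "monom (lead_coeff f) (degree f - degree P)~=0" by (simp add: monom_eq_0_iff)
  moreover have "P~=0" using P(4) by auto
  ultimately have "degree Q = degree (monom (lead_coeff f) (degree f - degree P)) + degree P"
   unfolding Q_def by (rule degree_mult_eq)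
  hence dQ: "degree Q = degree f" using False degree_monom_eq[OF l0, of "degree f - degree P"] by linarith
  have "lead_coeff (monom (lead_coeff f) (degree f - degree P)) = lead_coeff f" unfolding degree_monom_eq[OF l0] by simp
  hence lQ: "lead_coeff Q = lead_coeff f" unfolding Q_def lead_coeff_mult P(2) by simp
  have "degree (f - Q) < degree f"
  proof (rule degree_lessI)
   show "\<forall>k\<ge>degree f. coeff (f - Q) k = 0"
   proof (intro allI impI)
    fix k assume "degree f\<le>k"
    then consider "k = degree f" | "k > degree f" by linarith
    thus "coeff (f - Q) k = 0" using lQ dQ by cases (auto simp: coeff_eq_0)
   qed
  qed (use f0 in simp)
  moreover have "f - Q\<in>pol S" by (intro subring_diff[OF pol_subring[OF S]] less.prems Q)
  ultimately obtain r where "r\<in>pol S" "degree r < degree P" "poly (f - Q) y = poly r y" using less.hyps by blast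
  thus ?thesis using P(3) by (auto simp: Q_def)
 qed
qed

lemma algebraic_adjoin_poly: assumes M: "is_subfield M" and "algebraic_over M y" "g\<in>adjoin M {y}"
 shows "\<exists>f\<in>pol M. g = poly f y"
proof -
 note R = subfield_subring[OF M]
 obtain p r where pr: "p\<in>pol M" "r\<in>pol M" "poly r y~=0" "g = poly p y/poly r y"
  using adjoin_singleton[OF M assms(3)] .
 define x where "x = poly r y"
 have "algebraic_over M x"
 proof -
  have "y\<in>{y. algebraic_over M y}" "M\<subseteq>{y. algebraic_over M y}" using assms(2) algebraic_base[OF M] by auto
  thus ?thesis unfolding x_def
   using pol_eval[OF subfield_subring[OF algebraics_subfield[OF M]]] pol_mono[of M] pr(2) by blast
 qed
 then obtain P where P: "P\<in>pol M" "lead_coeff P = 1" "poly P x = 0" "degree P > 0"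
  "\<And>p. p\<in>pol M ==> degree p < degree P ==> poly p x = 0 ==> p = 0" using minimal_poly[OF M] by blast
 obtain c P' where cP: "P = pCons c P'" by (cases P)
 have P'0: "P'~=0" using P(4) cP by auto
 have P': "P'\<in>pol M" "c\<in>M"
 proof -
  show "P'\<in>pol M" using P(1) cP by (auto simp: pol_def) (metis coeff_pCons_Suc)
  show "c\<in>M" using polD[OF P(1), of 0] cP by simp
 qed
 have c0: "c~=0"
 proof
  assume "c = 0"
  hence "poly P' x = 0" using P(3) cP pr(3) by (simp add: x_def)
  moreover have "degree P' < degree P" using cP P'0 by simp
  ultimately show False using P(5) P'(1) P'0 by blast
 qed
 have "inverse x = - poly P' x/c" using P(3) c0 pr(3) cP by (simp add: x_def field_simps add_eq_0_iff)
 hence "g = poly (p * smult (- inverse c) (pcompose P' r)) y"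
  using pr(4) by (simp add: x_def poly_pcompose divide_inverse mult.assoc)
 moreover have "p * smult (- inverse c) (pcompose P' r)\<in>pol M"
  by (intro subring_mult[OF pol_subring[OF R]] pr pol_smult R subring_uminus[OF R]
   subfield_inverse[OF M] P' pol_pcompose)
 ultimately show ?thesis by blast
qed

lemma minimal_fraction: assumes M: "is_subfield M" and "g\<in>adjoin M {y}"
 obtains p r where "p\<in>pol M" "r\<in>pol M" "lead_coeff r = 1" "poly r y~=0" "g * poly r y = poly p y"
  "\<And>p' r'. p'\<in>pol M ==> r'\<in>pol M ==> poly r' y~=0 ==> g * poly r' y = poly p' y ==> degree r\<le>degree r'"
proof -
 note R = subfield_subring[OF M]
 define Q where "Q d \<longleftrightarrow> (\<exists>p\<in>pol M. \<exists>r\<in>pol M. poly r y~=0 \<and> g * poly r y = poly p y \<and> degree r = d)" for d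
 obtain p0 r0 where pr: "p0\<in>pol M" "r0\<in>pol M" "poly r0 y~=0" "g = poly p0 y/poly r0 y"
  using adjoin_singleton[OF M assms(2)] .
 have ex: "\<exists>d. Q d" unfolding Q_def using pr by (intro exI[of _ "degree r0"] bexI[of _ p0] bexI[of _ r0]) auto
 define d where "d = (LEAST d. Q d)"
 have "Q d" unfolding d_def using LeastI_ex[OF ex] .
 then obtain p r where p: "p\<in>pol M" "r\<in>pol M" "poly r y~=0" "g * poly r y = poly p y" "degree r = d"
  by (auto simp: Q_def)
 have min: "d\<le>degree r'" if "p'\<in>pol M" "r'\<in>pol M" "poly r' y~=0" "g * poly r' y = poly p' y" for p' r'
  unfolding d_def by (rule Least_le) (use that in \<open>auto simp: Q_def\<close>)
 define c where "c = inverse (lead_coeff r)"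
 have c: "c~=0" "c\<in>M" using p subfield_inverse[OF M polD[OF p(2)]] by (auto simp: c_def)
 have l1: "lead_coeff (smult c r) = 1" using p(3) by (auto simp: c_def)
 show thesis by (rule that[of "smult c p" "smult c r"])
   (use p c l1 min in \<open>auto intro: pol_smult[OF R] simp: mult.left_commute\<close>)
qed

section \<open>Semi-invariants\<close>

text \<open>The minimal polynomial of \<open>c\<close> is transformed into itself by \<open>\<tau>\<close>, up to a scaling of the variable, so
  its constant coefficient is again a semi-invariant.\<close>

lemma semi_invariant_algebraic:
 assumes M: "is_subfield M" "stab M" and "algebraic_over M c" "c~=0" and "ch\<in>M" "ch~=0" "\<tau> c = ch * c"
 shows "\<exists>c'\<in>M. c'~=0 \<and> (\<exists>m\<ge>1. \<tau> c' = ch^m * c')"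
proof -
 note R = subfield_subring[OF M(1)]
 obtain P where P: "P\<in>pol M" "lead_coeff P = 1" "poly P c = 0" "degree P > 0"
  "\<And>p. p\<in>pol M ==> degree p < degree P ==> poly p c = 0 ==> p = 0" using minimal_poly[OF M(1) assms(3)] by blast
 define Q where "Q = smult (inverse (ch^degree P)) (tp ch 0 P)"
 have Q: "Q\<in>pol M" unfolding Q_def
  by (intro pol_smult R subfield_inverse[OF M(1)] subring_power[OF R] assms(5) tp_pol M(2) subring_0[OF R] P(1))
 have dQ: "degree P = degree Q" "lead_coeff Q = 1"
  using assms(6) P(2) lead_tp[OF assms(6), of 0 P] by (simp_all add: Q_def degree_tp t_1)
 have zQ: "poly Q c = 0" using poly_tp[of c ch 0 P] assms(7) P(3) by (simp add: Q_def t_0)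
 have "P = Q" by (rule monic_unique[OF R P(1) Q P(2) dQ(2,1) P(3) zQ P(4)]) (rule P(5))
 hence "coeff P 0 = inverse (ch^degree P) * coeff (tp ch 0 P) 0" by (metis Q_def coeff_smult)
 also have "coeff (tp ch 0 P) 0 = \<tau> (coeff P 0)" by (simp add: coeff_tp_0 poly_0_coeff_0 coeff_map_poly t_0)
 finally have inv: "coeff P 0 = inverse (ch^degree P)*\<tau> (coeff P 0)" .
 have "B = X * A" if "A = inverse X * B" "X~=0" for A B X :: 'a using that by simp
 from this[OF inv] have t: "\<tau> (coeff P 0) = ch^degree P * coeff P 0" using assms(6) by simp
 have "coeff P 0~=0"
 proof
  assume z: "coeff P 0 = 0"
  obtain a P' where aP: "P = pCons a P'" by (cases P)
  have a: "a = 0" using z aP by simp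
  have "poly P' c = 0" using P(3) aP a assms(4) by simp
  moreover have "P'\<in>pol M" using P(1) aP by (auto simp: pol_def) (metis coeff_pCons_Suc)
  moreover have "degree P' < degree P" "P'~=0" using aP P(4) by auto
  ultimately show False using P(5) by blast
 qed
 thus ?thesis using t P(4) polD[OF P(1)] by (intro bexI[of _ "coeff P 0"]) (auto intro!: exI[of _ "degree P"])
qed

text \<open>If \<open>y\<close> is transcendental, the quotient of the leading coefficients of numerator and denominator of
  \<open>c\<close> is a semi-invariant over \<open>M\<close>; its multiplier differs from \<open>ch\<close> by a power of \<open>a\<close>.\<close>

lemma semi_invariant_peel: assumes M: "is_subfield M" "stab M" and y: "\<tau> y = a * y + b" "a\<in>M" "a~=0" "b\<in>M"
  and c: "c\<in>adjoin M {y}" "c~=0" and chi: "ch\<in>M" "ch~=0" "\<tau> c = ch * c"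
 shows "\<exists>c'\<in>M. c'~=0 \<and> (\<exists>m\<ge>1. \<exists>d. \<tau> c' = ch^m * a powi d * c')"
proof (cases "algebraic_over M y")
 case True
 have "{y}\<subseteq>{y. algebraic_over M y}" using True by simp
 hence "adjoin M {y}\<subseteq>{y. algebraic_over M y}"
  using algebraic_base[OF M(1)] by (intro adjoin_minimal algebraics_subfield M(1)) auto
 hence "algebraic_over M c" using c by auto
 from semi_invariant_algebraic[OF M this c(2) chi] obtain c' m where
  "c'\<in>M" "c'~=0" "m\<ge>1" "\<tau> c' = ch^m * c'" by blast
 thus ?thesis by (intro bexI[of _ c'] conjI exI[of _ m] exI[of _ 0]) auto
next case False
 note R = subfield_subring[OF M(1)]
 obtain p r where pr: "p\<in>pol M" "r\<in>pol M" "poly r y~=0" "c = poly p y/poly r y"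
  using adjoin_singleton[OF M(1) c(1)] .
 have p0: "p~=0" and r0: "r~=0" using pr c(2) by auto
 have ty: "\<tau> (poly f y) = poly (tp a b f) y" for f using poly_tp[OF y(1)] by simp
 have tr: "poly (tp a b r) y~=0" using pr(3) t_eq_0 by (simp flip: ty)
 have "poly (tp a b p) y/poly (tp a b r) y = ch*(poly p y/poly r y)" using chi(3) by (simp add: pr(4) t_divide ty)
 hence "poly (tp a b p * r - smult ch (p * tp a b r)) y = 0" using tr pr(3) by (simp add: field_simps)
 moreover have "tp a b p * r - smult ch (p * tp a b r)\<in>pol M"
  by (intro subring_diff[OF pol_subring[OF R]] subring_mult[OF pol_subring[OF R]] pol_smult R tp_pol M(2) y pr chi)
 ultimately have "tp a b p * r - smult ch (p * tp a b r) = 0" by (rule transc_zero[OF M(1) False, rotated])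
 hence "lead_coeff (tp a b p * r) = lead_coeff (smult ch (p * tp a b r))" by simp
 hence eq: "\<tau> (lead_coeff p) * a^degree p * lead_coeff r = ch*(lead_coeff p*(\<tau> (lead_coeff r) * a^degree r))"
  using lead_tp[OF y(3)] by (simp add: lead_coeff_mult)
 define c' where "c' = lead_coeff p/lead_coeff r"
 have tr0: "\<tau> (lead_coeff r)~=0" using r0 by (simp add: t_eq_0)
 have "\<tau> c' = ch*(a^degree r/a^degree p) * c'" using eq r0 y(3) tr0 by (simp add: c'_def t_divide field_simps)
 also have "a^degree r/a^degree p = a powi (int (degree r) - int (degree p))"
  using y(3) by (simp add: power_int_diff)
 finally have "\<tau> c' = ch^1 * a powi (int (degree r) - int (degree p)) * c'" by simp
 moreover have "c'\<in>M" unfolding c'_def by (intro subfield_divide[OF M(1)] polD pr)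
 moreover have "c'~=0" using p0 r0 by (simp add: c'_def)
 ultimately show ?thesis by blast
qed

section \<open>Separation of weights\<close>

text \<open>\<open>N\<close> is a field of functions of weight 0, \<open>\<Omega>\<close> has weight 1, and \<open>S\<close> is generated over
  \<open>N[\<Omega>]\<close> by solutions of \<open>\<tau> z - z \<in> \<Omega> S\<close>, whose inhomogeneous terms have positive
  weight. Grading \<open>S\<close> itself by weights is impossible, because a solution \<open>z\<close> is only determined
  up to constants, which have weight 0. The following property serves instead: solutions of an
  equation \<open>\<tau> g - g \<in> S\<close> in the field \<open>E\<close> of fractions lie in \<open>S\<close>, and the part of weight 0 of the
  equation can already be solved in \<open>N\<close>. It is stable under the adjunction of further solutions,
  because \<open>S[z]\<close> is a free \<open>S\<close>-module on powers of \<open>z\<close>, also when \<open>z\<close> is algebraic.\<close>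

definition weight_sep :: "'a set => 'a => 'a set => 'a set => bool" where
 "weight_sep N \<Omega> S E \<longleftrightarrow> is_subring S \<and> is_subfield E \<and> S\<subseteq>E \<and> E\<subseteq>FT \<and> K\<subseteq>N \<and> N\<subseteq>S \<and> \<Omega>\<in>S \<and>
   stab S \<and> stab E \<and> (\<forall>g\<in>E. \<tau> g - g\<in>S --> g\<in>S) \<and> (\<forall>g\<in>S. \<forall>\<nu>\<in>N. \<forall>s\<in>S. \<tau> g - g = \<nu> + \<Omega> * s --> (\<exists>g'\<in>N. \<tau> g' - g' = \<nu>))"

lemma weight_sepD: assumes "weight_sep N \<Omega> S E"
 shows "is_subring S" "is_subfield E" "S\<subseteq>E" "E\<subseteq>FT" "K\<subseteq>N" "N\<subseteq>S" "\<Omega>\<in>S" "stab S" "stab E"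
  "\<And>g. g\<in>E ==> \<tau> g - g\<in>S ==> g\<in>S" "\<And>g \<nu> s. g\<in>S ==> \<nu>\<in>N ==> s\<in>S ==> \<tau> g - g = \<nu> + \<Omega> * s ==> \<exists>g'\<in>N. \<tau> g' - g' = \<nu>"
 using assms unfolding weight_sep_def by blast+

lemma stab_rgen: assumes "stab S" "\<tau> z\<in>rgen S {z}" "is_subring S" shows "stab (rgen S {z})" unfolding stab_def
proof
 fix x assume "x\<in>rgen S {z}"
 then obtain p where p: "p\<in>pol S" "x = poly p z" unfolding rgen_singleton[OF assms(3)] by auto
 have "poly (map_poly \<tau> p) (\<tau> z)\<in>rgen S {z}"
  using map_t_pol[OF assms(1) p(1)] pol_mono[OF rgen_base[of S "{z}"]] assms(2)
  by (intro pol_eval[OF rgen_subring]) auto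
 thus "\<tau> x\<in>rgen S {z}" by (simp add: p(2) poly_map_t)
qed

lemma stab_adjoin: assumes "stab E" "\<tau> z\<in>adjoin E {z}" "is_subfield E" shows "stab (adjoin E {z})" unfolding stab_def
proof
 fix x assume "x\<in>adjoin E {z}"
 then obtain p r where p: "p\<in>pol E" "r\<in>pol E" "x = poly p z/poly r z" using adjoin_singleton[OF assms(3)] by metis
 have H: "poly (map_poly \<tau> f) (\<tau> z)\<in>adjoin E {z}" if "f\<in>pol E" for f
  using map_t_pol[OF assms(1) that] pol_mono[OF adjoin_base[of E "{z}"]] assms(2)
  by (intro pol_eval[OF subfield_subring[OF adjoin_subfield]]) auto
 show "\<tau> x\<in>adjoin E {z}" unfolding p(3) t_divide poly_map_t by (intro subfield_divide[OF adjoin_subfield] H p(1,2))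
qed

end

context diff_field
begin

text \<open>If \<open>\<tau> g - g\<close> is a polynomial in a transcendental element \<open>y\<close>, then the monic denominator of minimal degree of \<open>g\<close> is
  preserved by \<open>\<tau>\<close>, up to the normalization of its leading coefficient.\<close>

lemma minimal_denominator_invariant:
 assumes M: "is_subfield M" "stab M" and y: "\<tau> y = a * y + b" "a\<in>M" "a~=0" "b\<in>M"
  and g: "g\<in>adjoin M {y}" "\<tau> g - g = poly s y" "s\<in>pol M"
 obtains p r where "p\<in>pol M" "r\<in>pol M" "lead_coeff r = 1" "poly r y~=0" "g * poly r y = poly p y"
  "\<And>p' r'. p'\<in>pol M ==> r'\<in>pol M ==> poly r' y~=0 ==> g * poly r' y = poly p' y ==> degree r\<le>degree r'"
  "\<not> algebraic_over M y ==> smult (inverse (a^degree r)) (tp a b r) = r"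
proof -
 note R = subfield_subring[OF M(1)]
 note Rp = pol_subring[OF R]
 obtain p r where pr: "p\<in>pol M" "r\<in>pol M" "lead_coeff r = 1" "poly r y~=0" "g * poly r y = poly p y"
  and min: "\<And>p' r'. p'\<in>pol M ==> r'\<in>pol M ==> poly r' y~=0 ==> g * poly r' y = poly p' y ==> degree r\<le>degree r'"
  using minimal_fraction[OF M(1) g(1)] by blast
 define u where "u = inverse (a^degree r)"
 have u: "u\<in>M" "u~=0" unfolding u_def using subfield_inverse[OF M(1) subring_power[OF R y(2)]] y(3) by auto
 define r' where "r' = smult u (tp a b r)"
 have r': "r'\<in>pol M" unfolding r'_def by (intro pol_smult R u tp_pol M(2) y pr)
 have dr': "degree r' = degree r" "lead_coeff r' = 1"
  using u y(3) lead_tp[OF y(3), of b r] pr(3) by (simp_all add: r'_def degree_tp t_1 u_def)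
 have "r' = r" if tr: "\<not> algebraic_over M y"
 proof (rule ccontr)
  assume ne: "r'~=r"
  define w where "w = r - r'"
  have w: "w\<in>pol M" "w~=0" unfolding w_def using ne by (auto intro: subring_diff[OF Rp pr(2) r'])
  have "\<tau> g * poly (tp a b r) y = poly (tp a b p) y"
   using arg_cong[OF pr(5), of \<tau>] poly_tp[OF y(1)] by (simp add: t_mult)
  hence "(g + poly s y) * poly (tp a b r) y = poly (tp a b p) y" using g(2) by (simp add: algebra_simps)
  hence "u*((g + poly s y) * poly (tp a b r) y) = u * poly (tp a b p) y" by simp
  hence "(g + poly s y) * poly r' y = poly (smult u (tp a b p)) y" by (simp add: r'_def ac_simps)
  hence gr': "g * poly r' y = poly (smult u (tp a b p) - s * r') y" by (simp add: algebra_simps)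
  have "g * poly w y = poly (p - (smult u (tp a b p) - s * r')) y" using pr(5) gr' by (simp add: w_def algebra_simps)
  moreover have "p - (smult u (tp a b p) - s * r')\<in>pol M"
   by (intro subring_diff[OF Rp] subring_mult[OF Rp] pol_smult R u tp_pol M(2) y pr g r')
  moreover have "poly w y~=0" using transc_zero[OF M(1) tr w(1)] w(2) by blast
  ultimately have "degree r\<le>degree w" using w(1) by (intro min) auto
  moreover have "degree w < degree r"
  proof (rule ccontr)
   assume "\<not> degree w < degree r"
   moreover have "degree w\<le>degree r" unfolding w_def using dr'(1) by (intro degree_diff_le) auto
   ultimately have "degree w = degree r" by simp
   hence "lead_coeff w = 0" using dr' pr(3) by (simp add: w_def)
   thus False using w(2) by simp
  qed
  ultimately show False by simp
 qed
 thus thesis using that[OF pr min] by (simp add: r'_def u_def)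
qed

text \<open>By the assumption on semi-invariants \<open>\<Omega>\<close> is transcendental over \<open>N\<close>, and the only invariant
  denominators are powers of \<open>\<Omega>\<close>. Such a denominator is impossible in a solution of \<open>\<tau> g - g \<in> N[\<Omega>]\<close>,
  because the lowest coefficient of the numerator would be a semi-invariant with multiplier \<open>A ^ d\<close>.\<close>

lemma weight_sep_base:
 assumes N: "is_subfield N" "stab N" "K\<subseteq>N" "N\<subseteq>FT" and Om: "\<Omega>\<in>FT" "\<Omega>~=0" "\<tau> \<Omega> = A*\<Omega>" "A\<in>K" "A~=0"
  and T: "\<And>k c. k~=0 ==> c\<in>N ==> \<tau> c = A powi k * c ==> c = 0" shows "weight_sep N \<Omega> (rgen N {\<Omega>}) (adjoin N {\<Omega>})"
proof -
 note R = subfield_subring[OF N(1)]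
 note Rp = pol_subring[OF R]
 have AN: "A\<in>N" using Om(4) N(3) by blast
 have tr: "\<not> algebraic_over N \<Omega>"
 proof
  assume "algebraic_over N \<Omega>"
  from semi_invariant_algebraic[OF N(1,2) this Om(2) AN Om(5,3)] obtain c m where
   "c\<in>N" "c~=0" "m\<ge>1" "\<tau> c = A^m * c" by blast
  thus False using T[of "int m" c] by simp
 qed
 have Om': "\<tau> \<Omega> = A*\<Omega> + 0" using Om(3) by simp
 have tO: "\<tau> \<Omega>\<in>rgen N {\<Omega>}" unfolding Om(3)
  using rgen_base[of N "{\<Omega>}"] rgen_gens[of "{\<Omega>}" N] AN by (intro subring_mult[OF rgen_subring]) auto
 have RE: "rgen N {\<Omega>}\<subseteq>adjoin N {\<Omega>}" by (intro rgen_minimal adjoin_base adjoin_gens subfield_subring adjoin_subfield)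
 have reg: "g\<in>rgen N {\<Omega>}" if g: "g\<in>adjoin N {\<Omega>}" "\<tau> g - g\<in>rgen N {\<Omega>}" for g
 proof -
  obtain s where s: "s\<in>pol N" "\<tau> g - g = poly s \<Omega>" using g(2) unfolding rgen_singleton[OF R] by blast
  obtain p r where pr: "p\<in>pol N" "r\<in>pol N" "lead_coeff r = 1" "poly r \<Omega>~=0" "g * poly r \<Omega> = poly p \<Omega>"
   and min: "\<And>p' r'. p'\<in>pol N ==> r'\<in>pol N ==> poly r' \<Omega>~=0 ==> g * poly r' \<Omega> = poly p' \<Omega> ==> degree r\<le>degree r'"
   and inv: "smult (inverse (A^degree r)) (tp A 0 r) = r"
   using minimal_denominator_invariant[OF N(1,2) Om' AN Om(5) subring_0[OF R] g(1) s(2,1)] tr by metis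
  define d where "d = degree r"
  have tA: "coeff (tp A 0 f) k = \<tau> (coeff f k) * A^k" for f k
   unfolding tp_def by (simp add: coeff_pcompose_linear coeff_map_poly t_0 mult.commute)
  have rk0: "coeff r k = 0" if "k < d" for k
  proof -
   have "inverse (A^d)*(\<tau> (coeff r k) * A^k) = coeff r k"
    using arg_cong[OF inv, of "\<lambda>f. coeff f k"] by (simp add: tA d_def)
   hence "\<tau> (coeff r k) * A^k = A^d * coeff r k" using Om(5) by (simp add: field_simps)
   hence "\<tau> (coeff r k) = A powi int (d - k) * coeff r k"
    using that Om(5) power_add[of A "d - k" k] by (simp add: ac_simps del: of_nat_diff)
   thus ?thesis using T[of "int (d - k)" "coeff r k"] that polD[OF pr(2)] by simp
  qed
  have rX: "r = monom 1 d"
  proof (rule poly_eqI)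
   fix k
   consider "k < d" | "k = d" | "k > d" by linarith
   thus "coeff r k = coeff (monom 1 d) k" using rk0 pr(3) by cases (auto simp: d_def coeff_eq_0)
  qed
  have "d = 0"
  proof (rule ccontr)
   assume d0: "d~=0"
   have gO: "g*\<Omega>^d = poly p \<Omega>" using pr(5) by (simp add: rX poly_monom)
   have p0: "coeff p 0~=0"
   proof
    assume z: "coeff p 0 = 0"
    obtain c p' where cp: "p = pCons c p'" by (cases p)
    have p': "p'\<in>pol N" using pr(1) cp by (auto simp: pol_def) (metis coeff_pCons_Suc)
    have "g*\<Omega>^(d - 1)*\<Omega> = poly p' \<Omega>*\<Omega>" using gO z cp d0 by (simp add: power_eq_if[of \<Omega> d] ac_simps)
    hence "g * poly (monom 1 (d - 1)) \<Omega> = poly p' \<Omega>" using Om(2) by (simp add: poly_monom)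
    hence "degree r\<le>degree (monom (1::'a) (d - 1))"
     using p' Om(2) by (intro min) (auto simp: poly_monom intro: pol_monom[OF R subring_1[OF R]])
    thus False using d0 by (simp add: d_def degree_monom_eq)
   qed
   have "\<tau> g*(A^d*\<Omega>^d) = poly (tp A 0 p) \<Omega>"
    using arg_cong[OF gO, of \<tau>] poly_tp[OF Om', of p] by (simp add: t_mult t_power Om(3) power_mult_distrib)
   hence "poly (smult (A^d) (p + s * monom 1 d) - tp A 0 p) \<Omega> = 0"
    using s(2) gO by (simp add: poly_monom algebra_simps)
   moreover have "smult (A^d) (p + s * monom 1 d) - tp A 0 p\<in>pol N"
    by (intro subring_diff[OF Rp] pol_smult R subring_power[OF R] AN subring_add[OF Rp] subring_mult[OF Rp]
      pr s tp_pol N(2) subring_0[OF R] pol_monom subring_1[OF R])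
   ultimately have "smult (A^d) (p + s * monom 1 d) - tp A 0 p = 0" by (rule transc_zero[OF N(1) tr, rotated])
   hence "coeff (smult (A^d) (p + s * monom 1 d) - tp A 0 p) 0 = 0" by simp
   hence "\<tau> (coeff p 0) = A powi int d * coeff p 0" using d0 by (simp add: tA coeff_mult coeff_monom)
   thus False using T[of "int d" "coeff p 0"] d0 p0 polD[OF pr(1)] by simp
  qed
  hence "g = poly p \<Omega>" using pr(5) by (simp add: rX)
  thus ?thesis using pr(1) unfolding rgen_singleton[OF R] by blast
 qed
 have proj: "\<exists>g'\<in>N. \<tau> g' - g' = \<nu>" if g: "g\<in>rgen N {\<Omega>}" "\<nu>\<in>N" "s\<in>rgen N {\<Omega>}" "\<tau> g - g = \<nu> + \<Omega> * s" for g \<nu> s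
 proof -
  obtain f h where fh: "f\<in>pol N" "h\<in>pol N" "g = poly f \<Omega>" "s = poly h \<Omega>"
   using g unfolding rgen_singleton[OF R] by blast
  have "poly (tp A 0 f - f - pCons \<nu> h) \<Omega> = 0" using g(4) poly_tp[OF Om', of f] by (simp add: fh algebra_simps)
  moreover have "tp A 0 f - f - pCons \<nu> h\<in>pol N"
   by (intro subring_diff[OF Rp] tp_pol R N(2) AN subring_0[OF R] fh pol_pCons g)
  ultimately have "tp A 0 f - f - pCons \<nu> h = 0" by (rule transc_zero[OF N(1) tr, rotated])
  hence "coeff (tp A 0 f - f - pCons \<nu> h) 0 = 0" by simp
  hence "\<tau> (coeff f 0) - coeff f 0 = \<nu>" by (simp add: coeff_tp_0 poly_0_coeff_0 coeff_map_poly t_0)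
  thus ?thesis using polD[OF fh(1)] by blast
 qed
 have "adjoin N {\<Omega>}\<subseteq>FT" using N(4) Om(1) by (intro adjoin_minimal FT) auto
 moreover have "stab (rgen N {\<Omega>})" by (rule stab_rgen[OF N(2) tO R])
 moreover have "stab (adjoin N {\<Omega>})" using tO RE by (intro stab_adjoin N) auto
 ultimately show ?thesis unfolding weight_sep_def
  using rgen_subring[of N "{\<Omega>}"] adjoin_subfield[of N "{\<Omega>}"] RE N(3) rgen_base[of N "{\<Omega>}"]
   rgen_gens[of "{\<Omega>}" N] reg proj by auto
qed

text \<open>The inductive step. Uniqueness of the representation of elements as polynomials in \<open>z\<close> holds for
  degrees below the degree of \<open>z\<close>; \<open>D\<close> is the set of these degrees. In the algebraic case the
  minimal polynomial has coefficients in \<open>S\<close>, as they satisfy equations \<open>\<tau> g - g \<in> S\<close>.\<close>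

lemma weight_sep_step_core: assumes ws: "weight_sep N \<Omega> S E" and z: "z\<in>FT" "\<tau> z = z + \<Omega> * b" "b\<in>S"
  and D: "\<And>d d'. D d ==> d'\<le>d ==> D (d'::nat)" and uniq: "\<And>p. p\<in>pol E ==> D (degree p) ==> poly p z = 0 ==> p = 0"
  and red: "\<And>x. x\<in>rgen S {z} ==> \<exists>p\<in>pol S. D (degree p) \<and> x = poly p z"
  and rep: "\<And>g. g\<in>adjoin E {z} ==> \<tau> g - g\<in>rgen S {z} ==> \<exists>f\<in>pol E. D (degree f) \<and> g = poly f z"
 shows "weight_sep N \<Omega> (rgen S {z}) (adjoin E {z})"
proof -
 note w = weight_sepD(1-9)[OF ws] and regS = weight_sepD(10)[OF ws] and projS = weight_sepD(11)[OF ws]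
 note RE = subfield_subring[OF w(2)]
 define b' where "b' = \<Omega> * b"
 have b': "b'\<in>S" unfolding b'_def by (rule subring_mult[OF w(1,7) z(3)])
 have tz: "\<tau> z = 1 * z + b'" using z(2) by (simp add: b'_def)
 have bE: "b'\<in>E" using b' w(3) by blast
 have rg: "S\<subseteq>rgen S {z}" "z\<in>rgen S {z}" using rgen_base rgen_gens by blast+
 have tzr: "\<tau> z\<in>rgen S {z}" unfolding tz using rg b' by (auto intro: subring_add[OF rgen_subring])
 have stS: "stab (rgen S {z})" by (rule stab_rgen[OF w(8) tzr w(1)])
 have sub: "rgen S {z}\<subseteq>adjoin E {z}" using w(3) adjoin_base[of E "{z}"] adjoin_gens[of "{z}" E]
  by (intro rgen_minimal subfield_subring adjoin_subfield) auto
 have stE: "stab (adjoin E {z})" using tzr sub by (intro stab_adjoin w) auto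
 have FTE: "adjoin E {z}\<subseteq>FT" using w(4) z(1) by (intro adjoin_minimal FT) auto
 have pz: "poly (tp 1 b' f) z = \<tau> (poly f z)" for f by (rule poly_tp[OF tz])
 have one: "1\<in>S" by (rule subring_1[OF w(1)])
 have tpS: "tp 1 b' f\<in>pol S" if "f\<in>pol S" for f by (intro tp_pol w one b' that)
 have tpE: "tp 1 b' f\<in>pol E" if "f\<in>pol E" for f by (intro tp_pol RE w(9) subring_1[OF RE] bE that)
 have regf: "poly f z\<in>rgen S {z}" if "f\<in>pol E" "D (degree f)" "\<tau> (poly f z) - poly f z\<in>rgen S {z}" for f
  using that
 proof (induction "degree f" arbitrary: f rule: less_induct)
  case less
  define d where "d = degree f"
  obtain s where s: "s\<in>pol S" "D (degree s)" "\<tau> (poly f z) - poly f z = poly s z" using red less.prems by blast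
  have sE: "s\<in>pol E" using s(1) pol_mono[OF w(3)] by blast
  have "D (degree (tp 1 b' f - f - s))"
  proof -
   have "degree (tp 1 b' f - f - s)\<le>max d (degree s)" by (intro degree_diff_le) (auto simp: degree_tp d_def)
   moreover have "D (max d (degree s))" using less.prems(2) s(2) by (simp add: max_def d_def)
   ultimately show ?thesis using D by blast
  qed
  moreover have "tp 1 b' f - f - s\<in>pol E" by (intro subring_diff[OF pol_subring[OF RE]] tpE less.prems sE)
  moreover have "poly (tp 1 b' f - f - s) z = 0" using s(3) by (simp add: pz)
  ultimately have "tp 1 b' f - f - s = 0" by (intro uniq)
  hence "coeff (tp 1 b' f - f - s) d = 0" by simp
  hence "\<tau> (coeff f d) - coeff f d = coeff s d" using coeff_tp_top[of f d b'] by (simp add: d_def)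
  hence fd: "coeff f d\<in>S" using regS[of "coeff f d"] polD[OF less.prems(1)] polD[OF s(1)] by simp
  define t where "t = coeff f d * z^d"
  have t: "t\<in>rgen S {z}" unfolding t_def using fd rg
   by (intro subring_mult[OF rgen_subring] subring_power[OF rgen_subring]) auto
  define f' where "f' = f - monom (coeff f d) d"
  have f'E: "f'\<in>pol E" unfolding f'_def
   by (intro subring_diff[OF pol_subring[OF RE]] less.prems pol_monom RE polD[OF less.prems(1)])
  have ft: "poly f z = poly f' z + t" by (simp add: f'_def t_def poly_monom)
  have "poly f' z\<in>rgen S {z}"
  proof (cases "f' = 0")
   case True thus ?thesis using subring_0[OF rgen_subring] by simp
  next case False
   have "degree f'\<le>d" unfolding f'_def d_def by (intro degree_diff_le) (auto simp: degree_monom_le)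
   moreover have "coeff f' d = 0" by (simp add: f'_def)
   ultimately have deg: "degree f' < d" using False by (metis le_neq_implies_less leading_coeff_0_iff)
   have "\<tau> (poly f' z) - poly f' z = (\<tau> (poly f z) - poly f z) - (\<tau> t - t)" by (simp add: ft t_add)
   also have "...\<in>rgen S {z}" by (intro subring_diff[OF rgen_subring] less.prems t stabD[OF stS])
   finally show ?thesis using less.hyps[of f'] deg f'E D[OF less.prems(2), of "degree f'"] by (simp add: d_def)
  qed
  thus ?case unfolding ft using t by (rule subring_add[OF rgen_subring])
 qed
 have reg: "g\<in>rgen S {z}" if "g\<in>adjoin E {z}" "\<tau> g - g\<in>rgen S {z}" for g using rep[OF that] regf that by blast
 have proj: "\<exists>g'\<in>N. \<tau> g' - g' = \<nu>" if g: "g\<in>rgen S {z}" "\<nu>\<in>N" "s\<in>rgen S {z}" "\<tau> g - g = \<nu> + \<Omega> * s" for g \<nu> s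
 proof -
  obtain f where f: "f\<in>pol S" "D (degree f)" "g = poly f z" using red[OF g(1)] by blast
  obtain h where h: "h\<in>pol S" "D (degree h)" "s = poly h z" using red[OF g(3)] by blast
  define Q where "Q = tp 1 b' f - f - [:\<nu>:] - smult \<Omega> h"
  have nuS: "\<nu>\<in>S" using g(2) w(6) by blast
  have "degree Q\<le>max (degree f) (degree h)"
   unfolding Q_def by (intro degree_diff_le) (auto simp: degree_tp intro: order.trans[OF degree_smult_le])
  moreover have "D (max (degree f) (degree h))" using f(2) h(2) by (simp add: max_def)
  ultimately have "D (degree Q)" using D by blast
  moreover have "Q\<in>pol S" unfolding Q_def
   by (intro subring_diff[OF pol_subring[OF w(1)]] tpS f pol_const nuS w pol_smult h)
  hence "Q\<in>pol E" using pol_mono[OF w(3)] by blast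
  moreover have "poly Q z = 0" using g(4) by (simp add: Q_def pz f h)
  ultimately have "Q = 0" by (intro uniq)
  obtain c f' where cf: "map_poly \<tau> f = pCons c f'" by (cases "map_poly \<tau> f")
  have "c = \<tau> (coeff f 0)" using arg_cong[OF cf, of "\<lambda>p. coeff p 0"] by (simp add: coeff_map_poly t_0)
  have f': "f'\<in>pol S" using map_t_pol[OF w(8) f(1)] cf by (auto simp: pol_def) (metis coeff_pCons_Suc)
  have "coeff Q 0 = c + b' * poly f' b' - coeff f 0 - \<nu> - \<Omega> * coeff h 0" by (simp add: Q_def coeff_tp_0 cf)
  hence "\<tau> (coeff f 0) - coeff f 0 = \<nu> + \<Omega>*(coeff h 0 - b * poly f' b')"
   using \<open>Q = 0\<close> \<open>c = _\<close> by (simp add: b'_def algebra_simps)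
  moreover have "coeff h 0 - b * poly f' b'\<in>S"
   by (intro subring_diff[OF w(1)] subring_mult[OF w(1)] pol_eval w f' b' z polD[OF h(1)])
  ultimately show ?thesis using projS[of "coeff f 0" \<nu>] polD[OF f(1)] g(2) by blast
 qed
 have "N\<subseteq>rgen S {z}" "\<Omega>\<in>rgen S {z}" using w rg by auto
 thus ?thesis unfolding weight_sep_def
  using rgen_subring[of S "{z}"] adjoin_subfield[of E "{z}"] sub FTE w(5) stS stE reg proj by auto
qed

text \<open>If \<open>z\<close> is transcendental over \<open>E\<close>, an invariant denominator is a constant and hence equal to 1. If \<open>z\<close> is
  algebraic, its minimal polynomial is invariant, and descending induction on the degree puts its
  coefficients into \<open>S\<close>.\<close>

lemma weight_sep_step: assumes ws: "weight_sep N \<Omega> S E" and z: "z\<in>FT" "\<tau> z = z + \<Omega> * b" "b\<in>S"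
 shows "weight_sep N \<Omega> (rgen S {z}) (adjoin E {z})"
proof -
 note w = weight_sepD(1-9)[OF ws] and regS = weight_sepD(10)[OF ws] and projS = weight_sepD(11)[OF ws]
 note RE = subfield_subring[OF w(2)]
 define b' where "b' = \<Omega> * b"
 have b': "b'\<in>S" unfolding b'_def by (rule subring_mult[OF w(1,7) z(3)])
 have bE: "b'\<in>E" using b' w(3) by blast
 have tz: "\<tau> z = 1 * z + b'" using z(2) by (simp add: b'_def)
 have oneE: "1\<in>E" "0\<in>E" by (rule subring_1[OF RE], rule subring_0[OF RE])
 show ?thesis
 proof (cases "algebraic_over E z")
  case False show ?thesis
  proof (rule weight_sep_step_core[OF ws z, where D = "\<lambda>_. True"])
   show "p = 0" if "p\<in>pol E" "poly p z = 0" for p by (rule transc_zero[OF w(2) False that])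
   show "\<exists>p\<in>pol S. True \<and> x = poly p z" if "x\<in>rgen S {z}" for x using that unfolding rgen_singleton[OF w(1)] by blast
   fix g assume g: "g\<in>adjoin E {z}" "\<tau> g - g\<in>rgen S {z}"
   obtain s where s: "s\<in>pol E" "\<tau> g - g = poly s z"
    using g(2) pol_mono[OF w(3)] unfolding rgen_singleton[OF w(1)] by blast
   obtain p r where pr: "p\<in>pol E" "r\<in>pol E" "lead_coeff r = 1" "poly r z~=0" "g * poly r z = poly p z"
    and inv: "smult (inverse (1^degree r)) (tp 1 b' r) = r"
    using minimal_denominator_invariant[OF w(2,9) tz oneE(1) _ bE g(1) s(2,1)] False by (metis one_neq_zero)
   have "\<tau> (poly r z) = poly r z" using inv poly_tp[OF tz, of r] by simp
   moreover have "poly r z\<in>FT" using pol_eval[OF subfield_subring[OF FT] _ z(1)] pr(2) pol_mono[OF w(4)] by blast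
   ultimately have "poly r z\<in>E" using const w(3,5,6) by blast
   hence "r - [:poly r z:]\<in>pol E" by (intro subring_diff[OF pol_subring[OF RE]] pr pol_const RE)
   moreover have "poly (r - [:poly r z:]) z = 0" by simp
   ultimately have "r - [:poly r z:] = 0" by (rule transc_zero[OF w(2) False])
   hence r: "r = [:poly r z:]" by simp
   hence "lead_coeff r = poly r z" by (metis degree_pCons_0 coeff_pCons_0)
   hence "poly r z = 1" using pr(3) by simp
   thus "\<exists>f\<in>pol E. True \<and> g = poly f z" using pr by auto
  qed simp
 next case True
  obtain P where P: "P\<in>pol E" "lead_coeff P = 1" "poly P z = 0" "degree P > 0"
   and min: "\<And>p. p\<in>pol E ==> degree p < degree P ==> poly p z = 0 ==> p = 0" using minimal_poly[OF w(2) True] by blast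
  have tpE: "tp 1 b' P\<in>pol E" by (intro tp_pol RE w(9) oneE bE P(1))
  have "P = tp 1 b' P"
  proof (rule monic_unique[OF RE P(1) tpE P(2) _ _ P(3) _ P(4)])
   show "lead_coeff (tp 1 b' P) = 1" "degree P = degree (tp 1 b' P)"
    using lead_tp[of 1 b' P] P(2) by (simp_all add: t_1 degree_tp)
   show "poly (tp 1 b' P) z = 0" using poly_tp[OF tz, of P] P(3) by (simp add: t_0)
  qed (rule min)
  hence tP: "tp 1 b' P = P" by simp
  have "\<forall>j\<ge>k. coeff P j\<in>S" if "degree P < k + n" for k n using that
  proof (induction n arbitrary: k)
   case 0 thus ?case using subring_0[OF w(1)] by (auto simp: coeff_eq_0)
  next case (Suc n) hence IH: "\<forall>j\<ge>Suc k. coeff P j\<in>S" using Suc.IH[of "Suc k"] by simp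
   define H where "H = Abs_poly (\<lambda>j. if j > k then coeff P j else 0)"
   have cH: "coeff H j = (if j > k then coeff P j else 0)" for j
    unfolding H_def by (subst coeff_Abs_poly[of "degree P"]) (auto simp: coeff_eq_0)
   have HS: "H\<in>pol S" using IH subring_0[OF w(1)] by (auto simp: pol_def cH)
   have "degree (P - H)\<le>k" by (rule degree_le) (auto simp: cH)
   hence "coeff (tp 1 b' (P - H)) k = \<tau> (coeff P k)" using coeff_tp_top[of "P - H" k b'] by (simp add: cH)
   moreover have "tp 1 b' P = tp 1 b' (P - H) + tp 1 b' H" using tp_add[of 1 b' "P - H" H] by simp
   ultimately have "coeff P k = \<tau> (coeff P k) + coeff (tp 1 b' H) k" using tP by (metis coeff_add)
   hence "\<tau> (coeff P k) - coeff P k = - coeff (tp 1 b' H) k" by (simp add: algebra_simps)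
   moreover have "tp 1 b' H\<in>pol S" by (intro tp_pol w b' HS subring_1[OF w(1)])
   ultimately have "\<tau> (coeff P k) - coeff P k\<in>S" using subring_uminus[OF w(1)] polD by metis
   hence "coeff P k\<in>S" by (rule regS[OF polD[OF P(1)]])
   thus ?case using IH by (metis le_neq_implies_less Suc_leI)
  qed
  from this[of 0 "Suc (degree P)"] have "coeff P j\<in>S" for j by simp
  hence PS: "P\<in>pol S" by (simp add: pol_def)
  show ?thesis
  proof (rule weight_sep_step_core[OF ws z, where D = "\<lambda>d. d < degree P"])
   show "p = 0" if "p\<in>pol E" "degree p < degree P" "poly p z = 0" for p by (rule min[OF that])
   show "\<exists>p\<in>pol S. degree p < degree P \<and> x = poly p z" if "x\<in>rgen S {z}" for x
    using that monic_division[OF w(1) PS P(2,3,4)] unfolding rgen_singleton[OF w(1)] by blast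
   show "\<exists>f\<in>pol E. degree f < degree P \<and> g = poly f z" if "g\<in>adjoin E {z}" for g
    using algebraic_adjoin_poly[OF w(2) True that] monic_division[OF RE P(1,2,3,4)] by metis
  qed simp
 qed
qed

lemma weight_sep_list: assumes "weight_sep N \<Omega> (rgen N {\<Omega>}) (adjoin N {\<Omega>})" and "\<And>i. i < length zs ==> zs ! i\<in>FT \<and>
     (\<exists>b\<in>rgen N (insert \<Omega> (set (take i zs))). \<tau> (zs ! i) = zs ! i + \<Omega> * b)"
 shows "weight_sep N \<Omega> (rgen N (insert \<Omega> (set zs))) (adjoin N (insert \<Omega> (set zs)))" using assms(2)
proof (induction zs rule: rev_induct)
 case Nil thus ?case using assms(1) by simp
next case (snoc z zs)
 have "weight_sep N \<Omega> (rgen N (insert \<Omega> (set zs))) (adjoin N (insert \<Omega> (set zs)))"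
 proof (rule snoc.IH)
  fix i assume "i < length zs"
  thus "zs ! i\<in>FT \<and> (\<exists>b\<in>rgen N (insert \<Omega> (set (take i zs))). \<tau> (zs ! i) = zs ! i + \<Omega> * b)"
   using snoc.prems[of i] by (simp add: nth_append)
 qed
 moreover obtain b where "z\<in>FT" "b\<in>rgen N (insert \<Omega> (set zs))" "\<tau> z = z + \<Omega> * b"
  using snoc.prems[of "length zs"] by auto
 ultimately have "weight_sep N \<Omega> (rgen (rgen N (insert \<Omega> (set zs))) {z}) (adjoin (adjoin N (insert \<Omega> (set zs))) {z})"
  by (intro weight_sep_step)
 moreover have "rgen (rgen N (insert \<Omega> (set zs))) {z} = rgen N (insert \<Omega> (set (zs @ [z])))"
  unfolding rgen_def by (metis hull_Un_left Un_insert_left Un_insert_right set_append list.simps(15) empty_set sup_bot_right sup_bot.left_neutral Un_assoc)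
 moreover have "adjoin (adjoin N (insert \<Omega> (set zs))) {z} = adjoin N (insert \<Omega> (set (zs @ [z])))"
  by (simp add: adjoin_Un Un_commute insert_commute)
 ultimately show ?case by simp
qed

text \<open>A solution \<open>w\<close> of \<open>\<tau> w = w + \<beta>\<close> that is algebraic over \<open>E\<close> satisfies an additive relation with
  constant coefficients; this is a shortest relation between the elements \<open>w ^ (p ^ k)\<close> modulo \<open>E\<close>.\<close>

lemma additive_relation: assumes E: "is_subfield E" "stab E" "E\<subseteq>FT" and w: "\<tau> w = w + \<beta>" "\<beta>\<in>E" "algebraic_over E w"
 shows "\<exists>s c. (\<forall>k<s. c k\<in>K \<and> \<tau> (c k) = c k) \<and> w^(CHAR('a)^s) + (\<Sum>k<s. c k * w^(CHAR('a)^k))\<in>E"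
proof -
 note R = subfield_subring[OF E(1)]
 define p where "p = CHAR('a)"
 have frob: "(x + y)^(p^k) = x^(p^k) + y^(p^k)" for x y :: 'a and k
  using freshmans_dream'[OF char] by (simp add: p_def)
 have "fin_stable E {w}" using w(3) by (intro fin_stable_finite[OF E(1)]) auto
 then obtain W where W: "finite W" "1\<in>W" "\<forall>u\<in>W. w * u\<in>lspan E W" unfolding fin_stable_def by auto
 have pw: "w^i\<in>lspan E W" for i
 proof (induction i)
  case (Suc i)
  have "w * w^i\<in>lspan E W" by (rule lspan_mult_image[OF _ R Suc]) (use W(3) in blast)
  thus ?case by simp
 qed (use lspan_gen[OF R W(2)] in simp)
 obtain x where x: "\<forall>i\<in>{..card W}. x i\<in>E" "\<exists>i\<in>{..card W}. x i~=0" "(\<Sum>i\<in>{..card W}. x i * w^(p^i)) = 0"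
  using lspan_dependent[OF E(1) W(1), of "{..card W}" "\<lambda>i. w^(p^i)"] pw by auto
 define Q where "Q s \<longleftrightarrow> (\<exists>c. (\<forall>k<s. c k\<in>E) \<and> w^(p^s) + (\<Sum>k<s. c k * w^(p^k))\<in>E)" for s
 \<comment> \<open>normalization of the last nonzero coefficient\<close>
 have QI: "Q s" if "s < n" "\<And>k. k < n ==> c k\<in>E" "c s~=0" "\<And>k. s < k ==> k < n ==> c k = 0"
  "(\<Sum>k<n. c k * w^(p^k))\<in>E" for s n c
 proof -
  have "(\<Sum>k<n. c k * w^(p^k)) = (\<Sum>k<Suc s. c k * w^(p^k))" using that by (intro sum.mono_neutral_right) auto
  hence "inverse (c s)*(\<Sum>k<Suc s. c k * w^(p^k))\<in>E"
   using that subring_mult[OF R subfield_inverse[OF E(1)]] by simp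
  moreover have "inverse (c s)*(\<Sum>k<Suc s. c k * w^(p^k)) =
    w^(p^s) + (\<Sum>k<s. (inverse (c s) * c k) * w^(p^k))"
   using that(3) by (simp add: distrib_left sum_distrib_left mult.assoc)
  moreover have "\<forall>k<s. inverse (c s) * c k\<in>E" using that subring_mult[OF R subfield_inverse[OF E(1)]] by simp
  ultimately show ?thesis unfolding Q_def by (intro exI[of _ "\<lambda>k. inverse (c s) * c k"]) simp
 qed
 have last: "\<exists>s<n. c s~=0 \<and> (\<forall>k. s < k --> k < n --> c k = 0)" if "\<exists>k<n. c k~=0" for c :: "nat => 'a" and n
 proof -
  have fin: "finite {k. k < n \<and> c k~=0}" "{k. k < n \<and> c k~=0}~={}" using that by auto
  define s where "s = Max {k. k < n \<and> c k~=0}"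
  have s: "s < n" "c s~=0" using Max_in[OF fin] by (auto simp: s_def)
  have "k\<le>s" if "k < n" "c k~=0" for k unfolding s_def using fin that by (intro Max_ge) auto
  thus ?thesis using s by (intro exI[of _ s]) (auto simp: not_le[symmetric])
 qed
 have ex: "\<exists>s. Q s"
 proof -
  obtain s where s: "s < Suc (card W)" "x s~=0" "\<forall>k. s < k --> k < Suc (card W) --> x k = 0"
   using last[of "Suc (card W)" x] x(2) by (auto simp: less_Suc_eq_le)
  have "Q s" using s x(1,3) subring_0[OF R] by (intro QI[of s "Suc (card W)" x]) (auto simp: lessThan_Suc_atMost)
  thus ?thesis by blast
 qed
 define s where "s = (LEAST s. Q s)"
 have "Q s" unfolding s_def by (rule LeastI_ex[OF ex])
 then obtain c where c: "\<And>k. k < s ==> c k\<in>E" "w^(p^s) + (\<Sum>k<s. c k * w^(p^k))\<in>E" unfolding Q_def by blast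
 define a where "a = w^(p^s) + (\<Sum>k<s. c k * w^(p^k))"
 have ta: "\<tau> a = (w^(p^s) + \<beta>^(p^s)) + (\<Sum>k<s. \<tau> (c k)*(w^(p^k) + \<beta>^(p^k)))"
  by (simp add: a_def t_add t_power t_sum t_mult w(1) frob)
 have "(\<Sum>k<s. (\<tau> (c k) - c k) * w^(p^k)) = \<tau> a - a - \<beta>^(p^s) - (\<Sum>k<s. \<tau> (c k)*\<beta>^(p^k))"
  unfolding ta unfolding a_def by (simp add: algebra_simps sum.distrib sum_subtractf)
 also have "...\<in>E" using c stabD[OF E(2)] w(2) unfolding a_def[symmetric]
  by (intro subring_diff[OF R] subring_sum[OF R] subring_mult[OF R] subring_power[OF R]) auto
 finally have rel: "(\<Sum>k<s. (\<tau> (c k) - c k) * w^(p^k))\<in>E" .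
 have fixed: "\<tau> (c k) = c k" if "k < s" for k
 proof (rule ccontr)
  assume "\<tau> (c k)~=c k"
  hence "\<exists>k<s. \<tau> (c k) - c k~=0" using that by auto
  from last[OF this] obtain s' where s': "s' < s" "\<tau> (c s') - c s'~=0"
   "\<forall>k. s' < k --> k < s --> \<tau> (c k) - c k = 0" by blast
  have "Q s'"
   by (rule QI[of s' s "\<lambda>k. \<tau> (c k) - c k"]) (use s' c rel stabD[OF E(2)] in \<open>auto intro: subring_diff[OF R]\<close>)
  thus False using not_less_Least[of s' Q] s'(1) by (simp add: s_def)
 qed
 have "c k\<in>K" if "k < s" for k using const fixed[OF that] c(1)[OF that] E(3) by blast
 thus ?thesis using c(2) fixed unfolding p_def by blast
qed

text \<open>The left side \<open>a\<close> of the additive relation satisfies \<open>\<tau> a - a \<in> N\<close>. Hence it lies in \<open>S\<close>, and by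
  the separation of weights \<open>N\<close> contains a solution of the same equation. The two solutions differ
  by a constant, so \<open>a \<in> N\<close> and the relation is one over \<open>N\<close>.\<close>

theorem weight_zero_algebraic:
 assumes N: "is_subfield N" and ws: "weight_sep N \<Omega> S E" and w: "w\<in>FT" "\<tau> w = w + \<beta>" "\<beta>\<in>N" "algebraic_over E w"
 shows "algebraic_over N w"
proof -
 note s = weight_sepD(1-9)[OF ws] and regS = weight_sepD(10)[OF ws] and projS = weight_sepD(11)[OF ws]
 note RN = subfield_subring[OF N]
 have NE: "N\<subseteq>E" using s by blast
 define p where "p = CHAR('a)"
 have p: "p > 1" using char prime_gt_1_nat by (simp add: p_def)
 obtain n c where "\<forall>k<n. c k\<in>K \<and> \<tau> (c k) = c k" and aE: "w^(p^n) + (\<Sum>k<n. c k * w^(p^k))\<in>E"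
  using additive_relation[OF s(2,9,4) w(2) _ w(4)] w(3) NE unfolding p_def by blast
 hence c: "c k\<in>N" "c k\<in>FT" "\<tau> (c k) = c k" if "k < n" for k using that s(5) K_FT by auto
 define a where "a = w^(p^n) + (\<Sum>k<n. c k * w^(p^k))"
 define \<nu> where "\<nu> = \<beta>^(p^n) + (\<Sum>k<n. c k*\<beta>^(p^k))"
 have frob: "(x + y)^(p^k) = x^(p^k) + y^(p^k)" for x y :: 'a and k
  using freshmans_dream'[OF char] by (simp add: p_def)
 have "\<tau> a = (w^(p^n) + \<beta>^(p^n)) + (\<Sum>k<n. c k*(w^(p^k) + \<beta>^(p^k)))"
  by (simp add: a_def t_add t_power t_sum t_mult w(2) frob c(3))
 hence ta: "\<tau> a - a = \<nu>" by (simp add: a_def \<nu>_def sum.distrib distrib_left)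
 have \<nu>: "\<nu>\<in>N" unfolding \<nu>_def
  using c w(3) by (intro subring_add[OF RN] subring_sum[OF RN] subring_mult[OF RN] subring_power[OF RN]) auto
 have "\<tau> a - a\<in>S" unfolding ta using \<nu> s(6) by (rule subsetD[rotated])
 from regS[OF _ this] have aS: "a\<in>S" using aE unfolding a_def by simp
 obtain g where g: "g\<in>N" "\<tau> g - g = \<nu>"
  using projS[OF aS \<nu> subring_0[OF s(1)]] unfolding ta by (metis add_0_right mult_zero_right)
 have aN: "a\<in>N"
 proof -
  have "a - g\<in>FT" using aS g(1) s(3,4) NE by (intro subring_diff[OF subfield_subring[OF FT]]) auto
  moreover have "\<tau> (a - g) = a - g" using ta g(2) by (simp add: t_diff algebra_simps)
  ultimately have "a - g\<in>N" using const s(5) by blast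
  thus ?thesis using subring_add[OF RN _ g(1)] by (metis diff_add_cancel)
 qed
 define P where "P = monom 1 (p^n) + (\<Sum>k<n. monom (c k) (p^k)) - [:a:]"
 have "P\<in>pol N" unfolding P_def
  using c aN by (intro subring_diff[OF pol_subring[OF RN]] subring_add[OF pol_subring[OF RN]]
   subring_sum[OF pol_subring[OF RN]] pol_monom pol_const RN subring_1[OF RN]) auto
 moreover have "coeff P (p^n) = 1"
 proof -
  have "p^k~=p^n" if "k < n" for k using power_strict_increasing[OF that p] by simp
  hence "(\<Sum>k<n. coeff (monom (c k) (p^k)) (p^n)) = 0" by (intro sum.neutral) auto
  moreover have "coeff [:a:] (p^n) = 0" using p by (simp add: coeff_pCons split: nat.splits)
  ultimately show ?thesis by (simp add: P_def coeff_sum)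
 qed
 hence "P~=0" by auto
 moreover have "poly P w = 0" by (simp add: P_def poly_monom poly_sum a_def)
 ultimately show ?thesis using algebraic_iff_pol[OF N] by blast
qed

end

section \<open>Multiplicative relations\<close>

context diff_field
begin

text \<open>A bound for the group of multipliers of semi-invariants in \<open>M\<close>, written in terms of
  exponents.\<close>

definition exponents_in :: "(nat => 'a) => nat => 'a set => (nat => int) set => bool" where "exponents_in g l M L \<longleftrightarrow>
   (\<forall>c\<in>M. c~=0 --> (\<forall>e. \<tau> c = (\<Prod>i<l. g i powi e i) * c --> e\<in>L))"

text \<open>Adjoining a solution of a first order equation with multiplier \<open>\<Prod>i<l. g i powi f i\<close> changes the
  exponents by multiples of \<open>f\<close> and allows roots, so it preserves the inclusion into \<open>L\<close> under the
  following closure property.\<close>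

definition absorbs :: "(nat => int) set => (nat => int) => bool" where
 "absorbs L f \<longleftrightarrow> (\<forall>e m d. m\<ge>(1::nat) --> (\<lambda>i. int m * e i + d * f i)\<in>L --> e\<in>L)"

lemma powi_prod_power:
 fixes g :: "nat => 'a"
 assumes "\<And>i. i < l ==> g i~=0"
 shows "(\<Prod>i<l. g i powi e i)^m*(\<Prod>i<l. g i powi f i) powi d = (\<Prod>i<l. g i powi (int m * e i + d * f i))"
proof -
 have 1: "(\<Prod>i<l. g i powi f i) powi d = (\<Prod>i<l. (g i powi f i) powi d)"
  by (induction l) (simp_all add: power_int_mult_distrib)
 have "g i powi (int m * e i + d * f i) = (g i powi e i)^m*(g i powi f i) powi d" if "i < l" for i
  using assms[OF that] by (simp add: power_int_add power_int_mult mult.commute[of d] mult.commute[of "int m"])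
 thus ?thesis unfolding 1 by (simp add: prod.distrib flip: prod_power_distrib)
qed

lemma exponents_in_step: assumes M: "is_subfield M" "stab M" and g: "\<And>i. i < l ==> g i\<in>M \<and> g i~=0"
  and y: "\<tau> y = (\<Prod>i<l. g i powi f i) * y + b" "b\<in>M" and L: "absorbs L f" "exponents_in g l M L"
 shows "exponents_in g l (adjoin M {y}) L" unfolding exponents_in_def
proof (intro ballI impI allI)
 note R = subfield_subring[OF M(1)]
 have pw: "(\<Prod>i<l. g i powi h i)\<in>M" "(\<Prod>i<l. g i powi h i)~=0" for h
 proof -
  have "g i powi h i\<in>M" if "i < l" for i
   using g[OF that] subring_power[OF R] subfield_inverse[OF M(1)] by (simp add: power_int_def)
  thus "(\<Prod>i<l. g i powi h i)\<in>M" by (intro subring_prod[OF R]) auto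
  show "(\<Prod>i<l. g i powi h i)~=0" using g by auto
 qed
 fix c e assume c: "c\<in>adjoin M {y}" "c~=0" "\<tau> c = (\<Prod>i<l. g i powi e i) * c"
 obtain c' m d where "c'\<in>M" "c'~=0" "m\<ge>1" "\<tau> c' = (\<Prod>i<l. g i powi e i)^m*(\<Prod>i<l. g i powi f i) powi d * c'"
  using semi_invariant_peel[OF M y(1) pw y(2) c(1,2) pw c(3)] by blast
 moreover have "(\<Prod>i<l. g i powi e i)^m*(\<Prod>i<l. g i powi f i) powi d = (\<Prod>i<l. g i powi (int m * e i + d * f i))"
  using g by (intro powi_prod_power) auto
 ultimately have "(\<lambda>i. int m * e i + d * f i)\<in>L" using L(2) unfolding exponents_in_def by metis
 thus "e\<in>L" using L(1) \<open>m \<ge> 1\<close> unfolding absorbs_def by blast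
qed

lemma exponents_in_list: assumes M: "is_subfield M" "stab M" and g: "\<And>i. i < l ==> g i\<in>M \<and> g i~=0"
  and L: "exponents_in g l M L" and y: "\<And>j. j < length ys ==> \<exists>f b. \<tau> (ys ! j) = (\<Prod>i<l. g i powi f i)*(ys ! j) + b \<and>
       b\<in>adjoin M (set (take j ys)) \<and> absorbs L f"
 shows "stab (adjoin M (set ys)) \<and> exponents_in g l (adjoin M (set ys)) L" using y
proof (induction ys rule: rev_induct)
 case Nil thus ?case using M L by (simp add: adjoin_same)
next case (snoc y ys)
 define N where "N = adjoin M (set ys)"
 have "stab N \<and> exponents_in g l N L" unfolding N_def
 proof (rule snoc.IH)
  fix j assume "j < length ys"
  thus "\<exists>f b. \<tau> (ys ! j) = (\<Prod>i<l. g i powi f i)*(ys ! j) + b \<and> b\<in>adjoin M (set (take j ys)) \<and> absorbs L f"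
   using snoc.prems[of j] by (simp add: nth_append)
 qed
 hence N: "is_subfield N" "stab N" "exponents_in g l N L" by (auto simp: N_def adjoin_subfield)
 obtain f b where f: "\<tau> y = (\<Prod>i<l. g i powi f i) * y + b" "b\<in>N" "absorbs L f"
  using snoc.prems[of "length ys"] by (auto simp: N_def)
 have g': "g i\<in>N \<and> g i~=0" if "i < l" for i
  using g[OF that] subsetD[OF adjoin_base, of "g i" M "set ys"] by (simp add: N_def)
 have "g i powi f i\<in>N" if "i < l" for i
  using g'[OF that] subring_power[OF subfield_subring[OF N(1)]] subfield_inverse[OF N(1)] by (simp add: power_int_def)
 hence "(\<Prod>i<l. g i powi f i)\<in>N" by (intro subring_prod[OF subfield_subring[OF N(1)]]) auto
 hence "\<tau> y\<in>adjoin N {y}" unfolding f(1)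
  using subsetD[OF adjoin_base[of N "{y}"]] subsetD[OF adjoin_gens[of "{y}" N], of y] f(2)
  by (intro subring_add[OF subfield_subring[OF adjoin_subfield]] subring_mult[OF subfield_subring[OF adjoin_subfield]]) auto
 hence "stab (adjoin N {y})" by (intro stab_adjoin N)
 moreover have "exponents_in g l (adjoin N {y}) L" by (rule exponents_in_step[OF N(1,2) g' f N(3)])
 moreover have "adjoin N {y} = adjoin M (set (ys @ [y]))" by (simp add: N_def adjoin_Un Un_commute)
 ultimately show ?case by simp
qed

end

section \<open>The difference field of Laurent series\<close>

context C_inf_l
begin

definition rl :: "'c => 'c" where "rl = rt ^^ l"

lemma rl_add: "rl (x + y) = rl x + rl y"
proof -
 have "(rt ^^ m) (x + y) = (rt ^^ m) x + (rt ^^ m) y" for m by (induction m) (simp_all add: rt_add)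
 thus ?thesis by (simp add: rl_def)
qed

lemma rl_mult: "rl (x * y) = rl x * rl y"
proof -
 have "(rt ^^ m) (x * y) = (rt ^^ m) x*(rt ^^ m) y" for m by (induction m) (simp_all add: rt_mult)
 thus ?thesis by (simp add: rl_def)
qed

lemma rl_0 [simp]: "rl 0 = 0"
proof -
 have "(rt ^^ m) 0 = 0" for m by (induction m) simp_all
 thus ?thesis by (simp add: rl_def)
qed

lemma rl_1 [simp]: "rl 1 = 1"
proof -
 have "(rt ^^ m) 1 = 1" for m by (induction m) simp_all
 thus ?thesis by (simp add: rl_def)
qed

lemma rl_pow: "rl x^(q^l) = x" unfolding rl_def by (rule rtn_pow)

lemma rl_eq_0 [simp]: "rl x = 0 \<longleftrightarrow> x = 0"
proof
 assume "rl x = 0"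
 hence "x = 0^(q^l)" using rl_pow[of x] by simp
 also have "... = 0" using q_ge2 by (intro zero_power zero_less_power) simp
 finally show "x = 0" .
qed simp

lemma rl_sum: "rl (sum f A) = (\<Sum>i\<in>A. rl (f i))" by (induction A rule: infinite_finite_induct) (simp_all add: rl_add)

lemma rl_fixed_Fc: "rl x = x ==> x\<in>Fc" using rl_pow[of x] by (simp add: Fc_def)

definition tau :: "'c fls => 'c fls" where "tau f = Abs_fls (\<lambda>n. rl (fls_nth f n))"

lemma tau_nth [simp]: "fls_nth (tau f) n = rl (fls_nth f n)"
proof -
 have "\<forall>\<^sub>\<infinity>n. fls_nth f (- int n) = 0" by (rule MOST_fls_neg_nth_eq_0)
 hence "\<forall>\<^sub>\<infinity>n. rl (fls_nth f (- int n)) = 0" by (rule MOST_mono) simp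
 thus ?thesis by (simp add: tau_def)
qed

lemma tau_fps: "tau (fps_to_fls f) = fps_to_fls ((sg ^^ l) f)" by (rule fls_eqI) (simp add: sgn_nth rl_def[symmetric])

lemma tau_subdegree: "fls_subdegree (tau f) = fls_subdegree f"
proof (cases "f = 0")
 case True hence "tau f = 0" by (intro fls_eqI) simp thus ?thesis using True by simp
next case False thus ?thesis by (intro fls_subdegree_eqI) auto
qed

lemma tau_add: "tau (f + g) = tau f + tau g" by (rule fls_eqI) (simp add: rl_add)

lemma tau_mult: "tau (f * g) = tau f * tau g"
 by (rule fls_eqI) (simp add: fls_times_nth(2) tau_subdegree rl_sum rl_mult)

lemma tau_1: "tau 1 = 1" by (rule fls_eqI) simp

lemma tau_0: "tau 0 = 0" by (rule fls_eqI) simp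

lemma tau_eq_0: "tau f = 0 \<longleftrightarrow> f = 0" by (metis fls_eqI fls_zero_nth rl_eq_0 tau_nth)

lemma tau_divide: "tau (f/g) = tau f/tau g"
proof (cases "g = 0")
 case False hence "tau (f/g) * tau g = tau f" by (simp flip: tau_mult)
 moreover have "tau g~=0" using False by (simp add: tau_eq_0)
 ultimately show ?thesis by (simp add: nonzero_eq_divide_eq)
qed (simp add: tau_0)

lemma PB_sgn: "x\<in>PB ==> (sg ^^ n) x\<in>PB" by (induction n) (simp_all add: PB_sg)

lemma tau_KK: "x\<in>KK ==> tau x\<in>KK"
proof -
 assume "x\<in>KK"
 then obtain a b where "a\<in>PB" "b\<in>PB" "x = fps_to_fls a/fps_to_fls b" unfolding KK_def fracs_def by blast
 hence "tau x = fps_to_fls ((sg ^^ l) a)/fps_to_fls ((sg ^^ l) b)" "(sg ^^ l) a\<in>PB" "(sg ^^ l) b\<in>PB"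
  using PB_sgn by (simp_all add: tau_divide tau_fps)
 thus ?thesis unfolding KK_def fracs_def by blast
qed

lemma PB_const: "a\<in>BB ==> fps_const a\<in>PB"
 using PB_I[OF pol_const[OF BB_subring], of a] fps_of_poly_const[of a] by metis

lemma PB_X: "fps_X\<in>PB"
proof -
 have "[:0, 1:]\<in>pol BB" by (intro pol_pCons pol_0 BB_subring subring_0 subring_1)
 thus ?thesis using PB_I by fastforce
qed

text \<open>The radius exceeds \<open>v \<theta> = q\<close>, so that evaluation at \<open>\<theta>\<close> makes sense, but stays below \<open>q ^ q\<close>, the
  absolute value of the first pole of the Anderson--Thakur series.\<close>

definition RR :: real where "RR = 3 * real q/2"

lemma RR: "RR > v \<theta>" "RR > 1" "RR\<ge>0" "RR\<le>real q^q"
proof -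
 have q2: "real q\<ge>2" using q_ge2 by simp
 show "RR > v \<theta>" "RR > 1" "RR\<ge>0" using q2 v_theta by (simp_all add: RR_def)
 have "real q*2\<le>real q * real q" using q2 by (intro mult_left_mono) auto
 also have "... = real q^2" by (simp add: power2_eq_square)
 also have "...\<le>real q^q" using q_ge2 q2 by (intro power_increasing) auto
 finally show "RR\<le>real q^q" using q2 by (simp add: RR_def)
qed

definition FT :: "'c fls set" where "FT = fracs (fps_to_fls`{f. bdd RR f})"

lemma FT_subfield: "is_subfield FT" unfolding FT_def by (intro fracs_subfield fps_to_fls_subring bdd_subring RR)

lemma bdd_FT: "bdd RR f ==> fps_to_fls f\<in>FT"
 unfolding FT_def by (rule subsetD[OF fracs_base[OF fps_to_fls_subring[OF bdd_subring]]]) (auto simp: RR)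

lemma PB_bdd: "f\<in>PB ==> bdd RR f" by (auto simp: PB_def intro: bdd_poly RR)

lemma KK_FT: "KK\<subseteq>FT" unfolding KK_def FT_def fracs_def using PB_bdd by blast

text \<open>If \<open>f = g * c\<close> with \<open>f\<close> and \<open>g\<close> convergent on a disc of radius larger than 1 and \<open>c\<close> with coefficients in
  the finite field, then \<open>c\<close> is rational. Let \<open>i\<^sub>0\<close> be the last index at which the coefficients of
  \<open>g\<close> attain their maximal absolute value \<open>M\<close>. Comparison of coefficients shows that
  \<open>\<Sum>i\<le>i\<^sub>0. g\<^sub>i * c\<^sub>n\<^sub>-\<^sub>i\<close> is smaller than \<open>M\<close> from some place on. After the reduction of the \<open>g\<^sub>i\<close> to
  those which are linearly independent over the finite field modulo elements smaller than \<open>M\<close>,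
  this is a linear recurrence for \<open>c\<close>.\<close>

lemma bdd_eventually_small: assumes "bdd R f" "R > 1" "e > 0" shows "\<exists>N. \<forall>n\<ge>N. v (fps_nth f n) < e"
proof -
 obtain C where C: "nb R C f" using assms(1) by (auto simp: bdd_def)
 have "(\<lambda>n. C*(1/R)^n) \<longlonglongrightarrow> C*0" using assms(2) by (intro tendsto_mult tendsto_const LIMSEQ_power_zero) simp
 hence "\<forall>\<^sub>F n in sequentially. C*(1/R)^n < e" using assms(3) by (intro order_tendstoD) auto
 moreover have "v (fps_nth f n)\<le>C*(1/R)^n" for n using nbD[OF C, of n] assms(2) by (simp add: field_simps)
 ultimately show ?thesis unfolding eventually_sequentially by (meson le_less_trans)
qed

lemma last_maximal_coeff: assumes g: "bdd R g" "R > 1" "g~=0"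
 obtains i0 D where "v (fps_nth g i0) > D" "D\<ge>0" "\<And>i. i\<le>i0 ==> v (fps_nth g i)\<le>v (fps_nth g i0)"
  "\<And>i. i > i0 ==> v (fps_nth g i)\<le>D"
proof -
 let ?g = "\<lambda>i. v (fps_nth g i)"
 obtain j where j: "fps_nth g j~=0" using g(3) fps_nonzero_nth by blast
 have vj: "?g j > 0" using j nonneg[of "fps_nth g j"] eq_0_iff[of "fps_nth g j"] by linarith
 obtain N where N: "\<forall>n\<ge>N. ?g n < ?g j/2" using bdd_eventually_small[OF g(1,2), of "?g j/2"] vj by auto
 have jN: "j < N" using N vj by (metis field_sum_of_halves not_le less_add_same_cancel1 half_gt_zero not_less_iff_gr_or_eq less_trans)
 define M where "M = Max (?g`{..<N})"
 have M: "?g i\<le>M" if "i < N" for i unfolding M_def using that by (intro Max_ge) auto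
 have "M\<in>?g`{..<N}" unfolding M_def using jN by (intro Max_in) auto
 hence I: "{i. i < N \<and> ?g i = M}~={}" "finite {i. i < N \<and> ?g i = M}" by auto
 define i0 where "i0 = Max {i. i < N \<and> ?g i = M}"
 have i0: "i0 < N" "?g i0 = M" using Max_in[OF I(2,1)] by (auto simp: i0_def)
 have lt: "?g i < M" if "i > i0" "i < N" for i
 proof -
  have "i\<le>i0" if "?g i = M" unfolding i0_def using I(2) that \<open>i < N\<close> by (intro Max_ge) auto
  thus ?thesis using M[OF that(2)] that(1) by fastforce
 qed
 have jM: "?g j\<le>M" by (rule M[OF jN])
 define D where "D = Max (insert (?g j/2) (?g`{i0<..<N}))"
 have "D < M" unfolding D_def using lt jM vj by (subst Max_less_iff) auto
 moreover have "D\<ge>?g j/2" unfolding D_def by (intro Max_ge) auto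
 moreover have "?g i\<le>D" if "i > i0" for i
 proof (cases "i < N")
  case True thus ?thesis unfolding D_def using that by (intro Max_ge) auto
 next case False thus ?thesis using N \<open>D \<ge> _\<close> by (meson less_imp_le not_le order_trans)
 qed
 moreover have "?g i\<le>?g i0" if "i\<le>i0" for i using M[of i] i0 that by simp
 ultimately show thesis using that[of D i0] i0(2) vj by simp
qed

lemma v_sum_less: "0 < C ==> (\<And>i. i\<in>A ==> v (f i) < C) ==> v (sum f A) < C"
proof (induction A rule: infinite_finite_induct)
 case (insert i A) thus ?case using ultrametric[of "f i" "sum f A"] by fastforce
qed simp_all

lemma quotient_recurrence: assumes g: "bdd R g" "R > 1" "g~=0" and cg: "bdd R (g * c)" and c: "\<And>n. fps_nth c n\<in>Fc"
 shows "\<exists>p\<in>pol Fc. p~=0 \<and> (\<exists>n1. \<forall>n\<ge>n1. fps_nth (fps_of_poly p * c) n = 0)"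
proof -
 let ?c = "fps_nth c" and ?g = "fps_nth g"
 note RF = subfield_subring[OF Fc_subfield]
 have vc: "v x\<le>1" if "x\<in>Fc" for x using v_Fc[OF that] by (cases "x = 0") auto
 obtain i0 D where D: "v (?g i0) > D" "D\<ge>0" "\<And>i. i > i0 ==> v (?g i)\<le>D" using last_maximal_coeff[OF g] by metis
 define M where "M = v (?g i0)"
 have M: "M > 0" using D by (simp add: M_def)
 obtain N1 where N1: "\<forall>n\<ge>N1. v (fps_nth (g * c) n) < M" using bdd_eventually_small[OF cg g(2) M] by blast
 have vcg: "v (x * y) < C" if "x\<in>Fc" "v y < C" for x y C
  using mult_right_mono[OF vc[OF that(1)] nonneg[of y]] that(2) by (simp add: mult)
 have small: "v (\<Sum>i\<le>i0. ?c (n - i) * ?g i) < M" if "n\<ge>max N1 i0" for n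
 proof -
  have "{0..n} = {..i0}\<union>{i0<..n}" "{..i0}\<inter>{i0<..n} = {}" using that by auto
  hence "fps_nth (g * c) n = (\<Sum>i\<le>i0. ?c (n - i) * ?g i) + (\<Sum>i\<in>{i0<..n}. ?c (n - i) * ?g i)"
   unfolding fps_mult_nth by (simp add: sum.union_disjoint mult.commute)
  hence eq: "(\<Sum>i\<le>i0. ?c (n - i) * ?g i) = fps_nth (g * c) n - (\<Sum>i\<in>{i0<..n}. ?c (n - i) * ?g i)" by simp
  have "v (\<Sum>i\<in>{i0<..n}. ?c (n - i) * ?g i) < M" using D by (intro v_sum_less M vcg c) (force simp: M_def)
  thus ?thesis unfolding eq using N1 that by (intro le_less_trans[OF v_diff]) auto
 qed
 define ind where "ind T \<longleftrightarrow> (\<forall>a. (\<forall>i\<in>T. a i\<in>Fc) \<and> v (\<Sum>i\<in>T. a i * ?g i) < M --> (\<forall>i\<in>T. a i = 0))" for T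
 define TT where "TT = {T. T\<subseteq>{..i0} \<and> i0\<in>T \<and> ind T}"
 have "a = 0" if "a\<in>Fc" "v (a * ?g i0) < M" for a using that v_Fc[of a] by (cases "a = 0") (simp_all add: mult M_def)
 hence "{i0}\<in>TT" by (simp add: TT_def ind_def)
 moreover have "finite TT" by (rule finite_subset[of _ "Pow {..i0}"]) (auto simp: TT_def)
 ultimately obtain T where "T\<in>TT" and max: "\<And>S. S\<in>TT ==> T\<subseteq>S ==> T = S"
  using finite_has_maximal2[of TT "{i0}"] by metis
 hence T: "T\<subseteq>{..i0}" "i0\<in>T" "ind T" by (auto simp: TT_def)
 have finT: "finite T" using T(1) finite_subset by blast
 define U where "U = {..i0} - T"
 have "\<exists>b. (\<forall>i\<in>T. b i\<in>Fc) \<and> v (?g k - (\<Sum>i\<in>T. b i * ?g i)) < M" if k: "k\<in>U" for k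
 proof -
  have "insert k T\<notin>TT" using max[of "insert k T"] k by (auto simp: U_def)
  hence "\<not> ind (insert k T)" using T k by (auto simp: TT_def U_def)
  then obtain a where a: "\<forall>i\<in>insert k T. a i\<in>Fc" "v (\<Sum>i\<in>insert k T. a i * ?g i) < M" "\<not> (\<forall>i\<in>insert k T. a i = 0)"
   unfolding ind_def by blast
  have s: "(\<Sum>i\<in>insert k T. a i * ?g i) = a k * ?g k + (\<Sum>i\<in>T. a i * ?g i)" using finT k by (simp add: U_def)
  have ak: "a k~=0"
  proof
   assume z: "a k = 0"
   hence "\<forall>i\<in>T. a i = 0" using T(3) a(1,2) unfolding ind_def s by simp
   thus False using a(3) z by simp
  qed
  have ik: "inverse (a k)\<in>Fc" using a(1) subfield_inverse[OF Fc_subfield] by simp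
  have "v (inverse (a k)*(a k * ?g k + (\<Sum>i\<in>T. a i * ?g i))) < M" using vcg[OF ik a(2)] unfolding s .
  moreover have "inverse (a k)*(a k * ?g k + (\<Sum>i\<in>T. a i * ?g i)) = ?g k - (\<Sum>i\<in>T. - (inverse (a k) * a i) * ?g i)"
   using ak by (simp add: distrib_left sum_distrib_left sum_negf mult.assoc)
  moreover have "\<forall>i\<in>T. - (inverse (a k) * a i)\<in>Fc" using a(1) ik subring_uminus[OF RF] subring_mult[OF RF] by simp
  ultimately show ?thesis by (intro exI[of _ "\<lambda>i. - (inverse (a k) * a i)"]) simp
 qed
 then obtain b where b: "\<And>k i. k\<in>U ==> i\<in>T ==> b k i\<in>Fc" "\<And>k. k\<in>U ==> v (?g k - (\<Sum>i\<in>T. b k i * ?g i)) < M" by metis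
 have finU: "finite U" by (simp add: U_def)
 have rec: "?c (n - i0) + (\<Sum>k\<in>U. b k i0 * ?c (n - k)) = 0" if n: "n\<ge>max N1 i0" for n
 proof -
  define x where "x i = ?c (n - i) + (\<Sum>k\<in>U. b k i * ?c (n - k))" for i
  have "{..i0} = T\<union>U" "T\<inter>U = {}" using T(1) by (auto simp: U_def)
  hence "(\<Sum>i\<le>i0. ?c (n - i) * ?g i) = (\<Sum>i\<in>T. ?c (n - i) * ?g i) + (\<Sum>k\<in>U. ?c (n - k) * ?g k)"
   using finT finU by (simp add: sum.union_disjoint)
  moreover have "(\<Sum>i\<in>T. x i * ?g i) = (\<Sum>i\<in>T. ?c (n - i) * ?g i) + (\<Sum>k\<in>U. ?c (n - k)*(\<Sum>i\<in>T. b k i * ?g i))"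
   unfolding x_def distrib_right sum.distrib sum_distrib_left sum_distrib_right
   by (subst (2) sum.swap) (simp add: ac_simps)
  ultimately have "(\<Sum>i\<in>T. x i * ?g i) = (\<Sum>i\<le>i0. ?c (n - i) * ?g i) - (\<Sum>k\<in>U. ?c (n - k)*(?g k - (\<Sum>i\<in>T. b k i * ?g i)))"
   by (simp add: right_diff_distrib sum_subtractf)
  moreover have "v (\<Sum>k\<in>U. ?c (n - k)*(?g k - (\<Sum>i\<in>T. b k i * ?g i))) < M" by (intro v_sum_less M vcg c b)
  ultimately have "v (\<Sum>i\<in>T. x i * ?g i) < M" using small[OF n] by (simp only:) (intro le_less_trans[OF v_diff], simp)
  moreover have "\<forall>i\<in>T. x i\<in>Fc" unfolding x_def
   by (intro ballI subring_add[OF RF] subring_sum[OF RF] subring_mult[OF RF] c b)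
  ultimately have "x i0 = 0" using T(2,3) unfolding ind_def by blast
  thus ?thesis by (simp add: x_def)
 qed
 define p where "p = monom 1 i0 + (\<Sum>k\<in>U. monom (b k i0) k)"
 have "p\<in>pol Fc" unfolding p_def
  by (intro subring_add[OF pol_subring] subring_sum[OF pol_subring] pol_monom RF subring_1 b T(2))
 moreover have "coeff p i0 = 1" using T(2) by (simp add: p_def coeff_sum U_def)
 hence "p~=0" by auto
 moreover have "fps_nth (fps_of_poly p * c) n = 0" if n: "n\<ge>max N1 i0" for n
 proof -
  have "k\<le>i0" if "k\<in>U" for k using that by (simp add: U_def)
  hence "fps_nth (fps_of_poly p * c) n = ?c (n - i0) + (\<Sum>k\<in>U. b k i0 * ?c (n - k))"
   using n unfolding p_def fps_of_poly_add fps_of_poly_sum fps_of_poly_monom distrib_right sum_distrib_right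
   by (force simp: fps_sum_nth mult.assoc fps_X_power_mult_nth intro!: sum.cong)
  thus ?thesis using rec[OF n] by simp
 qed
 ultimately show ?thesis by blast
qed

lemma quotient_rational: assumes g: "bdd R g" "R > 1" "g~=0" and cg: "bdd R (g * c)" and c: "\<And>n. fps_nth c n\<in>Fc"
 shows "fps_to_fls c\<in>KK"
proof -
 note RF = subfield_subring[OF Fc_subfield]
 obtain p n1 where p: "p\<in>pol Fc" "p~=0" "\<forall>n\<ge>n1. fps_nth (fps_of_poly p * c) n = 0"
  using quotient_recurrence[OF g cg c] by blast
 define r where "r = Poly (map (fps_nth (fps_of_poly p * c)) [0..<n1])"
 have eq: "fps_of_poly r = fps_of_poly p * c"
 proof (rule fps_ext)
  fix n show "fps_nth (fps_of_poly r) n = fps_nth (fps_of_poly p * c) n"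
   using p(3) by (cases "n < n1") (auto simp: r_def nth_default_def)
 qed
 have "coeff r n\<in>Fc" for n
 proof -
  have "coeff r n = fps_nth (fps_of_poly p * c) n" using arg_cong[OF eq, of "\<lambda>f. fps_nth f n"] by simp
  thus ?thesis unfolding fps_mult_nth fps_of_poly_nth
   by (simp only:) (intro subring_sum[OF RF] subring_mult[OF RF] polD[OF p(1)] c)
 qed
 hence "r\<in>pol Fc" by (rule polI)
 hence PB: "fps_of_poly r\<in>PB" "fps_of_poly p\<in>PB" using p(1) pol_mono[OF BB_Fc] PB_I by blast+
 have "fps_to_fls (fps_of_poly p)~=0" using p(2) by simp
 moreover have "fps_to_fls (fps_of_poly r) = fps_to_fls (fps_of_poly p) * fps_to_fls c"
  by (simp add: eq fps_to_fls_mult)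
 ultimately have "fps_to_fls c = fps_to_fls (fps_of_poly r)/fps_to_fls (fps_of_poly p)" by (simp add: field_simps)
 thus ?thesis unfolding KK_def fracs_def using PB by blast
qed

lemma constants_rational: assumes "x\<in>FT" "tau x = x" shows "x\<in>KK"
proof (cases "x = 0")
 case True thus ?thesis using subring_0[OF subfield_subring[OF KK_subfield]] by simp
next case False
 obtain f g where fg: "bdd RR f" "bdd RR g" "x = fps_to_fls f/fps_to_fls g"
  using assms(1) unfolding FT_def fracs_def by blast
 have g0: "g~=0" using False fg(3) by auto
 have xF: "fls_nth x n\<in>Fc" for n using rl_fixed_Fc assms(2) by (metis tau_nth)
 define k where "k = nat (- fls_subdegree x)"
 define c where "c = fls_regpart (fls_shift (- int k) x)"
 have c: "fps_to_fls c = fls_X^k * x"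
 proof -
  have "0\<le>fls_subdegree (fls_shift (- int k) x)" using False by (simp add: k_def)
  thus ?thesis unfolding c_def by (simp add: fls_X_power_times_conv_shift fls_regpart_to_fls_trivial)
 qed
 have X: "fls_X^k = fps_to_fls (fps_X^k :: 'c fps)" by (simp add: fps_to_fls_pow)
 have "fps_to_fls (g * c) = fps_to_fls (fps_X^k * f)" using g0 by (simp add: fps_to_fls_mult c fg(3) X)
 hence "g * c = fps_X^k * f" by (simp only: fps_to_fls_eq_iff)
 hence "bdd RR (g * c)" by (simp add: bdd_mult bdd_power bdd_X RR fg)
 moreover have "fps_nth c n\<in>Fc" for n unfolding c_def using xF by simp
 ultimately have "fps_to_fls c\<in>KK" by (intro quotient_rational[OF fg(2) RR(2) g0])
 moreover have "fls_X^k\<in>KK" unfolding X by (intro PB_KK subring_power[OF PB_subring] PB_X)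
 moreover have "(fls_X :: 'c fls)^k~=0" by simp
 hence "x = fps_to_fls c/fls_X^k" unfolding c by (rule nonzero_mult_div_cancel_left[symmetric])
 ultimately show ?thesis using subfield_divide[OF KK_subfield] by metis
qed

end

sublocale C_inf_l \<subseteq> df: diff_field tau KK FT by unfold_locales
  (simp_all add: tau_add tau_mult tau_1 KK_subfield tau_KK FT_subfield KK_FT constants_rational prime_char)

section \<open>Divisors of rational functions\<close>

lemma order_mult_coprime:
 fixes r :: "'a::field poly"
 assumes "poly r x~=0" shows "order x ([:- x, 1:]^n * r) = n"
proof -
 have "[:- x, 1:]^n * r~=0" using assms by auto
 thus ?thesis using assms by (simp add: order_mult order_power_n_n order_0I)
qed

context C_inf_l
begin

lemma map_rt_mult: "map_poly rt (p * r) = map_poly rt p * map_poly rt r"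
proof -
 have "fps_of_poly (map_poly rt (p * r)) = fps_of_poly (map_poly rt p * map_poly rt r)"
  by (simp add: sg_poly[symmetric] fps_of_poly_mult sg_mult)
 thus ?thesis by simp
qed

lemma map_rt_power: "map_poly rt (p^n) = map_poly rt p^n" by (induction n) (simp_all add: map_rt_mult)

lemma poly_map_rt: "poly (map_poly rt p) (rt x) = rt (poly p x)"
 by (induction p) (simp_all add: map_poly_pCons rt_add rt_mult)

lemma order_map_rt: assumes "p~=0" shows "order (rt x) (map_poly rt p) = order x p"
proof -
 obtain r where r: "p = [:- x, 1:]^order x p * r" "\<not> [:- x, 1:] dvd r" using order_decomp[OF assms] by blast
 have "map_poly rt p = [:- rt x, 1:]^order x p * map_poly rt r"
  by (subst r(1)) (simp add: map_rt_mult map_rt_power map_poly_pCons rt_uminus)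
 moreover have "poly (map_poly rt r) (rt x)~=0" using r(2) by (simp add: poly_map_rt poly_eq_0_iff_dvd)
 ultimately show ?thesis by (simp add: order_mult_coprime)
qed

lemma order_map_rtn: "p~=0 ==> order x ((map_poly rt ^^ n) p) = order (x^(q^n)) p"
proof (induction n arbitrary: x)
 case (Suc n)
 have "(map_poly rt ^^ n) p~=0" using Suc.prems degree_map_poly_rtn by (induction n) (simp_all add: map_poly_eq_0_iff)
 from order_map_rt[OF this, of "x^q"] show ?case using Suc by (simp flip: power_mult)
qed simp

definition lin :: "nat => 'c fls" where "lin i = fps_to_fls (fps_of_poly [:- th i, 1:])"

lemma lin_KK: "lin i\<in>KK" and lin_0: "lin i~=0"
proof -
 have "[:- th i, 1:]\<in>pol BB" by (intro pol_pCons pol_0 BB_subring subring_1 subring_uminus BB_th)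
 thus "lin i\<in>KK" unfolding lin_def by (intro PB_KK PB_I)
 have "fps_nth (fps_of_poly [:- th i, 1:]) 1~=0" by simp
 hence "fps_of_poly [:- th i, 1:]~=0" by (metis fps_zero_nth)
 thus "lin i~=0" by (simp add: lin_def)
qed

lemma order_prod_lin: "order x (\<Prod>i<l. [:- th i, 1:]^n i) = (\<Sum>i<l. if th i = x then n i else 0)"
proof -
 have nz: "(\<Prod>i<m. [:- th i, 1:]^n i)~=0" for m by simp
 have ord: "order x ([:- th i, 1:]^k) = (if th i = x then k else 0)" for i k
 proof (cases "th i = x")
  case True thus ?thesis using order_power_n_n[of "th i" k] by simp
 next case False thus ?thesis by (simp add: order_0I)
 qed
 have "order x (\<Prod>i<m. [:- th i, 1:]^n i) = (\<Sum>i<m. if th i = x then n i else 0)" for m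
 proof (induction m)
  case (Suc m)
  have "order x ((\<Prod>i<m. [:- th i, 1:]^n i) * [:- th m, 1:]^n m) =
    order x (\<Prod>i<m. [:- th i, 1:]^n i) + order x ([:- th m, 1:]^n m)"
   by (rule order_mult) (use nz[of "Suc m"] in simp)
  thus ?case using Suc ord by (simp only: prod.lessThan_Suc sum.lessThan_Suc)
 qed (simp add: order_0I)
 thus ?thesis .
qed

text \<open>The divisor of \<open>tau c / c\<close> has degree 0 on every orbit of \<open>x \<mapsto> x ^ (q ^ l)\<close>, and the points
  \<open>th i\<close> with \<open>i < l\<close> lie on different orbits.\<close>

lemma rational_exponents_trivial: "df.exponents_in lin l KK {e. \<forall>i<l. e i = 0}" unfolding df.exponents_in_def
proof (intro ballI impI allI CollectI)
 fix c and e :: "nat => int" and j assume c: "c\<in>KK" "c~=0" "tau c = (\<Prod>i<l. lin i powi e i) * c" and j: "j < l"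
 obtain f g where fg: "c = fps_to_fls (fps_of_poly f)/fps_to_fls (fps_of_poly g)"
  using c(1) unfolding KK_def fracs_def PB_def by blast
 have f0: "f~=0" and g0: "g~=0" using c(2) fg by auto
 define T where "T = (map_poly rt ^^ l)"
 have tT: "tau (fps_to_fls (fps_of_poly p)) = fps_to_fls (fps_of_poly (T p))" for p
  by (simp add: tau_fps sgn_poly T_def)
 have T0: "T p~=0" if "p~=0" for p
 proof
  assume "T p = 0"
  hence "fps_to_fls (fps_of_poly p) = 0" using tT[of p] by (simp add: tau_eq_0)
  thus False using that by simp
 qed
 define A where "A = (\<Prod>i<l. [:- th i, 1:]^nat (e i))"
 define B where "B = (\<Prod>i<l. [:- th i, 1:]^nat (- e i))"
 have AB0: "A~=0" "B~=0" by (simp_all add: A_def B_def)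
 have FA: "fps_to_fls (fps_of_poly (\<Prod>i<l. [:- th i, 1:]^n i)) = (\<Prod>i<l. lin i^n i)" for n
  by (simp add: fps_of_poly_prod fps_to_fls_prod fps_of_poly_power fps_to_fls_pow lin_def)
 have "lin i powi e i * lin i^nat (- e i) = lin i^nat (e i)" for i
  using lin_0[of i] by (cases "e i\<ge>0") (simp_all add: power_int_def field_simps)
 hence pe: "(\<Prod>i<l. lin i powi e i) * fps_to_fls (fps_of_poly B) = fps_to_fls (fps_of_poly A)"
  by (simp add: A_def B_def FA flip: prod.distrib)
 have nz: "fps_to_fls (fps_of_poly p)~=0" if "p~=0" for p :: "'c poly" using that by simp
 have "fps_to_fls (fps_of_poly (T f))/fps_to_fls (fps_of_poly (T g)) =
   (\<Prod>i<l. lin i powi e i)*(fps_to_fls (fps_of_poly f)/fps_to_fls (fps_of_poly g))"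
  using c(3) by (simp add: fg tau_divide tT)
 hence "fps_to_fls (fps_of_poly (T f)) * fps_to_fls (fps_of_poly g) =
   (\<Prod>i<l. lin i powi e i) * fps_to_fls (fps_of_poly f) * fps_to_fls (fps_of_poly (T g))"
  using nz[OF g0] nz[OF T0[OF g0]] by (simp add: divide_simps)
 hence "fps_to_fls (fps_of_poly (T f)) * fps_to_fls (fps_of_poly g) * fps_to_fls (fps_of_poly B) =
   fps_to_fls (fps_of_poly A) * fps_to_fls (fps_of_poly f) * fps_to_fls (fps_of_poly (T g))" by (simp flip: pe)
 hence "fps_to_fls (fps_of_poly (T f * g * B)) = fps_to_fls (fps_of_poly (A * f * T g))"
  by (simp add: fps_of_poly_mult fps_to_fls_mult)
 hence eq: "T f * g * B = A * f * T g" by (simp only: fps_to_fls_eq_iff fps_of_poly_eq_iff)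
 define D where "D x = int (order x f) - int (order x g)" for x
 have oT: "order x (T p) = order (x^(q^l)) p" if "p~=0" for x p unfolding T_def by (rule order_map_rtn[OF that])
 have DD: "D (x^(q^l)) - D x = (\<Sum>i<l. if th i = x then e i else 0)" for x
 proof -
  have "order x (T f * g * B) = order x (A * f * T g)" by (simp add: eq)
  hence "order (x^(q^l)) f + order x g + order x B = order x A + order x f + order (x^(q^l)) g"
   using f0 g0 T0 AB0 by (simp add: order_mult oT)
  hence "D (x^(q^l)) - D x = int (order x A) - int (order x B)" by (simp add: D_def)
  also have "... = (\<Sum>i<l. if th i = x then e i else 0)"
   unfolding A_def B_def order_prod_lin by (simp flip: sum_subtractf) (intro sum.cong, auto)
  finally show ?thesis .
 qed
 have "{x. D x~=0}\<subseteq>{x. poly f x = 0}\<union>{x. poly g x = 0}" using f0 g0 by (auto simp: D_def order_root)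
 hence fin: "finite {x. D x~=0}" by (rule finite_subset) (simp add: poly_roots_finite f0 g0)
 have const0: "D (x 0) = 0" if "inj x" "\<And>m. D (x (Suc m)) = D (x m)" for x :: "nat => 'c"
 proof -
  have "infinite (range x)" using that(1) by (simp add: range_inj_infinite)
  then obtain m where "D (x m) = 0" using fin finite_subset[of "range x" "{x. D x~=0}"] by blast
  moreover have "D (x m) = D (x 0)" by (induction m) (simp_all add: that(2))
  ultimately show ?thesis by simp
 qed
 have "D (th (j + l*0)) = 0"
 proof (rule const0[of "\<lambda>m. th (j + l * m)"])
  show "inj (\<lambda>m. th (j + l * m))"
  proof (rule injI)
   fix m n assume "th (j + l * m) = th (j + l * n)"
   from injD[OF th_inj this] show "m = n" using l_pos by simp
  qed
  fix m
  have "th (j + l * Suc m)^(q^l) = th (j + l * m)" using th_add_pow[of "j + l * m" l] by (simp add: ac_simps)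
  moreover have "th i~=th (j + l * Suc m)" if "i < l" for i using that injD[OF th_inj, of i "j + l * Suc m"] by auto
  ultimately show "D (th (j + l * Suc m)) = D (th (j + l * m))" using DD[of "th (j + l * Suc m)"] by simp
 qed
 moreover have "D (th j^(q^l)) = 0"
 proof -
  define x where "x m = th j^(q^(l * Suc m))" for m
  have x: "x m^(q^l) = x (Suc m)" for m by (simp add: x_def power_add ac_simps flip: power_mult)
  have v1: "v (x m) > 1" for m using v_th_gt1[of j] q_ge2 by (simp add: x_def v_power one_less_power)
  have mono: "v (x m) < v (x (Suc m))" for m
   using power_strict_increasing[of 1 "q^l" "v (x m)"] v1[of m] ql_ge2 by (simp add: v_power flip: x)
  hence "strict_mono (\<lambda>m. v (x m))" by (simp add: strict_mono_Suc_iff)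
  hence "inj x" using strict_mono_eq by (metis injI)
  have "th j^(q^l) = (th j^(q^j))^(q^(l - j))" using j by (simp flip: power_mult power_add)
  hence "th j^(q^l) = \<theta>^(q^(l - j))" using th_add_pow[of 0 j] by (simp add: th_0)
  hence "v (x 0) = v \<theta>^(q^(l - j))" by (simp add: x_def v_power)
  moreover have "v \<theta>^1 < v \<theta>^(q^(l - j))"
  proof (rule power_strict_increasing)
   show "1 < q^(l - j)" using q_ge2 j by (intro one_less_power) auto
   show "1 < v \<theta>" using v_th_gt1[of 0] by (simp add: th_0)
  qed
  ultimately have "v \<theta> < v (x 0)" by simp
  moreover have "v (x 0)\<le>v (x m)" for m using strict_mono_less_eq[OF \<open>strict_mono _\<close>, of 0 m] by simp
  ultimately have "th i~=x m" for i m using v_th_le[of i] by (metis le_less_trans less_le_trans less_irrefl)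
  hence "D (x (Suc m)) = D (x m)" for m using DD[of "x m"] by (simp add: x)
  hence "D (x 0) = 0" using const0[OF \<open>inj x\<close>] by blast
  thus ?thesis by (simp add: x_def)
 qed
 moreover have "th i = th j \<longleftrightarrow> i = j" for i using inj_eq[OF th_inj] .
 hence "(\<Sum>i<l. if th i = th j then e i else 0) = e j" using j by simp
 ultimately show "e j = 0" using DD[of "th j"] by simp
qed

end

section \<open>Hyperderivatives\<close>

lemma hyperderiv_nth [simp]: "fps_nth (hyperderiv m f) i = of_nat ((i + m) choose m) * fps_nth f (i + m)"
 by (simp add: hyperderiv_def)

lemma hyperderiv_zeroth [simp]: "hyperderiv 0 f = f" by (rule fps_ext) simp

lemma hyperderiv_0 [simp]: "hyperderiv m 0 = 0" by (rule fps_ext) simp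

lemma hyperderiv_add: "hyperderiv m (f + g) = hyperderiv m f + hyperderiv m g"
 by (rule fps_ext) (simp add: algebra_simps)

lemma hyperderiv_uminus: "hyperderiv m (- f) = - hyperderiv m f" by (rule fps_ext) simp

lemma hyperderiv_1: "hyperderiv m 1 = (if m = 0 then 1 else 0)" by (rule fps_ext) (simp add: fps_one_nth)

lemma hyperderiv_mult:
 fixes f g :: "'a::field fps"
 shows "hyperderiv m (f * g) = (\<Sum>k\<le>m. hyperderiv k f * hyperderiv (m - k) g)"
proof (rule fps_ext)
 fix i
 let ?h = "\<lambda>k a. of_nat (a choose k) * fps_nth f a*(of_nat ((i + m - a) choose (m - k)) * fps_nth g (i + m - a))"
 have "fps_nth (hyperderiv k f * hyperderiv (m - k) g) i = (\<Sum>a=0..i + m. ?h k a)" if "k\<le>m" for k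
 proof -
  have "fps_nth (hyperderiv k f * hyperderiv (m - k) g) i = (\<Sum>c=0..i. ?h k (c + k))"
   unfolding fps_mult_nth using that by (intro sum.cong) (auto simp: algebra_simps)
  also have "... = (\<Sum>a=0 + k..i + k. ?h k a)" by (rule sum.shift_bounds_cl_nat_ivl[symmetric])
  also have "... = (\<Sum>a=0..i + m. ?h k a)"
  proof (rule sum.mono_neutral_left)
   show "\<forall>a\<in>{0..i + m} - {0 + k..i + k}. ?h k a = 0"
   proof
    fix a assume a: "a\<in>{0..i + m} - {0 + k..i + k}"
    then consider "a < k" | "i + m - a < m - k" using that by fastforce
    thus "?h k a = 0" by cases (simp_all add: binomial_eq_0)
   qed
  qed (use that in auto)
  finally show ?thesis .
 qed
 hence "fps_nth (\<Sum>k\<le>m. hyperderiv k f * hyperderiv (m - k) g) i = (\<Sum>k\<le>m. \<Sum>a=0..i + m. ?h k a)"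
  by (simp add: fps_sum_nth)
 also have "... = (\<Sum>a=0..i + m. \<Sum>k\<le>m. ?h k a)" by (rule sum.swap)
 also have "... = (\<Sum>a=0..i + m. of_nat ((i + m) choose m)*(fps_nth f a * fps_nth g (i + m - a)))"
 proof (rule sum.cong[OF refl])
  fix a assume "a\<in>{0..i + m}"
  hence "(i + m) choose m = (\<Sum>k\<le>m. (a choose k)*((i + m - a) choose (m - k)))"
   using vandermonde[of a "i + m - a" m] by simp
  thus "(\<Sum>k\<le>m. ?h k a) = of_nat ((i + m) choose m)*(fps_nth f a * fps_nth g (i + m - a))"
   by (simp add: sum_distrib_left sum_distrib_right ac_simps)
 qed
 also have "... = fps_nth (hyperderiv m (f * g)) i" by (simp add: fps_mult_nth sum_distrib_left)
 finally show "fps_nth (hyperderiv m (f * g)) i = fps_nth (\<Sum>k\<le>m. hyperderiv k f * hyperderiv (m - k) g) i" by simp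
qed

lemma hyperderiv_linear_mult:
 fixes f :: "'a::field fps"
 shows "hyperderiv m ((fps_X - fps_const a) * f) =
  (fps_X - fps_const a) * hyperderiv m f + (if m = 0 then 0 else hyperderiv (m - 1) f)"
proof -
 have "hyperderiv k (fps_X - fps_const a) = (if k = 0 then fps_X - fps_const a else if k = 1 then 1 else 0)" for k
  by (rule fps_ext) (auto simp: fps_X_def)
 hence "hyperderiv m ((fps_X - fps_const a) * f) =
   (\<Sum>k\<le>m. (if k = 0 then fps_X - fps_const a else if k = 1 then 1 else 0) * hyperderiv (m - k) f)"
  unfolding hyperderiv_mult by simp
 also have "... = (\<Sum>k\<in>{..m}\<inter>{0, 1}. (if k = 0 then fps_X - fps_const a else if k = 1 then 1 else 0) * hyperderiv (m - k) f)"
  by (rule sum.mono_neutral_right) auto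
 also have "{..m}\<inter>{0, 1} = (if m = 0 then {0} else {0, 1})" by auto
 finally show ?thesis by simp
qed

lemma (in nonarch_abs_value) bdd_hyperderiv: assumes "bdd R f" "R > 0" shows "bdd R (hyperderiv m f)"
proof -
 obtain C where C: "nb R C f" using assms(1) by (auto simp: bdd_def)
 have "nb R (C/R^m) (hyperderiv m f)" unfolding nb_def
 proof
  fix i
  have "v (fps_nth (hyperderiv m f) i) * R^i\<le>v (fps_nth f (i + m)) * R^i"
   using mult_right_mono[OF v_of_nat[of "(i + m) choose m"] nonneg[of "fps_nth f (i + m)"]] assms(2)
   by (simp add: mult mult_right_mono)
  also have "...\<le>C/R^m" using nbD[OF C, of "i + m"] assms(2) by (simp add: power_add field_simps)
  finally show "v (fps_nth (hyperderiv m f) i) * R^i\<le>C/R^m" .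
 qed
 thus ?thesis by (rule bddI)
qed

context C_inf_l
begin

lemma sg_hyperderiv: "sg (hyperderiv m f) = hyperderiv m (sg f)" by (rule fps_ext) (simp add: rt_mult)

lemma sgn_hyperderiv: "(sg ^^ k) (hyperderiv m f) = hyperderiv m ((sg ^^ k) f)"
 by (induction k) (simp_all add: sg_hyperderiv)

lemma PB_hyperderiv: assumes "f\<in>PB" shows "hyperderiv m f\<in>PB"
proof -
 obtain p where p: "f = fps_of_poly p" "p\<in>pol BB" using assms by (auto simp: PB_def)
 define r where "r = Poly (map (fps_nth (hyperderiv m f)) [0..<Suc (degree p)])"
 have r: "fps_of_poly r = hyperderiv m f"
 proof (rule fps_ext)
  fix i show "fps_nth (fps_of_poly r) i = fps_nth (hyperderiv m f) i"
   by (cases "i < Suc (degree p)") (simp_all add: r_def nth_default_def p(1) coeff_eq_0 del: upt_Suc)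
 qed
 have "coeff r i\<in>BB" for i
 proof -
  have "coeff r i = of_nat ((i + m) choose m) * coeff p (i + m)"
   using arg_cong[OF r, of "\<lambda>f. fps_nth f i"] by (simp add: p(1))
  thus ?thesis using subring_mult[OF BB_subring subring_of_nat[OF BB_subring] polD[OF p(2)]] by simp
 qed
 thus ?thesis unfolding r[symmetric] by (intro PB_I polI)
qed

end

section \<open>The functions Omega\<close>

context C_infinity
begin

lemma vconv_rt: assumes "vconv F f L" shows "vconv F (\<lambda>x. rt (f x)) (rt L)" unfolding vconv_def
proof (intro allI impI)
 fix e :: real assume e: "e > 0"
 have "\<forall>\<^sub>F x in F. v (f x - L) < e^q" by (rule vconvD[OF assms]) (use e in simp)
 thus "\<forall>\<^sub>F x in F. v (rt (f x) - rt L) < e"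
 proof (rule eventually_mono)
  fix x assume "v (f x - L) < e^q"
  hence "v (rt (f x) - rt L)^q < e^q" by (simp add: v_rt flip: rt_diff)
  thus "v (rt (f x) - rt L) < e" by (rule power_less_imp_less_base) (use e in simp)
 qed
qed

lemma vconv_rtn: "vconv F f L ==> vconv F (\<lambda>x. (rt ^^ n) (f x)) ((rt ^^ n) L)" by (induction n) (simp_all add: vconv_rt)

lemma vconv_fps_mult: assumes "\<And>n. vconv F (\<lambda>x. fps_nth (f x) n) (fps_nth L n)"
 shows "vconv F (\<lambda>x. fps_nth (g * f x) n) (fps_nth (g * L) n)"
 unfolding fps_mult_nth by (intro vconv_sum vconv_mult_left assms)

lemma root_of_pow: "(rt ^^ m) (x^(q^m)) = x"
proof (induction m arbitrary: x)
 case (Suc m)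
 have "x^(q^Suc m) = (x^q)^(q^m)" by (simp flip: power_mult)
 hence "(rt ^^ Suc m) (x^(q^Suc m)) = rt (x^q)" using Suc by simp
 thus ?case by simp
qed simp

lemma rtn_inverse: "(rt ^^ m) (inverse x) = inverse ((rt ^^ m) x)" by (induction m) (simp_all add: rt_inverse)

lemma sgn_const: "(sg ^^ m) (fps_const c) = fps_const ((rt ^^ m) c)" by (induction m) simp_all
lemma sgn_X: "(sg ^^ m) fps_X = fps_X" by (induction m) simp_all
lemma sgn_1: "(sg ^^ m) 1 = 1" by (induction m) simp_all
lemma sgn_diff: "(sg ^^ m) (f - g) = (sg ^^ m) f - (sg ^^ m) g" by (induction m) (simp_all add: sg_diff)
lemma sgn_prod: "(sg ^^ m) (prod f A) = (\<Prod>i\<in>A. (sg ^^ m) (f i))" by (induction m) (simp_all add: sg_prod)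

text \<open>The partial products are bounded by 1 on the disc of radius \<open>q ^ (q ^ j)\<close>, since all zeros
  \<open>\<theta> ^ (q ^ (i * j))\<close> lie outside this disc.\<close>

lemma Omega_properties: assumes j: "j\<ge>1" and \<rho>: "\<rho>^(q^j - 1) = - \<theta>" and R: "0\<le>R" "R\<le>real q^(q^j)"
 shows "(sg ^^ j) (Omega v q \<theta> j \<rho>) = (fps_X - fps_const \<theta>) * Omega v q \<theta> j \<rho>"
  and "bdd R (Omega v q \<theta> j \<rho>)" and "Omega v q \<theta> j \<rho>~=0"
proof -
 define a where "a i = inverse (\<theta>^(q^(i * j)))" for i
 define P where "P N = (\<Prod>i=1..N. 1 - fps_const (a i) * fps_X)" for N
 have th0: "\<theta>~=0" using v_theta q_ge2 by auto
 have q1: "real q > 1" using q_ge2 by simp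
 have va: "v (a i) = (1/real q)^(q^(i * j))" for i
  by (simp add: a_def v_inverse v_power v_theta power_one_over inverse_eq_divide v_divide)
 have va_le: "v (a i)\<le>(1/real q)^i" for i
 proof -
  have "i\<le>i * j" using j by simp
  also have "...\<le>2^(i * j)" by (rule less_imp_le[OF less_exp])
  also have "...\<le>q^(i * j)" using q_ge2 by (intro power_mono) auto
  finally show ?thesis unfolding va using q1 by (intro power_decreasing) auto
 qed
 have va_R: "v (a i) * R\<le>1" if "i\<ge>1" for i
 proof -
  have "j\<le>i * j" using that by simp
  hence "q^j\<le>q^(i * j)" using q_ge2 by (intro power_increasing) simp_all
  from power_decreasing[OF this, of "1/real q"] have "(1/real q)^(q^(i * j))\<le>(1/real q)^(q^j)"
   using q1 by simp
  hence "v (a i) * R\<le>(1/real q)^(q^j) * real q^(q^j)" unfolding va using R q1 by (intro mult_mono) auto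
  also have "... = 1" using q1 by (simp add: power_one_over)
  finally show ?thesis .
 qed
 have nb_P: "nb r 1 (P N)" if r: "0\<le>r" "\<And>i. i\<ge>1 ==> v (a i) * r\<le>1" for r N
 proof (induction N)
  case 0 show ?case using nb_const[of r 1] by (simp add: P_def)
 next case (Suc N)
  have "nb r 1 (1 - fps_const (a (Suc N)) * fps_X)" unfolding nb_def
  proof
   fix n :: nat
   consider "n = 0" | "n = 1" | "n > 1" by linarith
   thus "v (fps_nth (1 - fps_const (a (Suc N)) * fps_X) n) * r^n\<le>1"
    using r(2)[of "Suc N"] by cases (simp_all add: v_uminus fps_X_def)
  qed
  from nb_mult[OF Suc this r(1)] show ?case by (simp add: P_def mult.commute)
 qed
 have nb1: "nb R 1 (P N)" for N by (rule nb_P[OF R(1) va_R])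
 have nb11: "v (fps_nth (P N) n)\<le>1" for N n
 proof -
  have "v (a i)\<le>1" for i using va_le[of i] power_le_one[of "1/real q" i] q1 by simp
  thus ?thesis using nbD[OF nb_P[of 1 N], of n] by simp
 qed
 have PS: "P (Suc N) = P N - fps_const (a (Suc N))*(fps_X * P N)" for N by (simp add: P_def algebra_simps)
 have "\<exists>L. vconv sequentially (\<lambda>N. fps_nth (P N) n) L" for n
 proof (rule complete_consecutive[OF complete])
  fix e :: real assume "e > 0"
  then obtain N0 where N0: "(1/real q)^N0 < e" using real_arch_pow_inv[of e "1/real q"] q1 by auto
  have "v (fps_nth (P (Suc N)) n - fps_nth (P N) n) < e" if "N\<ge>N0" for N
  proof -
   have "v (fps_nth (P (Suc N)) n - fps_nth (P N) n) = v (a (Suc N)) * v (fps_nth (fps_X * P N) n)"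
    by (simp add: PS v_uminus mult)
   also have "...\<le>(1/real q)^Suc N*1" by (intro mult_mono va_le) (auto simp: nonneg nb11)
   also have "...\<le>(1/real q)^N0" using that q1 by (simp only: mult_1_right) (intro power_decreasing, auto)
   finally show ?thesis using N0 by simp
  qed
  thus "\<exists>N. \<forall>n'\<ge>N. v (fps_nth (P (Suc n')) n - fps_nth (P n') n) < e" by blast
 qed
 then obtain c where c: "\<And>n. vconv sequentially (\<lambda>N. fps_nth (P N) n) (c n)" by metis
 define P' where "P' = Abs_fps c"
 have P': "vconv sequentially (\<lambda>N. fps_nth (P N) n) (fps_nth P' n)" for n by (simp add: P'_def c)
 have "fps_vlim v sequentially P = P'" unfolding fps_vlim_def by (rule fps_ext) (simp add: vlim_eq[OF P'])
 hence Om: "Omega v q \<theta> j \<rho> = fps_const (inverse (\<rho>^(q^j))) * P'" unfolding Omega_def P_def a_def by simp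
 have "nb R 1 P'" unfolding nb_def
 proof
  fix n
  have "vconv sequentially (\<lambda>N. fps_nth (P N) n) (fps_nth P' n)" by (rule P')
  show "v (fps_nth P' n) * R^n\<le>1"
  proof (cases "R^n = 0")
   case False hence Rn: "R^n > 0" using R by (metis zero_le_power order_le_less)
   have "v (fps_nth P' n)\<le>1/R^n" using nbD[OF nb1, of _ n] Rn
    by (intro vconv_bound[OF P']) (auto simp: field_simps)
   thus ?thesis using Rn by (simp add: field_simps)
  next case True thus ?thesis by (simp only: mult_zero_right zero_le_one)
  qed
 qed
 thus "bdd R (Omega v q \<theta> j \<rho>)" unfolding Om by (intro bdd_mult bdd_const bddI R)
 have \<rho>0: "\<rho>~=0"
 proof
  assume "\<rho> = 0"
  moreover have "2^1\<le>(2::nat)^j" using j by (intro power_increasing) auto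
  hence "q^j\<ge>2" using power_mono[OF q_ge2, of j] by simp
  ultimately show False using \<rho> th0 by (simp add: zero_power)
 qed
 have "vconv sequentially (\<lambda>N. fps_nth (P N) 0) 1"
 proof -
  have "fps_nth (P N) 0 = 1" for N by (induction N) (simp_all add: P_def)
  thus ?thesis by (simp add: vconv_const)
 qed
 hence "fps_nth P' 0 = 1" using vconv_unique[OF P'[of 0]] by simp
 thus "Omega v q \<theta> j \<rho>~=0" unfolding Om using \<rho>0 by auto
 have sP: "(sg ^^ j) (P (Suc N)) = (1 - fps_const (inverse \<theta>) * fps_X) * P N" for N
 proof -
  have "(sg ^^ j) (1 - fps_const (a (Suc i)) * fps_X) = 1 - fps_const (a i) * fps_X" for i
  proof -
   have "\<theta>^(q^(Suc i * j)) = (\<theta>^(q^(i * j)))^(q^j)" by (simp add: power_add mult.commute flip: power_mult)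
   hence "(rt ^^ j) (a (Suc i)) = a i" by (simp add: a_def rtn_inverse root_of_pow)
   thus ?thesis by (simp add: sgn_diff sgn_mult sgn_const sgn_X sgn_1)
  qed
  moreover have "(sg ^^ j) (P (Suc N)) = (\<Prod>i=0..N. (sg ^^ j) (1 - fps_const (a (Suc i)) * fps_X))"
   unfolding P_def sgn_prod
   using prod.shift_bounds_cl_Suc_ivl[of "\<lambda>i. (sg ^^ j) (1 - fps_const (a i) * fps_X)" 0 N] by simp
  ultimately have "(sg ^^ j) (P (Suc N)) = (\<Prod>i=0..N. 1 - fps_const (a i) * fps_X)" by simp
  also have "... = (1 - fps_const (a 0) * fps_X) * P N"
   unfolding P_def using prod.atLeast_Suc_atMost[of 0 N "\<lambda>i. 1 - fps_const (a i) * fps_X"] by simp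
  finally show ?thesis by (simp add: a_def)
 qed
 have "(sg ^^ j) P' = (1 - fps_const (inverse \<theta>) * fps_X) * P'"
 proof (rule fps_ext)
  fix n
  have "vconv sequentially (\<lambda>N. fps_nth ((sg ^^ j) (P (Suc N))) n) (fps_nth ((sg ^^ j) P') n)"
   unfolding sgn_nth by (intro vconv_rtn vconv_Suc P')
  moreover have "vconv sequentially (\<lambda>N. fps_nth ((sg ^^ j) (P (Suc N))) n)
    (fps_nth ((1 - fps_const (inverse \<theta>) * fps_X) * P') n)" unfolding sP by (intro vconv_fps_mult P')
  ultimately show "fps_nth ((sg ^^ j) P') n = fps_nth ((1 - fps_const (inverse \<theta>) * fps_X) * P') n"
   by (rule vconv_unique) simp
 qed
 hence "(sg ^^ j) (Omega v q \<theta> j \<rho>) = fps_const (inverse \<rho>)*((1 - fps_const (inverse \<theta>) * fps_X) * P')"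
  by (simp add: Om sgn_mult sgn_const rtn_inverse root_of_pow)
 also have "fps_const (inverse \<rho>) = fps_const (inverse (\<rho>^(q^j))) * fps_const (- \<theta>)"
 proof -
  have "\<rho>^(q^j) = \<rho>*\<rho>^(q^j - 1)" using q_ge2 by (simp add: power_eq_if[of \<rho> "q^j"])
  hence "\<rho>^(q^j) = \<rho> * - \<theta>" unfolding \<rho> .
  thus ?thesis using \<rho>0 th0 by simp
 qed
 also have "fps_const (inverse (\<rho>^(q^j))) * fps_const (- \<theta>)*((1 - fps_const (inverse \<theta>) * fps_X) * P') =
   (fps_const (- \<theta>)*(1 - fps_const (inverse \<theta>) * fps_X))*(fps_const (inverse (\<rho>^(q^j))) * P')"
  by (simp only: ac_simps)
 also have "fps_const (- \<theta>)*(1 - fps_const (inverse \<theta>) * fps_X) = fps_X - fps_const \<theta>"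
  using th0 by (simp add: right_diff_distrib flip: mult.assoc)
 finally show "(sg ^^ j) (Omega v q \<theta> j \<rho>) = (fps_X - fps_const \<theta>) * Omega v q \<theta> j \<rho>" unfolding Om .
qed

end

section \<open>Anderson--Thakur polynomials\<close>

context C_inf_l
begin

lemma AT_D_nonzero: "(AT_D q i :: 'c poly)~=0"
proof -
 have "monom 1 (q^i) - monom 1 (q^j)~=(0 :: 'c poly)" if "j < i" for j
 proof -
  have "q^j < q^i" using that q_ge2 by (intro power_strict_increasing) auto
  thus ?thesis by (simp add: monom_eq_iff')
 qed
 thus ?thesis by (auto simp: AT_D_def)
qed

lemma AT_gamma_nonzero: "(AT_gamma q m :: 'c poly)~=0" by (simp add: AT_gamma_def AT_D_nonzero)

lemma AT_D_Suc: "(AT_D q (Suc k) :: 'c poly) = (monom 1 (q^Suc k) - monom 1 1) * AT_D q k^q"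
proof -
 have pc: "prime CHAR('c poly)" using prime_char by simp
 obtain e where e: "q = CHAR('c poly)^e" using q_power by auto
 have frob: "(x + y)^q = x^q + y^q" for x y :: "'c poly" by (rule freshmans_dream'[OF pc e])
 have frob_diff: "(x - y)^q = x^q - y^q" for x y :: "'c poly"
  using frob[of "x - y" y] by (simp add: algebra_simps)
 have "(AT_D q k :: 'c poly)^q = (\<Prod>j<k. monom 1 (q^Suc k) - monom 1 (q^Suc j))"
  unfolding AT_D_def prod_power_distrib by (simp add: frob_diff monom_power mult.commute)
 thus ?thesis unfolding AT_D_def prod.lessThan_Suc_shift by (simp add: o_def)
qed

definition dvd_Fc :: "'c poly => 'c poly => bool" where "dvd_Fc a b \<longleftrightarrow> (\<exists>c\<in>pol Fc. b = c * a)"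

definition digit_prod :: "nat => nat => nat => 'c poly" where
 "digit_prod k N n = (\<Prod>i<N. AT_D q (k + i)^(n div q^i mod q))"

lemma digit_prod_Suc: "digit_prod k (Suc N) n = AT_D q k^(n mod q) * digit_prod (Suc k) N (n div q)"
 unfolding digit_prod_def prod.lessThan_Suc_shift by (simp add: o_def div_mult2_eq)

text \<open>Addition of \<open>q ^ i\<close> to \<open>n\<close> either increases a digit or replaces digits \<open>q - 1\<close> by 0 and
  increases a later one. The claim holds because \<open>D\<^sub>k ^ q\<close> divides \<open>D\<^sub>k\<^sub>+\<^sub>1\<close>.\<close>

lemma digit_prod_dvd: "n + q^i < q^N ==> dvd_Fc (AT_D q (k + i) * digit_prod k N n) (digit_prod k N (n + q^i))"
proof (induction N arbitrary: k n i)
 case 0 thus ?case using q_ge2 by simp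
next case (Suc N)
 note R = subfield_subring[OF Fc_subfield]
 note Rp = pol_subring[OF R]
 show ?case
 proof (cases i)
  case 0 show ?thesis
  proof (cases "Suc (n mod q) = q")
   case False hence "digit_prod k (Suc N) (n + q^i) = 1*(AT_D q (k + i) * digit_prod k (Suc N) n)"
    by (simp add: digit_prod_Suc 0 mod_Suc div_Suc)
   thus ?thesis unfolding dvd_Fc_def using subring_1[OF Rp] by blast
  next case True
   have nq: "Suc n = q * Suc (n div q)" using True by (metis Suc_mult_cancel1 add_Suc_right div_mult_mod_eq mult.commute mult_Suc_right add.commute)
   hence "q * Suc (n div q) < q * q^N" using Suc.prems 0 by simp
   hence "Suc (n div q) < q^N" by (metis mult_less_cancel1)
   hence "n div q + q^0 < q^N" by simp
   from Suc.IH[OF this, of "Suc k"] obtain c where c: "c\<in>pol Fc"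
    "digit_prod (Suc k) N (n div q + q^0) = c*(AT_D q (Suc k + 0) * digit_prod (Suc k) N (n div q))"
    unfolding dvd_Fc_def by blast
   define w where "w = c*(monom 1 (q^Suc k) - monom 1 1)"
   have w: "w\<in>pol Fc" unfolding w_def by (intro subring_mult[OF Rp] c subring_diff[OF Rp] pol_monom R subring_1[OF R])
   have nm: "n mod q = q - 1" using True by simp
   have "digit_prod k (Suc N) (n + q^i) = digit_prod (Suc k) N (n div q + q^0)"
    unfolding digit_prod_Suc using nq q_ge2 by (simp add: 0)
   also have "... = w*(AT_D q k^q * digit_prod (Suc k) N (n div q))"
    unfolding c(2) by (simp add: w_def AT_D_Suc ac_simps)
   also have "AT_D q k^q * digit_prod (Suc k) N (n div q) = AT_D q (k + i) * digit_prod k (Suc N) n"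
    unfolding digit_prod_Suc nm using q_ge2 by (simp add: 0 power_eq_if[of _ q])
   finally show ?thesis unfolding dvd_Fc_def using w by blast
  qed
 next case (Suc i')
  have "(n + q^i) div q = n div q + q^i'" "(n + q^i) mod q = n mod q" using q_ge2 by (simp_all add: Suc)
  moreover have "n div q + q^i' < q^N"
  proof -
   have "(n + q^i) div q < q^N" using Suc.prems by (simp add: less_mult_imp_div_less mult.commute)
   thus ?thesis using \<open>_ div q = _\<close> by simp
  qed
  from Suc.IH[OF this, of "Suc k"] obtain c where c: "c\<in>pol Fc"
   "digit_prod (Suc k) N (n div q + q^i') = c*(AT_D q (Suc k + i') * digit_prod (Suc k) N (n div q))"
   unfolding dvd_Fc_def by blast
  ultimately have "digit_prod k (Suc N) (n + q^i) = c*(AT_D q (k + i) * digit_prod k (Suc N) n)"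
   unfolding digit_prod_Suc by (simp add: Suc ac_simps)
  thus ?thesis unfolding dvd_Fc_def using c(1) by blast
 qed
qed

lemma AT_gamma_digit_prod: assumes "m < q^N" shows "AT_gamma q m = digit_prod 0 N m"
proof -
 have less: "m < q^Suc m" using less_exp[of "Suc m"] power_mono[OF q_ge2, of "Suc m"] by simp
 have "(\<Prod>i<N'. AT_D q i^(m div q^i mod q)) = (\<Prod>i<max N (Suc m). (AT_D q i :: 'c poly)^(m div q^i mod q))"
  if "m < q^N'" "N'\<le>max N (Suc m)" for N'
 proof (rule prod.mono_neutral_left)
  show "\<forall>i\<in>{..<max N (Suc m)} - {..<N'}. (AT_D q i :: 'c poly)^(m div q^i mod q) = 1"
  proof
   fix i assume "i\<in>{..<max N (Suc m)} - {..<N'}"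
   hence "q^N'\<le>q^i" using q_ge2 by (intro power_increasing) auto
   hence "m div q^i = 0" using that by simp
   thus "(AT_D q i :: 'c poly)^(m div q^i mod q) = 1" by simp
  qed
 qed (use that in auto)
 from this[of N] this[of "Suc m"] show ?thesis
  using assms less by (simp add: AT_gamma_def digit_prod_def lessThan_Suc_atMost)
qed

lemma AT_gamma_dvd: assumes "q^i\<le>m" shows "\<exists>w\<in>pol Fc. AT_gamma q m = w*(AT_D q i * AT_gamma q (m - q^i))"
proof -
 have m: "m < q^Suc m" using less_exp[of "Suc m"] power_mono[OF q_ge2, of "Suc m"] by simp
 hence "dvd_Fc (AT_D q (0 + i) * digit_prod 0 (Suc m) (m - q^i)) (digit_prod 0 (Suc m) (m - q^i + q^i))"
  using assms by (intro digit_prod_dvd) simp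
 moreover have m': "m - q^i < q^Suc m" using m by linarith
 ultimately show ?thesis using assms unfolding dvd_Fc_def AT_gamma_digit_prod[OF m] AT_gamma_digit_prod[OF m'] by simp
qed

text \<open>Polynomials in \<open>t\<close> whose coefficients are polynomials in \<open>\<theta>\<close> of degree at most \<open>X\<close>.\<close>

definition theta_degree_le :: "nat => 'c poly set" where "theta_degree_le X = {p. \<forall>i. coeff p i\<in>Bn 0 X}"

lemma theta_degree_mult: "p\<in>theta_degree_le X ==> r\<in>theta_degree_le Y ==> p * r\<in>theta_degree_le (X + Y)"
 unfolding theta_degree_le_def using poly_mult_Bn by blast

lemma theta_degree_mono: "p\<in>theta_degree_le X ==> X\<le>Y ==> p\<in>theta_degree_le Y"
 unfolding theta_degree_le_def using Bn_mono by blast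

lemma theta_degree_Fc: "p\<in>pol Fc ==> p\<in>theta_degree_le 0"
 unfolding theta_degree_le_def Bn_def using Bd_Fc polD by blast

lemma theta_degree_add: "p\<in>theta_degree_le X ==> r\<in>theta_degree_le X ==> p + r\<in>theta_degree_le X"
 unfolding theta_degree_le_def Bn_def by (simp add: Bd_add)

lemma theta_degree_1: "1\<in>theta_degree_le X" unfolding theta_degree_le_def by (auto simp: coeff_1 Bn_0 Bn_1)

lemma theta_degree_0: "0\<in>theta_degree_le X" unfolding theta_degree_le_def by (auto simp: Bn_0)

lemma theta_degree_AT_G: "AT_G q \<theta> i\<in>theta_degree_le (\<Sum>j=1..i. q^j)"
proof -
 have f: "monom 1 n - [:\<theta>^m:]\<in>theta_degree_le m" for n m
 proof -
  have "coeff (monom 1 n - [:\<theta>^m:]) k\<in>Bn 0 m" for k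
  proof -
   have "\<theta>^m\<in>Bn 0 m" using Bn_th[of 0 m] by (simp add: th_0)
   hence "coeff [:\<theta>^m:] k\<in>Bn 0 m" by (cases k) (simp_all add: Bn_0)
   moreover have "coeff (monom 1 n) k\<in>Bn 0 m" by (simp add: Bn_0 Bn_1 coeff_monom)
   ultimately show ?thesis unfolding Bn_def by (simp add: Bd_diff)
  qed
  thus ?thesis by (simp add: theta_degree_le_def)
 qed
 have "(\<Prod>j=1..k. monom 1 n - [:\<theta>^(q^j):])\<in>theta_degree_le (\<Sum>j=1..k. q^j)" for k n
  by (induction k) (simp_all add: theta_degree_1 theta_degree_mult f)
 thus ?thesis by (simp add: AT_G_def)
qed

lemma geometric_sum_q: "(q - 1)*(\<Sum>j=1..i. q^j) + q = q^Suc i"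
proof (induction i)
 case (Suc i)
 have "(q - 1)*(\<Sum>j=1..Suc i. q^j) + q = ((q - 1)*(\<Sum>j=1..i. q^j) + q) + (q - 1) * q^Suc i"
  by (simp add: algebra_simps)
 also have "... = (1 + (q - 1)) * q^Suc i" unfolding Suc distrib_right by simp
 also have "1 + (q - 1) = q" using q_ge2 by simp
 finally show ?case by simp
qed simp

lemma sum_Fract_common: assumes "\<And>j. j\<in>A ==> \<exists>h. f j = Fraction_Field.Fract h d \<and> h\<in>theta_degree_le X" "d~=0"
 shows "\<exists>h. sum f A = Fraction_Field.Fract h d \<and> h\<in>theta_degree_le X" using assms(1)
proof (induction A rule: infinite_finite_induct)
 case (insert j A)
 obtain h h' where "f j = Fraction_Field.Fract h d" "h\<in>theta_degree_le X"
  "sum f A = Fraction_Field.Fract h' d" "h'\<in>theta_degree_le X" using insert by blast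
 moreover have "Fraction_Field.Fract h d + Fraction_Field.Fract h' d = Fraction_Field.Fract (h + h') d"
  using assms(2) by (simp add: eq_fract algebra_simps)
 ultimately show ?case using insert.hyps theta_degree_add by auto
qed (auto intro!: exI[of _ 0] simp: theta_degree_0 Zero_fract_def eq_fract)

text \<open>By the recursion for the coefficients of the inverse series, a coefficient times \<open>\<gamma>\<^sub>m\<close> is
  integral; and \<open>G\<^sub>i\<close> has degree at most \<open>q ^ (i + 1) / (q - 1)\<close> in \<open>\<theta>\<close>.\<close>

lemma AT_H_exists: "\<exists>h. fps_nth (inverse (1 - AT_gen q \<theta>)) m = Fraction_Field.Fract h (AT_gamma q m) \<and>
    h\<in>theta_degree_le (q * m div (q - 1))"
proof (induction m rule: less_induct)
 case (less m)
 define F where "F = inverse (1 - AT_gen q \<theta>)"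
 have gen_pow: "fps_nth (AT_gen q \<theta>) (q^i) = Fraction_Field.Fract (AT_G q \<theta> i) (AT_D q i)" for i
 proof -
  have "{i'. q^i' = q^i} = {i}" using q_ge2 by auto
  thus ?thesis by (simp add: AT_gen_def)
 qed
 have gen_other: "fps_nth (AT_gen q \<theta>) j = 0" if "\<And>i. j~=q^i" for j
 proof -
  have "{i. q^i = j} = {}" using that by auto
  thus ?thesis by (simp add: AT_gen_def)
 qed
 have gen0: "fps_nth (AT_gen q \<theta>) 0 = 0" by (rule gen_other) (use q_ge2 in auto)
 have "F*(1 - AT_gen q \<theta>) = 1" unfolding F_def by (rule inverse_mult_eq_1) (simp add: gen0)
 hence "F = 1 + AT_gen q \<theta> * F" by (simp add: algebra_simps)
 hence "fps_nth F m = fps_nth (1 + AT_gen q \<theta> * F) m" by (rule arg_cong[where f = "\<lambda>f. fps_nth f m"])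
 hence rec: "fps_nth F m = (if m = 0 then 1 else 0) + (\<Sum>j=0..m. fps_nth (AT_gen q \<theta>) j * fps_nth F (m - j))"
  unfolding fps_add_nth fps_one_nth fps_mult_nth .
 show ?case
 proof (cases "m = 0")
  case True hence "fps_nth F m = Fraction_Field.Fract 1 (AT_gamma q m)"
   using rec by (simp add: gen0 AT_gamma_def One_fract_def)
  thus ?thesis unfolding F_def[symmetric] using theta_degree_1 by blast
 next case False
  have "\<exists>h. (\<Sum>j=0..m. fps_nth (AT_gen q \<theta>) j * fps_nth F (m - j)) = Fraction_Field.Fract h (AT_gamma q m) \<and>
    h\<in>theta_degree_le (q * m div (q - 1))"
  proof (rule sum_Fract_common[OF _ AT_gamma_nonzero])
   fix j assume j: "j\<in>{0..m}"
   show "\<exists>h. fps_nth (AT_gen q \<theta>) j * fps_nth F (m - j) = Fraction_Field.Fract h (AT_gamma q m) \<and>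
     h\<in>theta_degree_le (q * m div (q - 1))"
   proof (cases "\<exists>i. j = q^i")
    case True
    then obtain i where i: "j = q^i" by blast
    have "m - j < m" using i False q_ge2 by simp
    from less.IH[OF this] obtain h where h: "fps_nth F (m - j) = Fraction_Field.Fract h (AT_gamma q (m - j))"
     "h\<in>theta_degree_le (q*(m - j) div (q - 1))" unfolding F_def by blast
    obtain w where w: "w\<in>pol Fc" "AT_gamma q m = w*(AT_D q i * AT_gamma q (m - j))"
     using AT_gamma_dvd[of i m] j i by auto
    have w0: "w~=0" using AT_gamma_nonzero[of m] w(2) by auto
    have "fps_nth (AT_gen q \<theta>) j * fps_nth F (m - j) =
      Fraction_Field.Fract (w*(AT_G q \<theta> i * h)) (AT_gamma q m)"
     unfolding i gen_pow h(1)[unfolded i] w(2)[unfolded i] mult_fract mult_fract_cancel[OF w0] ..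
    moreover have "w*(AT_G q \<theta> i * h)\<in>theta_degree_le (q * m div (q - 1))"
    proof -
     have "w*(AT_G q \<theta> i * h)\<in>theta_degree_le (0 + ((\<Sum>j=1..i. q^j) + q*(m - j) div (q - 1)))"
      by (intro theta_degree_mult theta_degree_Fc w theta_degree_AT_G h)
     moreover have "(\<Sum>j=1..i. q^j) + q*(m - j) div (q - 1)\<le>q * m div (q - 1)"
     proof -
      define d where "d = q - 1"
      have d: "d > 0" using q_ge2 by (simp add: d_def)
      have "d*((\<Sum>j=1..i. q^j) + q*(m - j) div d) = d*(\<Sum>j=1..i. q^j) + d*(q*(m - j) div d)"
       by (rule distrib_left)
      also have "...\<le>q^Suc i + q*(m - j)" using geometric_sum_q[of i] by (intro add_mono) (simp_all add: d_def)
      also have "... = q*(q^i + (m - j))" by (simp add: distrib_left)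
      also have "q^i + (m - j) = m" using i j by simp
      finally have "(d*((\<Sum>j=1..i. q^j) + q*(m - j) div d)) div d\<le>q * m div d" by (rule div_le_mono)
      thus ?thesis using d unfolding d_def[symmetric] by simp
     qed
     ultimately show ?thesis using theta_degree_mono by simp
    qed
    ultimately show ?thesis by blast
   next case False hence "fps_nth (AT_gen q \<theta>) j * fps_nth F (m - j) = 0" using gen_other[of j] by simp
    moreover have "Fraction_Field.Fract 0 (AT_gamma q m) = (0 :: 'c poly fract)"
     by (simp add: Zero_fract_def eq_fract AT_gamma_nonzero)
    ultimately show ?thesis using theta_degree_0 by (intro exI[of _ 0]) simp
   qed
  qed
  thus ?thesis using rec False unfolding F_def[symmetric] by simp
 qed
qed

lemma AT_H_degree: "AT_H q \<theta> m\<in>theta_degree_le (q * m div (q - 1))"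
proof -
 obtain h where h: "fps_nth (inverse (1 - AT_gen q \<theta>)) m = Fraction_Field.Fract h (AT_gamma q m)"
  "h\<in>theta_degree_le (q * m div (q - 1))" using AT_H_exists by blast
 have "AT_H q \<theta> m = h" unfolding AT_H_def
 proof (rule the_equality)
  fix h' assume "fps_nth (inverse (1 - AT_gen q \<theta>)) m = Fraction_Field.Fract h' (AT_gamma q m)"
  thus "h' = h" using h(1) AT_gamma_nonzero by (simp add: eq_fract)
 qed (rule h(1))
 thus ?thesis using h(2) by simp
qed

lemma AT_H_BB: "AT_H q \<theta> m\<in>pol BB" using AT_H_degree[of m] BnBB unfolding theta_degree_le_def pol_def by blast

section \<open>Anderson--Thakur series\<close>

lemma twist_nth: "fps_nth (twist q (int i) f) n = fps_nth f n^(q^i)" by (simp add: twist_def frobenius_def)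

lemma sg_twist_Suc: "sg (twist q (int (Suc i)) f) = twist q (int i) f"
proof (rule fps_ext)
 fix n
 have "fps_nth f n^(q^Suc i) = (fps_nth f n^(q^i))^q" by (simp add: mult.commute flip: power_mult)
 thus "fps_nth (sg (twist q (int (Suc i)) f)) n = fps_nth (twist q (int i) f) n" unfolding sg_nth twist_nth by simp
qed

text \<open>One factor of the general term of the series: the term for \<open>i\<^sub>1 > \<dots> > i\<^sub>d\<close> is the product of the
  \<open>zterm s\<^sub>k i\<^sub>k\<close>.\<close>

definition zterm :: "nat => nat => 'c fps" where
 "zterm s i = twist q (int i) (fps_of_poly (AT_H q \<theta> (s - 1)))/fps_of_poly (AT_L q \<theta> i)^s"

lemma theta_0: "\<theta>~=0" using v_theta q_ge2 by auto

lemma fps_of_poly_linear: "fps_of_poly [:- a, 1:] = fps_X - fps_const (a :: 'c)"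
 by (rule fps_ext) (simp add: fps_X_def coeff_pCons split: nat.splits)

lemma AT_L_prod: "fps_of_poly (AT_L q \<theta> i) = (\<Prod>j=1..i. fps_X - fps_const (\<theta>^(q^j)))"
 by (simp add: AT_L_def fps_of_poly_prod fps_of_poly_linear del: fps_of_poly_pCons)

lemma AT_L_nth_0: "fps_nth (fps_of_poly (AT_L q \<theta> i)) 0~=0"
proof -
 have "fps_nth (fps_of_poly (AT_L q \<theta> i)) 0 = (\<Prod>j=1..i. - (\<theta>^(q^j)))" unfolding AT_L_prod by (induction i) simp_all
 also have "...~=0" using theta_0 by simp
 finally show ?thesis .
qed

lemma zterm_eq: "zterm s i * fps_of_poly (AT_L q \<theta> i)^s = twist q (int i) (fps_of_poly (AT_H q \<theta> (s - 1)))"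
proof -
 let ?L = "fps_of_poly (AT_L q \<theta> i)^s"
 have "fps_nth ?L 0~=0" using AT_L_nth_0 by (simp add: fps_nth_power_0)
 thus ?thesis unfolding zterm_def by (simp add: fps_divide_unit mult.assoc inverse_mult_eq_1)
qed

lemma sg_AT_L: "sg (fps_of_poly (AT_L q \<theta> (Suc i))) = (fps_X - fps_const \<theta>) * fps_of_poly (AT_L q \<theta> i)"
proof -
 have f: "sg (fps_X - fps_const (\<theta>^(q^Suc j))) = fps_X - fps_const (\<theta>^(q^j))" for j
 proof -
  have "\<theta>^(q^Suc j) = (\<theta>^(q^j))^q" by (simp add: mult.commute flip: power_mult)
  thus ?thesis by (simp add: sg_diff)
 qed
 have "sg (fps_of_poly (AT_L q \<theta> (Suc i))) = (\<Prod>j=0..i. sg (fps_X - fps_const (\<theta>^(q^Suc j))))"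
  unfolding AT_L_prod sg_prod
  using prod.shift_bounds_cl_Suc_ivl[of "\<lambda>j. sg (fps_X - fps_const (\<theta>^(q^j)))" 0 i] by simp
 also have "... = (\<Prod>j=0..i. fps_X - fps_const (\<theta>^(q^j)))" by (simp only: f)
 also have "... = (fps_X - fps_const \<theta>) * fps_of_poly (AT_L q \<theta> i)"
  unfolding AT_L_prod using prod.atLeast_Suc_atMost[of 0 i "\<lambda>j. fps_X - fps_const (\<theta>^(q^j))"] by simp
 finally show ?thesis .
qed

lemma zterm_Suc: "(fps_X - fps_const \<theta>)^s * sg (zterm s (Suc i)) = zterm s i"
proof -
 let ?L = "fps_of_poly (AT_L q \<theta> i)^s"
 have L0: "?L~=0" using AT_L_nth_0[of i] by auto
 have "sg (zterm s (Suc i))*((fps_X - fps_const \<theta>) * fps_of_poly (AT_L q \<theta> i))^s =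
   sg (zterm s (Suc i) * fps_of_poly (AT_L q \<theta> (Suc i))^s)" by (simp only: sg_mult sg_power sg_AT_L)
 also have "... = zterm s i * ?L" by (simp only: zterm_eq sg_twist_Suc)
 finally have "sg (zterm s (Suc i))*((fps_X - fps_const \<theta>) * fps_of_poly (AT_L q \<theta> i))^s = zterm s i * ?L" .
 hence "((fps_X - fps_const \<theta>)^s * sg (zterm s (Suc i))) * ?L = zterm s i * ?L"
  by (simp add: power_mult_distrib ac_simps)
 thus ?thesis using L0 by (simp only: mult_cancel_right) simp
qed

lemma zterm_0: "zterm s 0 = fps_of_poly (AT_H q \<theta> (s - 1))"
proof -
 have "twist q (int 0) f = f" for f by (rule fps_ext) (simp only: twist_nth, simp)
 thus ?thesis using zterm_eq[of s 0] by (simp add: AT_L_def)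
qed

lemma nb_inverse_linear: assumes "v a\<ge>R" "R > 0" shows "nb R (1/v a) (inverse (fps_X - fps_const a))"
proof -
 have a0: "a~=0" using assms by auto
 have "inverse (fps_X - fps_const a) = Abs_fps (\<lambda>n. - inverse (a^Suc n))"
 proof (rule fps_inverse_unique)
  show "(fps_X - fps_const a) * Abs_fps (\<lambda>n. - inverse (a^Suc n)) = 1"
  proof (rule fps_ext)
   fix n show "fps_nth ((fps_X - fps_const a) * Abs_fps (\<lambda>n. - inverse (a^Suc n))) n = fps_nth 1 n"
    using a0 by (cases n) (simp_all add: left_diff_distrib fps_X_mult_nth)
  qed
 qed
 moreover have "v (- inverse (a^Suc n)) * R^n\<le>1/v a" for n
 proof -
  have "R^n\<le>v a^n" using assms by (intro power_mono) auto
  hence "R^n/v a^n\<le>1" using assms by (simp add: divide_le_eq_1)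
  hence "R^n/v a^n/v a\<le>1/v a" using assms by (intro divide_right_mono) auto
  thus ?thesis by (simp add: v_uminus v_inverse v_power v_divide mult field_simps)
 qed
 ultimately show ?thesis by (simp add: nb_def)
qed

lemma nb_power: assumes "nb R C f" "R\<ge>0" shows "nb R (C^n) (f^n)"
proof (induction n)
 case 0 show ?case using nb_const[of R 1] by simp
next case (Suc n) thus ?case using nb_mult[OF assms(1) Suc assms(2)] by simp
qed

lemma zterm_exponent: assumes "s\<ge>1" "X = q*(s - 1) div (q - 1)"
 shows "X * q^i + q^i\<le>s*(\<Sum>j=1..i. q^j) + 2 * s"
proof -
 define d where "d = q - 1"
 have d: "d\<ge>1" and qd: "q = Suc d" using q_ge2 by (simp_all add: d_def)
 have dX: "d * X\<le>q*(s - 1)" unfolding assms(2) d_def by simp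
 define Y where "Y = (\<Sum>j=1..i. q^j)"
 have Y: "d * Y + q = q * q^i" using geometric_sum_q[of i] by (simp add: Y_def d_def)
 obtain s' where s': "s = Suc s'" using assms(1) by (cases s) auto
 have "d*(X * q^i + q^i) = (d * X + d) * q^i" by (simp add: algebra_simps)
 also have "...\<le>(q * s' + q) * q^i" using dX qd s' by (intro mult_right_mono add_mono) auto
 also have "... = s*(q * q^i)" by (simp add: s' algebra_simps)
 also have "... = s*(d * Y + q)" by (simp add: Y)
 also have "...\<le>d*(s * Y + 2 * s)"
 proof -
  have "s * q\<le>s*(2 * d)" using d qd by (intro mult_left_mono) auto
  thus ?thesis by (simp add: algebra_simps)
 qed
 finally have "d*(X * q^i + q^i)\<le>d*(s * Y + 2 * s)" .
 thus ?thesis using d by (simp add: Y_def)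
qed

text \<open>The exponential growth of the degrees in the twisted numerator is compensated by the denominators,
  because \<open>H\<^bsub>s-1\<^esub>\<close> has degree at most \<open>q (s - 1) / (q - 1) < q s / (q - 1)\<close> in \<open>\<theta>\<close>.\<close>

lemma zterm_bound: assumes s: "s\<ge>1" and R: "0 < R" "R\<le>real q^q"
 shows "\<exists>C\<ge>0. \<forall>i. nb R (C*(1/real q)^i) (zterm s i)"
proof -
 define X where "X = q*(s - 1) div (q - 1)"
 define H where "H = AT_H q \<theta> (s - 1)"
 have H: "v (coeff H n)\<le>real q^X" for n
  using AT_H_degree[of "s - 1"] Bn_upper[of _ 0 X] by (simp add: theta_degree_le_def H_def X_def v_theta)
 define R' where "R' = max 1 R^degree H"
 have q1: "real q > 1" using q_ge2 by simp
 have R': "R'\<ge>1" unfolding R'_def by (intro one_le_power) simp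
 have nbt: "nb R ((real q^X)^(q^i) * R') (twist q (int i) (fps_of_poly H))" for i unfolding nb_def
 proof
  fix n
  show "v (fps_nth (twist q (int i) (fps_of_poly H)) n) * R^n\<le>(real q^X)^(q^i) * R'"
  proof (cases "n\<le>degree H")
   case True
   have "R^n\<le>max 1 R^n" using R by (intro power_mono) auto
   also have "...\<le>R'" unfolding R'_def using True by (intro power_increasing) auto
   finally show ?thesis unfolding twist_nth fps_of_poly_nth v_power
    using R by (intro mult_mono power_mono H nonneg) auto
  next case False hence "fps_nth (twist q (int i) (fps_of_poly H)) n = 0"
    unfolding twist_nth using q_ge2 by (simp add: coeff_eq_0)
   thus ?thesis using R' by simp
  qed
 qed
 define Y where "Y i = (\<Sum>j=1..i. q^j)" for i
 have nbL: "nb R ((1/real q)^Y i) (inverse (fps_of_poly (AT_L q \<theta> i)))" for i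
 proof (induction i)
  case 0 show ?case using nb_const[of R 1] by (simp add: Y_def AT_L_def)
 next case (Suc i)
  have "real q^q^1\<le>real q^(q^Suc i)" using q1 q_ge2 by (intro power_increasing) auto
  hence "nb R (1/v (\<theta>^(q^Suc i))) (inverse (fps_X - fps_const (\<theta>^(q^Suc i))))"
   using R by (intro nb_inverse_linear) (auto simp: v_power v_theta)
  hence "nb R ((1/real q)^Y i*(1/v (\<theta>^(q^Suc i))))
    (inverse (fps_of_poly (AT_L q \<theta> i)) * inverse (fps_X - fps_const (\<theta>^(q^Suc i))))"
   using Suc R by (intro nb_mult) auto
  moreover have "(1/real q)^Y i*(1/v (\<theta>^(q^Suc i))) = (1/real q)^Y (Suc i)"
   by (simp add: Y_def v_power v_theta power_add power_one_over)
  moreover have "inverse (fps_of_poly (AT_L q \<theta> (Suc i))) =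
    inverse (fps_of_poly (AT_L q \<theta> i)) * inverse (fps_X - fps_const (\<theta>^(q^Suc i)))"
   unfolding AT_L_prod by (simp add: fps_inverse_mult mult.commute)
  ultimately show ?case by simp
 qed
 have zt: "zterm s i = twist q (int i) (fps_of_poly H) * inverse (fps_of_poly (AT_L q \<theta> i))^s" for i
 proof -
  have "fps_nth (fps_of_poly (AT_L q \<theta> i)^s) 0~=0" using AT_L_nth_0 by (simp add: fps_nth_power_0)
  thus ?thesis unfolding zterm_def H_def by (simp add: fps_divide_unit fps_inverse_power)
 qed
 have "nb R (real q^(2 * s) * R'*(1/real q)^i) (zterm s i)" for i
 proof (rule nb_mono)
  show "nb R ((real q^X)^(q^i) * R'*((1/real q)^Y i)^s) (zterm s i)"
   unfolding zt using R by (intro nb_mult nbt nb_power nbL) auto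
  have "i\<le>2^i" by (rule less_imp_le[OF less_exp])
  also have "...\<le>q^i" using q_ge2 by (intro power_mono) auto
  finally have "i\<le>q^i" .
  hence "X * q^i + i\<le>s * Y i + 2 * s" using zterm_exponent[OF s X_def, of i] by (simp add: Y_def)
  hence "real q^(X * q^i + i)\<le>real q^(s * Y i + 2 * s)" using q1 by (intro power_increasing) auto
  hence "real q^(X * q^i) * real q^i\<le>real q^(Y i * s) * real q^(2 * s)"
   by (simp add: power_add mult.commute)
  hence "real q^(X * q^i)*(1/real q)^(Y i * s)\<le>real q^(2 * s)*(1/real q)^i"
   using q1 by (simp add: power_one_over field_simps)
  hence "(real q^(X * q^i)*(1/real q)^(Y i * s)) * R'\<le>(real q^(2 * s)*(1/real q)^i) * R'"
   using R' by (intro mult_right_mono) auto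
  thus "(real q^X)^(q^i) * R'*((1/real q)^Y i)^s\<le>real q^(2 * s) * R'*(1/real q)^i"
   by (simp only: ac_simps flip: power_mult)
 qed
 thus ?thesis using R' by (intro exI[of _ "real q^(2 * s) * R'"]) auto
qed

end

context C_inf_l
begin

text \<open>Partial sums over \<open>N > i\<^sub>1 > \<dots> > i\<^sub>d\<close>. Their recursive form makes functional equations and estimates
  accessible to induction on the index.\<close>

fun zsum :: "nat list => nat => 'c fps" where "zsum [] N = 1"
| "zsum (s # ss) N = (\<Sum>i<N. zterm s i * zsum ss i)"

text \<open>The contribution of the terms with \<open>i\<^sub>d = 0\<close>, which the inverse twist does not carry to terms of the
  same series.\<close>

definition zstep :: "nat => 'c fps" where "zstep s = (fps_X - fps_const \<theta>)^s * sg (fps_of_poly (AT_H q \<theta> (s - 1)))"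

lemma zsum_functional_equation: "s~=[] ==> (fps_X - fps_const \<theta>)^sum_list s * sg (zsum s (Suc N)) =
   zsum s N + zstep (last s) * zsum (butlast s) N"
proof (induction s arbitrary: N)
 case (Cons a ss)
 let ?x = "fps_X - fps_const \<theta>"
 have split: "?x^sum_list (a # ss) * sg (zsum (a # ss) (Suc N)) =
   ?x^a * sg (zterm a 0)*(?x^sum_list ss * sg (zsum ss 0)) +
   (\<Sum>i<N. zterm a i*(?x^sum_list ss * sg (zsum ss (Suc i))))"
 proof -
  have "?x^sum_list (a # ss) * sg (zsum (a # ss) (Suc N)) =
    (\<Sum>i<Suc N. (?x^a * sg (zterm a i))*(?x^sum_list ss * sg (zsum ss i)))"
   by (simp only: zsum.simps sg_sum sg_mult sum_list.Cons power_add sum_distrib_left) (simp only: ac_simps)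
  also have "... = (?x^a * sg (zterm a 0))*(?x^sum_list ss * sg (zsum ss 0)) +
    (\<Sum>i<N. (?x^a * sg (zterm a (Suc i)))*(?x^sum_list ss * sg (zsum ss (Suc i))))"
   by (rule sum.lessThan_Suc_shift)
  finally show ?thesis by (simp only: zterm_Suc)
 qed
 show ?case
 proof (cases "ss = []")
  case True show ?thesis unfolding split by (simp add: True zstep_def zterm_0)
 next case False
  then obtain b bs where ss: "ss = b # bs" by (cases ss) auto
  have "?x^sum_list ss * sg (zsum ss 0) = 0" by (simp add: ss)
  hence "?x^sum_list (a # ss) * sg (zsum (a # ss) (Suc N)) =
    (\<Sum>i<N. zterm a i*(zsum ss i + zstep (last ss) * zsum (butlast ss) i))" unfolding split Cons.IH[OF False] by simp
  also have "... = zsum (a # ss) N + zstep (last ss) * zsum (a # butlast ss) N"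
   by (simp add: distrib_left sum.distrib sum_distrib_left ac_simps)
  finally show ?thesis using False by simp
 qed
qed simp

definition hd0 :: "nat list => nat" where "hd0 xs = (case xs of [] => 0 | x # _ => x)"

lemma AT_zeta_term_Cons: "AT_zeta_term q \<theta> (s # ss) (i # is) = zterm s i * AT_zeta_term q \<theta> ss is"
 unfolding AT_zeta_term_def by (simp add: zterm_def prod.lessThan_Suc_shift del: prod.lessThan_Suc)

lemma AT_zeta_term_bound: assumes R: "0 < R" "R\<le>real q^q" and "\<forall>a\<in>set s. a\<ge>1"
 shows "\<exists>C\<ge>0. \<forall>is. length is = length s --> nb R (C*(1/real q)^hd0 is) (AT_zeta_term q \<theta> s is)" using assms(3)
proof (induction s)
 case Nil
 have "nb R 1 1" using nb_const[of R 1] by simp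
 thus ?case by (intro exI[of _ 1]) (simp add: AT_zeta_term_def hd0_def)
next case (Cons a s)
 obtain C where C: "C\<ge>0" "\<And>is. length is = length s ==> nb R (C*(1/real q)^hd0 is) (AT_zeta_term q \<theta> s is)"
  using Cons by auto
 obtain D where D: "D\<ge>0" "\<And>i. nb R (D*(1/real q)^i) (zterm a i)"
  using zterm_bound[OF _ R, of a] Cons.prems by auto
 have q1: "real q > 1" using q_ge2 by simp
 have "nb R (D * C*(1/real q)^hd0 js) (AT_zeta_term q \<theta> (a # s) js)" if js: "length js = length (a # s)" for js
 proof -
  obtain i "is" where js': "js = i # is" "length is = length s" using js by (cases js) auto
  have "C*(1/real q)^hd0 is\<le>C*1" using C(1) q1 by (intro mult_left_mono power_le_one) auto
  hence "nb R C (AT_zeta_term q \<theta> s is)" using C(2)[OF js'(2)] nb_mono by simp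
  hence "nb R (D*(1/real q)^i * C) (zterm a i * AT_zeta_term q \<theta> s is)" using D(2) R by (intro nb_mult) auto
  thus ?thesis by (simp add: js' AT_zeta_term_Cons hd0_def ac_simps)
 qed
 thus ?case using C(1) D(1) by (intro exI[of _ "D * C"]) auto
qed

lemma zsum_bound: assumes R: "0 < R" "R\<le>real q^q" and "\<forall>a\<in>set s. a\<ge>1"
 shows "\<exists>C\<ge>0. \<forall>N. nb R C (zsum s N) \<and> nb R (C*(1/real q)^N) (zsum s (Suc N) - zsum s N)" using assms(3)
proof (induction s)
 case Nil
 have "nb R 1 1" using nb_const[of R 1] by simp
 thus ?case by (intro exI[of _ 1]) (simp add: nb_0)
next case (Cons a s)
 obtain C where C: "C\<ge>0" "\<And>N. nb R C (zsum s N)" using Cons by auto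
 obtain D where D: "D\<ge>0" "\<And>i. nb R (D*(1/real q)^i) (zterm a i)"
  using zterm_bound[OF _ R, of a] Cons.prems by auto
 have q1: "real q > 1" using q_ge2 by simp
 have t: "nb R (D * C*(1/real q)^i) (zterm a i * zsum s i)" for i
  using nb_mult[OF D(2) C(2), of i i] R by (simp add: ac_simps)
 have "D * C*(1/real q)^i\<le>D * C*1" for i using C(1) D(1) q1 by (intro mult_left_mono power_le_one) auto
 hence "nb R (D * C) (zterm a i * zsum s i)" for i using nb_mono[OF t] by simp
 hence "nb R (D * C) (zsum (a # s) N)" for N using C(1) D(1) R by (simp add: nb_sum)
 moreover have "nb R (D * C*(1/real q)^N) (zsum (a # s) (Suc N) - zsum (a # s) N)" for N using t[of N] by simp
 ultimately show ?case using C(1) D(1) by (intro exI[of _ "D * C"]) auto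
qed

lemma q_power_small: "e > 0 ==> C\<ge>0 ==> \<exists>N0. \<forall>N\<ge>N0. C*(1/real q)^N < (e :: real)"
proof -
 assume e: "e > 0" "C\<ge>0"
 have q1: "real q > 1" using q_ge2 by simp
 obtain N0 where N0: "(1/real q)^N0 < e/(C + 1)" using real_arch_pow_inv[of "e/(C + 1)" "1/real q"] e q1 by auto
 have "C*(1/real q)^N < e" if "N\<ge>N0" for N
 proof -
  have "(1/real q)^N\<le>(1/real q)^N0" using that q1 by (intro power_decreasing) auto
  hence "(C + 1)*(1/real q)^N < (C + 1)*(e/(C + 1))" using N0 e by (intro mult_strict_left_mono) auto
  hence "(C + 1)*(1/real q)^N < e" using e by simp
  moreover have "C*(1/real q)^N\<le>(C + 1)*(1/real q)^N" by (intro mult_right_mono) auto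
  ultimately show ?thesis by linarith
 qed
 thus ?thesis by blast
qed

lemma nth_small: assumes "nb R C f" "R > 0" shows "v (fps_nth f n)\<le>C/R^n"
 using nbD[OF assms(1), of n] assms(2) by (simp add: field_simps)

lemma zsum_converges: assumes "\<forall>a\<in>set s. a\<ge>1"
 shows "\<exists>Z. (\<forall>n. vconv sequentially (\<lambda>N. fps_nth (zsum s N) n) (fps_nth Z n)) \<and> bdd RR Z"
proof -
 have R: "0 < RR" "RR\<le>real q^q" using RR by auto
 obtain C where C: "C\<ge>0" "\<And>N. nb RR C (zsum s N)"
  "\<And>N. nb RR (C*(1/real q)^N) (zsum s (Suc N) - zsum s N)" using zsum_bound[OF R assms] by blast
 have "\<exists>L. vconv sequentially (\<lambda>N. fps_nth (zsum s N) n) L" for n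
 proof (rule complete_consecutive[OF complete])
  fix e :: real assume "e > 0"
  then obtain N0 where N0: "\<forall>N\<ge>N0. C*(1/real q)^N < e * RR^n"
   using q_power_small[of "e * RR^n" C] C(1) R by auto
  have "v (fps_nth (zsum s (Suc N)) n - fps_nth (zsum s N) n) < e" if "N\<ge>N0" for N
  proof -
   have "v (fps_nth (zsum s (Suc N) - zsum s N) n)\<le>C*(1/real q)^N/RR^n" by (rule nth_small[OF C(3) R(1)])
   also have "... < e" using N0 that R by (simp add: pos_divide_less_eq)
   finally show ?thesis by simp
  qed
  thus "\<exists>N. \<forall>n'\<ge>N. v (fps_nth (zsum s (Suc n')) n - fps_nth (zsum s n') n) < e" by blast
 qed
 then obtain c where c: "\<And>n. vconv sequentially (\<lambda>N. fps_nth (zsum s N) n) (c n)" by metis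
 have "nb RR C (Abs_fps c)" unfolding nb_def
 proof
  fix n
  have "v (c n)\<le>C/RR^n" by (rule vconv_bound[OF c]) (simp_all add: nth_small[OF C(2) R(1)])
  thus "v (fps_nth (Abs_fps c) n) * RR^n\<le>C" using R by (simp add: pos_le_divide_eq)
 qed
 thus ?thesis using c by (intro exI[of _ "Abs_fps c"]) (auto intro: bddI)
qed

definition decr :: "nat list => nat list set" where "decr s = {is'. length is' = length s \<and> sorted_wrt (>) is'}"

definition decr_below :: "nat list => nat => nat list set" where "decr_below s N = {is'\<in>decr s. \<forall>i\<in>set is'. i < N}"

lemma decr_below_Cons: "decr_below (a # s) N = (\<lambda>(i, is). i # is)`(SIGMA i:{..<N}. decr_below s i)"
proof (intro equalityI subsetI)
 fix js assume "js\<in>decr_below (a # s) N"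
 then obtain i "is" where "js = i # is" "i < N" "is\<in>decr_below s i" by (cases js) (auto simp: decr_below_def decr_def)
 thus "js\<in>(\<lambda>(i, is). i # is)`(SIGMA i:{..<N}. decr_below s i)" by force
next fix js assume "js\<in>(\<lambda>(i, is). i # is)`(SIGMA i:{..<N}. decr_below s i)"
 thus "js\<in>decr_below (a # s) N" by (fastforce simp: decr_below_def decr_def)
qed

lemma finite_decr_below: "finite (decr_below s N)"
proof (induction s arbitrary: N)
 case Nil
 have "decr_below [] N\<subseteq>{[]}" by (auto simp: decr_below_def decr_def)
 thus ?case by (rule finite_subset) simp
qed (simp add: decr_below_Cons)

lemma sum_decr_below: "(\<Sum>is\<in>decr_below s N. AT_zeta_term q \<theta> s is) = zsum s N"
proof (induction s arbitrary: N)
 case Nil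
 have "decr_below [] N = {[]}" by (auto simp: decr_below_def decr_def)
 thus ?case by (simp add: AT_zeta_term_def)
next case (Cons a s)
 have inj: "inj_on (\<lambda>(i, is). i # is) (SIGMA i:{..<N}. decr_below s i)" by (auto simp: inj_on_def)
 have "(\<Sum>is\<in>decr_below (a # s) N. AT_zeta_term q \<theta> (a # s) is) =
   (\<Sum>(i, is)\<in>(SIGMA i:{..<N}. decr_below s i). zterm a i * AT_zeta_term q \<theta> s is)"
  unfolding decr_below_Cons sum.reindex[OF inj] by (simp add: case_prod_unfold o_def AT_zeta_term_Cons)
 also have "... = (\<Sum>i<N. \<Sum>is\<in>decr_below s i. zterm a i * AT_zeta_term q \<theta> s is)"
  by (rule sum.Sigma[symmetric]) (auto simp: finite_decr_below)
 also have "... = zsum (a # s) N" by (simp add: Cons flip: sum_distrib_left)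
 finally show ?case .
qed

text \<open>The terms tend to 0 along the cofinite filter, so the net of finite partial sums converges to the
  limit of the sums over \<open>i\<^sub>1 < N\<close>.\<close>

lemma AT_zeta_eq: assumes s: "s~=[]" "\<forall>a\<in>set s. a\<ge>1"
  and Z: "\<And>n. vconv sequentially (\<lambda>N. fps_nth (zsum s N) n) (fps_nth Z n)" shows "AT_zeta v q \<theta> s = Z"
proof -
 have R: "0 < RR" "RR\<le>real q^q" using RR by auto
 obtain C where C: "C\<ge>0" "\<And>is. length is = length s ==> nb RR (C*(1/real q)^hd0 is) (AT_zeta_term q \<theta> s is)"
  using AT_zeta_term_bound[OF R s(2)] by blast
 have q1: "real q > 1" using q_ge2 by simp
 have "vconv (finite_subsets_at_top (decr s)) (\<lambda>F. fps_nth (\<Sum>is\<in>F. AT_zeta_term q \<theta> s is) n) (fps_nth Z n)" for n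
  unfolding vconv_def
 proof (intro allI impI)
  fix e :: real assume e: "e > 0"
  obtain N0 where N0: "\<forall>N\<ge>N0. C*(1/real q)^N < e/2 * RR^n"
   using q_power_small[of "e/2 * RR^n" C] C(1) e R by auto
  obtain N1 where N1: "\<forall>N\<ge>N1. v (fps_nth (zsum s N) n - fps_nth Z n) < e"
   using vconvD[OF Z e] unfolding eventually_sequentially by blast
  define N where "N = max N0 N1"
  have small: "v (fps_nth (AT_zeta_term q \<theta> s is) n)\<le>e/2" if "is\<in>decr s" "is\<notin>decr_below s N" for "is"
  proof -
   have "\<not> (\<forall>i\<in>set is. i < N)" using that by (simp add: decr_below_def)
   then obtain i where i: "i\<in>set is" "i\<ge>N" using not_less by blast
   then obtain k ks where k: "is = k # ks" by (cases "is") auto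
   have "k\<ge>i" using i that(1) by (auto simp: k decr_def)
   hence "hd0 is\<ge>N0" using i(2) by (simp add: k hd0_def N_def)
   hence "C*(1/real q)^hd0 is < e/2 * RR^n" using N0 by blast
   moreover have "v (fps_nth (AT_zeta_term q \<theta> s is) n)\<le>C*(1/real q)^hd0 is/RR^n"
    using that(1) by (intro nth_small C(2) R) (simp add: decr_def)
   ultimately show ?thesis using R by (smt (verit) divide_less_eq zero_less_power)
  qed
  have "v (fps_nth (\<Sum>is\<in>F. AT_zeta_term q \<theta> s is) n - fps_nth Z n) < e"
   if F: "finite F" "decr_below s N\<subseteq>F" "F\<subseteq>decr s" for F
  proof -
   have "(\<Sum>is\<in>F. AT_zeta_term q \<theta> s is) = zsum s N + (\<Sum>is\<in>F - decr_below s N. AT_zeta_term q \<theta> s is)"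
    using sum.subset_diff[OF F(2,1), of "AT_zeta_term q \<theta> s"] by (simp add: sum_decr_below add.commute)
   hence eq: "fps_nth (\<Sum>is\<in>F. AT_zeta_term q \<theta> s is) n - fps_nth Z n =
     (fps_nth (zsum s N) n - fps_nth Z n) + (\<Sum>is\<in>F - decr_below s N. fps_nth (AT_zeta_term q \<theta> s is) n)"
    by (simp add: fps_sum_nth)
   have "v (\<Sum>is\<in>F - decr_below s N. fps_nth (AT_zeta_term q \<theta> s is) n)\<le>e/2"
    by (rule v_sum) (use e small F(3) in auto)
   moreover have "v (fps_nth (zsum s N) n - fps_nth Z n) < e" using N1 by (simp add: N_def)
   ultimately show ?thesis unfolding eq by (intro le_less_trans[OF ultrametric]) (use e in simp)
  qed
  moreover have "decr_below s N\<subseteq>decr s" by (auto simp: decr_below_def)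
  ultimately show "\<forall>\<^sub>F F in finite_subsets_at_top (decr s). v (fps_nth (\<Sum>is\<in>F. AT_zeta_term q \<theta> s is) n - fps_nth Z n) < e"
   unfolding eventually_finite_subsets_at_top by (intro exI[of _ "decr_below s N"]) (simp add: finite_decr_below)
 qed
 hence "vlim v (finite_subsets_at_top (decr s)) (\<lambda>F. fps_nth (\<Sum>is\<in>F. AT_zeta_term q \<theta> s is) n) = fps_nth Z n" for n
  by (rule vlim_eq) (rule finite_subsets_at_top_neq_bot)
 thus ?thesis unfolding AT_zeta_def fps_vlim_def decr_def[symmetric] by (intro fps_ext) simp
qed

definition zet :: "nat list => 'c fps" where "zet s = (if s = [] then 1 else AT_zeta v q \<theta> s)"

lemma zet_limit: assumes "\<forall>a\<in>set s. a\<ge>1"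
 shows "vconv sequentially (\<lambda>N. fps_nth (zsum s N) n) (fps_nth (zet s) n)" and "bdd RR (zet s)"
proof -
 obtain Z where Z: "\<And>n. vconv sequentially (\<lambda>N. fps_nth (zsum s N) n) (fps_nth Z n)" "bdd RR Z"
  using zsum_converges[OF assms] by blast
 have "zet s = Z"
 proof (cases "s = []")
  case True
  have "fps_nth Z n = fps_nth 1 n" for n
   using vconv_unique[OF Z(1)[of n], of "fps_nth 1 n"] by (simp add: True vconv_const)
  thus ?thesis by (simp add: zet_def True fps_eq_iff)
 next case False thus ?thesis using AT_zeta_eq[OF False assms Z(1)] by (simp add: zet_def)
 qed
 thus "vconv sequentially (\<lambda>N. fps_nth (zsum s N) n) (fps_nth (zet s) n)" "bdd RR (zet s)" using Z by auto
qed

lemma zet_functional_equation: assumes "s~=[]" "\<forall>a\<in>set s. a\<ge>1"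
 shows "(fps_X - fps_const \<theta>)^sum_list s * sg (zet s) = zet s + zstep (last s) * zet (butlast s)"
proof (rule fps_ext)
 fix n
 let ?x = "fps_X - fps_const \<theta>"
 have b: "\<forall>a\<in>set (butlast s). a\<ge>1" using assms(2) by (auto dest: in_set_butlastD)
 have "vconv sequentially (\<lambda>N. fps_nth (?x^sum_list s * sg (zsum s (Suc N))) n) (fps_nth (?x^sum_list s * sg (zet s)) n)"
  by (intro vconv_fps_mult) (simp only: sg_nth, intro vconv_rt vconv_Suc zet_limit assms(2))
 moreover have "vconv sequentially (\<lambda>N. fps_nth (?x^sum_list s * sg (zsum s (Suc N))) n)
   (fps_nth (zet s + zstep (last s) * zet (butlast s)) n)" unfolding zsum_functional_equation[OF assms(1)] fps_add_nth
  by (intro vconv_add vconv_fps_mult zet_limit assms(2) b)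
 ultimately show "fps_nth (?x^sum_list s * sg (zet s)) n = fps_nth (zet s + zstep (last s) * zet (butlast s)) n"
  by (rule vconv_unique) simp
qed

lemma zstep_PB: "zstep a\<in>PB" unfolding zstep_def
 by (intro subring_mult[OF PB_subring] subring_power[OF PB_subring] subring_diff[OF PB_subring]
  PB_X PB_const BB_theta PB_sg PB_I AT_H_BB)

end

section \<open>Jets of functions\<close>

locale jet_setup = C_inf_l where v = v and q = q and \<theta> = \<theta> and l = l for v :: "'c::field => real" and q \<theta> l +
 fixes \<rho>1 \<rho>l :: 'c and n :: nat and I :: "nat list set"
 assumes \<rho>1: "\<rho>1^(q^1 - 1) = - \<theta>" and \<rho>l: "\<rho>l^(q^l - 1) = - \<theta>"
  and finite_I: "finite I" and index_I: "s\<in>I ==> s~=[] \<and> (\<forall>a\<in>set s. a\<ge>1)"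
  and butlast_I: "s\<in>I ==> butlast s\<in>insert [] I"
begin

abbreviation F :: "'c fps => 'c fls" where "F \<equiv> fps_to_fls"
abbreviation tt :: "'c fps" where "tt \<equiv> fps_X - fps_const \<theta>"

definition Om :: "'c fps" where "Om = Omega v q \<theta> 1 \<rho>1"
definition u :: "nat => 'c fps" where "u i = (sg ^^ i) (Omega v q \<theta> l \<rho>l)"

lemma sg_Om: "sg Om = tt * Om" and bdd_Om: "bdd RR Om" and Om_0: "Om~=0"
 using Omega_properties[OF _ \<rho>1, of RR] RR by (simp_all add: Om_def)

lemma sg_u: "sg (u i) = u (Suc i)" by (simp add: u_def)

lemma u_l: "u l = tt * u 0" using Omega_properties(1)[OF l_pos \<rho>l, of 0] by (simp add: u_def)

lemma u_0: "u i~=0"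
proof (induction i)
 case 0 show ?case using Omega_properties(3)[OF l_pos \<rho>l, of 0] by (simp add: u_def)
next case (Suc i) thus ?case using sg_inj[of "u i" 0] by (simp add: sg_u)
qed

lemma bdd_u: assumes "i < l" shows "bdd RR (u i)"
proof -
 have q1: "real q > 1" using q_ge2 by simp
 have "bdd (real q^(q^(l - i))) (u i)" if "i\<le>l" for i using that
 proof (induction i)
  case 0 show ?case using Omega_properties(2)[OF l_pos \<rho>l, of "real q^(q^l)"] by (simp add: u_def)
 next case (Suc i)
  have "q^(l - i) = q^(l - Suc i) * q" using Suc.prems by (simp flip: power_Suc2 add: Suc_diff_Suc)
  hence "real q^(q^(l - i)) = (real q^(q^(l - Suc i)))^q" by (simp add: power_mult)
  hence "root q (real q^(q^(l - i))) = real q^(q^(l - Suc i))" using q_ge2 by (simp add: real_root_power_cancel)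
  thus ?case using bdd_sg[of "real q^(q^(l - i))" "u i"] Suc q1 by (simp add: sg_u)
 qed
 moreover have "RR\<le>real q^(q^(l - i))"
 proof -
  have "q^1\<le>q^(l - i)" using assms q_ge2 by (intro power_increasing) auto
  hence "real q^q\<le>real q^(q^(l - i))" using q1 by (intro power_increasing) auto
  thus ?thesis using RR(4) by linarith
 qed
 ultimately show ?thesis using assms RR(3) by (meson bdd_antimono less_imp_le)
qed

definition jets :: "'c fps set => 'c fps set" where "jets B = {hyperderiv j f | j f. j\<le>n \<and> f\<in>B}"

lemma jets_image: "jets B = (\<lambda>(j, f). hyperderiv j f)`({..n}\<times>B)" by (auto simp: jets_def)

lemma finite_jets: "finite B ==> finite (jets B)" by (simp add: jets_image)

lemma jets_Un: "jets (A\<union>B) = jets A\<union>jets B" by (auto simp: jets_def)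

lemma bdd_jets: "(\<And>f. f\<in>B ==> bdd RR f) ==> g\<in>jets B ==> bdd RR g" using bdd_hyperderiv RR by (auto simp: jets_def)

definition hol :: "'c fls set => 'c fps set" where "hol M = {f. \<forall>j\<le>n. F (hyperderiv j f)\<in>M}"

lemma hol_jets: "F`jets B\<subseteq>M \<longleftrightarrow> B\<subseteq>hol M" by (auto simp: jets_def hol_def)

lemma hol_subring: assumes M: "is_subring M" shows "is_subring (hol M)"
proof (rule subringI)
 show "0\<in>hol M" "1\<in>hol M" using subring_0[OF M] subring_1[OF M] by (auto simp: hol_def hyperderiv_1)
 show "x + y\<in>hol M" if "x\<in>hol M" "y\<in>hol M" for x y
  using that subring_add[OF M] by (simp add: hol_def hyperderiv_add)
 show "- x\<in>hol M" if "x\<in>hol M" for x using that subring_uminus[OF M] by (simp add: hol_def hyperderiv_uminus)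
 show "x * y\<in>hol M" if "x\<in>hol M" "y\<in>hol M" for x y
  unfolding hol_def hyperderiv_mult fps_to_fls_sum fps_to_fls_mult mem_Collect_eq
  using that by (intro allI impI subring_sum[OF M] subring_mult[OF M]) (simp_all add: hol_def)
qed

lemma hol_PB: "KK\<subseteq>M ==> PB\<subseteq>hol M" using PB_KK PB_hyperderiv by (auto simp: hol_def)

text \<open>The hyperderivatives of \<open>g\<close> are found successively from those of \<open>f\<close> and \<open>f * g\<close> by the Leibniz rule.\<close>

lemma hol_cancel: assumes M: "is_subfield M" and "f * g\<in>hol M" "f\<in>hol M" "f~=0" shows "g\<in>hol M"
proof -
 note R = subfield_subring[OF M]
 have "F (hyperderiv j g)\<in>M" if "j\<le>n" for j using that
 proof (induction j rule: less_induct)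
  case (less j)
  have "hyperderiv j (f * g) = f * hyperderiv j g + (\<Sum>k\<in>{1..j}. hyperderiv k f * hyperderiv (j - k) g)"
   unfolding hyperderiv_mult by (simp add: sum.atMost_shift sum.atLeast1_atMost_eq lessThan_Suc_atMost)
  hence "F (hyperderiv j (f * g)) = F f * F (hyperderiv j g) + (\<Sum>k\<in>{1..j}. F (hyperderiv k f) * F (hyperderiv (j - k) g))"
   by (simp add: fps_to_fls_sum fps_to_fls_mult)
  hence "F (hyperderiv j g) = (F (hyperderiv j (f * g)) - (\<Sum>k\<in>{1..j}. F (hyperderiv k f) * F (hyperderiv (j - k) g)))/F f"
   using assms(4) by simp
  moreover have "F f\<in>M" using assms(3) unfolding hol_def by (metis (mono_tags) hyperderiv_zeroth le0 mem_Collect_eq)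
  moreover have "(\<Sum>k\<in>{1..j}. F (hyperderiv k f) * F (hyperderiv (j - k) g))\<in>M"
   using less assms(3) by (intro subring_sum[OF R] subring_mult[OF R]) (auto simp: hol_def)
  moreover have "F (hyperderiv j (f * g))\<in>M" using assms(2) less.prems by (simp add: hol_def)
  ultimately show ?case by (simp only:) (intro subfield_divide[OF M] subring_diff[OF R])
 qed
 thus ?thesis by (simp add: hol_def)
qed

section \<open>Difference systems for the jets\<close>

text \<open>Localization of the span of \<open>G\<close> at \<open>t - \<theta>\<close>, which vanishes at none of the points \<open>th N\<close> with \<open>N \<ge> 1\<close>.\<close>

definition loc :: "'c fps set => 'c fps set" where "loc G = {f. \<exists>M. tt^M * f\<in>lspan PB G}"

lemma tt_PB: "tt\<in>PB" by (intro subring_diff[OF PB_subring] PB_X PB_const BB_theta)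

lemma tt_power_PB: "tt^k\<in>PB" by (intro subring_power[OF PB_subring] tt_PB)

lemma loc_mono_exponent: assumes "tt^M * f\<in>lspan PB G" "M\<le>M'" shows "tt^M' * f\<in>lspan PB G"
proof -
 have "tt^M' = tt^(M' - M) * tt^M" unfolding power_add[symmetric] using assms(2) by simp
 hence "tt^M' * f = tt^(M' - M)*(tt^M * f)" by (simp only: mult.assoc)
 thus ?thesis using lspan_scale[OF PB_subring tt_power_PB assms(1)] by (simp only:)
qed

lemma loc_add: "f\<in>loc G ==> g\<in>loc G ==> f + g\<in>loc G"
proof -
 assume "f\<in>loc G" "g\<in>loc G"
 then obtain M M' where "tt^M * f\<in>lspan PB G" "tt^M' * g\<in>lspan PB G" by (auto simp: loc_def)
 hence "tt^(M + M') * f\<in>lspan PB G" "tt^(M + M') * g\<in>lspan PB G"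
  using loc_mono_exponent le_add1 le_add2 by blast+
 hence "tt^(M + M')*(f + g)\<in>lspan PB G" by (simp add: distrib_left lspan_add)
 thus ?thesis by (auto simp: loc_def)
qed

lemma loc_PB_mult: "p\<in>PB ==> f\<in>loc G ==> p * f\<in>loc G"
proof -
 assume p: "p\<in>PB" "f\<in>loc G"
 then obtain M where "tt^M * f\<in>lspan PB G" by (auto simp: loc_def)
 from lspan_scale[OF PB_subring p(1) this] have "tt^M*(p * f)\<in>lspan PB G" by (simp add: ac_simps)
 thus ?thesis by (auto simp: loc_def)
qed

lemma loc_uminus: "f\<in>loc G ==> - f\<in>loc G"
 using loc_PB_mult[of "- 1" f G] subring_uminus[OF PB_subring subring_1[OF PB_subring]] by simp

lemma loc_0: "0\<in>loc G" by (auto simp: loc_def lspan.zero)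

lemma loc_sum: "(\<And>i. i\<in>A ==> f i\<in>loc G) ==> sum f A\<in>loc G"
 by (induction A rule: infinite_finite_induct) (auto intro: loc_add loc_0)

lemma loc_gen: "g\<in>G ==> g\<in>loc G"
 unfolding loc_def by (rule CollectI, rule exI[of _ 0]) (simp add: lspan_gen[OF PB_subring])

lemma loc_cancel: "tt^k * f\<in>loc G ==> f\<in>loc G" unfolding loc_def by (auto simp flip: mult.assoc power_add)

definition jloc :: "'c fps set => 'c fps set" where "jloc G = {f. \<forall>j\<le>n. hyperderiv j f\<in>loc G}"

lemma jloc_add: "f\<in>jloc G ==> g\<in>jloc G ==> f + g\<in>jloc G" by (simp add: jloc_def hyperderiv_add loc_add)

lemma jloc_uminus: "f\<in>jloc G ==> - f\<in>jloc G" by (simp add: jloc_def hyperderiv_uminus loc_uminus)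

lemma jloc_PB_mult: "p\<in>PB ==> f\<in>jloc G ==> p * f\<in>jloc G" unfolding jloc_def hyperderiv_mult mem_Collect_eq
 by (intro allI impI loc_sum loc_PB_mult PB_hyperderiv) auto

text \<open>By the Leibniz rule for \<open>t - \<theta>\<close>, the hyperderivative of order \<open>j\<close> of the product determines that of
  the other factor up to terms of lower order.\<close>

lemma jloc_cancel: assumes "tt^k * f\<in>jloc G" shows "f\<in>jloc G"
proof -
 have "hyperderiv j f\<in>loc G" if "j\<le>n" for j using that
 proof (induction j rule: less_induct)
  case (less j)
  have "hyperderiv j (tt^k * f) = tt^k * hyperderiv j f + (\<Sum>i\<in>{1..j}. hyperderiv i (tt^k) * hyperderiv (j - i) f)"
   unfolding hyperderiv_mult by (simp add: sum.atMost_shift sum.atLeast1_atMost_eq lessThan_Suc_atMost)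
  hence "tt^k * hyperderiv j f = hyperderiv j (tt^k * f) + - (\<Sum>i\<in>{1..j}. hyperderiv i (tt^k) * hyperderiv (j - i) f)"
   by simp
  also have "...\<in>loc G"
   using less assms by (intro loc_add loc_uminus loc_sum loc_PB_mult PB_hyperderiv tt_power_PB) (auto simp: jloc_def)
  finally show ?case by (rule loc_cancel)
 qed
 thus ?thesis by (simp add: jloc_def)
qed

text \<open>Passing from \<open>loc\<close> to the span of \<open>G\<close> requires one common power of \<open>t - \<theta>\<close> for finitely many functions.\<close>

lemma jet_system: assumes B: "finite B" and G: "G = insert 1 (jets B)"
  and good: "\<And>f. f\<in>B ==> sg f\<in>jloc G \<and> f\<in>jloc (sg`G)" shows "system G"
proof -
 have fin: "finite G" using finite_jets[OF B] by (simp add: G)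
 have 1: "sg g\<in>loc G \<and> g\<in>loc (sg`G)" if "g\<in>G" for g
 proof (cases "g = 1")
  case True
  have "1\<in>G" "1\<in>sg`G" using image_eqI[of 1 sg 1 G] by (auto simp: G)
  thus ?thesis using True loc_gen by auto
 next case False
  then obtain j f where "g = hyperderiv j f" "j\<le>n" "f\<in>B" using \<open>g \<in> G\<close> by (auto simp: G jets_def)
  thus ?thesis using good by (auto simp: sg_hyperderiv jloc_def)
 qed
 have uniform: "\<exists>M. \<forall>g\<in>G. tt^M * h g\<in>lspan PB G'" if "\<And>g. g\<in>G ==> h g\<in>loc G'" for h G'
 proof -
  have "\<forall>g\<in>G. \<exists>M. tt^M * h g\<in>lspan PB G'" using that by (auto simp: loc_def)
  from bchoice[OF this] obtain M where M: "\<forall>g\<in>G. tt^M g * h g\<in>lspan PB G'" ..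
  have "tt^(\<Sum>g\<in>G. M g) * h g\<in>lspan PB G'" if "g\<in>G" for g
  proof (rule loc_mono_exponent)
   show "tt^M g * h g\<in>lspan PB G'" using M that by (rule bspec)
   show "M g\<le>(\<Sum>g\<in>G. M g)" using that fin by (intro member_le_sum) auto
  qed
  thus ?thesis by blast
 qed
 have lin: "[:- \<theta>, 1:]^M\<in>pol BB" for M
  by (intro subring_power[OF pol_subring[OF BB_subring]] pol_pCons pol_0 BB_subring subring_1 subring_uminus BB_theta)
 have pw: "fps_of_poly ([:- \<theta>, 1:]^M) = tt^M" for M
  by (simp add: fps_of_poly_power fps_of_poly_linear del: fps_of_poly_pCons)
 obtain M M' where "\<forall>g\<in>G. tt^M * sg g\<in>lspan PB G" "\<forall>g\<in>G. tt^M' * g\<in>lspan PB (sg`G)"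
  using uniform[of sg G] uniform[of "\<lambda>g. g" "sg`G"] 1 by blast
 moreover have "poly ([:- \<theta>, 1:]^M') (th N)~=0" if "N\<ge>1" for N
  using injD[OF th_inj, of N 0] that by (auto simp: th_0)
 moreover have "[:- \<theta>, 1:]^M~=0" by simp
 ultimately show ?thesis unfolding system_def using lin pw by metis
qed

lemma jloc_gen: "jets {f}\<subseteq>G ==> f\<in>jloc G \<and> sg f\<in>jloc (sg`G)"
 by (auto simp: jloc_def jets_def sg_hyperderiv[symmetric] intro: loc_gen)

lemma jloc_1: "1\<in>G ==> 1\<in>jloc G" by (auto simp: jloc_def hyperderiv_1 loc_gen loc_0)

lemma Om_good: "jets {Om}\<subseteq>G ==> sg Om\<in>jloc G \<and> Om\<in>jloc (sg`G)"
 using jloc_gen[of Om G] jloc_PB_mult[OF tt_PB, of Om G] jloc_cancel[of 1 Om "sg`G"] sg_Om by simp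

lemma u_good: assumes "\<And>i. i < l ==> jets {u i}\<subseteq>G" "i < l" shows "sg (u i)\<in>jloc G \<and> u i\<in>jloc (sg`G)"
proof
 show "sg (u i)\<in>jloc G"
 proof (cases "Suc i < l")
  case True thus ?thesis using jloc_gen assms(1) by (auto simp: sg_u)
 next case False hence "sg (u i) = tt * u 0" using assms(2) u_l by (metis Suc_lessI sg_u)
  thus ?thesis using jloc_PB_mult[OF tt_PB] jloc_gen assms by (metis le_less_trans le0)
 qed
 show "u i\<in>jloc (sg`G)"
 proof (cases i)
  case 0
  have "sg (u (l - 1)) = tt * u 0" using l_pos u_l by (simp add: sg_u)
  moreover have "sg (u (l - 1))\<in>jloc (sg`G)" using jloc_gen assms(1) l_pos by simp
  ultimately show ?thesis using jloc_cancel[of 1 "u 0"] 0 by simp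
 next case (Suc j) thus ?thesis using jloc_gen[OF assms(1), of j] assms(2) by (simp add: sg_u)
 qed
qed

lemma zet_good: assumes "\<And>s. s\<in>I ==> jets {zet s}\<subseteq>G" "1\<in>G" "s\<in>I"
 shows "sg (zet s)\<in>jloc G \<and> zet s\<in>jloc (sg`G)"
proof -
 have fe: "tt^sum_list s * sg (zet s) = zet s + zstep (last s) * zet (butlast s)" if "s\<in>I" for s
  using zet_functional_equation index_I[OF that] by blast
 have zG: "zet s\<in>jloc G" if "s\<in>insert [] I" for s
 proof (cases "s = []")
  case True thus ?thesis using jloc_1[OF assms(2)] by (simp add: zet_def)
 next case False thus ?thesis using jloc_gen[OF assms(1), of s] that by blast
 qed
 have "sg (zet s)\<in>jloc G" by (rule jloc_cancel[of "sum_list s"])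
   (unfold fe[OF assms(3)], intro jloc_add jloc_PB_mult zstep_PB zG butlast_I assms insertI2)
 moreover have "zet s\<in>jloc (sg`G)" using assms(3)
 proof (induction "length s" arbitrary: s rule: less_induct)
  case less
  have one: "1\<in>sg`G" using image_eqI[of 1 sg 1 G] assms(2) by simp
  have "zet (butlast s)\<in>jloc (sg`G)"
  proof (cases "butlast s = []")
   case True thus ?thesis using jloc_1[OF one] by (simp add: zet_def)
  next case False hence "butlast s\<in>I" using butlast_I[OF less.prems] by simp
   moreover have "length (butlast s) < length s" using index_I[OF less.prems] by simp
   ultimately show ?thesis using less.hyps by blast
  qed
  moreover have "zet s = tt^sum_list s * sg (zet s) + - (zstep (last s) * zet (butlast s))"
   using fe[OF less.prems] by simp
  moreover have "sg (zet s)\<in>jloc (sg`G)" using jloc_gen[OF assms(1)[OF less.prems]] by blast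
  ultimately show ?case using jloc_add jloc_uminus jloc_PB_mult zstep_PB tt_power_PB by metis
 qed
 ultimately show ?thesis ..
qed

definition Us :: "'c fps set" where "Us = u`{..<l}"
definition Zs :: "'c fps set" where "Zs = zet`I"

lemma finite_Us: "finite Us" and finite_Zs: "finite Zs" by (simp_all add: Us_def Zs_def finite_I)

lemma bdd_all: "f\<in>{Om}\<union>Us\<union>Zs ==> bdd RR f" using bdd_Om bdd_u zet_limit(2) index_I by (auto simp: Us_def Zs_def)

lemma system_all: "system (insert 1 (jets ({Om}\<union>Us\<union>Zs)))"
proof (rule jet_system[OF _ refl])
 define G where "G = insert 1 (jets ({Om}\<union>Us\<union>Zs))"
 fix f assume "f\<in>{Om}\<union>Us\<union>Zs"
 moreover have "sg Om\<in>jloc G \<and> Om\<in>jloc (sg`G)" by (rule Om_good) (auto simp: G_def jets_def)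
 moreover have "sg (u i)\<in>jloc G \<and> u i\<in>jloc (sg`G)" if "i < l" for i
  by (rule u_good[OF _ that]) (auto simp: G_def jets_def Us_def)
 moreover have "sg (zet s)\<in>jloc G \<and> zet s\<in>jloc (sg`G)" if "s\<in>I" for s
  by (rule zet_good[OF _ _ that]) (auto simp: G_def jets_def Zs_def)
 ultimately show "sg f\<in>jloc (insert 1 (jets ({Om}\<union>Us\<union>Zs))) \<and> f\<in>jloc (sg`insert 1 (jets ({Om}\<union>Us\<union>Zs)))"
  unfolding G_def[symmetric] by (auto simp: Us_def Zs_def)
qed (simp add: finite_Us finite_Zs)

lemma system_Om: "system (insert 1 (jets {Om}))"
 using Om_good[of "insert 1 (jets {Om})"] by (intro jet_system[OF _ refl]) auto

definition rf :: "'c fps set => nat" where "rf B = rk KK (F`jets B)"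
definition rv :: "'c fps set => nat" where "rv B = rk FF ((\<lambda>g. fps_value v g \<theta>)`jets B)"

lemma rk_insert_1: "is_subfield K ==> finite S ==> rk K (insert 1 S) = rk K S"
 using rk_insert[of S K 1] subring_1[OF subfield_subring] acl_base[of K S] by auto

lemma rf_le_rv: assumes "finite B" "\<And>f. f\<in>B ==> bdd RR f" "system (insert 1 (jets B))" shows "rf B\<le>rv B"
proof -
 have "rk KK (F`insert 1 (jets B))\<le>rk FF ((\<lambda>g. fps_value v g \<theta>)`insert 1 (jets B))"
 proof (rule rk_functions_le_values[OF _ assms(3) RR(1)])
  show "finite (insert 1 (jets B))" using finite_jets[OF assms(1)] by simp
  show "bdd RR g" if "g\<in>insert 1 (jets B)" for g using that bdd_jets[OF assms(2)] bdd_const[of RR 1] by auto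
 qed
 moreover have "fps_value v 1 \<theta> = 1" using value_const[of \<theta> 1] v_theta q_ge2 by simp
 ultimately show ?thesis using finite_jets[OF assms(1)] by (simp add: rf_def rv_def rk_insert_1 KK_subfield FF_subfield)
qed

lemma rv_le_rf: "finite B ==> (\<And>f. f\<in>B ==> bdd RR f) ==> rv B\<le>rf B"
 unfolding rf_def rv_def by (rule rk_values_le_functions[OF finite_jets RR(1) bdd_jets])

end

context jet_setup
begin

section \<open>The difference equations of the jets\<close>

text \<open>The multiplier of \<open>\<Omega>\<close> under the \<open>l\<close>-fold inverse twist.\<close>

definition Ap :: "'c fps" where "Ap = (\<Prod>i<l. fps_X - fps_const (th i))"

lemma linear_PB: "fps_X - fps_const (th i)\<in>PB" by (intro subring_diff[OF PB_subring] PB_X PB_const BB_th)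

lemma Ap_PB: "Ap\<in>PB" unfolding Ap_def by (intro subring_prod[OF PB_subring] linear_PB)

lemma lin_eq: "lin i = F (fps_X - fps_const (th i))" unfolding lin_def fps_of_poly_linear ..

lemma F_Ap: "F Ap = (\<Prod>i<l. lin i)" unfolding Ap_def fps_to_fls_prod lin_eq ..

lemma F_Ap_0: "F Ap~=0" unfolding F_Ap using lin_0 by simp

lemma sgn_tt: "(sg ^^ i) tt = fps_X - fps_const (th i)" by (simp add: sgn_diff sgn_X sgn_const th_def)

lemma sgn_Om: "(sg ^^ l) Om = Ap * Om"
proof -
 have "(sg ^^ m) Om = (\<Prod>i<m. fps_X - fps_const (th i)) * Om" for m
 proof (induction m)
  case (Suc m)
  have "(sg ^^ Suc m) Om = (sg ^^ m) (tt * Om)" using sg_Om by (simp add: funpow_swap1)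
  also have "... = (fps_X - fps_const (th m))*((\<Prod>i<m. fps_X - fps_const (th i)) * Om)"
   by (simp only: sgn_mult sgn_tt Suc)
  finally show ?case by (simp add: ac_simps)
 qed simp
 thus ?thesis by (simp add: Ap_def)
qed

lemma sgn_u: "(sg ^^ l) (u i) = (fps_X - fps_const (th i)) * u i"
proof -
 have "(sg ^^ l) (u i) = (sg ^^ (l + i)) (Omega v q \<theta> l \<rho>l)" by (simp only: u_def funpow_add comp_apply)
 also have "... = (sg ^^ i) (u l)" unfolding add.commute[of l i] by (simp only: u_def funpow_add comp_apply)
 also have "... = (fps_X - fps_const (th i))*(sg ^^ i) (u 0)" by (simp only: u_l sgn_mult sgn_tt)
 finally show ?thesis by (simp add: u_def)
qed

text \<open>Logarithmic hyperderivatives turn the equations of the hyperderivatives, which are coupled with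
  multipliers different from 1, into equations \<open>\<tau> w = w + \<beta>\<close>.\<close>

definition om :: "nat => 'c fls" where "om j = F (hyperderiv j Om)/F Om"
definition w :: "nat => nat => 'c fls" where "w i j = F (hyperderiv j (u i))/F (u i)"

lemma F_Om_0: "F Om~=0" using Om_0 by simp
lemma F_u_0: "F (u i)~=0" using u_0 by simp

lemma tau_F_hyperderiv: "tau (F (hyperderiv j f)) = F (hyperderiv j ((sg ^^ l) f))"
 by (simp add: tau_fps sgn_hyperderiv)

lemma tau_Om: "tau (F Om) = F Ap * F Om" using tau_fps[of Om] by (simp add: sgn_Om fps_to_fls_mult)

lemma tau_u: "tau (F (u i)) = lin i * F (u i)"
 using tau_fps[of "u i"] by (simp add: sgn_u fps_to_fls_mult lin_eq del: fps_to_fls_minus)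

lemma tau_om: "tau (om j) = om j + (\<Sum>k\<in>{1..j}. F (hyperderiv k Ap)/F Ap * om (j - k))"
proof -
 have "F (hyperderiv j (Ap * Om)) = (\<Sum>k\<le>j. F (hyperderiv k Ap) * F (hyperderiv (j - k) Om))"
  by (simp add: hyperderiv_mult fps_to_fls_sum fps_to_fls_mult)
 hence "tau (om j) = (\<Sum>k\<le>j. F (hyperderiv k Ap) * F (hyperderiv (j - k) Om))/(F Ap * F Om)"
  by (simp add: om_def tau_divide tau_F_hyperderiv tau_Om sgn_Om)
 also have "... = (\<Sum>k\<le>j. F (hyperderiv k Ap)/F Ap * om (j - k))" by (simp add: om_def sum_divide_distrib)
 also have "... = om j + (\<Sum>k\<in>{1..j}. F (hyperderiv k Ap)/F Ap * om (j - k))"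
  using F_Ap_0 by (simp add: sum.atMost_shift sum.atLeast1_atMost_eq lessThan_Suc_atMost)
 finally show ?thesis .
qed

lemma tau_w: "tau (w i j) = w i j + (if j = 0 then 0 else w i (j - 1)/lin i)"
proof -
 have "tau (w i j) = F (hyperderiv j ((fps_X - fps_const (th i)) * u i))/(lin i * F (u i))"
  by (simp only: w_def tau_divide tau_F_hyperderiv tau_u sgn_u)
 also have "F (hyperderiv j ((fps_X - fps_const (th i)) * u i)) =
   lin i * F (hyperderiv j (u i)) + (if j = 0 then 0 else F (hyperderiv (j - 1) (u i)))"
  unfolding hyperderiv_linear_mult lin_eq by (simp add: fps_to_fls_mult)
 also have "(lin i * F (hyperderiv j (u i)) + (if j = 0 then 0 else F (hyperderiv (j - 1) (u i))))/(lin i * F (u i)) =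
   w i j + (if j = 0 then 0 else w i (j - 1)/lin i)"
  unfolding w_def using lin_0[of i] F_u_0[of i] by (cases "j = 0") (simp_all add: field_simps)
 finally show ?thesis .
qed

text \<open>Multiplication by a power of \<open>\<Omega>\<close> makes the Anderson--Thakur series solutions of equations with
  multiplier 1 and inhomogeneous term divisible by \<open>\<Omega>\<close>.\<close>

definition Zf :: "nat list => 'c fps" where "Zf s = Om^sum_list s * zet s"

lemma Zf_Nil: "Zf [] = 1" by (simp add: Zf_def zet_def)

definition lower :: "nat => 'c fps set" where "lower m = rgen PB (insert Om (Zf`{s\<in>insert [] I. length s < m}))"

lemma lower_mono: "m\<le>m' ==> lower m\<subseteq>lower m'" unfolding lower_def by (rule rgen_mono) auto

lemma lower_gens: "p\<in>PB ==> p\<in>lower m" "Om\<in>lower m" "s\<in>insert [] I ==> length s < m ==> Zf s\<in>lower m"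
proof -
 show "p\<in>lower m" if "p\<in>PB" using that subsetD[OF rgen_base] by (simp add: lower_def)
 show "Om\<in>lower m" unfolding lower_def by (rule subsetD[OF rgen_gens]) simp
 show "Zf s\<in>lower m" if "s\<in>insert [] I" "length s < m"
  unfolding lower_def by (rule subsetD[OF rgen_gens]) (use that in blast)
qed

lemma lower_subring: "is_subring (lower m)" unfolding lower_def by (rule rgen_subring)

lemma sg_Zf: assumes "s\<in>I" shows "\<exists>e\<in>lower (length s). sg (Zf s) = Zf s + Om * e"
proof -
 note s = index_I[OF assms]
 have snoc: "s = butlast s @ [last s]" using s by simp
 have sl: "sum_list s = sum_list (butlast s) + last s" by (subst snoc) simp
 obtain a where a: "last s = Suc a" using s last_in_set[of s] by (cases "last s") auto
 define e where "e = Om^a*(zstep (last s) * Zf (butlast s))"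
 have "sg (Zf s) = Om^sum_list s*(tt^sum_list s * sg (zet s))"
  by (simp only: Zf_def sg_mult sg_power sg_Om power_mult_distrib) (simp only: ac_simps)
 also have "... = Om^sum_list s*(zet s + zstep (last s) * zet (butlast s))" using zet_functional_equation s by simp
 also have "... = Zf s + Om * e" by (simp add: Zf_def e_def a sl power_add algebra_simps)
 finally have eq: "sg (Zf s) = Zf s + Om * e" .
 have "length (butlast s) < length s" using s by simp
 hence "e\<in>lower (length s)" unfolding e_def using butlast_I[OF assms]
  by (intro subring_mult[OF lower_subring] subring_power[OF lower_subring] lower_gens zstep_PB)
 thus ?thesis using eq by blast
qed

lemma sg_lower: "e\<in>lower m ==> sg e\<in>lower m"
proof -
 have "lower m\<subseteq>{x. sg x\<in>lower m}" unfolding lower_def[of m]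
 proof (rule rgen_minimal, unfold lower_def[symmetric])
  show "PB\<subseteq>{x. sg x\<in>lower m}" using lower_gens(1) PB_sg by blast
  show "is_subring {x. sg x\<in>lower m}"
   by (rule subringI) (auto simp: sg_add sg_mult sg_uminus intro: subring_0[OF lower_subring] subring_1[OF lower_subring]
     subring_add[OF lower_subring] subring_mult[OF lower_subring] subring_uminus[OF lower_subring])
  have "sg Om\<in>lower m" unfolding sg_Om by (intro subring_mult[OF lower_subring] lower_gens tt_PB)
  moreover have "sg (Zf s)\<in>lower m" if s: "s\<in>insert [] I" "length s < m" for s
  proof (cases "s = []")
   case True thus ?thesis using subring_1[OF lower_subring] by (simp add: Zf_Nil)
  next case False
   then obtain e where e: "e\<in>lower (length s)" "sg (Zf s) = Zf s + Om * e" using sg_Zf s(1) by blast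
   have "e\<in>lower m" using e(1) lower_mono[of "length s" m] s(2) by auto
   thus ?thesis unfolding e(2)
    by (rule subring_add[OF lower_subring lower_gens(3)[OF s] subring_mult[OF lower_subring lower_gens(2)]])
  qed
  ultimately show "insert Om (Zf`{s\<in>insert [] I. length s < m})\<subseteq>{x. sg x\<in>lower m}" by auto
 qed
 thus "e\<in>lower m ==> sg e\<in>lower m" by blast
qed

lemma sgn_Zf: assumes "s\<in>I" shows "\<exists>e\<in>lower (length s). (sg ^^ i) (Zf s) = Zf s + Om * e"
proof (induction i)
 case 0 show ?case using subring_0[OF lower_subring] by force
next case (Suc i)
 then obtain e where e: "e\<in>lower (length s)" "(sg ^^ i) (Zf s) = Zf s + Om * e" by blast
 obtain e' where e': "e'\<in>lower (length s)" "sg (Zf s) = Zf s + Om * e'" using sg_Zf[OF assms] by blast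
 have "(sg ^^ Suc i) (Zf s) = Zf s + Om*(e' + tt * sg e)" by (simp add: e(2) sg_add sg_mult sg_Om e'(2) algebra_simps)
 moreover have "e' + tt * sg e\<in>lower (length s)"
  by (intro subring_add[OF lower_subring] subring_mult[OF lower_subring] lower_gens tt_PB sg_lower e e')
 ultimately show ?case by blast
qed

definition ZZ :: "nat => 'c fls set" where "ZZ m = {F (hyperderiv j (Zf s)) | j s. j\<le>n \<and> s\<in>I \<and> length s < m}"

lemma tau_Zf: assumes N: "is_subring N" "KK\<subseteq>N" "\<And>j. j\<le>n ==> om j\<in>N" and s: "s\<in>I" "j\<le>n"
 shows "\<exists>b\<in>rgen N (insert (F Om) (ZZ (length s))).
      tau (F (hyperderiv j (Zf s))) = F (hyperderiv j (Zf s)) + F Om * b"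
proof -
 define R where "R = rgen N (insert (F Om) (ZZ (length s)))"
 have R: "is_subring R" unfolding R_def by (rule rgen_subring)
 have NR: "N\<subseteq>R" unfolding R_def by (rule rgen_base)
 have gR: "insert (F Om) (ZZ (length s))\<subseteq>R" unfolding R_def by (rule rgen_gens)
 have omR: "om j\<in>R" if "j\<le>n" for j using N(3)[OF that] NR by blast
 have hOm: "F (hyperderiv j Om) = om j * F Om" for j using F_Om_0 by (simp add: om_def)
 have "lower (length s)\<subseteq>hol R" unfolding lower_def
 proof (rule rgen_minimal[OF _ _ hol_subring[OF R]])
  show "PB\<subseteq>hol R" using hol_PB N(2) NR by blast
  have "Om\<in>hol R" using omR gR subring_mult[OF R] by (auto simp: hol_def hOm)
  moreover have "Zf s'\<in>hol R" if "s'\<in>insert [] I" "length s' < length s" for s'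
  proof (cases "s' = []")
   case True thus ?thesis using subring_1[OF hol_subring[OF R]] by (simp add: Zf_Nil)
  next case False hence "F (hyperderiv j (Zf s'))\<in>ZZ (length s)" if "j\<le>n" for j
    using \<open>s' \<in> _\<close> \<open>length s' < _\<close> that by (auto simp: ZZ_def)
   thus ?thesis using gR by (auto simp: hol_def)
  qed
  ultimately show "insert Om (Zf`{s'\<in>insert [] I. length s' < length s})\<subseteq>hol R" by auto
 qed
 moreover obtain e where e: "e\<in>lower (length s)" "(sg ^^ l) (Zf s) = Zf s + Om * e" using sgn_Zf[OF s(1)] by blast
 ultimately have eR: "F (hyperderiv i e)\<in>R" if "i\<le>n" for i using that by (auto simp: hol_def)
 define b where "b = (\<Sum>k\<le>j. om k * F (hyperderiv (j - k) e))"
 have "b\<in>R" unfolding b_def using s(2) by (intro subring_sum[OF R] subring_mult[OF R] omR eR) auto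
 moreover have "tau (F (hyperderiv j (Zf s))) = F (hyperderiv j (Zf s)) + F Om * b"
  unfolding tau_F_hyperderiv e(2) hyperderiv_add hyperderiv_mult fps_to_fls_plus fps_to_fls_sum fps_to_fls_mult hOm b_def
  by (simp add: sum_distrib_left ac_simps)
 ultimately show ?thesis unfolding R_def by blast
qed

section \<open>Towers of difference fields\<close>

text \<open>A field over which the multipliers of semi-invariants are controlled by \<open>L\<close>. The set \<open>L\<close> is chosen
  according to the function that is to be shown transcendental.\<close>

definition tower :: "(nat => int) set => 'c fls set => bool" where
 "tower L M \<longleftrightarrow> is_subfield M \<and> KK\<subseteq>M \<and> df.stab M \<and> df.exponents_in lin l M L"

lemma tower_KK: "{e. \<forall>i<l. e i = 0}\<subseteq>L ==> tower L KK"
proof -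
 assume L: "{e. \<forall>i<l. e i = 0}\<subseteq>L"
 have "df.exponents_in lin l KK L" using rational_exponents_trivial subsetD[OF L] unfolding df.exponents_in_def by meson
 thus ?thesis using KK_subfield tau_KK by (simp add: tower_def df.stab_def)
qed

lemma tower_list:
 assumes M: "tower L M" and y: "\<And>j. j < length ys ==> \<exists>f b. tau (ys ! j) = (\<Prod>i<l. lin i powi f i)*(ys ! j) + b \<and>
       b\<in>adjoin M (set (take j ys)) \<and> df.absorbs L f" shows "tower L (adjoin M (set ys))"
proof -
 have m: "is_subfield M" "KK\<subseteq>M" "df.stab M" "df.exponents_in lin l M L" using M by (auto simp: tower_def)
 have g: "lin i\<in>M \<and> lin i~=0" if "i < l" for i using m(2) lin_KK lin_0 by blast
 show ?thesis
  using df.exponents_in_list[OF m(1,3) g m(4) y] adjoin_subfield[of M "set ys"] adjoin_base[of M "set ys"] m(2)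
  unfolding tower_def by blast
qed

lemma absorbs_0: "(\<And>e m. m\<ge>1 ==> (\<lambda>i. int m * e i)\<in>L ==> e\<in>L) ==> df.absorbs L (\<lambda>_. 0)" by (auto simp: df.absorbs_def)

definition os :: "'c fls list" where "os = map om [0..<Suc n]"

text \<open>The quotients \<open>w i j\<close>, ordered by increasing \<open>j\<close>: the inhomogeneous term of the equation of
  \<open>w i j\<close> only involves \<open>w i (j - 1)\<close>.\<close>

definition ws :: "'c fls list" where "ws = map (\<lambda>k. w (k mod l) (k div l)) [0..<l * Suc n]"

lemma take_map_upt: "j\<le>m ==> set (take j (map f [0..<m])) = f`{..<j}" by (auto simp: take_map take_upt)

lemma tower_os: assumes "tower L M" "df.absorbs L (\<lambda>_. 0)" shows "tower L (adjoin M (set os))"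
proof (rule tower_list[OF assms(1)])
 fix j assume j: "j < length os"
 define b where "b = (\<Sum>k\<in>{1..j}. F (hyperderiv k Ap)/F Ap * om (j - k))"
 define N where "N = adjoin M (set (take j os))"
 have N: "is_subfield N" "KK\<subseteq>N" "om i\<in>N" if "i < j" for i
 proof -
  show "is_subfield N" unfolding N_def by (rule adjoin_subfield)
  show "KK\<subseteq>N" using assms(1) adjoin_base[of M] unfolding tower_def N_def by blast
  have "set (take j os) = om`{..<j}" unfolding os_def by (rule take_map_upt) (use j in \<open>simp add: os_def\<close>)
  thus "om i\<in>N" using adjoin_gens[of "set (take j os)" M] that by (auto simp: N_def)
 qed
 have "b\<in>N"
 proof (cases "j = 0")
  case True thus ?thesis using subring_0[OF subfield_subring[OF adjoin_subfield]] by (simp add: b_def N_def)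
 next case False hence j0: "0 < j" by simp
  note S = subfield_subring[OF N(1)[OF j0]]
  have "F (hyperderiv k Ap)/F Ap * om (j - k)\<in>N" if "k\<in>{1..j}" for k
   using that N(2)[OF j0] N(3)[of "j - k"] PB_KK[OF PB_hyperderiv[OF Ap_PB]] PB_KK[OF Ap_PB]
   by (intro subring_mult[OF S] subfield_divide[OF N(1)[OF j0]]) auto
  thus ?thesis unfolding b_def by (intro subring_sum[OF S])
 qed
 moreover have "os ! j = om j" using j by (simp add: os_def del: upt_Suc)
 hence "tau (os ! j) = (\<Prod>i<l. lin i powi 0)*(os ! j) + b" using tau_om[of j] by (simp add: b_def)
 ultimately show "\<exists>f b. tau (os ! j) = (\<Prod>i<l. lin i powi f i)*(os ! j) + b \<and>
   b\<in>adjoin M (set (take j os)) \<and> df.absorbs L f"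
  using assms(2) unfolding N_def by (intro exI[of _ "\<lambda>_. 0"] exI[of _ b] conjI)
qed

lemma length_ws: "length ws = l * Suc n" by (simp add: ws_def del: upt_Suc)

lemma ws_nth: "p < length ws ==> ws ! p = w (p mod l) (p div l)" by (simp add: ws_def del: upt_Suc mult_Suc_right)

lemma set_take_ws: "p\<le>length ws ==> set (take p ws) = (\<lambda>k. w (k mod l) (k div l))`{..<p}"
 unfolding length_ws unfolding ws_def by (rule take_map_upt)

lemma tau_ws: assumes "p < length ws" "KK\<subseteq>M" shows "\<exists>\<beta>\<in>adjoin M (set (take p ws)). tau (ws ! p) = ws ! p + \<beta>"
proof (cases "p div l = 0")
 case True
 thus ?thesis using tau_w[of "p mod l" "p div l"] ws_nth[OF assms(1)] subring_0[OF subfield_subring[OF adjoin_subfield]]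
  by (intro bexI[of _ 0]) auto
next case False
 have pl: "p\<ge>l" using False by (metis div_less not_less)
 have "w (p mod l) (p div l - 1) = w ((p - l) mod l) ((p - l) div l)"
 proof -
  have p: "p = (p - l) + l" using pl by simp
  have "p mod l = (p - l) mod l" by (subst p) (rule mod_add_self2)
  moreover have "p div l = (p - l) div l + 1" by (subst p) (rule div_add_self2, use l_pos in simp)
  ultimately show ?thesis by simp
 qed
 moreover have "w ((p - l) mod l) ((p - l) div l)\<in>set (take p ws)"
 proof -
  have "p - l < p" using pl l_pos by simp
  thus ?thesis using set_take_ws[of p] assms(1) by auto
 qed
 ultimately have "w (p mod l) (p div l - 1)\<in>adjoin M (set (take p ws))" using subsetD[OF adjoin_gens] by metis
 moreover have "lin (p mod l)\<in>adjoin M (set (take p ws))" using lin_KK assms(2) subsetD[OF adjoin_base] by blast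
 ultimately have "w (p mod l) (p div l - 1)/lin (p mod l)\<in>adjoin M (set (take p ws))"
  by (rule subfield_divide[OF adjoin_subfield])
 thus ?thesis using tau_w[of "p mod l" "p div l"] False ws_nth[OF assms(1)] by auto
qed

lemma tower_ws: assumes "tower L M" "df.absorbs L (\<lambda>_. 0)" "p\<le>length ws" shows "tower L (adjoin M (set (take p ws)))"
proof (rule tower_list[OF assms(1)])
 fix j assume j: "j < length (take p ws)"
 have "KK\<subseteq>M" using assms(1) by (simp add: tower_def)
 then obtain b where "b\<in>adjoin M (set (take j ws))" "tau (ws ! j) = ws ! j + b" using tau_ws[of j M] j by auto
 moreover have "j < p" using j by simp
 hence "take j (take p ws) = take j ws" "take p ws ! j = ws ! j" by (simp_all add: min_def)
 ultimately show "\<exists>f b. tau (take p ws ! j) = (\<Prod>i<l. lin i powi f i)*(take p ws ! j) + b \<and>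
   b\<in>adjoin M (set (take j (take p ws))) \<and> df.absorbs L f"
  using assms(2) by (intro exI[of _ "\<lambda>_. 0"] exI[of _ b]) simp
qed

lemma tower_Om: assumes "tower L M" "df.absorbs L (\<lambda>_. 1)" shows "tower L (adjoin M {F Om})"
proof -
 have "tower L (adjoin M (set [F Om]))"
 proof (rule tower_list[OF assms(1)])
  fix j assume "j < length [F Om]"
  thus "\<exists>f b. tau ([F Om] ! j) = (\<Prod>i<l. lin i powi f i)*([F Om] ! j) + b \<and>
    b\<in>adjoin M (set (take j [F Om])) \<and> df.absorbs L f"
   using assms(2) subring_0[OF subfield_subring[OF adjoin_subfield]]
   by (intro exI[of _ "\<lambda>_. 1"] exI[of _ 0]) (simp add: tau_Om F_Ap)
 qed
 thus ?thesis by simp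
qed

definition us :: "'c fls list" where "us = map (\<lambda>i. F (u i)) [0..<l]"

lemma tower_us: assumes "tower L M" "k\<le>l" "\<And>i. i < k ==> df.absorbs L (\<lambda>j. if j = i then 1 else 0)"
 shows "tower L (adjoin M (set (take k us)))"
proof (rule tower_list[OF assms(1)])
 fix i assume i: "i < length (take k us)"
 hence il: "i < l" "i < k" by (auto simp: us_def)
 have "(\<Prod>j<l. lin j powi (if j = i then 1 else 0)) = (\<Prod>j<l. if j = i then lin i else 1)" by (rule prod.cong) auto
 also have "... = lin i" using il by (simp add: prod.delta)
 finally have "tau (take k us ! i) = (\<Prod>j<l. lin j powi (if j = i then 1 else 0))*(take k us ! i) + 0"
  using il by (simp add: us_def tau_u)
 thus "\<exists>f b. tau (take k us ! i) = (\<Prod>j<l. lin j powi f j)*(take k us ! i) + b \<and>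
   b\<in>adjoin M (set (take i (take k us))) \<and> df.absorbs L f"
  using assms(3)[OF il(2)] subring_0[OF subfield_subring[OF adjoin_subfield]]
  by (intro exI[of _ "\<lambda>j. if j = i then 1 else 0"] exI[of _ 0] conjI)
qed

text \<open>An enumeration of the jets of the functions \<open>Zf s\<close> by increasing length of \<open>s\<close>.\<close>

lemma ZZ_list:
 obtains zs where "\<And>p. p < length zs ==> \<exists>s j. s\<in>I \<and> j\<le>n \<and> zs ! p = F (hyperderiv j (Zf s)) \<and> ZZ (length s)\<subseteq>set (take p zs)"
  "set zs = F`jets (Zf`I)"
proof -
 obtain ps where ps: "set ps = I\<times>{..n}" using finite_list[of "I\<times>{..n}"] finite_I by auto
 define key where "key p = length (fst p)" for p :: "nat list\<times>nat"
 define qs where "qs = sort_key key ps"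
 define zs where "zs = map (\<lambda>(s, j). F (hyperderiv j (Zf s))) qs"
 have qs: "set qs = I\<times>{..n}" "sorted (map key qs)" by (simp_all add: qs_def ps)
 show thesis
 proof (rule that)
  have "set zs = (\<lambda>(s, j). F (hyperderiv j (Zf s)))`(I\<times>{..n})" by (simp add: zs_def qs(1))
  thus "set zs = F`jets (Zf`I)" by (force simp: jets_def)
  fix p assume p: "p < length zs"
  hence p': "p < length qs" by (simp add: zs_def)
  obtain s j where sj: "qs ! p = (s, j)" by (cases "qs ! p")
  have "s\<in>I" "j\<le>n" using nth_mem[OF p'] qs(1) by (auto simp: sj)
  moreover have "ZZ (length s)\<subseteq>set (take p zs)"
  proof
   fix x assume "x\<in>ZZ (length s)"
   then obtain j' s' where x: "x = F (hyperderiv j' (Zf s'))" "j'\<le>n" "s'\<in>I" "length s' < length s"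
    by (auto simp: ZZ_def)
   hence "(s', j')\<in>set qs" by (simp add: qs(1))
   then obtain k where k: "k < length qs" "qs ! k = (s', j')" by (auto simp: in_set_conv_nth)
   have "k < p"
   proof (rule ccontr)
    assume "\<not> k < p"
    hence "map key qs ! p\<le>map key qs ! k" using k(1) by (intro sorted_nth_mono[OF qs(2)]) auto
    thus False using x(4) k p' sj by (simp add: key_def)
   qed
   thus "x\<in>set (take p zs)" using k p' by (auto simp: in_set_conv_nth zs_def x(1) intro!: exI[of _ k])
  qed
  ultimately show "\<exists>s j. s\<in>I \<and> j\<le>n \<and> zs ! p = F (hyperderiv j (Zf s)) \<and> ZZ (length s)\<subseteq>set (take p zs)"
   using p' sj by (auto simp: zs_def)
 qed
qed

end

context jet_setup
begin

section \<open>Independence of the functions\<close>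

lemma FT_jet: "bdd RR f ==> F (hyperderiv j f)\<in>FT" using bdd_hyperderiv RR by (intro bdd_FT) auto

lemma F_Om_FT: "F Om\<in>FT" using bdd_FT bdd_Om by blast

lemma om_FT: "om j\<in>FT" unfolding om_def by (intro subfield_divide[OF FT_subfield] FT_jet bdd_Om F_Om_FT)

lemma w_FT: "i < l ==> w i j\<in>FT" unfolding w_def by (intro subfield_divide[OF FT_subfield] FT_jet bdd_u bdd_FT)

lemma Zf_FT: "s\<in>I ==> F (hyperderiv j (Zf s))\<in>FT" unfolding Zf_def using index_I[of s] RR(3)
 by (intro FT_jet bdd_mult bdd_power bdd_Om zet_limit(2)) auto

lemma ws_FT: "set ws\<subseteq>FT" using w_FT l_pos by (auto simp: ws_def)

lemma os_FT: "set os\<subseteq>FT" using om_FT by (auto simp: os_def)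

lemma om_os: "j\<le>n ==> om j\<in>set os" by (auto simp: os_def simp del: upt_Suc)

definition om_gens :: "'c fls set" where "om_gens = insert (F Om) (set os)"

text \<open>The field \<open>N\<close> generated by the functions of weight 0 contains no semi-invariant whose multiplier is a
  nonzero power of that of \<open>\<Omega>\<close>, so weights over \<open>N\<close> can be separated.\<close>

lemma w_step: assumes p: "p < length ws" and alg: "ws ! p\<in>acl KK (om_gens\<union>F`jets (Zf`I)\<union>set (take p ws))"
 shows "ws ! p\<in>acl KK (om_gens\<union>set (take p ws))"
proof -
 define L0 where "L0 = {e :: nat => int. \<forall>i<l. e i = 0}"
 have ab: "df.absorbs L0 (\<lambda>_. 0)" by (rule absorbs_0) (auto simp: L0_def)
 define N0 where "N0 = adjoin KK (set os)"
 define N where "N = adjoin N0 (set (take p ws))"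
 have T0: "tower L0 N0" unfolding N0_def by (intro tower_os tower_KK ab) (simp add: L0_def)
 have TN: "tower L0 N" unfolding N_def by (intro tower_ws T0 ab) (use p in simp)
 hence N: "is_subfield N" "KK\<subseteq>N" "df.stab N" "df.exponents_in lin l N L0" by (auto simp: tower_def)
 note RN = subfield_subring[OF N(1)]
 have osN: "set os\<subseteq>N" unfolding N_def N0_def using adjoin_gens[of "set os" KK] adjoin_base by blast
 have wsN: "set (take p ws)\<subseteq>N" unfolding N_def by (rule adjoin_gens)
 have N_eq: "N = adjoin KK (set os\<union>set (take p ws))" unfolding N_def N0_def by (rule adjoin_Un)
 have NFT: "N\<subseteq>FT" unfolding N_eq
  using KK_FT os_FT ws_FT set_take_subset[of p ws] by (intro adjoin_minimal FT_subfield) auto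
 have base: "df.weight_sep N (F Om) (rgen N {F Om}) (adjoin N {F Om})"
 proof (rule df.weight_sep_base[OF N(1,3,2) NFT F_Om_FT F_Om_0 tau_Om _ F_Ap_0])
  show "F Ap\<in>KK" by (rule PB_KK[OF Ap_PB])
  fix k :: int and c assume k: "k~=0" and c: "c\<in>N" "tau c = F Ap powi k * c"
  have "(\<Prod>i<m. lin i) powi k = (\<Prod>i<m. lin i powi k)" for m by (induction m) (simp_all add: power_int_mult_distrib)
  hence "tau c = (\<Prod>i<l. lin i powi k) * c" using c(2) by (simp add: F_Ap)
  hence "(\<lambda>_. k)\<in>L0" if "c~=0"
   using N(4)[unfolded df.exponents_in_def, THEN bspec, OF c(1), THEN mp, OF that, THEN spec[of _ "\<lambda>_. k"]] by simp
  thus "c = 0" using k l_pos by (auto simp: L0_def)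
 qed
 obtain zs where zs: "\<And>p. p < length zs ==> \<exists>s j. s\<in>I \<and> j\<le>n \<and> zs ! p = F (hyperderiv j (Zf s)) \<and> ZZ (length s)\<subseteq>set (take p zs)"
  and set_zs: "set zs = F`jets (Zf`I)" by (rule ZZ_list) blast
 have omN: "om j\<in>N" if "j\<le>n" for j using om_os[OF that] osN by blast
 have sep: "df.weight_sep N (F Om) (rgen N (insert (F Om) (set zs))) (adjoin N (insert (F Om) (set zs)))"
 proof (rule df.weight_sep_list[OF base])
  fix k assume "k < length zs"
  then obtain s j where sj: "s\<in>I" "j\<le>n" "zs ! k = F (hyperderiv j (Zf s))" "ZZ (length s)\<subseteq>set (take k zs)"
   using zs by blast
  obtain b where b: "b\<in>rgen N (insert (F Om) (ZZ (length s)))" "tau (zs ! k) = zs ! k + F Om * b"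
   using tau_Zf[OF RN N(2) omN sj(1,2)] sj(3) by auto
  have "rgen N (insert (F Om) (ZZ (length s)))\<subseteq>rgen N (insert (F Om) (set (take k zs)))"
   using sj(4) by (intro rgen_mono) auto
  thus "zs ! k\<in>FT \<and> (\<exists>b\<in>rgen N (insert (F Om) (set (take k zs))). tau (zs ! k) = zs ! k + F Om * b)"
   using b Zf_FT[OF sj(1)] sj(3) by auto
 qed
 define E where "E = adjoin N (insert (F Om) (set zs))"
 have NE: "N\<subseteq>E" and gE: "insert (F Om) (set zs)\<subseteq>E" unfolding E_def by (rule adjoin_base, rule adjoin_gens)
 have "adjoin KK (om_gens\<union>F`jets (Zf`I)\<union>set (take p ws))\<subseteq>E"
 proof (rule adjoin_minimal)
  show "KK\<subseteq>E" using N(2) NE by blast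
  show "om_gens\<union>F`jets (Zf`I)\<union>set (take p ws)\<subseteq>E" using osN wsN NE gE unfolding om_gens_def set_zs by blast
  show "is_subfield E" unfolding E_def by (rule adjoin_subfield)
 qed
 hence algE: "algebraic_over E (ws ! p)" using alg algebraic_mono unfolding acl_def by blast
 have KN0: "KK\<subseteq>N0" using T0 by (simp add: tower_def)
 obtain \<beta> where \<beta>: "\<beta>\<in>N" "tau (ws ! p) = ws ! p + \<beta>" using tau_ws[OF p KN0] unfolding N_def by blast
 have "ws ! p\<in>FT" using ws_FT nth_mem[OF p] by blast
 from df.weight_zero_algebraic[OF N(1) sep this \<beta>(2,1) algE[unfolded E_def]]
 have "algebraic_over N (ws ! p)" .
 moreover have "N\<subseteq>adjoin KK (om_gens\<union>set (take p ws))" unfolding N_eq om_gens_def by (rule adjoin_mono) auto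
 ultimately show ?thesis using algebraic_mono unfolding acl_def by blast
qed

text \<open>Up to this stage all steps of the tower have exponents that agree at the places \<open>i, \<dots>, l - 1\<close>: those
  of \<open>\<Omega>\<close> are all equal to 1, and those of \<open>u a\<close> with \<open>a < i\<close> vanish at these places. If \<open>u i\<close> were
  algebraic, a semi-invariant with exponent \<open>m > 0\<close> at \<open>i\<close> and 0 at \<open>l - 1\<close> would exist.\<close>

lemma u_step: assumes i: "Suc i < l" shows "F (u i)\<notin>acl KK (om_gens\<union>F`jets (Zf`I)\<union>set ws\<union>set (take i us))"
proof
 assume alg: "F (u i)\<in>acl KK (om_gens\<union>F`jets (Zf`I)\<union>set ws\<union>set (take i us))"
 define L where "L = {e :: nat => int. \<forall>a b. i\<le>a --> a < l --> i\<le>b --> b < l --> e a = e b}"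
 have ab: "df.absorbs L f" if f: "\<And>a b. i\<le>a ==> a < l ==> i\<le>b ==> b < l ==> f a = f b" for f unfolding df.absorbs_def
 proof (intro allI impI)
  fix e :: "nat => int" and m :: nat and d :: int assume m: "1\<le>m" and e: "(\<lambda>i. int m * e i + d * f i)\<in>L"
  show "e\<in>L" unfolding L_def
  proof (intro CollectI allI impI)
   fix a b assume r: "i\<le>a" "a < l" "i\<le>b" "b < l"
   hence "int m * e a + d * f a = int m * e b + d * f b" using e unfolding L_def by blast
   thus "e a = e b" using f[OF r] m by simp
  qed
 qed
 define M1 where "M1 = adjoin KK (set os)"
 define M2 where "M2 = adjoin M1 (set ws)"
 define M3 where "M3 = adjoin M2 {F Om}"
 have T1: "tower L M1" unfolding M1_def by (intro tower_os tower_KK ab) (auto simp: L_def)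
 have "tower L (adjoin M1 (set (take (length ws) ws)))" by (intro tower_ws T1 ab) auto
 hence T2: "tower L M2" by (simp add: M2_def)
 have T3: "tower L M3" unfolding M3_def by (intro tower_Om T2 ab) auto
 obtain zs where zs: "\<And>p. p < length zs ==> \<exists>s j. s\<in>I \<and> j\<le>n \<and> zs ! p = F (hyperderiv j (Zf s)) \<and> ZZ (length s)\<subseteq>set (take p zs)"
  and set_zs: "set zs = F`jets (Zf`I)" by (rule ZZ_list) blast
 define M4 where "M4 = adjoin M3 (set zs)"
 have M13: "M1\<subseteq>M3" "F Om\<in>M3" unfolding M3_def M2_def
  using adjoin_base[of M1 "set ws"] adjoin_base[of "adjoin M1 (set ws)"] adjoin_gens[of "{F Om}"] by blast+
 have M1: "is_subfield M1" "KK\<subseteq>M1" using T1 by (auto simp: tower_def)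
 have omM: "om j\<in>M1" if "j\<le>n" for j using om_os[OF that] adjoin_gens[of "set os" KK] unfolding M1_def by blast
 have T4: "tower L M4" unfolding M4_def
 proof (rule tower_list[OF T3])
  fix k assume "k < length zs"
  then obtain s j where sj: "s\<in>I" "j\<le>n" "zs ! k = F (hyperderiv j (Zf s))" "ZZ (length s)\<subseteq>set (take k zs)"
   using zs by blast
  obtain b where b: "b\<in>rgen M1 (insert (F Om) (ZZ (length s)))" "tau (zs ! k) = zs ! k + F Om * b"
   using tau_Zf[OF subfield_subring[OF M1(1)] M1(2) omM sj(1,2)] sj(3) by auto
  define M where "M = adjoin M3 (set (take k zs))"
  have M: "is_subfield M" "M3\<subseteq>M" "set (take k zs)\<subseteq>M" unfolding M_def
   by (rule adjoin_subfield, rule adjoin_base, rule adjoin_gens)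
  have "rgen M1 (insert (F Om) (ZZ (length s)))\<subseteq>M"
   using M M13 sj(4) by (intro rgen_minimal subfield_subring M(1)) auto
  hence "F Om * b\<in>M" using b(1) M(2) M13(2) by (intro subring_mult[OF subfield_subring[OF M(1)]]) auto
  thus "\<exists>f b. tau (zs ! k) = (\<Prod>i<l. lin i powi f i)*(zs ! k) + b \<and>
    b\<in>adjoin M3 (set (take k zs)) \<and> df.absorbs L f"
   using b(2) ab[of "\<lambda>_. 0"] unfolding M_def by (intro exI[of _ "\<lambda>_. 0"] exI[of _ "F Om * b"]) simp
 qed
 define M5 where "M5 = adjoin M4 (set (take i us))"
 have T5: "tower L M5" unfolding M5_def by (intro tower_us T4 ab) (use i in auto)
 have "M5 = adjoin KK (om_gens\<union>F`jets (Zf`I)\<union>set ws\<union>set (take i us))"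
  unfolding M5_def M4_def M3_def M2_def M1_def adjoin_Un set_zs om_gens_def by (rule arg_cong[of _ _ "adjoin KK"]) auto
 hence algM: "algebraic_over M5 (F (u i))" using alg by (simp add: acl_def)
 have M5: "is_subfield M5" "df.stab M5" "KK\<subseteq>M5" "df.exponents_in lin l M5 L" using T5 by (auto simp: tower_def)
 have "lin i\<in>M5" using M5(3) lin_KK by blast
 from df.semi_invariant_algebraic[OF M5(1,2) algM F_u_0 this lin_0 tau_u]
 obtain c m where c: "c\<in>M5" "c~=0" "m\<ge>1" "tau c = lin i^m * c" by blast
 have "(\<Prod>j<l. lin j powi (if j = i then int m else 0)) = (\<Prod>j<l. if j = i then lin i^m else 1)"
  by (rule prod.cong) auto
 also have "... = lin i^m" using i by (simp add: prod.delta)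
 finally have "tau c = (\<Prod>j<l. lin j powi (if j = i then int m else 0)) * c" using c(4) by (simp only:)
 hence "(\<lambda>j. if j = i then int m else 0)\<in>L"
  using M5(4)[unfolded df.exponents_in_def, THEN bspec, OF c(1), THEN mp, OF c(2),
    THEN spec[of _ "\<lambda>j. if j = i then int m else 0"]] by simp
 hence "(if i = i then int m else 0) = (if l - 1 = i then int m else 0)"
  unfolding L_def mem_Collect_eq by (elim allE[of _ i] allE[of _ "l - 1"]) (use i in simp)
 moreover have "l - 1~=i" using i by simp
 ultimately show False using c(3) by simp
qed

lemma u_last: "F (u (l - 1))\<in>adjoin KK (insert (F Om) (set (take (l - 1) us)))"
proof -
 define P where "P m = (\<Prod>i<m. F (u i))" for m
 have P0: "P m~=0" for m by (simp add: P_def u_0)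
 define \<kappa> where "\<kappa> = F Om/P l"
 have \<kappa>0: "\<kappa>~=0" using F_Om_0 P0 by (simp add: \<kappa>_def)
 have "P l\<in>FT" unfolding P_def using bdd_u by (intro subring_prod[OF subfield_subring[OF FT_subfield]] bdd_FT) auto
 hence "\<kappa>\<in>FT" unfolding \<kappa>_def by (intro subfield_divide[OF FT_subfield] F_Om_FT)
 moreover have "tau \<kappa> = \<kappa>"
 proof -
  have "tau (P m) = (\<Prod>i<m. lin i) * P m" for m by (induction m) (simp_all add: P_def tau_1 tau_mult tau_u)
  hence "tau \<kappa> = (F Ap * F Om)/(F Ap * P l)" by (simp add: \<kappa>_def tau_divide tau_Om F_Ap)
  thus ?thesis using F_Ap_0 by (simp add: \<kappa>_def)
 qed
 ultimately have \<kappa>: "\<kappa>\<in>KK" by (rule constants_rational)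
 define M where "M = adjoin KK (insert (F Om) (set (take (l - 1) us)))"
 have M: "is_subfield M" "KK\<subseteq>M" "insert (F Om) (set (take (l - 1) us))\<subseteq>M" unfolding M_def
  by (rule adjoin_subfield, rule adjoin_base, rule adjoin_gens)
 have "set (take (l - 1) us) = (\<lambda>i. F (u i))`{..<l - 1}" unfolding us_def by (rule take_map_upt) simp
 hence "P (l - 1)\<in>M" unfolding P_def using M(3) by (intro subring_prod[OF subfield_subring[OF M(1)]]) auto
 moreover have "P l = P (l - 1) * F (u (l - 1))" using l_pos by (cases l) (simp_all add: P_def)
 hence "F (u (l - 1)) = F Om/(\<kappa> * P (l - 1))" using \<kappa>0 P0 F_Om_0 by (simp add: \<kappa>_def field_simps)
 ultimately show ?thesis unfolding M_def[symmetric] using M \<kappa>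
  by (simp only:) (intro subfield_divide[OF M(1)] subring_mult[OF subfield_subring[OF M(1)]], auto)
qed

section \<open>Transcendence degrees of the functions\<close>

lemma rk_same_fields: assumes "finite S" "finite T" "\<And>M. is_subfield M ==> KK\<subseteq>M ==> S\<subseteq>M \<longleftrightarrow> T\<subseteq>M"
 shows "rk KK S = rk KK T"
proof (rule rk_cong[OF assms(1,2)])
 show "S\<subseteq>acl KK T" using assms(3)[OF acl_subfield acl_base] acl_gens[of T KK] by blast
 show "T\<subseteq>acl KK S" using assms(3)[OF acl_subfield acl_base] acl_gens[of S KK] by blast
qed

lemma om_gens_iff: assumes M: "is_subfield M" shows "om_gens\<subseteq>M \<longleftrightarrow> Om\<in>hol M"
proof
 assume "om_gens\<subseteq>M"
 hence "om j * F Om\<in>M" if "j\<le>n" for j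
  using om_os[OF that] by (intro subring_mult[OF subfield_subring[OF M]]) (auto simp: om_gens_def)
 thus "Om\<in>hol M" using F_Om_0 by (simp add: hol_def om_def)
next assume "Om\<in>hol M"
 hence h: "F (hyperderiv j Om)\<in>M" if "j\<le>n" for j using that by (simp add: hol_def)
 from h[of 0] have "F Om\<in>M" by simp
 thus "om_gens\<subseteq>M" using h subfield_divide[OF M] by (auto simp: om_gens_def os_def om_def less_Suc_eq_le)
qed

lemma us_iff: assumes M: "is_subfield M" shows "set ws\<union>set us\<subseteq>M \<longleftrightarrow> Us\<subseteq>hol M"
proof
 assume a: "set ws\<union>set us\<subseteq>M"
 have "F (hyperderiv j (u i))\<in>M" if "i < l" "j\<le>n" for i j
 proof -
  have "j * l + i < l * Suc n"
  proof -
   have "j * l + i < Suc j * l" using that(1) by simp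
   also have "...\<le>Suc n * l" using that(2) by (intro mult_right_mono) auto
   finally show ?thesis by (simp only: mult.commute)
  qed
  moreover have "(j * l + i) mod l = i" "(j * l + i) div l = j" using that(1) by auto
  ultimately have "w i j\<in>set ws" by (force simp: ws_def)
  moreover have "F (u i)\<in>set us" using that(1) by (simp add: us_def)
  ultimately have "w i j * F (u i)\<in>M" using a by (intro subring_mult[OF subfield_subring[OF M]]) auto
  thus ?thesis using F_u_0 by (simp add: w_def)
 qed
 thus "Us\<subseteq>hol M" by (auto simp: Us_def hol_def)
next assume "Us\<subseteq>hol M"
 hence h: "F (hyperderiv j (u i))\<in>M" if "i < l" "j\<le>n" for i j using that by (auto simp: Us_def hol_def)
 have uM: "F (u i)\<in>M" if "i < l" for i using h[OF that, of 0] by simp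
 have "w (k mod l) (k div l)\<in>M" if "k < l * Suc n" for k
 proof -
  have "k div l < Suc n" using that by (simp add: less_mult_imp_div_less mult.commute)
  thus ?thesis unfolding w_def using l_pos by (intro subfield_divide[OF M] h uM) auto
 qed
 thus "set ws\<union>set us\<subseteq>M" using uM by (auto simp: ws_def us_def simp del: upt_Suc)
qed

lemma zs_iff: assumes M: "is_subfield M" "Om\<in>hol M" shows "F`jets (Zf`I)\<subseteq>M \<longleftrightarrow> Zs\<subseteq>hol M"
proof -
 note R = hol_subring[OF subfield_subring[OF M(1)]]
 have "Zf s\<in>hol M \<longleftrightarrow> zet s\<in>hol M" for s
  unfolding Zf_def using hol_cancel[OF M(1), of "Om^sum_list s" "zet s"] subring_mult[OF R] subring_power[OF R M(2)] Om_0
  by auto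
 thus ?thesis unfolding hol_jets Zs_def by blast
qed

theorem rf_modular: "rf ({Om}\<union>Us\<union>Zs) + rf {Om} = rf ({Om}\<union>Us) + rf ({Om}\<union>Zs)"
proof -
 define D where "D = F`jets (Zf`I)"
 have fin: "finite om_gens" "finite D" by (simp_all add: om_gens_def D_def finite_jets finite_I)
 have fj: "finite (F`jets B)" if "finite B" for B using finite_jets[OF that] by simp
 have "rk KK (om_gens\<union>D\<union>set (ws @ us)) + rk KK om_gens = rk KK (om_gens\<union>D) + rk KK (om_gens\<union>set (ws @ us))"
 proof (rule rk_modular_list[OF fin])
  fix p assume p: "p < length (ws @ us)" and alg: "(ws @ us) ! p\<in>acl KK (om_gens\<union>D\<union>set (take p (ws @ us)))"
  show "(ws @ us) ! p\<in>acl KK (om_gens\<union>set (take p (ws @ us)))"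
  proof (cases "p < length ws")
   case True thus ?thesis using w_step[OF True] alg by (simp add: nth_append D_def)
  next case False
   define i where "i = p - length ws"
   have i: "i < l" "(ws @ us) ! p = F (u i)" "set (take p (ws @ us)) = set ws\<union>set (take i us)"
    using p False by (auto simp: i_def us_def nth_append)
   have "\<not> Suc i < l"
   proof
    assume "Suc i < l"
    from u_step[OF this] show False using alg unfolding i D_def by (simp only: Un_assoc)
   qed
   hence "i = l - 1" using i(1) by simp
   hence "F (u i)\<in>adjoin KK (insert (F Om) (set (take i us)))" using u_last by simp
   moreover have "adjoin KK (insert (F Om) (set (take i us)))\<subseteq>acl KK (om_gens\<union>set (take p (ws @ us)))"
    unfolding i(3) by (rule order.trans[OF adjoin_mono adjoin_acl]) (auto simp: om_gens_def)
   ultimately show ?thesis unfolding i(2) by blast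
  qed
 qed
 moreover have "rk KK (om_gens\<union>D\<union>set (ws @ us)) = rf ({Om}\<union>Us\<union>Zs)" unfolding rf_def
 proof (rule rk_same_fields)
  fix M :: "'c fls set" assume M: "is_subfield M"
  show "om_gens\<union>D\<union>set (ws @ us)\<subseteq>M \<longleftrightarrow> F`jets ({Om}\<union>Us\<union>Zs)\<subseteq>M"
   using om_gens_iff[OF M] us_iff[OF M] zs_iff[OF M] unfolding D_def set_append Un_subset_iff hol_jets insert_subset by blast
 qed (use fin fj finite_Us finite_Zs in auto)
 moreover have "rk KK om_gens = rf {Om}" unfolding rf_def
 proof (rule rk_same_fields)
  fix M :: "'c fls set" assume M: "is_subfield M"
  show "om_gens\<subseteq>M \<longleftrightarrow> F`jets {Om}\<subseteq>M" using om_gens_iff[OF M] unfolding set_append Un_subset_iff hol_jets insert_subset by blast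
 qed (use fin fj in auto)
 moreover have "rk KK (om_gens\<union>D) = rf ({Om}\<union>Zs)" unfolding rf_def
 proof (rule rk_same_fields)
  fix M :: "'c fls set" assume M: "is_subfield M"
  show "om_gens\<union>D\<subseteq>M \<longleftrightarrow> F`jets ({Om}\<union>Zs)\<subseteq>M"
   using om_gens_iff[OF M] zs_iff[OF M] unfolding D_def set_append Un_subset_iff hol_jets insert_subset by blast
 qed (use fin fj finite_Zs in auto)
 moreover have "rk KK (om_gens\<union>set (ws @ us)) = rf ({Om}\<union>Us)" unfolding rf_def
 proof (rule rk_same_fields)
  fix M :: "'c fls set" assume M: "is_subfield M"
  show "om_gens\<union>set (ws @ us)\<subseteq>M \<longleftrightarrow> F`jets ({Om}\<union>Us)\<subseteq>M"
   using om_gens_iff[OF M] us_iff[OF M] unfolding set_append Un_subset_iff hol_jets insert_subset by blast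
 qed (use fin fj finite_Us in auto)
 ultimately show ?thesis by linarith
qed

section \<open>Transcendence degrees of the values\<close>

text \<open>Modularity passes from functions to values although the values of the two partial families are only
  bounded from above by the functions: submodularity supplies the opposite inequality.\<close>

theorem rv_modular: "rv ({Om}\<union>Us\<union>Zs) + rv {Om} = rv ({Om}\<union>Us) + rv ({Om}\<union>Zs)"
proof (rule antisym)
 let ?V = "(\<lambda>g. fps_value v g \<theta>)"
 have "rk FF (?V`jets {Om}\<union>?V`jets Us\<union>?V`jets Zs) + rk FF (?V`jets {Om})
   \<le> rk FF (?V`jets {Om}\<union>?V`jets Us) + rk FF (?V`jets {Om}\<union>?V`jets Zs)"
  by (rule rk_submodular) (simp_all add: finite_jets finite_Us finite_Zs)
 thus "rv ({Om}\<union>Us\<union>Zs) + rv {Om}\<le>rv ({Om}\<union>Us) + rv ({Om}\<union>Zs)" by (simp only: rv_def jets_Un image_Un)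
 have "rv ({Om}\<union>Us)\<le>rf ({Om}\<union>Us)" "rv ({Om}\<union>Zs)\<le>rf ({Om}\<union>Zs)"
  by (rule rv_le_rf, simp add: finite_Us finite_Zs, rule bdd_all, blast)+
 moreover have "rf {Om}\<le>rv {Om}" by (rule rf_le_rv[OF _ _ system_Om]) (use bdd_Om in auto)
 moreover have "rf ({Om}\<union>Us\<union>Zs)\<le>rv ({Om}\<union>Us\<union>Zs)"
  by (rule rf_le_rv[OF _ bdd_all system_all]) (simp add: finite_Us finite_Zs)
 ultimately show "rv ({Om}\<union>Us) + rv ({Om}\<union>Zs)\<le>rv ({Om}\<union>Us\<union>Zs) + rv {Om}" using rf_modular by linarith
qed

lemma trdeg_rv: "finite B ==> trdeg (rat_field q \<theta>) (adjoin (rat_field q \<theta>) ((\<lambda>g. fps_value v g \<theta>)`jets B)) = rv B"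
 unfolding rv_def by (simp add: trdeg_eq_rk rat_field_subfield finite_jets rk_FF)

lemma values_Om: "(\<lambda>g. fps_value v g \<theta>)`jets {Om} = {fps_value v (hyperderiv n' (Omega v q \<theta> 1 \<rho>1)) \<theta> | n'. n'\<le>n}"
 by (force simp: jets_def Om_def)

lemma values_Us: "(\<lambda>g. fps_value v g \<theta>)`jets Us =
  {fps_value v (hyperderiv n' (twist q (- int l') (Omega v q \<theta> l \<rho>l))) \<theta> | n' l'. n'\<le>n \<and> l'\<le>l - 1}"
proof -
 have "l'\<le>l - 1 \<longleftrightarrow> l' < l" for l' using l_pos by auto
 thus ?thesis unfolding jets_def Us_def u_def twist_neg by force
qed

lemma values_Zs:
 "(\<lambda>g. fps_value v g \<theta>)`jets Zs = {fps_value v (hyperderiv n' (AT_zeta v q \<theta> s)) \<theta> | n' s. n'\<le>n \<and> s\<in>I}"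
proof -
 have "zet s = AT_zeta v q \<theta> s" if "s\<in>I" for s using index_I[OF that] by (simp add: zet_def)
 hence "Zs = AT_zeta v q \<theta>`I" by (simp add: Zs_def)
 thus ?thesis unfolding jets_def by force
qed

theorem trdeg_values:
 fixes W Wl Z
 defines "k \<equiv> rat_field q \<theta>"
 defines "W \<equiv> {fps_value v (hyperderiv n' (Omega v q \<theta> 1 \<rho>1)) \<theta> | n'. n'\<le>n}"
 defines "Wl \<equiv> {fps_value v (hyperderiv n' (twist q (- int l') (Omega v q \<theta> l \<rho>l))) \<theta> | n' l'. n'\<le>n \<and> l'\<le>l - 1}"
 defines "Z \<equiv> {fps_value v (hyperderiv n' (AT_zeta v q \<theta> s)) \<theta> | n' s. n'\<le>n \<and> s\<in>I}"
 shows "trdeg k (adjoin k (W\<union>Wl\<union>Z)) + trdeg k (adjoin k W) =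
  trdeg k (adjoin k (W\<union>Wl)) + trdeg k (adjoin k (W\<union>Z))"
 using rv_modular trdeg_rv[of "{Om}\<union>Us\<union>Zs"] trdeg_rv[of "{Om}"] trdeg_rv[of "{Om}\<union>Us"] trdeg_rv[of "{Om}\<union>Zs"]
 unfolding k_def W_def Wl_def Z_def values_Om[symmetric] values_Us[symmetric] values_Zs[symmetric] jets_Un image_Un
 by (simp only: finite_Us finite_Zs finite_Un finite.intros simp_thms)

end

lemma butlast_Sub: assumes "s~=[]" "butlast s~=[]" shows "butlast s\<in>Sub s"
proof -
 have "length s\<ge>2" using assms by (cases s) (auto split: if_splits simp: Suc_le_eq)
 moreover have "butlast s = map ((!) s) [0..<length s - 1]" by (rule nth_equalityI) (simp_all add: nth_butlast)
 ultimately show ?thesis unfolding Sub_def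
  by (intro CollectI exI[of _ 0] exI[of _ "length s - 2"]) (simp add: Suc_diff_Suc numeral_2_eq_2)
qed

theorem theorem0p3:
  fixes v :: "'c::field \<Rightarrow> real" and q :: nat and \<theta> :: 'c
    and \<rho> :: "nat \<Rightarrow> 'c" and n l :: nat and I :: "nat list set"
  assumes "C_infinity v q \<theta>"
    and "\<And>j. j \<ge> 1 \<Longrightarrow> \<rho> j ^ (q ^ j - 1) = - \<theta>"
    and "l \<ge> 1"
    and "finite I" and "\<And>s. s \<in> I \<Longrightarrow> is_index s"
    and "I = (\<Union>s\<in>I. Sub s)"
  shows
    "let k = rat_field q \<theta>;
         \<Omega> = (\<lambda>j. Omega v q \<theta> j (\<rho> j));
         W = {fps_value v (hyperderiv n' (\<Omega> 1)) \<theta> | n'. n' \<le> n};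
         Wl = {fps_value v (hyperderiv n' (twist q (- int l') (\<Omega> l))) \<theta> | n' l'.
                 n' \<le> n \<and> l' \<le> l - 1};
         Z = {fps_value v (hyperderiv n' (AT_zeta v q \<theta> s)) \<theta> | n' s. n' \<le> n \<and> s \<in> I}
     in int (trdeg k (adjoin k (W \<union> Wl \<union> Z))) =
          int (trdeg k (adjoin k (W \<union> Wl))) + int (trdeg k (adjoin k (W \<union> Z)))
          - int (trdeg k (adjoin k W))"
proof -
 have "jet_setup v q \<theta> l (\<rho> 1) (\<rho> l) I"
 proof (intro jet_setup.intro C_inf_l.intro C_inf_l_axioms.intro jet_setup_axioms.intro assms(1,3,4))
  show "\<rho> 1^(q^1 - 1) = - \<theta>" "\<rho> l^(q^l - 1) = - \<theta>" using assms(2)[of 1] assms(2)[OF assms(3)] by simp_all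
  fix s assume s: "s\<in>I"
  show "s~=[] \<and> (\<forall>a\<in>set s. a\<ge>1)" using assms(5)[OF s] by (auto simp: is_index_def Suc_le_eq)
  hence "butlast s~=[] ==> butlast s\<in>Sub s" by (intro butlast_Sub) auto
  thus "butlast s\<in>insert [] I" using s assms(6) by blast
 qed
 from jet_setup.trdeg_values[OF this, of n] show ?thesis unfolding Let_def by linarith
qed

end
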